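(* Let $b \in \mathbb{R}$ and $s > 3/2$. For every $u_0 \in H^s(\mathbb{R})$ there are a $T > 0$ and a unique solution $u \in C^0([0,T],H^s(\mathbb{R}))$, on $[0,T]$, of the Cauchy problem for the Holm-Staley $b$-family with $u(0)=u_0$, i.e. a unique $u \in C^0([0,T],H^s(\mathbb{R}))$ such that \[ u(t) = u_0 + \int_0^t \Big[(1-\partial_x^2)^{-1}\big(-b\, u u_x + (b-3) u_x u_{xx}\big) - u u_x\Big]\, d\tau \] holds as an identity in $H^{s-1}(\mathbb{R})$ for all $t \in [0,T]$. Moreover, $T$ can be chosen to be the same for all initial values in some neighborhood $U \subseteq H^s(\mathbb{R})$ of $u_0$, and the map \[ U \to C^0([0,T],H^s(\mathbb{R})), \qquad u_0 \mapsto u, \] sending an initial value in $U$ to the corresponding solution on $[0,T]$, is continuous.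
   Context: The Holm-Staley $b$-family is the equation $u_t - u_{xxt} + (b+1) u u_x = b u_x u_{xx} + u u_{xxx}$, $x\in\mathbb{R}$, with real parameter $b$, for real-valued $u$; equivalently $u_t + u u_x = (1-\partial_x^2)^{-1}(-b u u_x + (b-3) u_x u_{xx})$. $H^s(\mathbb{R})$ is the usual $L^2$-based Sobolev space of real-valued functions, with norm $\|f\|_s^2=\int (1+\xi^2)^s|\hat f(\xi)|^2d\xi$; for negative index it is the dual of the space with the opposite index. The product $u_x u_{xx}$ is regarded as an element of $H^{s-2}(\mathbb{R})$; for $3/2<s<2$ (so $-1/2<s-2<0$) the product of $f\in H^{s-1}(\mathbb{R})$ and $g\in H^{s-2}(\mathbb{R})$ is the element $f\cdot g\in H^{s-2}(\mathbb{R})$ defined by $\langle f\cdot g,\psi\rangle=\langle g,f\psi\rangle$ for test functions $\psi$. The operator $(1-\partial_x^2)^{-1}$ maps $H^{s-2}(\mathbb{R})$ isomorphically onto $H^s(\mathbb{R})$. *)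

theory Defs
  imports "HOL-Probability.Probability"
begin

section \<open>Real Schwartz functions\<close>

text \<open>\<open>decaying_upto\<close> only serves the closure proofs; the Schwartz space is \<open>is_schwartz\<close>.\<close>

definition decaying_upto :: "nat \<Rightarrow> (real \<Rightarrow> real) \<Rightarrow> bool" where
  "decaying_upto n f \<longleftrightarrow> (\<forall>k\<le>n. (\<forall>x. (deriv ^^ k) f differentiable (at x)) \<and>
     (\<forall>j::nat. bounded (range (\<lambda>x. x ^ j * (deriv ^^ k) f x))))"

definition is_schwartz :: "(real \<Rightarrow> real) \<Rightarrow> bool" where
  "is_schwartz f \<longleftrightarrow> (\<forall>k. (\<forall>x. (deriv ^^ k) f differentiable (at x)) \<and>
     (\<forall>j::nat. bounded (range (\<lambda>x. x ^ j * (deriv ^^ k) f x))))"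

lemma is_schwartz_upto: "is_schwartz f \<longleftrightarrow> (\<forall>n. decaying_upto n f)"
  unfolding is_schwartz_def decaying_upto_def by auto

lemma deriv_pow_Suc: "(deriv ^^ Suc k) f = (deriv ^^ k) (deriv f)" for f :: "real \<Rightarrow> real"
  by (simp add: funpow_swap1)

lemma decaying_upto_0: "decaying_upto 0 f \<longleftrightarrow> (\<forall>x. f differentiable (at x)) \<and>
     (\<forall>j::nat. bounded (range (\<lambda>x. x ^ j * f x)))"
  unfolding decaying_upto_def by auto

lemma decaying_upto_Suc: "decaying_upto (Suc n) f \<longleftrightarrow> decaying_upto 0 f \<and> decaying_upto n (deriv f)"
proof -
  have *: "(\<forall>k\<le>Suc n. P k) \<longleftrightarrow> P 0 \<and> (\<forall>k\<le>n. P (Suc k))" for P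
    by (metis Suc_le_mono le0 not0_implies_Suc)
  show ?thesis
    unfolding decaying_upto_def * deriv_pow_Suc by simp
qed

lemma real_deriv_add:
  fixes f g :: "real \<Rightarrow> real"
  assumes "\<And>x. f differentiable (at x)" "\<And>x. g differentiable (at x)"
  shows "deriv (\<lambda>x. f x + g x) = (\<lambda>x. deriv f x + deriv g x)"
  by (rule ext, rule DERIV_imp_deriv)
     (use assms in \<open>auto intro!: derivative_intros simp: DERIV_deriv_iff_real_differentiable\<close>)

lemma real_deriv_mult:
  fixes f g :: "real \<Rightarrow> real"
  assumes "\<And>x. f differentiable (at x)" "\<And>x. g differentiable (at x)"
  shows "deriv (\<lambda>x. f x * g x) = (\<lambda>x. deriv f x * g x + f x * deriv g x)"
proof (rule ext, rule DERIV_imp_deriv)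
  fix x
  show "((\<lambda>x. f x * g x) has_field_derivative deriv f x * g x + f x * deriv g x) (at x)"
    using DERIV_mult[of f "deriv f x" x UNIV g "deriv g x"] assms
    by (simp add: DERIV_deriv_iff_real_differentiable mult.commute add.commute)
qed

lemma real_deriv_scale:
  fixes f :: "real \<Rightarrow> real"
  assumes "\<And>x. f differentiable (at x)"
  shows "deriv (\<lambda>x. c * f x) = (\<lambda>x. c * deriv f x)"
  by (rule ext, rule DERIV_imp_deriv)
     (use assms in \<open>auto intro!: DERIV_cmult simp: DERIV_deriv_iff_real_differentiable\<close>)

lemma decaying_upto_add:
  "decaying_upto n f \<Longrightarrow> decaying_upto n g \<Longrightarrow> decaying_upto n (\<lambda>x. f x + g x)"
proof (induction n arbitrary: f g)
  case 0
  have "bounded (range (\<lambda>x. x ^ j * (f x + g x)))" for j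
    using 0 bounded_plus_comp[of "\<lambda>x. x ^ j * f x" UNIV "\<lambda>x. x ^ j * g x"]
    by (simp add: decaying_upto_0 distrib_left)
  with 0 show ?case by (auto simp: decaying_upto_0 intro!: derivative_intros)
next
  case (Suc n)
  have "bounded (range (\<lambda>x. x ^ j * (f x + g x)))" for j
    using Suc.prems bounded_plus_comp[of "\<lambda>x. x ^ j * f x" UNIV "\<lambda>x. x ^ j * g x"]
    by (simp add: decaying_upto_0 decaying_upto_Suc distrib_left)
  with Suc.prems have "decaying_upto 0 (\<lambda>x. f x + g x)"
    by (auto simp: decaying_upto_0 decaying_upto_Suc intro!: derivative_intros)
  moreover have "deriv (\<lambda>x. f x + g x) = (\<lambda>x. deriv f x + deriv g x)"
    using Suc.prems by (intro real_deriv_add) (auto simp: decaying_upto_0 decaying_upto_Suc)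
  ultimately show ?case
    using Suc by (simp add: decaying_upto_Suc)
qed

lemma decaying_upto_scale:
  "decaying_upto n f \<Longrightarrow> decaying_upto n (\<lambda>x. c * f x)"
proof (induction n arbitrary: f)
  case 0
  have "bounded (range (\<lambda>x. x ^ j * (c * f x)))" for j
    using 0 bounded_scaleR_comp[of "\<lambda>x. x ^ j * f x" UNIV c]
    by (simp add: decaying_upto_0 mult.left_commute)
  with 0 show ?case by (auto simp: decaying_upto_0 intro!: derivative_intros)
next
  case (Suc n)
  have "bounded (range (\<lambda>x. x ^ j * (c * f x)))" for j
    using Suc.prems bounded_scaleR_comp[of "\<lambda>x. x ^ j * f x" UNIV c]
    by (simp add: decaying_upto_0 decaying_upto_Suc mult.left_commute)
  moreover have "deriv (\<lambda>x. c * f x) = (\<lambda>x. c * deriv f x)"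
    using Suc.prems by (intro real_deriv_scale) (auto simp: decaying_upto_0 decaying_upto_Suc)
  ultimately show ?case
    using Suc by (auto simp: decaying_upto_Suc decaying_upto_0 intro!: derivative_intros)
qed

lemma bounded_mult_range:
  fixes f g :: "real \<Rightarrow> real"
  assumes "bounded (range f)" "bounded (range g)"
  shows "bounded (range (\<lambda>x. f x * g x))"
proof -
  obtain A B where "\<And>x. \<bar>f x\<bar> \<le> A" "\<And>x. \<bar>g x\<bar> \<le> B"
    using assms by (auto simp: bounded_iff)
  then have "\<bar>f x * g x\<bar> \<le> A * B" for x
    unfolding abs_mult by (intro mult_mono) (auto intro: order_trans[OF abs_ge_zero])
  then show ?thesis by (auto simp: bounded_iff)
qed

lemma decaying_upto_0_mult:
  assumes "decaying_upto 0 f" "decaying_upto 0 g"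
  shows "decaying_upto 0 (\<lambda>x. f x * g x)"
proof -
  have "bounded (range (\<lambda>x. (x ^ j * f x) * (x ^ 0 * g x)))" for j
    by (rule bounded_mult_range) (use assms in \<open>unfold decaying_upto_0, blast+\<close>)
  then show ?thesis
    using assms by (auto simp: decaying_upto_0 mult.assoc intro!: derivative_intros)
qed

lemma is_schwartz_deriv: "is_schwartz f \<Longrightarrow> is_schwartz (deriv f)"
  by (metis is_schwartz_upto decaying_upto_Suc)

lemma decaying_upto_mult:
  "is_schwartz f \<Longrightarrow> is_schwartz g \<Longrightarrow> decaying_upto n (\<lambda>x. f x * g x)"
proof (induction n arbitrary: f g)
  case 0
  then show ?case by (intro decaying_upto_0_mult) (auto simp: is_schwartz_upto)
next
  case (Suc n)
  have 0: "decaying_upto 0 f" "decaying_upto 0 g"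
    using Suc.prems by (auto simp: is_schwartz_upto)
  have eq: "deriv (\<lambda>x. f x * g x) = (\<lambda>x. deriv f x * g x + f x * deriv g x)"
    using 0 by (intro real_deriv_mult) (auto simp: decaying_upto_0)
  have "decaying_upto n (\<lambda>x. deriv f x * g x + f x * deriv g x)"
    by (intro decaying_upto_add Suc.IH is_schwartz_deriv Suc.prems)
  then show ?case
    by (simp add: decaying_upto_Suc eq decaying_upto_0_mult[OF 0])
qed

lemma is_schwartz_zero: "is_schwartz (\<lambda>_. 0)"
proof -
  have "(deriv ^^ k) (\<lambda>_::real. 0::real) = (\<lambda>_. 0)" for k
    by (induction k) (simp, simp only: funpow.simps o_apply deriv_const)
  then show ?thesis unfolding is_schwartz_def by simp
qed

typedef schwartz = "{f. is_schwartz f}"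
  morphisms test_fun Schwartz
  using is_schwartz_zero by blast

setup_lifting type_definition_schwartz

instantiation schwartz :: real_vector
begin
lift_definition zero_schwartz :: schwartz is "\<lambda>_. 0" by (rule is_schwartz_zero)
lift_definition plus_schwartz :: "schwartz \<Rightarrow> schwartz \<Rightarrow> schwartz" is "\<lambda>f g x. f x + g x"
  by (auto simp: is_schwartz_upto intro: decaying_upto_add)
lift_definition scaleR_schwartz :: "real \<Rightarrow> schwartz \<Rightarrow> schwartz" is "\<lambda>c f x. c * f x"
  by (auto simp: is_schwartz_upto intro: decaying_upto_scale)
lift_definition uminus_schwartz :: "schwartz \<Rightarrow> schwartz" is "\<lambda>f x. - f x"
  using decaying_upto_scale[of _ _ "-1"] by (auto simp: is_schwartz_upto)
lift_definition minus_schwartz :: "schwartz \<Rightarrow> schwartz \<Rightarrow> schwartz" is "\<lambda>f g x. f x - g x"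
proof -
  fix f g assume "is_schwartz f" "is_schwartz g"
  then have "decaying_upto n (\<lambda>x. f x + (- 1) * g x)" for n
    by (intro decaying_upto_add decaying_upto_scale) (auto simp: is_schwartz_upto)
  then show "is_schwartz (\<lambda>x. f x - g x)" by (auto simp: is_schwartz_upto)
qed
instance
  by standard (transfer; auto simp: algebra_simps)+
end

lift_definition schwartz_mult :: "schwartz \<Rightarrow> schwartz \<Rightarrow> schwartz" is "\<lambda>f g x. f x * g x"
  by (auto simp: is_schwartz_upto[of "\<lambda>x. _ x * _ x"] decaying_upto_mult)

lift_definition schwartz_deriv :: "schwartz \<Rightarrow> schwartz" is deriv
  by (rule is_schwartz_deriv)

definition schwartz_seminorm :: "nat \<Rightarrow> nat \<Rightarrow> schwartz \<Rightarrow> real" where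
  "schwartz_seminorm j k \<phi> = (SUP x. \<bar>x ^ j * (deriv ^^ k) (test_fun \<phi>) x\<bar>)"

lemma seminorm_ge: "\<bar>x ^ j * (deriv ^^ k) (test_fun \<phi>) x\<bar> \<le> schwartz_seminorm j k \<phi>"
proof -
  have "bounded (range (\<lambda>x. x ^ j * (deriv ^^ k) (test_fun \<phi>) x))"
    using test_fun[of \<phi>] by (auto simp: is_schwartz_def)
  then have "bdd_above (range (\<lambda>x. \<bar>x ^ j * (deriv ^^ k) (test_fun \<phi>) x\<bar>))"
    by (auto simp: bounded_iff bdd_above_def)
  then show ?thesis unfolding schwartz_seminorm_def by (rule cSUP_upper2) auto
qed

lemma seminorm_le:
  "(\<And>x. \<bar>x ^ j * (deriv ^^ k) (test_fun \<phi>) x\<bar> \<le> C) \<Longrightarrow> schwartz_seminorm j k \<phi> \<le> C"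
  unfolding schwartz_seminorm_def by (rule cSUP_least) auto

lemma seminorm_nonneg: "0 \<le> schwartz_seminorm j k \<phi>"
  by (rule order_trans[OF abs_ge_zero seminorm_ge])

lemma seminorm_deriv: "schwartz_seminorm j k (schwartz_deriv \<phi>) = schwartz_seminorm j (Suc k) \<phi>"
  unfolding schwartz_seminorm_def deriv_pow_Suc schwartz_deriv.rep_eq ..

lemma test_fun_differentiable: "test_fun \<phi> differentiable (at x)"
proof -
  have "(deriv ^^ 0) (test_fun \<phi>) differentiable (at x)"
    using test_fun[of \<phi>] unfolding is_schwartz_def by blast
  then show ?thesis by simp
qed

lemma schwartz_deriv_add: "schwartz_deriv (\<phi> + \<psi>) = schwartz_deriv \<phi> + schwartz_deriv \<psi>"
  by (simp add: test_fun_inject[symmetric] schwartz_deriv.rep_eq plus_schwartz.rep_eq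
      real_deriv_add test_fun_differentiable)

lemma schwartz_deriv_scaleR: "schwartz_deriv (c *\<^sub>R \<phi>) = c *\<^sub>R schwartz_deriv \<phi>"
  by (simp add: test_fun_inject[symmetric] schwartz_deriv.rep_eq scaleR_schwartz.rep_eq
      real_deriv_scale test_fun_differentiable)

lemma schwartz_deriv_mult:
  "schwartz_deriv (schwartz_mult \<phi> \<psi>) =
   schwartz_mult (schwartz_deriv \<phi>) \<psi> + schwartz_mult \<phi> (schwartz_deriv \<psi>)"
  by (simp add: test_fun_inject[symmetric] schwartz_deriv.rep_eq plus_schwartz.rep_eq
      schwartz_mult.rep_eq real_deriv_mult test_fun_differentiable)

lemma seminorm_add: "schwartz_seminorm j k (\<phi> + \<psi>) \<le> schwartz_seminorm j k \<phi> + schwartz_seminorm j k \<psi>"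
proof (induction k arbitrary: \<phi> \<psi>)
  case 0
  show ?case
  proof (rule seminorm_le)
    fix x
    show "\<bar>x ^ j * (deriv ^^ 0) (test_fun (\<phi> + \<psi>)) x\<bar> \<le> schwartz_seminorm j 0 \<phi> + schwartz_seminorm j 0 \<psi>"
      using seminorm_ge[of x j 0 \<phi>] seminorm_ge[of x j 0 \<psi>]
      by (simp add: plus_schwartz.rep_eq distrib_left)
  qed
next
  case (Suc k)
  then show ?case by (simp add: seminorm_deriv[symmetric] schwartz_deriv_add)
qed

lemma seminorm_mult:
  "\<exists>C\<ge>0. \<forall>j \<phi>. schwartz_seminorm j k (schwartz_mult \<psi> \<phi>) \<le> C * (\<Sum>i\<le>k. schwartz_seminorm j i \<phi>)"
proof (induction k arbitrary: \<psi>)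
  case 0
  have "schwartz_seminorm j 0 (schwartz_mult \<psi> \<phi>) \<le> schwartz_seminorm 0 0 \<psi> * schwartz_seminorm j 0 \<phi>" for j \<phi>
  proof (rule seminorm_le)
    fix x
    have "\<bar>x ^ j * (deriv ^^ 0) (test_fun (schwartz_mult \<psi> \<phi>)) x\<bar>
        = \<bar>x ^ 0 * (deriv ^^ 0) (test_fun \<psi>) x\<bar> * \<bar>x ^ j * (deriv ^^ 0) (test_fun \<phi>) x\<bar>"
      by (simp add: schwartz_mult.rep_eq abs_mult)
    also have "\<dots> \<le> schwartz_seminorm 0 0 \<psi> * schwartz_seminorm j 0 \<phi>"
      by (intro mult_mono seminorm_ge seminorm_nonneg) auto
    finally show "\<bar>x ^ j * (deriv ^^ 0) (test_fun (schwartz_mult \<psi> \<phi>)) x\<bar>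
        \<le> schwartz_seminorm 0 0 \<psi> * schwartz_seminorm j 0 \<phi>" .
  qed
  then show ?case using seminorm_nonneg by (auto intro!: exI[of _ "schwartz_seminorm 0 0 \<psi>"])
next
  case (Suc k)
  obtain C1 where C1: "C1 \<ge> 0" "\<And>j \<phi>. schwartz_seminorm j k (schwartz_mult (schwartz_deriv \<psi>) \<phi>) \<le> C1 * (\<Sum>i\<le>k. schwartz_seminorm j i \<phi>)"
    using Suc by blast
  obtain C2 where C2: "C2 \<ge> 0" "\<And>j \<phi>. schwartz_seminorm j k (schwartz_mult \<psi> \<phi>) \<le> C2 * (\<Sum>i\<le>k. schwartz_seminorm j i \<phi>)"
    using Suc by blast
  have "schwartz_seminorm j (Suc k) (schwartz_mult \<psi> \<phi>) \<le> (C1 + C2) * (\<Sum>i\<le>Suc k. schwartz_seminorm j i \<phi>)" for j \<phi>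
  proof -
    have "schwartz_seminorm j (Suc k) (schwartz_mult \<psi> \<phi>)
      \<le> schwartz_seminorm j k (schwartz_mult (schwartz_deriv \<psi>) \<phi>) + schwartz_seminorm j k (schwartz_mult \<psi> (schwartz_deriv \<phi>))"
      unfolding seminorm_deriv[symmetric] schwartz_deriv_mult by (rule seminorm_add)
    also have "\<dots> \<le> C1 * (\<Sum>i\<le>k. schwartz_seminorm j i \<phi>) + C2 * (\<Sum>i\<le>k. schwartz_seminorm j (Suc i) \<phi>)"
      unfolding seminorm_deriv[symmetric] by (intro add_mono C1 C2)
    also have "\<dots> \<le> C1 * (\<Sum>i\<le>Suc k. schwartz_seminorm j i \<phi>) + C2 * (\<Sum>i\<le>Suc k. schwartz_seminorm j i \<phi>)"
    proof (intro add_mono mult_left_mono C1 C2)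
      show "(\<Sum>i\<le>k. schwartz_seminorm j i \<phi>) \<le> (\<Sum>i\<le>Suc k. schwartz_seminorm j i \<phi>)"
        using seminorm_nonneg by simp
      show "(\<Sum>i\<le>k. schwartz_seminorm j (Suc i) \<phi>) \<le> (\<Sum>i\<le>Suc k. schwartz_seminorm j i \<phi>)"
        unfolding sum.atMost_Suc_shift[of _ k] by (simp add: seminorm_nonneg)
    qed
    finally show ?thesis by (simp add: distrib_right)
  qed
  with C1(1) C2(1) show ?case by (intro exI[of _ "C1 + C2"]) auto
qed

section \<open>Real tempered distributions\<close>

definition tempered_bound :: "nat \<Rightarrow> schwartz \<Rightarrow> real" where
  "tempered_bound N \<phi> = (\<Sum>j\<le>N. \<Sum>k\<le>N. schwartz_seminorm j k \<phi>)"

lemma tempered_bound_nonneg: "0 \<le> tempered_bound N \<phi>"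
  unfolding tempered_bound_def by (intro sum_nonneg seminorm_nonneg)

lemma tempered_bound_mono: "M \<le> N \<Longrightarrow> tempered_bound M \<phi> \<le> tempered_bound N \<phi>"
  unfolding tempered_bound_def
  by (intro order_trans[OF sum_mono2[of "{..N}" "{..M}"] sum_mono] sum_mono2)
     (auto intro!: sum_nonneg seminorm_nonneg)

definition is_tempered :: "(schwartz \<Rightarrow> real) \<Rightarrow> bool" where
  "is_tempered T \<longleftrightarrow> linear T \<and> (\<exists>C N. \<forall>\<phi>. \<bar>T \<phi>\<bar> \<le> C * tempered_bound N \<phi>)"

lemma is_temperedI:
  assumes "linear T" "\<And>\<phi>. \<bar>T \<phi>\<bar> \<le> C * tempered_bound N \<phi>"
  shows "is_tempered T"
  using assms unfolding is_tempered_def by blast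

lemma is_temperedD:
  assumes "is_tempered T"
  shows "\<exists>C N. C \<ge> 0 \<and> (\<forall>\<phi>. \<bar>T \<phi>\<bar> \<le> C * tempered_bound N \<phi>)"
proof -
  obtain C N where CN: "\<And>\<phi>. \<bar>T \<phi>\<bar> \<le> C * tempered_bound N \<phi>"
    using assms unfolding is_tempered_def by blast
  have "\<bar>T \<phi>\<bar> \<le> \<bar>C\<bar> * tempered_bound N \<phi>" for \<phi>
    by (rule order_trans[OF CN]) (auto intro!: mult_right_mono tempered_bound_nonneg)
  then show ?thesis by (intro exI[of _ "\<bar>C\<bar>"]) auto
qed

lemma is_tempered_linear: "is_tempered T \<Longrightarrow> linear T"
  by (simp add: is_tempered_def)

lemma is_tempered_zero: "is_tempered (\<lambda>_. 0)"
  by (rule is_temperedI[of _ 0 0]) (auto simp: linear_iff)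

lemma is_tempered_scale: "is_tempered S \<Longrightarrow> is_tempered (\<lambda>\<phi>. c * S \<phi>)"
proof -
  assume S: "is_tempered S"
  obtain C N where CN: "C \<ge> 0" "\<And>\<phi>. \<bar>S \<phi>\<bar> \<le> C * tempered_bound N \<phi>" using is_temperedD[OF S] by blast
  show ?thesis
  proof (rule is_temperedI[of _ "\<bar>c\<bar> * C" N])
    show "linear (\<lambda>\<phi>. c * S \<phi>)"
      using is_tempered_linear[OF S] by (auto simp: linear_iff distrib_left)
    show "\<bar>c * S \<phi>\<bar> \<le> \<bar>c\<bar> * C * tempered_bound N \<phi>" for \<phi>
      using mult_left_mono[OF CN(2)[of \<phi>], of "\<bar>c\<bar>"] by (simp add: abs_mult mult.assoc)
  qed
qed

lemma is_tempered_add: "is_tempered S \<Longrightarrow> is_tempered T \<Longrightarrow> is_tempered (\<lambda>\<phi>. S \<phi> + T \<phi>)"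
proof -
  assume S: "is_tempered S" and T: "is_tempered T"
  obtain C N where CN: "C \<ge> 0" "\<And>\<phi>. \<bar>S \<phi>\<bar> \<le> C * tempered_bound N \<phi>" using is_temperedD[OF S] by blast
  obtain D M where DM: "D \<ge> 0" "\<And>\<phi>. \<bar>T \<phi>\<bar> \<le> D * tempered_bound M \<phi>" using is_temperedD[OF T] by blast
  show ?thesis
  proof (rule is_temperedI[of _ "C + D" "max N M"])
    show "linear (\<lambda>\<phi>. S \<phi> + T \<phi>)"
      using is_tempered_linear[OF S] is_tempered_linear[OF T] by (auto simp: linear_iff distrib_left)
    fix \<phi>
    have "\<bar>S \<phi> + T \<phi>\<bar> \<le> C * tempered_bound N \<phi> + D * tempered_bound M \<phi>"
      using CN(2)[of \<phi>] DM(2)[of \<phi>] by linarith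
    also have "\<dots> \<le> C * tempered_bound (max N M) \<phi> + D * tempered_bound (max N M) \<phi>"
      by (intro add_mono mult_left_mono tempered_bound_mono CN DM) auto
    finally show "\<bar>S \<phi> + T \<phi>\<bar> \<le> (C + D) * tempered_bound (max N M) \<phi>"
      by (simp add: distrib_right)
  qed
qed

text \<open>The spaces in question consist of real-valued functions, so it is enough to have real-valued
  functionals on real Schwartz functions.\<close>

typedef tempered = "{T. is_tempered T}"
  morphisms apply_dist Tempered
  using is_tempered_zero by blast

setup_lifting type_definition_tempered

instantiation tempered :: real_vector
begin
lift_definition zero_tempered :: tempered is "\<lambda>_. 0" by (rule is_tempered_zero)
lift_definition plus_tempered :: "tempered \<Rightarrow> tempered \<Rightarrow> tempered" is "\<lambda>S T \<phi>. S \<phi> + T \<phi>"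
  by (rule is_tempered_add)
lift_definition scaleR_tempered :: "real \<Rightarrow> tempered \<Rightarrow> tempered" is "\<lambda>c S \<phi>. c * S \<phi>"
  by (rule is_tempered_scale)
lift_definition uminus_tempered :: "tempered \<Rightarrow> tempered" is "\<lambda>S \<phi>. - S \<phi>"
  using is_tempered_scale[of _ "-1"] by simp
lift_definition minus_tempered :: "tempered \<Rightarrow> tempered \<Rightarrow> tempered" is "\<lambda>S T \<phi>. S \<phi> - T \<phi>"
  using is_tempered_add[OF _ is_tempered_scale[of _ "-1"]] by simp
instance
  by standard (transfer; auto simp: algebra_simps)+
end

lift_definition dist_deriv :: "tempered \<Rightarrow> tempered" is "\<lambda>T \<phi>. - T (schwartz_deriv \<phi>)"
proof -
  fix T assume T: "is_tempered T"
  obtain C N where CN: "C \<ge> 0" "\<And>\<phi>. \<bar>T \<phi>\<bar> \<le> C * tempered_bound N \<phi>" using is_temperedD[OF T] by blast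
  show "is_tempered (\<lambda>\<phi>. - T (schwartz_deriv \<phi>))"
  proof (rule is_temperedI[of _ C "Suc N"])
    show "linear (\<lambda>\<phi>. - T (schwartz_deriv \<phi>))"
      using is_tempered_linear[OF T]
      by (auto simp: linear_iff schwartz_deriv_add schwartz_deriv_scaleR)
    fix \<phi>
    have "tempered_bound N (schwartz_deriv \<phi>) = (\<Sum>j\<le>N. \<Sum>k\<le>N. schwartz_seminorm j (Suc k) \<phi>)"
      by (simp add: tempered_bound_def seminorm_deriv)
    also have "\<dots> \<le> (\<Sum>j\<le>N. \<Sum>k\<le>Suc N. schwartz_seminorm j k \<phi>)"
      by (intro sum_mono, unfold sum.atMost_Suc_shift[of _ N]) (simp add: seminorm_nonneg)
    also have "\<dots> \<le> tempered_bound (Suc N) \<phi>"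
      unfolding tempered_bound_def by (intro sum_mono2) (auto intro!: sum_nonneg add_nonneg_nonneg seminorm_nonneg)
    finally show "\<bar>- T (schwartz_deriv \<phi>)\<bar> \<le> C * tempered_bound (Suc N) \<phi>"
      using CN mult_left_mono[of _ _ C] by (metis abs_minus order_trans)
  qed
qed

lift_definition schwartz_times :: "schwartz \<Rightarrow> tempered \<Rightarrow> tempered" is
  "\<lambda>\<psi> T \<phi>. T (schwartz_mult \<psi> \<phi>)"
proof -
  fix T \<psi> assume T: "is_tempered T"
  obtain C N where CN: "C \<ge> 0" "\<And>\<phi>. \<bar>T \<phi>\<bar> \<le> C * tempered_bound N \<phi>" using is_temperedD[OF T] by blast
  obtain B where B: "\<And>k. B k \<ge> 0" "\<And>k j \<phi>. schwartz_seminorm j k (schwartz_mult \<psi> \<phi>) \<le> B k * (\<Sum>i\<le>k. schwartz_seminorm j i \<phi>)"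
    using seminorm_mult[of _ \<psi>] by metis
  show "is_tempered (\<lambda>\<phi>. T (schwartz_mult \<psi> \<phi>))"
  proof (rule is_temperedI[of _ "C * (\<Sum>k\<le>N. B k)" N])
    have "schwartz_mult \<psi> (\<phi> + \<theta>) = schwartz_mult \<psi> \<phi> + schwartz_mult \<psi> \<theta>"
         "schwartz_mult \<psi> (c *\<^sub>R \<phi>) = c *\<^sub>R schwartz_mult \<psi> \<phi>" for \<phi> \<theta> c
      by (transfer; simp add: algebra_simps)+
    then show "linear (\<lambda>\<phi>. T (schwartz_mult \<psi> \<phi>))"
      using is_tempered_linear[OF T] by (simp add: linear_iff)
    fix \<phi>
    have "tempered_bound N (schwartz_mult \<psi> \<phi>) \<le> (\<Sum>j\<le>N. \<Sum>k\<le>N. B k * (\<Sum>i\<le>N. schwartz_seminorm j i \<phi>))"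
      unfolding tempered_bound_def
      by (intro sum_mono order_trans[OF B(2)] mult_left_mono B sum_mono2) (auto intro: seminorm_nonneg)
    also have "\<dots> = (\<Sum>k\<le>N. B k) * tempered_bound N \<phi>"
      unfolding tempered_bound_def sum_distrib_right[symmetric] sum_distrib_left[symmetric] ..
    finally show "\<bar>T (schwartz_mult \<psi> \<phi>)\<bar> \<le> C * (\<Sum>k\<le>N. B k) * tempered_bound N \<phi>"
      using CN mult_left_mono[of _ _ C] by (metis mult.assoc order_trans)
  qed
qed

section \<open>Fourier transform and Sobolev spaces\<close>

text \<open>The unitary normalisation is used: \<open>schwartz_ift\<close> is the inverse transform
  \<open>\<phi>(x) \<mapsto> (2\<pi>)\<^sup>-\<^sup>1\<^sup>/\<^sup>2 \<integral> e\<^sup>i\<^sup>x\<^sup>\<xi> \<phi>(x) dx\<close>.  A function \<open>g\<close> is the Fourier transform of \<open>T\<close> iff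
  \<open>T(\<phi>) = \<integral> g(\<xi>) (F\<^sup>-\<^sup>1 \<phi>)(\<xi>) d\<xi>\<close> for every test function, i.e. \<open>T \<circ> F = g\<close> in the sense of
  tempered distributions; real test functions suffice by linearity.  Such a \<open>g\<close> is unique up to
  null sets (\<open>is_fourier_unique\<close> below), and \<open>fourier\<close> picks a representative.\<close>

definition schwartz_ift :: "schwartz \<Rightarrow> real \<Rightarrow> complex" where
  "schwartz_ift \<phi> \<xi> =
     complex_of_real (1 / sqrt (2 * pi)) * (LINT x|lborel. complex_of_real (test_fun \<phi> x) * cis (x * \<xi>))"

definition is_fourier :: "tempered \<Rightarrow> (real \<Rightarrow> complex) \<Rightarrow> bool" where
  "is_fourier T g \<longleftrightarrow> g \<in> borel_measurable lborel \<and>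
     (\<forall>\<phi>. integrable lborel (\<lambda>\<xi>. g \<xi> * schwartz_ift \<phi> \<xi>) \<and>
          complex_of_real (apply_dist T \<phi>) = (LINT \<xi>|lborel. g \<xi> * schwartz_ift \<phi> \<xi>))"

definition fourier :: "tempered \<Rightarrow> real \<Rightarrow> complex" where
  "fourier T = (SOME g. is_fourier T g)"

text \<open>\<open>H\<^sup>r(\<real>)\<close> for arbitrary real \<open>r\<close>, as a space of real tempered distributions.  A (class of) real
  function \<open>f\<close> is identified, as usual, with the distribution \<open>\<phi> \<mapsto> \<integral> f \<phi>\<close>.\<close>

definition sobolev :: "real \<Rightarrow> tempered set" where
  "sobolev r = {T. (\<exists>g. is_fourier T g) \<and>
     integrable lborel (\<lambda>\<xi>. (1 + \<xi>\<^sup>2) powr r * (cmod (fourier T \<xi>))\<^sup>2)}"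

definition sobolev_norm :: "real \<Rightarrow> tempered \<Rightarrow> real" where
  "sobolev_norm r T = sqrt (LINT \<xi>|lborel. (1 + \<xi>\<^sup>2) powr r * (cmod (fourier T \<xi>))\<^sup>2)"

subsection \<open>Uniqueness of the Fourier transform\<close>

lemma gauss_times_power_bounded: "bounded (range (\<lambda>y::real. y ^ k * exp (- y\<^sup>2 / 2)))"
proof -
  have "\<bar>y ^ k * exp (- y\<^sup>2 / 2)\<bar> \<le> fact k * exp (1/2)" for y :: real
  proof -
    have "\<bar>y\<bar> ^ k / fact k \<le> exp \<bar>y\<bar>"
    proof -
      have "(\<Sum>n\<in>{k}. \<bar>y\<bar> ^ n /\<^sub>R fact n) \<le> exp \<bar>y\<bar>"
        unfolding exp_def by (rule sum_le_suminf[OF summable_exp_generic]) auto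
      then show ?thesis by (simp add: field_simps)
    qed
    then have 1: "\<bar>y\<bar> ^ k \<le> fact k * exp \<bar>y\<bar>" by (simp add: field_simps)
    have "\<bar>y\<bar> - y\<^sup>2 / 2 \<le> 1/2"
      using zero_le_power2[of "\<bar>y\<bar> - 1"] by (simp add: power2_eq_square algebra_simps abs_mult_self_eq)
    then have 2: "exp \<bar>y\<bar> * exp (- y\<^sup>2 / 2) \<le> exp (1/2)"
      by (simp add: exp_add[symmetric])
    have "\<bar>y ^ k * exp (- y\<^sup>2 / 2)\<bar> \<le> fact k * exp \<bar>y\<bar> * exp (- y\<^sup>2 / 2)"
      using 1 by (simp add: abs_mult power_abs)
    also have "\<dots> \<le> fact k * exp (1/2)"
      using 2 by (simp add: mult.assoc)
    finally show ?thesis .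
  qed
  then show ?thesis by (auto simp: bounded_iff)
qed

lemma gauss_times_poly_bounded: "bounded (range (\<lambda>y::real. poly p y * exp (- y\<^sup>2 / 2)))"
proof -
  have "bounded (range (\<lambda>y::real. \<Sum>i\<in>I. c i * (y ^ i * exp (- y\<^sup>2 / 2))))" if "finite I" for I c
    using that
  proof (induction I)
    case (insert i I)
    have "bounded (range (\<lambda>y::real. c i *\<^sub>R (y ^ i * exp (- y\<^sup>2 / 2))))"
      by (intro bounded_scaleR_comp gauss_times_power_bounded)
    from bounded_plus_comp[OF this insert.IH] insert.hyps show ?case by simp
  qed simp
  from this[of "{..degree p}" "coeff p"] show ?thesis
    by (simp add: poly_altdef sum_distrib_right mult.assoc)
qed

lemma is_schwartz_gauss: "is_schwartz (\<lambda>x. exp (- (x - a)\<^sup>2 / 2))"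
proof -
  let ?G = "\<lambda>p x. poly p (x - a) * exp (- (x - a)\<^sup>2 / 2)"
  have der: "(?G p has_field_derivative ?G (pderiv p - [:0,1:] * p) x) (at x)" for p x
  proof -
    have "((\<lambda>x. poly p (x - a)) has_field_derivative poly (pderiv p) (x - a)) (at x)"
      by (auto intro!: derivative_eq_intros)
    moreover have "((\<lambda>x. exp (- (x - a)\<^sup>2 / 2)) has_field_derivative - (x - a) * exp (- (x - a)\<^sup>2 / 2)) (at x)"
      by (auto intro!: derivative_eq_intros simp: field_simps)
    ultimately have "(?G p has_field_derivative
       poly (pderiv p) (x - a) * exp (- (x - a)\<^sup>2 / 2) + - (x - a) * exp (- (x - a)\<^sup>2 / 2) * poly p (x - a)) (at x)"
      by (rule DERIV_mult)
    moreover have "poly (pderiv p) y * E + - y * E * poly p y = poly (pderiv p - [:0,1:] * p) y * E" for y E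
      by (simp add: algebra_simps)
    ultimately show ?thesis by metis
  qed
  have "\<exists>p. (deriv ^^ k) (?G 1) = ?G p" for k
  proof (induction k)
    case 0 show ?case by (rule exI[of _ 1]) simp
  next
    case (Suc k)
    then obtain p where "(deriv ^^ k) (?G 1) = ?G p" by blast
    moreover have "deriv (?G p) = ?G (pderiv p - [:0,1:] * p)"
      by (rule ext, rule DERIV_imp_deriv, rule der)
    ultimately have "(deriv ^^ Suc k) (?G 1) = ?G (pderiv p - [:0,1:] * p)"
      by (simp only: funpow.simps o_apply)
    then show ?case by blast
  qed
  then obtain P where P: "\<And>k. (deriv ^^ k) (?G 1) = ?G (P k)" by metis
  have "bounded (range (\<lambda>x. x ^ j * ?G p x))" for j p
  proof -
    have "range (\<lambda>x. x ^ j * ?G p x) = range (\<lambda>y. poly ([:a,1:] ^ j * p) y * exp (- y\<^sup>2 / 2))"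
    proof -
      have "(\<lambda>x. x ^ j * ?G p x) = (\<lambda>y. poly ([:a,1:] ^ j * p) y * exp (- y\<^sup>2 / 2)) \<circ> (\<lambda>x. x - a)"
        by (auto simp: fun_eq_iff poly_power)
      moreover have "surj (\<lambda>x. x - a)" by (metis add_diff_cancel surjI)
      ultimately show ?thesis by (metis image_comp)
    qed
    then show ?thesis using gauss_times_poly_bounded[of "[:a,1:] ^ j * p"] by (simp only:)
  qed
  moreover have "?G p differentiable (at x)" for p x
    using der real_differentiable_def by blast
  ultimately have "is_schwartz (?G 1)"
    unfolding is_schwartz_def P by blast
  then show ?thesis by simp
qed

lift_definition gauss :: "real \<Rightarrow> schwartz" is "\<lambda>a x. exp (- (x - a)\<^sup>2 / 2)"
  by (rule is_schwartz_gauss)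

lemma schwartz_ift_gauss: "schwartz_ift (gauss a) \<xi> = complex_of_real (exp (- \<xi>\<^sup>2 / 2)) * cis (a * \<xi>)"
proof -
  have "(LINT x|lborel. complex_of_real (exp (- (x - a)\<^sup>2 / 2)) * cis (x * \<xi>))
      = (LINT x|lborel. complex_of_real (exp (- x\<^sup>2 / 2)) * cis (x * \<xi>) * cis (a * \<xi>))"
    by (subst lborel_integral_real_affine[of 1 _ a]) (simp_all add: cis_mult distrib_right mult.assoc add.commute)
  also have "\<dots> = (LINT x|lborel. complex_of_real (exp (- x\<^sup>2 / 2)) * cis (x * \<xi>)) * cis (a * \<xi>)"
    by simp
  also have "(LINT x|lborel. complex_of_real (exp (- x\<^sup>2 / 2)) * cis (x * \<xi>))
      = complex_of_real (sqrt (2 * pi)) * char std_normal_distribution \<xi>"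
    unfolding char_def
    by (subst integral_density)
       (auto simp: std_normal_density_def cis_conv_exp scaleR_conv_of_real mult.commute[of \<xi>])
  finally show ?thesis
    by (simp add: schwartz_ift_def gauss.rep_eq char_std_normal_distribution)
qed

lemma char_density:
  assumes [measurable]: "P \<in> borel_measurable lborel" and nn: "\<And>x. (0::real) \<le> P x"
  shows "char (density lborel P) t = (LINT x|lborel. complex_of_real (P x) * cis (t * x))"
  unfolding char_def
  by (subst integral_density) (auto simp: nn cis_conv_exp scaleR_conv_of_real)

lemma real_distribution_density:
  assumes P: "integrable lborel P" and nn: "\<And>x. (0::real) \<le> P x" and 1: "(LINT x|lborel. P x) = 1"
  shows "real_distribution (density lborel P)"
proof -
  have "emeasure (density lborel P) (space (density lborel P)) = (\<integral>\<^sup>+x. P x \<partial>lborel)"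
    using borel_measurable_integrable[OF P] by (simp add: emeasure_density)
  also have "\<dots> = 1"
    using nn_integral_eq_integral[OF P] nn 1 by simp
  finally have "prob_space (density lborel P)" by (rule prob_spaceI)
  then show ?thesis
    by (simp add: real_distribution_def real_distribution_axioms_def)
qed

lemma fourier_zero_real:
  fixes f :: "real \<Rightarrow> real"
  assumes f: "integrable lborel f"
    and z: "\<And>a. (LINT x|lborel. complex_of_real (f x) * cis (a * x)) = 0"
  shows "AE x in lborel. f x = 0"
proof -
  note [measurable] = borel_measurable_integrable[OF f]
  define P where "P x = max (f x) 0" for x
  define N where "N x = max (- f x) 0" for x
  have P: "integrable lborel P" and N: "integrable lborel N"
    unfolding P_def N_def using f by auto
  have [measurable]: "P \<in> borel_measurable borel" "N \<in> borel_measurable borel"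
    using borel_measurable_integrable[OF P] borel_measurable_integrable[OF N] by auto
  have nn: "0 \<le> P x" "0 \<le> N x" and fPN: "f x = P x - N x" for x
    by (auto simp: P_def N_def)
  have intcis: "integrable lborel (\<lambda>x. complex_of_real (Q x) * cis (a * x))" if "integrable lborel Q" for Q a
  proof (rule Bochner_Integration.integrable_bound[OF that])
    show "(\<lambda>x. complex_of_real (Q x) * cis (a * x)) \<in> borel_measurable lborel"
      using borel_measurable_integrable[OF that]
      by (intro borel_measurable_times) (auto intro!: borel_measurable_continuous_onI continuous_intros)
  qed (simp add: norm_mult)
  have eq: "(LINT x|lborel. complex_of_real (P x) * cis (a * x)) = (LINT x|lborel. complex_of_real (N x) * cis (a * x))" for a
    using z[of a] Bochner_Integration.integral_diff[OF intcis[OF P, of a] intcis[OF N, of a]]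
    by (simp add: fPN left_diff_distrib)
  define c where "c = (LINT x|lborel. P x)"
  have cN: "c = (LINT x|lborel. N x)"
    using eq[of 0] by (simp add: c_def)
  have "c \<ge> 0" unfolding c_def by (simp add: nn)
  show ?thesis
  proof (cases "c = 0")
    case True
    have "AE x in lborel. P x = 0"
      using True integral_nonneg_eq_0_iff_AE[OF P] nn by (simp add: c_def)
    moreover have "AE x in lborel. N x = 0"
      using True integral_nonneg_eq_0_iff_AE[OF N] nn by (simp add: cN)
    ultimately show ?thesis by eventually_elim (simp add: fPN)
  next
    case False
    then have c: "c > 0" using \<open>c \<ge> 0\<close> by simp
    have "density lborel (\<lambda>x. ennreal (P x / c)) = density lborel (\<lambda>x. ennreal (N x / c))"
    proof (rule Levy_uniqueness)
      show "real_distribution (density lborel (\<lambda>x. ennreal (P x / c)))"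
        using P nn c by (intro real_distribution_density) (auto simp flip: c_def)
      show "real_distribution (density lborel (\<lambda>x. ennreal (N x / c)))"
        using N nn c by (intro real_distribution_density) (auto simp flip: cN)
      have "(LINT x|lborel. complex_of_real (P x / c) * cis (t * x)) = (LINT x|lborel. complex_of_real (N x / c) * cis (t * x))" for t
        using eq[of t] by simp
      then show "char (density lborel (\<lambda>x. ennreal (P x / c))) = char (density lborel (\<lambda>x. ennreal (N x / c)))"
        using nn c by (auto simp: fun_eq_iff char_density)
    qed
    then have "AE x in lborel. ennreal (P x / c) = ennreal (N x / c)"
      by (subst (asm) sigma_finite_measure.density_unique_iff[OF lborel.sigma_finite_measure_axioms]) auto
    then show ?thesis
      by eventually_elim (use nn c in \<open>auto simp: fPN\<close>)
  qed
qed

lemma fourier_zero_complex: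
  fixes h :: "real \<Rightarrow> complex"
  assumes h: "integrable lborel h"
    and z: "\<And>a. (LINT x|lborel. h x * cis (a * x)) = 0"
  shows "AE x in lborel. h x = 0"
proof -
  have int: "integrable lborel (\<lambda>x. h x * cis (a * x))" for a
  proof (rule Bochner_Integration.integrable_bound[OF h])
    show "(\<lambda>x. h x * cis (a * x)) \<in> borel_measurable lborel"
      using borel_measurable_integrable[OF h]
      by (intro borel_measurable_times) (auto intro!: borel_measurable_continuous_onI continuous_intros)
  qed (simp add: norm_mult)
  have cnj0: "(LINT x|lborel. cnj (h x) * cis (a * x)) = 0" for a
  proof -
    have "(LINT x|lborel. cnj (h x * cis (- a * x))) = 0"
      unfolding Bochner_Integration.integral_cnj z[of "-a"] by (rule complex_cnj_zero)
    then show ?thesis by (simp add: cis_cnj)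
  qed
  have intc: "integrable lborel (\<lambda>x. cnj (h x) * cis (a * x))" for a
    using Bochner_Integration.integrable_cnj[OF int[of "-a"]] by (simp add: cis_cnj)
  have "AE x in lborel. Re (h x) = 0"
  proof (rule fourier_zero_real)
    show "integrable lborel (\<lambda>x. Re (h x))" using h by simp
    fix a
    have "(\<lambda>x. complex_of_real (Re (h x)) * cis (a * x)) = (\<lambda>x. (h x * cis (a * x) + cnj (h x) * cis (a * x)) / 2)"
      by (auto simp: fun_eq_iff complex_add_cnj simp flip: distrib_right)
    then show "(LINT x|lborel. complex_of_real (Re (h x)) * cis (a * x)) = 0"
      using Bochner_Integration.integral_add[OF int[of a] intc[of a]] z[of a] cnj0[of a] by simp
  qed
  moreover have "AE x in lborel. Im (h x) = 0"
  proof (rule fourier_zero_real)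
    show "integrable lborel (\<lambda>x. Im (h x))" using h by simp
    fix a
    have "(\<lambda>x. complex_of_real (Im (h x)) * cis (a * x)) = (\<lambda>x. (h x * cis (a * x) - cnj (h x) * cis (a * x)) / (2 * \<i>))"
    proof -
      have "z * c - cnj z * c = 2 * \<i> * (complex_of_real (Im z) * c)" for z c
        by (simp add: complex_eq_iff algebra_simps)
      then show ?thesis by (simp add: fun_eq_iff)
    qed
    then show "(LINT x|lborel. complex_of_real (Im (h x)) * cis (a * x)) = 0"
      using Bochner_Integration.integral_diff[OF int[of a] intc[of a]] z[of a] cnj0[of a] by simp
  qed
  ultimately show ?thesis by eventually_elim (simp add: complex_eq_iff)
qed

lemma is_fourier_diff:
  "is_fourier S f \<Longrightarrow> is_fourier T g \<Longrightarrow> is_fourier (S - T) (\<lambda>\<xi>. f \<xi> - g \<xi>)"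
  unfolding is_fourier_def
  by (auto simp: left_diff_distrib minus_tempered.rep_eq)

lemma is_fourier_zero_imp:
  assumes "is_fourier 0 d"
  shows "AE \<xi> in lborel. d \<xi> = 0"
proof -
  let ?h = "\<lambda>\<xi>. d \<xi> * complex_of_real (exp (- \<xi>\<^sup>2 / 2))"
  have 1: "integrable lborel (\<lambda>\<xi>. ?h \<xi> * cis (a * \<xi>))" for a
    using assms unfolding is_fourier_def
    by (metis (mono_tags, lifting) Bochner_Integration.integrable_cong schwartz_ift_gauss mult.assoc)
  have 2: "(LINT \<xi>|lborel. ?h \<xi> * cis (a * \<xi>)) = 0" for a
  proof -
    have "(LINT \<xi>|lborel. d \<xi> * schwartz_ift (gauss a) \<xi>) = 0"
      using assms unfolding is_fourier_def by (metis of_real_0 zero_tempered.rep_eq)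
    then show ?thesis by (simp add: schwartz_ift_gauss mult.assoc)
  qed
  have "AE \<xi> in lborel. ?h \<xi> = 0"
    using 1[of 0] 2 by (intro fourier_zero_complex) simp_all
  then show ?thesis by eventually_elim simp
qed

lemma is_fourier_unique:
  assumes "is_fourier T f" "is_fourier T g"
  shows "AE \<xi> in lborel. f \<xi> = g \<xi>"
  using is_fourier_zero_imp[of "\<lambda>\<xi>. f \<xi> - g \<xi>"] is_fourier_diff[OF assms] by simp

lemma is_fourier_fourier: "is_fourier T g \<Longrightarrow> is_fourier T (fourier T)"
  unfolding fourier_def by (rule someI[of "is_fourier T"])

lemma is_fourier_AE:
  assumes "is_fourier T f" "AE \<xi> in lborel. f \<xi> = 0"
  shows "T = 0"
proof -
  have "apply_dist T \<phi> = 0" for \<phi>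
  proof -
    have "(LINT \<xi>|lborel. f \<xi> * schwartz_ift \<phi> \<xi>) = 0"
      using assms(2) by (intro integral_eq_zero_AE) (auto elim: eventually_mono)
    then show ?thesis using assms(1) unfolding is_fourier_def by (metis of_real_eq_0_iff)
  qed
  then show ?thesis by (simp add: apply_dist_inject[symmetric] zero_tempered.rep_eq fun_eq_iff)
qed

lemma sobolevD:
  assumes "T \<in> sobolev r"
  shows "is_fourier T (fourier T)" "fourier T \<in> borel_measurable lborel"
    "integrable lborel (\<lambda>\<xi>. (1 + \<xi>\<^sup>2) powr r * (cmod (fourier T \<xi>))\<^sup>2)"
proof -
  obtain g where "is_fourier T g" using assms unfolding sobolev_def by blast
  then show F: "is_fourier T (fourier T)" by (rule is_fourier_fourier)
  show "fourier T \<in> borel_measurable lborel" using F unfolding is_fourier_def by (rule conjunct1)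
  show "integrable lborel (\<lambda>\<xi>. (1 + \<xi>\<^sup>2) powr r * (cmod (fourier T \<xi>))\<^sup>2)"
    using assms unfolding sobolev_def by simp
qed

lemma weight_measurable [measurable]: "(\<lambda>\<xi>::real. (1 + \<xi>\<^sup>2) powr r) \<in> borel_measurable borel"
  by measurable

lemma sobolev_cong:
  assumes g: "is_fourier T g"
  shows "T \<in> sobolev r \<longleftrightarrow> integrable lborel (\<lambda>\<xi>. (1 + \<xi>\<^sup>2) powr r * (cmod (g \<xi>))\<^sup>2)"
    and "sobolev_norm r T = sqrt (LINT \<xi>|lborel. (1 + \<xi>\<^sup>2) powr r * (cmod (g \<xi>))\<^sup>2)"
proof -
  note F = is_fourier_fourier[OF g]
  have AE: "AE \<xi> in lborel. fourier T \<xi> = g \<xi>" using is_fourier_unique[OF F g] .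
  have [measurable]: "fourier T \<in> borel_measurable borel" "g \<in> borel_measurable borel"
    using F g unfolding is_fourier_def by auto
  have "integrable lborel (\<lambda>\<xi>. (1 + \<xi>\<^sup>2) powr r * (cmod (fourier T \<xi>))\<^sup>2)
     \<longleftrightarrow> integrable lborel (\<lambda>\<xi>. (1 + \<xi>\<^sup>2) powr r * (cmod (g \<xi>))\<^sup>2)"
    by (rule integrable_cong_AE) (measurable, use AE in \<open>auto elim: eventually_mono\<close>)
  then show "T \<in> sobolev r \<longleftrightarrow> integrable lborel (\<lambda>\<xi>. (1 + \<xi>\<^sup>2) powr r * (cmod (g \<xi>))\<^sup>2)"
    using g unfolding sobolev_def by blast
  have "(LINT \<xi>|lborel. (1 + \<xi>\<^sup>2) powr r * (cmod (fourier T \<xi>))\<^sup>2)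
     = (LINT \<xi>|lborel. (1 + \<xi>\<^sup>2) powr r * (cmod (g \<xi>))\<^sup>2)"
    by (rule integral_cong_AE) (measurable, use AE in \<open>auto elim: eventually_mono\<close>)
  then show "sobolev_norm r T = sqrt (LINT \<xi>|lborel. (1 + \<xi>\<^sup>2) powr r * (cmod (g \<xi>))\<^sup>2)"
    by (simp add: sobolev_norm_def)
qed

subsection \<open>The Sobolev metric\<close>

lemma weighted_L2_triangle:
  fixes f g :: "real \<Rightarrow> complex" and w :: "real \<Rightarrow> real"
  assumes [measurable]: "f \<in> borel_measurable lborel" "g \<in> borel_measurable lborel" "w \<in> borel_measurable lborel"
    and w: "\<And>x. w x \<ge> 0"
    and F: "integrable lborel (\<lambda>x. w x * (cmod (f x))\<^sup>2)" and G: "integrable lborel (\<lambda>x. w x * (cmod (g x))\<^sup>2)"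
  shows "integrable lborel (\<lambda>x. w x * (cmod (f x - g x))\<^sup>2)" (is ?I)
    and "sqrt (LINT x|lborel. w x * (cmod (f x - g x))\<^sup>2)
      \<le> sqrt (LINT x|lborel. w x * (cmod (f x))\<^sup>2) + sqrt (LINT x|lborel. w x * (cmod (g x))\<^sup>2)" (is ?T)
proof -
  have pw: "w x * (cmod (f x - g x))\<^sup>2 \<le> (1 + t) * (w x * (cmod (f x))\<^sup>2) + (1 + 1 / t) * (w x * (cmod (g x))\<^sup>2)"
    if t: "t > 0" for t x
  proof -
    let ?a = "cmod (f x)" and ?b = "cmod (g x)"
    have "(cmod (f x - g x))\<^sup>2 \<le> (?a + ?b)\<^sup>2"
      by (intro power_mono norm_triangle_ineq4) auto
    also have "\<dots> \<le> (1 + t) * ?a\<^sup>2 + (1 + 1 / t) * ?b\<^sup>2"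
    proof -
      have "0 \<le> (t * ?a - ?b)\<^sup>2 / t" using t by simp
      also have "\<dots> = t * ?a\<^sup>2 - 2 * ?a * ?b + ?b\<^sup>2 / t"
        using t by (simp add: field_simps power2_eq_square)
      finally show ?thesis by (simp add: power2_sum algebra_simps)
    qed
    finally have "w x * (cmod (f x - g x))\<^sup>2 \<le> w x * ((1 + t) * ?a\<^sup>2 + (1 + 1 / t) * ?b\<^sup>2)"
      by (intro mult_left_mono w)
    then show ?thesis by (simp add: algebra_simps)
  qed
  show I: ?I
  proof (rule Bochner_Integration.integrable_bound)
    show "integrable lborel (\<lambda>x. (1 + 1) * (w x * (cmod (f x))\<^sup>2) + (1 + 1 / 1) * (w x * (cmod (g x))\<^sup>2))"
      using F G by simp
    show "AE x in lborel. norm (w x * (cmod (f x - g x))\<^sup>2)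
        \<le> norm ((1 + 1) * (w x * (cmod (f x))\<^sup>2) + (1 + 1 / 1) * (w x * (cmod (g x))\<^sup>2))"
    proof (rule AE_I2)
      fix x
      show "norm (w x * (cmod (f x - g x))\<^sup>2)
        \<le> norm ((1 + 1) * (w x * (cmod (f x))\<^sup>2) + (1 + 1 / 1) * (w x * (cmod (g x))\<^sup>2))"
        using pw[of 1 x] w[of x] by simp
    qed
  qed measurable
  define A where "A = sqrt (LINT x|lborel. w x * (cmod (f x))\<^sup>2)"
  define B where "B = sqrt (LINT x|lborel. w x * (cmod (g x))\<^sup>2)"
  define L where "L = (LINT x|lborel. w x * (cmod (f x - g x))\<^sup>2)"
  have A2: "A\<^sup>2 = (LINT x|lborel. w x * (cmod (f x))\<^sup>2)" and B2: "B\<^sup>2 = (LINT x|lborel. w x * (cmod (g x))\<^sup>2)"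
    and nn: "0 \<le> A" "0 \<le> B" "0 \<le> L"
    unfolding A_def B_def L_def using w by simp_all
  have main: "L \<le> (1 + t) * A\<^sup>2 + (1 + 1 / t) * B\<^sup>2" if "t > 0" for t
  proof -
    have "L \<le> (LINT x|lborel. (1 + t) * (w x * (cmod (f x))\<^sup>2) + (1 + 1 / t) * (w x * (cmod (g x))\<^sup>2))"
      unfolding L_def using I F G pw[OF that] by (intro integral_mono) auto
    then show ?thesis using F G by (simp add: A2 B2)
  qed
  have "L \<le> (A + B + 2 * e)\<^sup>2" if e: "e > 0" for e
  proof -
    have "L \<le> (1 + (B + e) / (A + e)) * A\<^sup>2 + (1 + 1 / ((B + e) / (A + e))) * B\<^sup>2"
      using nn e by (intro main) simp
    also have "\<dots> \<le> (1 + (B + e) / (A + e)) * (A + e)\<^sup>2 + (1 + 1 / ((B + e) / (A + e))) * (B + e)\<^sup>2"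
      using nn e by (intro add_mono mult_left_mono power_mono) auto
    also have "\<dots> = (A + B + 2 * e)\<^sup>2"
    proof -
      have "A + e > 0" "B + e > 0" using nn e by auto
      moreover have "(1 + b / a) * a\<^sup>2 + (1 + 1 / (b / a)) * b\<^sup>2 = (a + b)\<^sup>2" if "a > 0" "b > 0" for a b :: real
        using that by (simp add: field_simps power2_eq_square)
      ultimately have "(1 + (B + e) / (A + e)) * (A + e)\<^sup>2 + (1 + 1 / ((B + e) / (A + e))) * (B + e)\<^sup>2 = ((A + e) + (B + e))\<^sup>2"
        by blast
      also have "(A + e) + (B + e) = A + B + 2 * e" by simp
      finally show ?thesis .
    qed
    finally show ?thesis .
  qed
  then have L: "sqrt L \<le> A + B + 2 * e" if "e > 0" for e
    using that nn by (intro real_le_lsqrt) auto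
  have "sqrt L \<le> A + B"
  proof (rule field_le_epsilon)
    fix e :: real assume "e > 0"
    then show "sqrt L \<le> A + B + e" using L[of "e / 2"] by simp
  qed
  then show ?T by (simp add: A_def B_def L_def)
qed

lemma sobolev_diff: "S \<in> sobolev r \<Longrightarrow> T \<in> sobolev r \<Longrightarrow> S - T \<in> sobolev r"
  and sobolev_norm_diff_le:
    "S \<in> sobolev r \<Longrightarrow> T \<in> sobolev r \<Longrightarrow> sobolev_norm r (S - T) \<le> sobolev_norm r S + sobolev_norm r T"
proof -
  assume S: "S \<in> sobolev r" and T: "T \<in> sobolev r"
  note D = is_fourier_diff[OF sobolevD(1)[OF S] sobolevD(1)[OF T]]
  note L2 = weighted_L2_triangle[OF sobolevD(2)[OF S] sobolevD(2)[OF T] _ _ sobolevD(3)[OF S] sobolevD(3)[OF T]]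
  show "S - T \<in> sobolev r"
    using L2(1) by (simp add: sobolev_cong[OF D])
  show "sobolev_norm r (S - T) \<le> sobolev_norm r S + sobolev_norm r T"
    unfolding sobolev_cong(2)[OF D] unfolding sobolev_norm_def using L2(2) by simp
qed

lemma zero_in_sobolev: "0 \<in> sobolev r" and sobolev_norm_zero: "sobolev_norm r 0 = 0"
proof -
  have "is_fourier 0 (\<lambda>_. 0)" by (simp add: is_fourier_def zero_tempered.rep_eq)
  from sobolev_cong[OF this] show "0 \<in> sobolev r" "sobolev_norm r 0 = 0" by simp_all
qed

lemma is_fourier_uminus: "is_fourier T g \<Longrightarrow> is_fourier (- T) (\<lambda>\<xi>. - g \<xi>)"
  by (auto simp: is_fourier_def uminus_tempered.rep_eq)

lemma sobolev_norm_uminus: "sobolev_norm r (- T) = sobolev_norm r T"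
proof (cases "\<exists>g. is_fourier T g")
  case True
  then obtain g where g: "is_fourier T g" by blast
  show ?thesis
    unfolding sobolev_cong(2)[OF is_fourier_uminus[OF g]] sobolev_cong(2)[OF g] by simp
next
  case False
  then have "\<not> is_fourier T g" "\<not> is_fourier (- T) g" for g
    using is_fourier_uminus[of "- T" g] by auto
  then have "fourier T = fourier (- T)"
    by (simp add: fourier_def)
  then show ?thesis by (simp add: sobolev_norm_def)
qed

lemma sobolev_norm_minus_commute: "sobolev_norm r (S - T) = sobolev_norm r (T - S)"
  using sobolev_norm_uminus[of r "S - T"] by simp

lemma sobolev_norm_eq_0:
  assumes "T \<in> sobolev r" "sobolev_norm r T = 0"
  shows "T = 0"
proof (rule is_fourier_AE)
  show "is_fourier T (fourier T)" by (rule sobolevD[OF assms(1)])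
  have "AE \<xi> in lborel. (1 + \<xi>\<^sup>2) powr r * (cmod (fourier T \<xi>))\<^sup>2 = 0"
    using assms(2) integral_nonneg_eq_0_iff_AE[OF sobolevD(3)[OF assms(1)]]
    by (simp add: sobolev_norm_def)
  then show "AE \<xi> in lborel. fourier T \<xi> = 0"
  proof eventually_elim
    case (elim \<xi>)
    have "1 + \<xi>\<^sup>2 > 0" by (simp add: add_pos_nonneg)
    with elim show ?case by simp
  qed
qed

lemma Metric_space_sobolev: "Metric_space (sobolev r) (\<lambda>S T. sobolev_norm r (S - T))"
proof
  show "0 \<le> sobolev_norm r (S - T)" for S T
    by (simp add: sobolev_norm_def)
next
  fix S T assume ST: "S \<in> sobolev r" "T \<in> sobolev r"
  then show "sobolev_norm r (S - T) = 0 \<longleftrightarrow> S = T"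
    using sobolev_norm_eq_0[OF sobolev_diff[OF ST]] sobolev_norm_zero by auto
next
  fix S T U assume S: "S \<in> sobolev r" "T \<in> sobolev r" "U \<in> sobolev r"
  have "sobolev_norm r (S - U) = sobolev_norm r ((S - T) - (U - T))" by simp
  also have "\<dots> \<le> sobolev_norm r (S - T) + sobolev_norm r (U - T)"
    by (intro sobolev_norm_diff_le sobolev_diff S)
  finally show "sobolev_norm r (S - U) \<le> sobolev_norm r (S - T) + sobolev_norm r (T - U)"
    by (simp add: sobolev_norm_minus_commute[of r U])
qed (rule sobolev_norm_minus_commute)

definition sobolev_metric :: "real \<Rightarrow> tempered metric" where
  "sobolev_metric r = metric (sobolev r, \<lambda>S T. sobolev_norm r (S - T))"

lemma mspace_sobolev_metric [simp]: "mspace (sobolev_metric r) = sobolev r"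
  unfolding sobolev_metric_def by (rule Metric_space.mspace_metric[OF Metric_space_sobolev])

lemma mdist_sobolev_metric [simp]: "mdist (sobolev_metric r) S T = sobolev_norm r (S - T)"
  unfolding sobolev_metric_def by (simp add: Metric_space.mdist_metric[OF Metric_space_sobolev])

text \<open>\<open>C\<^sup>0([0,T], H\<^sup>r)\<close> with the supremum metric.  Its elements are extensional functions, i.e.
  \<open>undefined\<close> outside \<open>[0,T]\<close>, so equality of elements is equality on \<open>[0,T]\<close>; boundedness, which
  \<open>cfunspace\<close> requires, is automatic on a compact interval.\<close>

definition C0_sobolev :: "real \<Rightarrow> real \<Rightarrow> (real \<Rightarrow> tempered) metric" where
  "C0_sobolev T r = cfunspace (top_of_set {0..T}) (sobolev_metric r)"

text \<open>The integral of an \<open>H\<^sup>r\<close>-valued function over \<open>[a,b]\<close>: the condition of \<open>has_integral_cbox\<close> with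
  convergence of the sums in the topology of \<open>H\<^sup>r\<close> (which is not a type, so \<open>has_integral\<close> itself
  does not apply).  For a continuous integrand it is the Riemann, and the Bochner, integral.\<close>

definition has_sobolev_integral ::
  "real \<Rightarrow> (real \<Rightarrow> tempered) \<Rightarrow> tempered \<Rightarrow> real \<Rightarrow> real \<Rightarrow> bool" where
  "has_sobolev_integral r F I a b \<longleftrightarrow> (\<forall>\<tau>\<in>{a..b}. F \<tau> \<in> sobolev r) \<and>
     limitin (mtopology_of (sobolev_metric r))
       (\<lambda>p. \<Sum>(\<tau>, K)\<in>p. measure lborel K *\<^sub>R F \<tau>) I (division_filter (cbox a b))"

section \<open>The Holm-Staley b-family\<close>

text \<open>The duality bracket between \<open>H\<^sup>r\<close> and \<open>H\<^sup>-\<^sup>r\<close>, which extends \<open>(g, h) \<mapsto> \<integral> g h dx\<close>.  For a test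
  function \<open>h = \<psi>\<close> one has \<open>fourier h (-\<xi>) = schwartz_ift \<psi> \<xi>\<close>, so that the bracket is \<open>g(\<psi>)\<close>.  The
  integral is real for real \<open>g\<close> and \<open>h\<close>.\<close>

definition dual_bracket :: "tempered \<Rightarrow> tempered \<Rightarrow> real" where
  "dual_bracket g h = Re (LINT \<xi>|lborel. fourier g \<xi> * fourier h (- \<xi>))"

text \<open>The product \<open>f \<cdot> g\<close> given by \<open>\<langle>f \<cdot> g, \<psi>\<rangle> = \<langle>g, f \<psi>\<rangle>\<close>, for \<open>f \<in> H\<^sup>r\<close>, \<open>g \<in> H\<^sup>q\<close> with \<open>r + q \<ge> 0\<close>.
  If \<open>f\<close> and \<open>g\<close> are both square integrable functions, the bracket is \<open>\<integral> g f \<psi> dx\<close> (Parseval)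
  and \<open>f \<cdot> g\<close> is the pointwise product.\<close>

definition dist_mult :: "tempered \<Rightarrow> tempered \<Rightarrow> tempered" where
  "dist_mult f g = (THE h. \<forall>\<psi>. apply_dist h \<psi> = dual_bracket g (schwartz_times \<psi> f))"

text \<open>\<open>1 - \<partial>\<^sup>2\<close> is a bijection of the tempered distributions (its symbol is \<open>1 + \<xi>\<^sup>2\<close>), mapping
  \<open>H\<^sup>r\<close> onto \<open>H\<^sup>r\<^sup>-\<^sup>2\<close>.\<close>

definition helmholtz_inverse :: "tempered \<Rightarrow> tempered" where
  "helmholtz_inverse f = (THE v. v - dist_deriv (dist_deriv v) = f)"

definition b_family_rhs :: "real \<Rightarrow> tempered \<Rightarrow> tempered" where
  "b_family_rhs b u =
     (let u_x = dist_deriv u; u_xx = dist_deriv u_x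
      in helmholtz_inverse ((- b) *\<^sub>R dist_mult u u_x + (b - 3) *\<^sub>R dist_mult u_x u_xx)
         - dist_mult u u_x)"

definition b_family_solution ::
  "real \<Rightarrow> real \<Rightarrow> real \<Rightarrow> tempered \<Rightarrow> (real \<Rightarrow> tempered) \<Rightarrow> bool" where
  "b_family_solution b s T u0 u \<longleftrightarrow> u \<in> mspace (C0_sobolev T s) \<and>
     (\<forall>t\<in>{0..T}. \<exists>I. has_sobolev_integral (s - 1) (\<lambda>\<tau>. b_family_rhs b (u \<tau>)) I 0 t \<and> u t = u0 + I)"

end

theory Submission
  imports Defs
begin

text \<open>In terms of \<open>v = \<langle>D\<rangle>\<^sup>s u \<in> L\<^sup>2\<close> the equation reads \<open>J v' = Q v v\<close> with \<open>J = \<langle>D\<rangle>\<^sup>-\<^sup>1\<close> and a bounded symmetric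
  bilinear operator \<open>Q\<close> on \<open>L\<^sup>2\<close>, given on the Fourier side by an explicit kernel: the nonlinearity loses
  one derivative, and only through the transport term.  Truncation to the frequencies \<open>\<bar>\<xi>\<bar> \<le> n\<close> gives an
  ordinary differential equation.  Antisymmetrising the kernel yields two a priori estimates: an energy
  estimate for the \<open>L\<^sup>2\<close> norm of \<open>v\<close> weighted by \<open>(min 1 (\<langle>\<xi>\<rangle> / N))\<^sup>2\<close>, uniform in \<open>n\<close> and \<open>N\<close>, so
  that the high-frequency tail of a solution is controlled by the tail of its initial value; and an
  estimate for differences of solutions in the weaker norm of \<open>u\<close> in \<open>H\<^sup>1\<^sup>/\<^sup>2\<close>.  The weak norm controls the
  low frequencies and the tail the high ones, so the two together give convergence of the truncated
  solutions, uniqueness, and continuity of the solution map in the strong norm.\<close>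

section \<open>An abstract quasilinear evolution equation\<close>

text \<open>The range s > 3/2 is used up to its edge in three places. The weight
  \<open>japanese \<xi> powr (1 - s)\<close> is square integrable, so that H^(s-1) is an algebra.
  The exponent of \<open>K\<close> is negative, so that the truncation error, merely bounded in L^2,
  tends to zero once \<open>K\<close> is applied. And a norm for differences exists: in H^\<sigma>
  the transport term wants multiplication by u_x in H^(s-1) to be bounded on H^\<sigma>, and the
  nonlocal term wants the same on H^(\<sigma>-1). This asks for 2 - s \<le> \<sigma> \<le> s - 1,
  and \<sigma> = 1/2 is the one choice that serves every s > 3/2. The weight min 1
  (\<langle>\<xi>\<rangle> / N) is nondecreasing in \<langle>\<xi>\<rangle> and at most doubles when
  \<langle>\<xi>\<rangle> doubles; hence its commutator with the transport term is bounded
  independently of N, while it tends to zero pointwise as N grows. Bounding the tail of a solution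
  by the tail of its data does the work for which solutions with mollified data are often compared
  with each other.\<close>

lemma gronwall:
  fixes E E' :: "real \<Rightarrow> real"
  assumes der: "\<And>t. t \<in> {0..T} \<Longrightarrow> (E has_real_derivative E' t) (at t within {0..T})"
    and le: "\<And>t. t \<in> {0..T} \<Longrightarrow> E' t \<le> c * E t + \<epsilon>" and c: "c > 0" and t: "t \<in> {0..T}"
  shows "E t \<le> (E 0 + \<epsilon> / c) * exp (c * t) - \<epsilon> / c"
proof -
  \<comment> \<open>The shift by \<open>\<epsilon> / c\<close> absorbs the inhomogeneity:
    \<open>E t + \<epsilon> / c\<close> satisfies the homogeneous inequality, so its product with
    \<open>exp (- c * t)\<close> decreases.\<close>
  define g where "g t = exp (- c * t) * (E t + \<epsilon> / c)" for t
  have g: "(g has_real_derivative exp (- c * t) * (E' t - c * E t - \<epsilon>)) (at t within {0..T})"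
    if "t \<in> {0..T}" for t
    unfolding g_def
    by (rule derivative_eq_intros der[OF that] refl)+ (use c in \<open>simp add: field_simps\<close>)
  have "g t \<le> g 0"
  proof (cases "t = 0")
    case False
    with t have "0 < t" by auto
    then show ?thesis
    proof (rule DERIV_nonpos_imp_decreasing_open[OF less_imp_le])
      fix x assume x: "0 < x" "x < t"
      then have "(g has_real_derivative exp (- c * x) * (E' x - c * E x - \<epsilon>)) (at x)"
        using g[of x] t by (simp add: at_within_Icc_at)
      moreover have "exp (- c * x) * (E' x - c * E x - \<epsilon>) \<le> 0"
        using le[of x] x t by (intro mult_nonneg_nonpos) auto
      ultimately show "\<exists>y. (g has_real_derivative y) (at x) \<and> y \<le> 0" by blast
    next
      have "continuous_on {0..T} g"
        using g by (intro DERIV_continuous_on)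
      then show "continuous_on {0..t} g"
        by (rule continuous_on_subset) (use t in auto)
    qed
  qed simp
  then have "exp (c * t) * g t \<le> exp (c * t) * g 0" by simp
  also have "exp (c * t) * g t = E t + \<epsilon> / c"
    unfolding g_def mult.assoc[symmetric] exp_add[symmetric] by simp
  finally show ?thesis by (simp add: g_def mult.commute)
qed

text \<open>The iteration contracts on the whole interval at once if the unknown is
  \<open>exp (- k * t) *\<^sub>R v t\<close> in place of \<open>v t\<close>: integrating
  \<open>exp (k * \<tau>)\<close> yields a factor \<open>1 / k\<close>, which beats the Lipschitz
  constant as soon as \<open>\<bar>L\<bar> / k \<le> 1/2\<close>.\<close>

lemma picard_global:
  fixes G :: "'a::banach \<Rightarrow> 'a" and T L :: real
  assumes lip: "\<And>x y. norm (G x - G y) \<le> L * norm (x - y)" and T: "0 \<le> T"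
  shows "\<exists>v. continuous_on {0..T} v \<and> (\<forall>t\<in>{0..T}. v t = x0 + integral {0..t} (\<lambda>\<tau>. G (v \<tau>)))"
proof -
  define k where "k = 2 * \<bar>L\<bar> + 1"
  have k: "k > 0" "\<bar>L\<bar> / k \<le> 1/2" by (auto simp: k_def field_simps)
  have lip': "norm (G x - G y) \<le> \<bar>L\<bar> * norm (x - y)" for x y
    by (rule order_trans[OF lip]) (simp add: mult_right_mono)
  have contG: "continuous_on UNIV G"
  proof -
    have "\<bar>L\<bar>-lipschitz_on UNIV G"
      using lip' by (intro lipschitz_onI) (auto simp: dist_norm)
    then show ?thesis by (rule lipschitz_on_continuous_on)
  qed
  define I where "I f t = integral {0..t} (\<lambda>\<tau>. G (exp (k * \<tau>) *\<^sub>R f \<tau>))" for f :: "real \<Rightarrow> 'a" and t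
  define H where "H f t = exp (- k * t) *\<^sub>R (x0 + I f t)" for f :: "real \<Rightarrow> 'a" and t
  have cont: "continuous_on A (\<lambda>\<tau>. G (exp (k * \<tau>) *\<^sub>R f \<tau>))" if "continuous_on A f" for A and f :: "real \<Rightarrow> 'a"
    by (rule continuous_on_compose2[OF contG]) (auto intro!: continuous_intros that)
  have contI: "continuous_on {0..T} (I f)" if "continuous_on {0..T} f" for f :: "real \<Rightarrow> 'a"
    unfolding I_def by (intro indefinite_integral_continuous_1 integrable_continuous_real cont that)
  have contH: "continuous_on {0..T} (H f)" if "continuous_on {0..T} f" for f :: "real \<Rightarrow> 'a"
    unfolding H_def by (intro continuous_intros contI that)
  \<comment> \<open>The fixed point is sought in the Banach space of bounded continuous functions on
    the whole line. \<open>ext_cont\<close> continues a function on \<open>{0..T}\<close> by its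
    boundary values, so the supremum over the line is the one over the interval.\<close>
  define \<Phi> :: "(real \<Rightarrow>\<^sub>C 'a) \<Rightarrow> (real \<Rightarrow>\<^sub>C 'a)"
    where "\<Phi> f = Bcontfun (ext_cont (H (apply_bcontfun f)) 0 T)" for f
  have app: "apply_bcontfun (\<Phi> f) = ext_cont (H (apply_bcontfun f)) 0 T" for f
    unfolding \<Phi>_def
  proof (rule Bcontfun_inverse)
    have c: "continuous_on (cbox 0 T) (H (apply_bcontfun f))"
      using contH[OF continuous_on_apply_bcontfun] by simp
    have "continuous_on UNIV (ext_cont (H (apply_bcontfun f)) 0 T)"
      using c by (rule continuous_on_ext_cont)
    moreover have "bounded (range (ext_cont (H (apply_bcontfun f)) 0 T))"
      unfolding ext_cont_def
      using compact_imp_bounded[OF compact_continuous_image[OF c compact_cbox]]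
      by (rule clamp_bounded)
    ultimately show "ext_cont (H (apply_bcontfun f)) 0 T \<in> bcontfun"
      by (simp add: bcontfun_def)
  qed
  have app_in: "apply_bcontfun (\<Phi> f) t = H (apply_bcontfun f) t" if "t \<in> {0..T}" for f t
    unfolding app using that by (simp add: ext_cont_def)
  have Hdist: "norm (H (apply_bcontfun f) t - H (apply_bcontfun g) t) \<le> 1/2 * dist f g" if t: "t \<in> {0..T}" for f g t
  proof -
    let ?d = "dist f g"
    have ci: "(\<lambda>\<tau>. G (exp (k * \<tau>) *\<^sub>R apply_bcontfun f \<tau>)) integrable_on {0..t}" for f
      by (intro integrable_continuous_real cont continuous_on_apply_bcontfun)
    have "I (apply_bcontfun f) t - I (apply_bcontfun g) t
        = integral {0..t} (\<lambda>\<tau>. G (exp (k * \<tau>) *\<^sub>R apply_bcontfun f \<tau>) - G (exp (k * \<tau>) *\<^sub>R apply_bcontfun g \<tau>))"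
      unfolding I_def by (rule Henstock_Kurzweil_Integration.integral_diff[symmetric, OF ci ci])
    also have "norm \<dots> \<le> integral {0..t} (\<lambda>\<tau>. (\<bar>L\<bar> * ?d) * exp (k * \<tau>))"
    proof (rule integral_norm_bound_integral)
      show "(\<lambda>\<tau>. G (exp (k * \<tau>) *\<^sub>R apply_bcontfun f \<tau>) - G (exp (k * \<tau>) *\<^sub>R apply_bcontfun g \<tau>)) integrable_on {0..t}"
        by (intro integrable_diff ci)
      show "(\<lambda>\<tau>. (\<bar>L\<bar> * ?d) * exp (k * \<tau>)) integrable_on {0..t}"
        by (intro integrable_continuous_real continuous_intros)
      fix \<tau> assume "\<tau> \<in> {0..t}"
      have "norm (G (exp (k * \<tau>) *\<^sub>R apply_bcontfun f \<tau>) - G (exp (k * \<tau>) *\<^sub>R apply_bcontfun g \<tau>))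
          \<le> \<bar>L\<bar> * norm (exp (k * \<tau>) *\<^sub>R (apply_bcontfun f \<tau> - apply_bcontfun g \<tau>))"
        using lip' by (simp add: scaleR_diff_right)
      also have "\<dots> \<le> \<bar>L\<bar> * (exp (k * \<tau>) * ?d)"
        using dist_bounded[of f \<tau> g] by (intro mult_left_mono) (auto simp: dist_norm)
      finally show "norm (G (exp (k * \<tau>) *\<^sub>R apply_bcontfun f \<tau>) - G (exp (k * \<tau>) *\<^sub>R apply_bcontfun g \<tau>))
          \<le> (\<bar>L\<bar> * ?d) * exp (k * \<tau>)" by (simp add: mult_ac)
    qed
    also have "\<dots> = (\<bar>L\<bar> * ?d) * ((exp (k * t) - 1) / k)"
    proof -
      have "((\<lambda>\<tau>. exp (k * \<tau>)) has_integral exp (k * t) / k - exp (k * 0) / k) {0..t}"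
        using t k by (intro fundamental_theorem_of_calculus)
          (auto intro!: derivative_eq_intros simp: has_real_derivative_iff_has_vector_derivative[symmetric])
      then have "((\<lambda>\<tau>. exp (k * \<tau>)) has_integral (exp (k * t) - 1) / k) {0..t}"
        by (simp add: diff_divide_distrib)
      then show ?thesis by (simp add: integral_unique)
    qed
    also have "\<dots> \<le> (\<bar>L\<bar> * ?d) * (exp (k * t) / k)"
      using k by (intro mult_left_mono divide_right_mono) auto
    finally have 1: "norm (I (apply_bcontfun f) t - I (apply_bcontfun g) t) \<le> (\<bar>L\<bar> * ?d) * (exp (k * t) / k)" .
    have "norm (H (apply_bcontfun f) t - H (apply_bcontfun g) t) = exp (- k * t) * norm (I (apply_bcontfun f) t - I (apply_bcontfun g) t)"
      by (simp add: H_def scaleR_diff_right[symmetric])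
    also have "\<dots> \<le> exp (- k * t) * ((\<bar>L\<bar> * ?d) * (exp (k * t) / k))"
      using 1 by (intro mult_left_mono) auto
    also have "\<dots> = (exp (- k * t) * exp (k * t)) * (\<bar>L\<bar> / k) * ?d" by simp
    also have "\<dots> = \<bar>L\<bar> / k * ?d" unfolding exp_add[symmetric] by simp
    also have "\<dots> \<le> 1/2 * ?d" using k by (intro mult_right_mono) auto
    finally show ?thesis .
  qed
  have "dist (\<Phi> f) (\<Phi> g) \<le> 1/2 * dist f g" for f g
  proof (rule dist_bound)
    fix t
    have "clamp 0 T t \<in> {0..T}" using clamp_in_interval[of 0 T t] T by simp
    from Hdist[OF this] show "dist (apply_bcontfun (\<Phi> f) t) (apply_bcontfun (\<Phi> g) t) \<le> 1/2 * dist f g"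
      unfolding app ext_cont_def by (simp add: dist_norm)
  qed
  then obtain f where f: "\<Phi> f = f"
    using banach_fix_type[of "1/2" \<Phi>] by auto
  define v where "v t = exp (k * t) *\<^sub>R apply_bcontfun f t" for t
  have "continuous_on {0..T} v" unfolding v_def by (intro continuous_intros continuous_on_apply_bcontfun)
  moreover have "v t = x0 + integral {0..t} (\<lambda>\<tau>. G (v \<tau>))" if t: "t \<in> {0..T}" for t
  proof -
    have "v t = exp (k * t) *\<^sub>R H (apply_bcontfun f) t"
      using app_in[OF t, of f] f by (simp add: v_def)
    then show ?thesis by (simp add: H_def I_def v_def exp_minus)
  qed
  ultimately show ?thesis by blast
qed

text \<open>The radial retraction onto the ball of radius \<open>R\<close>. Inserted into a
  quadratic map it gives a globally Lipschitz map that agrees with the old one on the ball. As the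
  value is \<open>x\<close> times a scalar in [0,1], sign conditions such as an energy estimate
  survive the insertion.\<close>

definition radial_ret :: "real \<Rightarrow> 'a::real_normed_vector \<Rightarrow> 'a" where
  "radial_ret R x = (R / max R (norm x)) *\<^sub>R x"

lemma radial_ret_id: "R > 0 \<Longrightarrow> norm x \<le> R \<Longrightarrow> radial_ret R x = x"
  by (simp add: radial_ret_def max_def)

lemma norm_radial_ret: "R > 0 \<Longrightarrow> norm (radial_ret R x) \<le> R"
  by (auto simp: radial_ret_def max_def field_simps)

text \<open>The difference splits into a change of the argument with the scalar fixed and a change
  of the scalar; each costs at most \<open>norm (x - y)\<close>, whence the constant 2 in any normed
  space.\<close>

lemma radial_ret_lipschitz:
  assumes R: "R > 0"
  shows "norm (radial_ret R x - radial_ret R y) \<le> 2 * norm (x - y)"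
proof -
  let ?m = "\<lambda>x. max R (norm x)"
  have m: "?m x > 0" "?m y > 0" using R by auto
  have eq: "radial_ret R x - radial_ret R y = (R / ?m x) *\<^sub>R (x - y) + (R / ?m x - R / ?m y) *\<^sub>R y"
    by (simp add: radial_ret_def algebra_simps)
  have 1: "norm ((R / ?m x) *\<^sub>R (x - y)) \<le> norm (x - y)"
  proof -
    have "R / ?m x \<le> 1" using R by (simp add: divide_le_eq)
    then have "(R / ?m x) * norm (x - y) \<le> 1 * norm (x - y)" by (rule mult_right_mono) simp
    then show ?thesis using R by simp
  qed
  have "R / ?m x - R / ?m y = (R / ?m x) * ((?m y - ?m x) / ?m y)"
    using m by (simp add: field_simps)
  then have "norm ((R / ?m x - R / ?m y) *\<^sub>R y) = (R / ?m x) * (\<bar>?m y - ?m x\<bar> * (norm y / ?m y))"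
    using m R by (simp add: abs_mult)
  also have "\<dots> \<le> 1 * (norm (x - y) * 1)"
  proof (intro mult_mono)
    show "R / ?m x \<le> 1" using R by (simp add: divide_le_eq)
    have "\<bar>?m y - ?m x\<bar> \<le> \<bar>norm y - norm x\<bar>" by (simp add: max_def)
    also have "\<dots> \<le> norm (x - y)" by (metis norm_minus_commute norm_triangle_ineq3)
    finally show "\<bar>?m y - ?m x\<bar> \<le> norm (x - y)" .
    show "norm y / ?m y \<le> 1" using m by (simp add: divide_le_eq)
  qed (use m in auto)
  finally show ?thesis using 1 unfolding eq by (smt (verit) norm_triangle_ineq)
qed

text \<open>For the b-family, \<open>v = \<langle>D\<rangle>\<^sup>s u\<close>, \<open>J = \<langle>D\<rangle>\<^sup>-\<^sup>1\<close>, \<open>K\<close> has the symbol \<open>\<langle>\<xi>\<rangle>\<close> to the power \<open>3 - 2 s\<close>, \<open>P n\<close> is the cutoff to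
  \<open>\<bar>\<xi>\<bar> \<le> n\<close>, \<open>L n = P n \<langle>D\<rangle>\<close>, and \<open>\<Theta> n\<close> has the symbol \<open>(min 1 (\<langle>\<xi>\<rangle> / (n + 1)))\<^sup>2\<close>.  The equation is
  \<open>J v' = Q v v\<close>; \<open>low\<close> below is the square of the \<open>H\<^sup>1\<^sup>/\<^sup>2\<close> norm of \<open>u\<close>, in which differences are
  estimated, and \<open>tail n\<close> measures the frequencies above \<open>n\<close>.\<close>

locale quasilinear =
  fixes J K :: "'a::{real_inner,banach} \<Rightarrow> 'a"
    and P L \<Theta> :: "nat \<Rightarrow> 'a \<Rightarrow> 'a"
    and Q :: "'a \<Rightarrow> 'a \<Rightarrow> 'a"
    and C :: real and \<epsilon> c :: "nat \<Rightarrow> real"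
  assumes J: "bounded_linear J" and K: "bounded_linear K"
    and P: "\<And>n. bounded_linear (P n)" and L: "\<And>n. bounded_linear (L n)"
    and \<Theta>: "\<And>n. bounded_linear (\<Theta> n)" and Q: "bounded_bilinear Q"
    and J_inj: "\<And>x. J x = 0 \<Longrightarrow> x = 0" and K_inj: "\<And>x. K x = 0 \<Longrightarrow> x = 0"
    and K_sym: "\<And>x y. inner (K x) y = inner x (K y)"
    and \<Theta>_sym: "\<And>n x y. inner (\<Theta> n x) y = inner x (\<Theta> n y)"
    and Q_commute: "\<And>x y. Q x y = Q y x"
    and P_idem: "\<And>n x. P n (P n x) = P n x" and JL: "\<And>n x. J (L n x) = P n x"
    and PL: "\<And>n x. P n (L n x) = L n x"
    and P_tendsto: "\<And>x. (\<lambda>n. P n x) \<longlonglongrightarrow> x"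
    and \<Theta>_nonneg: "\<And>n x. 0 \<le> inner (\<Theta> n x) x"
    and \<Theta>_le: "\<And>n x. inner (\<Theta> n x) x \<le> (norm x)\<^sup>2" and \<Theta>_0: "\<And>x. \<Theta> 0 x = x"
    and \<Theta>P: "\<And>n m x. inner (\<Theta> n (P m x)) (P m x) \<le> inner (\<Theta> n x) x"
    and \<Theta>_tendsto: "\<And>x. (\<lambda>n. inner (\<Theta> n x) x) \<longlonglongrightarrow> 0"
    and C: "C > 0"
    and low_nonneg: "\<And>x. 0 \<le> inner (K (J x)) (J x)"
    and low_estimate: "\<And>z w. inner (K (J w)) (Q z w) \<le> C * norm z * inner (K (J w)) (J w)"
    and energy_estimate: "\<And>n N v. P n v = v \<Longrightarrow>
        inner (\<Theta> N v) (L n (Q v v)) \<le> C * norm v * inner (\<Theta> N v) v"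
    and K_truncation: "\<And>n x. norm (K (x - P n x)) \<le> \<epsilon> n * norm x" and \<epsilon>: "\<epsilon> \<longlonglongrightarrow> 0"
    and splitting: "\<And>n x. (norm x)\<^sup>2 \<le> inner (\<Theta> n x) x + c n * inner (K (J x)) (J x)"
    and c: "\<And>n. c n > 0"
begin

section \<open>Weak norm, tails and uniqueness for the abstract equation\<close>

definition low :: "'a \<Rightarrow> real" where "low x = inner (K (J x)) (J x)"
definition tail :: "nat \<Rightarrow> 'a \<Rightarrow> real" where "tail n x = inner (\<Theta> n x) x"

text \<open>A derivative of \<open>v\<close> in the strong norm is not to be expected: only
  \<open>J v\<close> is differentiable, since the equation loses one derivative. Hence the
  integrated equation is stated for \<open>J v\<close>.\<close>

definition solution :: "real \<Rightarrow> 'a \<Rightarrow> (real \<Rightarrow> 'a) \<Rightarrow> bool" where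
  "solution T v0 v \<longleftrightarrow> continuous_on {0..T} v \<and>
     (\<forall>t\<in>{0..T}. ((\<lambda>\<tau>. Q (v \<tau>) (v \<tau>)) has_integral (J (v t) - J v0)) {0..t})"

text \<open>Parallelogram law for the nonnegative form of \<open>\<Theta> n\<close>, with the term
  of \<open>x + y\<close> dropped.\<close>

lemma tail_diff: "tail n (x - y) \<le> 2 * tail n x + 2 * tail n y"
proof -
  interpret T: bounded_linear "\<Theta> n" by (rule \<Theta>)
  have "tail n (x - y) + tail n (x + y) = 2 * tail n x + 2 * tail n y"
    by (simp add: tail_def T.diff T.add inner_diff inner_add)
  then show ?thesis using \<Theta>_nonneg[of n "x + y"] by (simp add: tail_def)
qed

lemma low_le: "\<exists>B>0. \<forall>x. low x \<le> B * (norm x)\<^sup>2"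
proof -
  obtain j where j: "j > 0" "\<And>x. norm (J x) \<le> norm x * j"
    using bounded_linear.pos_bounded[OF J] by blast
  obtain k where k: "k > 0" "\<And>x. norm (K x) \<le> norm x * k"
    using bounded_linear.pos_bounded[OF K] by blast
  have "low x \<le> (j * k * j) * (norm x)\<^sup>2" for x
  proof -
    have "low x \<le> norm (K (J x)) * norm (J x)" unfolding low_def by (rule norm_cauchy_schwarz)
    also have "\<dots> \<le> (norm x * j * k) * (norm x * j)"
      using j k by (intro mult_mono order_trans[OF k(2)] mult_right_mono j(2)) auto
    finally show ?thesis by (simp add: power2_eq_square mult_ac)
  qed
  then show ?thesis using j k by (intro exI[of _ "j * k * j"]) auto
qed

text \<open>By symmetry of \<open>Q\<close> the difference \<open>w\<close> obeys a linear equation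
  with \<open>Q (v1 + v2) w\<close> on the right, and \<open>low_estimate\<close> with
  \<open>norm (v1 + v2) \<le> 2 * R\<close> gives the rate \<open>4 * C * R\<close> after doubling.
  The residuals are moved under \<open>K\<close> by its symmetry, so only \<open>K (r1 t)\<close>
  and \<open>K (r2 t)\<close> have to be small. With zero residuals this compares exact solutions,
  otherwise truncated ones.\<close>

lemma low_diff_growth:
  assumes T: "t \<in> {0..T}" and R: "R > 0"
    and d1: "\<And>t. t \<in> {0..T} \<Longrightarrow> ((\<lambda>t. J (v1 t)) has_vector_derivative Q (v1 t) (v1 t) - r1 t) (at t within {0..T})"
    and d2: "\<And>t. t \<in> {0..T} \<Longrightarrow> ((\<lambda>t. J (v2 t)) has_vector_derivative Q (v2 t) (v2 t) - r2 t) (at t within {0..T})"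
    and n1: "\<And>t. t \<in> {0..T} \<Longrightarrow> norm (v1 t) \<le> R" and n2: "\<And>t. t \<in> {0..T} \<Longrightarrow> norm (v2 t) \<le> R"
    and r1: "\<And>t. t \<in> {0..T} \<Longrightarrow> norm (K (r1 t)) \<le> \<delta>1" and r2: "\<And>t. t \<in> {0..T} \<Longrightarrow> norm (K (r2 t)) \<le> \<delta>2"
  shows "low (v1 t - v2 t) \<le> (low (v1 0 - v2 0) + onorm J * (\<delta>1 + \<delta>2) / C) * exp (4 * C * R * t)"
proof -
  interpret J: bounded_linear J by (rule J)
  interpret K: bounded_linear K by (rule K)
  interpret Q: bounded_bilinear Q by (rule Q)
  define w where "w t = v1 t - v2 t" for t
  define D where "D t = 2 * inner (K (J (w t))) (Q (v1 t + v2 t) (w t) + (r2 t - r1 t))" for t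
  have onJ: "0 \<le> onorm J" by (rule onorm_pos_le[OF J])
  have dw: "((\<lambda>t. J (w t)) has_vector_derivative Q (v1 t + v2 t) (w t) + (r2 t - r1 t)) (at t within {0..T})"
    if "t \<in> {0..T}" for t
  proof -
    have "Q (v1 t) (v1 t) - r1 t - (Q (v2 t) (v2 t) - r2 t) = Q (v1 t + v2 t) (w t) + (r2 t - r1 t)"
      using Q_commute[of "v2 t" "v1 t"] by (simp add: w_def Q.add_left Q.diff_right)
    then show ?thesis
      using has_vector_derivative_diff[OF d1[OF that] d2[OF that]] unfolding w_def J.diff by (simp only:)
  qed
  have der: "((\<lambda>t. low (w t)) has_real_derivative D t) (at t within {0..T})" if t: "t \<in> {0..T}" for t
  proof -
    have "((\<lambda>t. inner (K (J (w t))) (J (w t))) has_derivative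
       (\<lambda>h. inner (K (J (w t))) (h *\<^sub>R (Q (v1 t + v2 t) (w t) + (r2 t - r1 t)))
          + inner (K (h *\<^sub>R (Q (v1 t + v2 t) (w t) + (r2 t - r1 t)))) (J (w t)))) (at t within {0..T})"
      using dw[OF t] unfolding has_vector_derivative_def
      by (intro has_derivative_inner K.has_derivative)
    moreover have "(\<lambda>h. inner (K (J (w t))) (h *\<^sub>R (Q (v1 t + v2 t) (w t) + (r2 t - r1 t)))
          + inner (K (h *\<^sub>R (Q (v1 t + v2 t) (w t) + (r2 t - r1 t)))) (J (w t))) = times (D t)"
      by (auto simp: D_def K.scaleR K_sym inner_commute fun_eq_iff)
    ultimately show ?thesis by (simp add: low_def has_field_derivative_def)
  qed
  have le: "D t \<le> (4 * C * R) * low (w t) + 4 * R * onorm J * (\<delta>1 + \<delta>2)" if t: "t \<in> {0..T}" for t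
  proof -
    have z: "norm (v1 t + v2 t) \<le> 2 * R" and nw: "norm (w t) \<le> 2 * R"
      using n1[OF t] n2[OF t] norm_triangle_ineq[of "v1 t" "v2 t"] norm_triangle_ineq4[of "v1 t" "v2 t"]
      by (auto simp: w_def)
    have "inner (K (J (w t))) (Q (v1 t + v2 t) (w t)) \<le> C * norm (v1 t + v2 t) * low (w t)"
      unfolding low_def by (rule low_estimate)
    also have "\<dots> \<le> C * (2 * R) * low (w t)"
      using C z low_nonneg[of "w t"] by (intro mult_right_mono mult_left_mono) (auto simp: low_def)
    finally have 1: "inner (K (J (w t))) (Q (v1 t + v2 t) (w t)) \<le> 2 * C * R * low (w t)" by simp
    have "inner (K (J (w t))) (r2 t - r1 t) = inner (J (w t)) (K (r2 t) - K (r1 t))"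
      by (simp add: K_sym K.diff)
    also have "\<dots> \<le> norm (J (w t)) * norm (K (r2 t) - K (r1 t))" by (rule norm_cauchy_schwarz)
    also have "\<dots> \<le> (onorm J * (2 * R)) * (\<delta>1 + \<delta>2)"
    proof (intro mult_mono)
      show "norm (J (w t)) \<le> onorm J * (2 * R)"
        by (rule order_trans[OF onorm[OF J] mult_left_mono[OF nw onJ]])
      show "norm (K (r2 t) - K (r1 t)) \<le> \<delta>1 + \<delta>2"
        using norm_triangle_ineq4[of "K (r2 t)" "K (r1 t)"] r1[OF t] r2[OF t] by linarith
    qed (use onJ R in auto)
    finally show ?thesis using 1 by (simp add: D_def inner_add_right algebra_simps)
  qed
  have "low (w t) \<le> (low (w 0) + 4 * R * onorm J * (\<delta>1 + \<delta>2) / (4 * C * R)) * exp (4 * C * R * t)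
      - 4 * R * onorm J * (\<delta>1 + \<delta>2) / (4 * C * R)"
    using C R by (intro gronwall[OF der le _ T]) auto
  also have "4 * R * onorm J * (\<delta>1 + \<delta>2) / (4 * C * R) = onorm J * (\<delta>1 + \<delta>2) / C"
    using R by simp
  also have "(low (w 0) + onorm J * (\<delta>1 + \<delta>2) / C) * exp (4 * C * R * t) - onorm J * (\<delta>1 + \<delta>2) / C
     \<le> (low (w 0) + onorm J * (\<delta>1 + \<delta>2) / C) * exp (4 * C * R * t)"
  proof -
    have "0 \<le> \<delta>1 + \<delta>2" using r1[OF T] r2[OF T] by (smt (verit) norm_ge_zero)
    then show ?thesis using onJ C by simp
  qed
  finally show ?thesis by (simp add: w_def)
qed

lemma solution_has_vector_derivative:
  assumes "solution T v0 v" "t \<in> {0..T}"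
  shows "((\<lambda>t. J (v t)) has_vector_derivative Q (v t) (v t)) (at t within {0..T})"
proof -
  interpret Q: bounded_bilinear Q by (rule Q)
  have cont: "continuous_on {0..T} v" using assms by (simp add: solution_def)
  then have "continuous_on {0..T} (\<lambda>\<tau>. Q (v \<tau>) (v \<tau>))"
    by (intro Q.continuous_on)
  from integral_has_vector_derivative[OF this assms(2)]
  have "((\<lambda>u. J v0 + integral {0..u} (\<lambda>\<tau>. Q (v \<tau>) (v \<tau>))) has_vector_derivative Q (v t) (v t)) (at t within {0..T})"
    by (auto intro!: derivative_eq_intros)
  moreover have "J v0 + integral {0..u} (\<lambda>\<tau>. Q (v \<tau>) (v \<tau>)) = J (v u)" if "u \<in> {0..T}" for u
    using assms(1) that by (auto simp: solution_def dest!: bspec[OF _ that] integral_unique)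
  ultimately show ?thesis
    by (rule has_vector_derivative_transform[OF assms(2) sym, rotated]) simp
qed

lemma solution_0:
  assumes "solution T v0 v" "0 \<le> T"
  shows "v 0 = v0"
proof -
  interpret J: bounded_linear J by (rule J)
  have "((\<lambda>\<tau>. Q (v \<tau>) (v \<tau>)) has_integral (J (v 0) - J v0)) {0..0}"
    using assms(1)[unfolded solution_def, THEN conjunct2, THEN bspec, of 0] assms(2) by (simp only: atLeastAtMost_iff order_refl simp_thms)
  moreover have "((\<lambda>\<tau>. Q (v \<tau>) (v \<tau>)) has_integral 0) {0..0}"
    using has_integral_refl(2)[of "\<lambda>\<tau>. Q (v \<tau>) (v \<tau>)" 0] by simp
  ultimately have "J (v 0) - J v0 = 0" by (rule has_integral_unique)
  then show ?thesis using J_inj[of "v 0 - v0"] by (simp add: J.diff)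
qed

lemma low_solution_growth:
  assumes "solution T v0 v" "solution T w0 w" "t \<in> {0..T}" and R: "R > 0"
    and "\<And>t. t \<in> {0..T} \<Longrightarrow> norm (v t) \<le> R" and "\<And>t. t \<in> {0..T} \<Longrightarrow> norm (w t) \<le> R"
  shows "low (v t - w t) \<le> low (v0 - w0) * exp (4 * C * R * t)"
proof -
  interpret K: bounded_linear K by (rule K)
  have T: "0 \<le> T" using assms(3) by auto
  have "low (v t - w t) \<le> (low (v 0 - w 0) + onorm J * (0 + 0) / C) * exp (4 * C * R * t)"
    using assms(3-) solution_has_vector_derivative[OF assms(1)] solution_has_vector_derivative[OF assms(2)]
    by (intro low_diff_growth[where ?r1.0 = "\<lambda>_. 0" and ?r2.0 = "\<lambda>_. 0"]) (auto simp: K.zero)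
  then show ?thesis using solution_0[OF assms(1) T] solution_0[OF assms(2) T] by simp
qed

text \<open>For fixed \<open>x\<close> with vanishing weak norm the term with \<open>c n\<close> in
  \<open>splitting\<close> is zero however large \<open>c n\<close> is, so only the tail remains,
  and it tends to zero.\<close>

lemma low_eq_0: "low x = 0 \<Longrightarrow> x = 0"
proof -
  assume l: "low x = 0"
  have "(\<lambda>n. inner (\<Theta> n x) x + c n * low x) \<longlonglongrightarrow> 0"
    using \<Theta>_tendsto[of x] l by simp
  then have "(norm x)\<^sup>2 \<le> 0"
    using splitting[of x] by (intro LIMSEQ_le_const) (auto simp: low_def)
  then show ?thesis by simp
qed

lemma solution_unique:
  assumes "solution T v0 v" "solution T v0 w" "t \<in> {0..T}"
  shows "v t = w t"
proof -
  interpret J: bounded_linear J by (rule J)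
  interpret K: bounded_linear K by (rule K)
  have "compact (v ` {0..T})" "compact (w ` {0..T})"
    using assms by (auto simp: solution_def intro!: compact_continuous_image)
  then obtain A B where AB: "\<And>t. t \<in> {0..T} \<Longrightarrow> norm (v t) \<le> A" "\<And>t. t \<in> {0..T} \<Longrightarrow> norm (w t) \<le> B"
    by (metis compact_imp_bounded bounded_iff imageI)
  define R where "R = max 1 (max A B)"
  have "low (v t - w t) \<le> low (v0 - v0) * exp (4 * C * R * t)"
    unfolding R_def
  proof (rule low_solution_growth[OF assms])
    show "norm (v t) \<le> max 1 (max A B)" "norm (w t) \<le> max 1 (max A B)" if "t \<in> {0..T}" for t
      using AB[OF that] by linarith+
  qed simp
  then have "low (v t - w t) = 0"
    using low_nonneg[of "v t - w t"] by (simp add: low_def J.zero K.zero)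
  then show ?thesis using low_eq_0[of "v t - w t"] by simp
qed

section \<open>The truncated equation and existence\<close>

text \<open>\<open>L n\<close> is bounded, so the truncated equation is an ordinary differential
  equation; with \<open>radial_ret\<close> inserted it is solvable on all of \<open>{0..T}\<close>.
  The energy estimate then shows that the ball of radius \<open>R\<close> is not left, so the
  insertion changed nothing. \<open>T\<close> is the time in which
  \<open>exp (2 * C * R * t)\<close> grows to 4: tails grow at most fourfold, and as the tail of
  index 0 is the squared norm, the norm grows at most from \<open>R / 2\<close> to
  \<open>R\<close>.\<close>

lemma galerkin:
  assumes v0: "norm v0 \<le> R / 2" and R: "R > 0" and T: "T = ln 4 / (2 * C * R)"
  shows "\<exists>v. continuous_on {0..T} v \<and> v 0 = P n v0 \<and>
    (\<forall>t\<in>{0..T}. (v has_vector_derivative L n (Q (v t) (v t))) (at t within {0..T}) \<and> P n (v t) = v t \<and>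
       norm (v t) \<le> R \<and> (\<forall>N. tail N (v t) \<le> 4 * tail N v0))"
proof -
  interpret Q: bounded_bilinear Q by (rule Q)
  interpret L: bounded_linear "L n" by (rule L)
  interpret P: bounded_linear "P n" by (rule P)
  have T0: "T > 0" using T C R by simp
  define G where "G v = L n (Q (radial_ret R v) (radial_ret R v))" for v
  obtain q where q: "q > 0" "\<And>x y. norm (Q x y) \<le> norm x * norm y * q" using Q.pos_bounded by blast
  obtain l where l: "l > 0" "\<And>x. norm (L n x) \<le> norm x * l" using L.pos_bounded by blast
  have lip: "norm (G x - G y) \<le> (4 * R * q * l) * norm (x - y)" for x y
  proof -
    let ?x = "radial_ret R x" and ?y = "radial_ret R y"
    have "G x - G y = L n (Q (?x + ?y) (?x - ?y))"
      using Q_commute[of ?y ?x] by (simp add: G_def L.diff[symmetric] Q.add_left Q.diff_right)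
    also have "norm \<dots> \<le> norm (Q (?x + ?y) (?x - ?y)) * l" by (rule l)
    also have "\<dots> \<le> (norm (?x + ?y) * norm (?x - ?y) * q) * l"
      using l q by (intro mult_right_mono) auto
    also have "\<dots> \<le> ((2 * R) * (2 * norm (x - y)) * q) * l"
    proof (intro mult_right_mono mult_mono)
      show "norm (?x + ?y) \<le> 2 * R"
        using norm_triangle_ineq[of ?x ?y] norm_radial_ret[OF R, of x] norm_radial_ret[OF R, of y] by linarith
    qed (use R l q radial_ret_lipschitz[OF R] in auto)
    finally show ?thesis by (simp add: mult_ac)
  qed
  obtain v where v: "continuous_on {0..T} v" "\<And>t. t \<in> {0..T} \<Longrightarrow> v t = P n v0 + integral {0..t} (\<lambda>\<tau>. G (v \<tau>))"
    using picard_global[OF lip less_imp_le[OF T0], of "P n v0"] by blast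
  have "(4 * R * q * l)-lipschitz_on UNIV G"
    using lip R q l by (intro lipschitz_onI) (auto simp: dist_norm)
  then have "continuous_on UNIV G" by (rule lipschitz_on_continuous_on)
  then have contG: "continuous_on {0..T} (\<lambda>\<tau>. G (v \<tau>))"
    by (rule continuous_on_compose2[OF _ v(1)]) simp
  have v_0: "v 0 = P n v0" using v(2)[of 0] T0 by simp
  \<comment> \<open>Initial value and vector field both lie in the range of \<open>P n\<close>. This
    invariance is what \<open>energy_estimate\<close> presupposes.\<close>
  have Pv: "P n (v t) = v t" if t: "t \<in> {0..T}" for t
  proof -
    have "continuous_on {0..t} (\<lambda>\<tau>. G (v \<tau>))" by (rule continuous_on_subset[OF contG]) (use t in auto)
    then have "P n (integral {0..t} (\<lambda>\<tau>. G (v \<tau>))) = integral {0..t} (\<lambda>\<tau>. P n (G (v \<tau>)))"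
      by (intro integral_linear[OF integrable_continuous_real P, unfolded o_def, symmetric])
    then show ?thesis by (simp add: v(2)[OF t] P.add P_idem G_def PL)
  qed
  have dv: "(v has_vector_derivative G (v t)) (at t within {0..T})" if t: "t \<in> {0..T}" for t
  proof -
    have "((\<lambda>u. P n v0 + integral {0..u} (\<lambda>\<tau>. G (v \<tau>))) has_vector_derivative G (v t)) (at t within {0..T})"
      using integral_has_vector_derivative[OF contG t] by (auto intro!: derivative_eq_intros)
    then show ?thesis
      by (rule has_vector_derivative_transform[OF t v(2), rotated])
  qed
  have tail: "tail N (v t) \<le> 4 * tail N v0" if t: "t \<in> {0..T}" for N t
  proof -
    interpret Th: bounded_linear "\<Theta> N" by (rule \<Theta>)
    have der: "((\<lambda>t. tail N (v t)) has_real_derivative 2 * inner (\<Theta> N (v t)) (G (v t))) (at t within {0..T})"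
      if t: "t \<in> {0..T}" for t
    proof -
      have "((\<lambda>t. inner (\<Theta> N (v t)) (v t)) has_derivative
         (\<lambda>h. inner (\<Theta> N (v t)) (h *\<^sub>R G (v t)) + inner (\<Theta> N (h *\<^sub>R G (v t))) (v t))) (at t within {0..T})"
        using dv[OF t] unfolding has_vector_derivative_def
        by (intro has_derivative_inner Th.has_derivative)
      moreover have "(\<lambda>h. inner (\<Theta> N (v t)) (h *\<^sub>R G (v t)) + inner (\<Theta> N (h *\<^sub>R G (v t))) (v t)) = times (2 * inner (\<Theta> N (v t)) (G (v t)))"
        using trans[OF \<Theta>_sym[of N "G (v t)" "v t"] inner_commute]
        by (simp add: Th.scaleR fun_eq_iff)
      ultimately show ?thesis by (simp add: tail_def has_field_derivative_def)
    qed
    have le: "2 * inner (\<Theta> N (v t)) (G (v t)) \<le> (2 * C * R) * tail N (v t) + 0" if t: "t \<in> {0..T}" for t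
    proof -
      \<comment> \<open>The modified field is \<open>\<theta> * \<theta>\<close> times the original
        one. One factor turns \<open>norm (v t)\<close> into at most \<open>R\<close>, the other is
        bounded by 1; the rate \<open>C * R\<close> thus holds before the bound on \<open>v\<close>
        is known.\<close>
      define \<theta> where "\<theta> = R / max R (norm (v t))"
      have th: "0 \<le> \<theta>" "\<theta> \<le> 1" using R by (auto simp: \<theta>_def divide_le_eq)
      have r: "radial_ret R (v t) = \<theta> *\<^sub>R v t" by (simp add: radial_ret_def \<theta>_def)
      have tn: "\<theta> * norm (v t) \<le> R" using norm_radial_ret[OF R, of "v t"] th by (simp add: r)
      have "inner (\<Theta> N (v t)) (G (v t)) = \<theta> * \<theta> * inner (\<Theta> N (v t)) (L n (Q (v t) (v t)))"
        by (simp add: G_def r Q.scaleR_left Q.scaleR_right L.scaleR)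
      also have "\<dots> \<le> \<theta> * \<theta> * (C * norm (v t) * tail N (v t))"
        using th energy_estimate[OF Pv[OF t]] by (intro mult_left_mono) (auto simp: tail_def)
      also have "\<dots> = \<theta> * (\<theta> * norm (v t)) * (C * tail N (v t))" by simp
      also have "\<dots> \<le> 1 * R * (C * tail N (v t))"
        using th tn C R \<Theta>_nonneg[of N "v t"] by (intro mult_mono) (auto simp: tail_def)
      also have "\<dots> = C * R * tail N (v t)" by simp
      finally show ?thesis by linarith
    qed
    have "tail N (v t) \<le> (tail N (v 0) + 0 / (2 * C * R)) * exp (2 * C * R * t) - 0 / (2 * C * R)"
      using C R by (intro gronwall[OF der le _ t]) auto
    also have "\<dots> = tail N (v 0) * exp (2 * C * R * t)" by simp
    also have "\<dots> \<le> tail N v0 * 4"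
    proof (intro mult_mono)
      show "tail N (v 0) \<le> tail N v0" unfolding v_0 tail_def by (rule \<Theta>P)
      have "2 * C * R * t \<le> 2 * C * R * T" using t C R by (intro mult_left_mono) auto
      also have "\<dots> = ln 4" using C R by (simp add: T)
      finally show "exp (2 * C * R * t) \<le> 4" by (metis exp_le_cancel_iff exp_ln zero_less_numeral)
    qed (use \<Theta>_nonneg[of N v0] in \<open>auto simp: tail_def\<close>)
    finally show ?thesis by simp
  qed
  have bound: "norm (v t) \<le> R" if t: "t \<in> {0..T}" for t
  proof -
    have "(norm (v t))\<^sup>2 \<le> 4 * (norm v0)\<^sup>2"
      using tail[OF t, of 0] by (simp add: tail_def \<Theta>_0 power2_norm_eq_inner)
    also have "\<dots> \<le> 4 * (R / 2)\<^sup>2" using v0 by (intro mult_left_mono power_mono) auto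
    also have "\<dots> = R\<^sup>2" by (simp add: power2_eq_square)
    finally show ?thesis by (rule power2_le_imp_le) (use R in simp)
  qed
  have G: "G (v t) = L n (Q (v t) (v t))" if "t \<in> {0..T}" for t
    unfolding G_def radial_ret_id[OF R bound[OF that]] ..
  have "(v has_vector_derivative L n (Q (v t) (v t))) (at t within {0..T})" if "t \<in> {0..T}" for t
    using dv[OF that] unfolding G[OF that] .
  with v(1) v_0 Pv bound tail show ?thesis by blast
qed

text \<open>The truncated solutions form a uniform Cauchy sequence in the strong norm. By
  \<open>splitting\<close> the square of a difference is at most its tail, small for a suitable
  \<open>N\<close> uniformly in time and in the truncation, plus \<open>c N\<close> times its weak
  norm, which for this fixed \<open>N\<close> tends to zero by
  \<open>low_diff_growth\<close>.\<close>

lemma solution_exists: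
  assumes v0: "norm v0 \<le> R / 2" and R: "R > 0" and T: "T = ln 4 / (2 * C * R)"
  shows "\<exists>v. solution T v0 v \<and> (\<forall>t\<in>{0..T}. norm (v t) \<le> R \<and> (\<forall>N. tail N (v t) \<le> 4 * tail N v0))"
proof -
  interpret Q: bounded_bilinear Q by (rule Q)
  interpret J: bounded_linear J by (rule J)
  interpret K: bounded_linear K by (rule K)
  have T0: "T > 0" using T C R by simp
  obtain v where v: "\<And>n. continuous_on {0..T} (v n)" "\<And>n. v n 0 = P n v0"
    "\<And>n t. t \<in> {0..T} \<Longrightarrow> (v n has_vector_derivative L n (Q (v n t) (v n t))) (at t within {0..T})"
    "\<And>n t. t \<in> {0..T} \<Longrightarrow> norm (v n t) \<le> R"
    "\<And>n t N. t \<in> {0..T} \<Longrightarrow> tail N (v n t) \<le> 4 * tail N v0"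
    using galerkin[OF assms] by metis
  obtain q where q: "q > 0" "\<And>x y. norm (Q x y) \<le> norm x * norm y * q" using Q.pos_bounded by blast
  define r where "r n t = Q (v n t) (v n t) - P n (Q (v n t) (v n t))" for n t
  define \<delta> where "\<delta> n = \<bar>\<epsilon> n\<bar> * (R * R * q)" for n
  have \<delta>: "\<delta> \<longlonglongrightarrow> 0" unfolding \<delta>_def using \<epsilon> by (intro tendsto_mult_left_zero tendsto_rabs_zero)
  have r: "norm (K (r n t)) \<le> \<delta> n" if "t \<in> {0..T}" for n t
  proof -
    have "norm (K (r n t)) \<le> \<epsilon> n * norm (Q (v n t) (v n t))" unfolding r_def by (rule K_truncation)
    also have "\<dots> \<le> \<bar>\<epsilon> n\<bar> * (norm (v n t) * norm (v n t) * q)"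
      using q by (intro mult_mono) auto
    also have "\<dots> \<le> \<delta> n" unfolding \<delta>_def
      using v(4)[OF that, of n] q R by (intro mult_left_mono mult_right_mono mult_mono) auto
    finally show ?thesis .
  qed
  have dJ: "((\<lambda>t. J (v n t)) has_vector_derivative Q (v n t) (v n t) - r n t) (at t within {0..T})" if "t \<in> {0..T}" for n t
    using bounded_linear.has_vector_derivative[OF J v(3)[OF that, of n]] by (simp add: r_def JL)
  have low: "low (v n t - v m t) \<le> (low (P n v0 - P m v0) + onorm J * (\<delta> n + \<delta> m) / C) * exp (4 * C * R * T)"
    if t: "t \<in> {0..T}" for n m t
  proof -
    have "low (v n t - v m t) \<le> (low (v n 0 - v m 0) + onorm J * (\<delta> n + \<delta> m) / C) * exp (4 * C * R * t)"
      by (rule low_diff_growth[OF t R dJ dJ v(4) v(4) r r])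
    also have "\<dots> \<le> (low (v n 0 - v m 0) + onorm J * (\<delta> n + \<delta> m) / C) * exp (4 * C * R * T)"
      using t C R low_nonneg[of "v n 0 - v m 0"] onorm_pos_le[OF J] q(1)
      by (intro mult_left_mono) (auto simp: low_def \<delta>_def)
    finally show ?thesis by (simp add: v(2))
  qed
  obtain B where B: "B > 0" "\<And>x. low x \<le> B * (norm x)\<^sup>2" using low_le by blast
  have "uniformly_convergent_on {0..T} v"
    unfolding uniformly_convergent_eq_Cauchy uniformly_Cauchy_on_def
  proof (intro allI impI)
    fix e :: real assume e: "e > 0"
    \<comment> \<open>The 16 collects a factor 2 from \<open>tail_diff\<close> and a factor 4 from
      the growth of tails, for each of two solutions.\<close>
    have T16: "(\<lambda>N. 16 * tail N v0) \<longlonglongrightarrow> 0"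
      using \<Theta>_tendsto[of v0] by (auto intro: tendsto_mult_right_zero simp: tail_def)
    have "\<forall>\<^sub>F N in sequentially. 16 * tail N v0 < e\<^sup>2 / 2"
      using e by (intro order_tendstoD(2)[OF T16]) auto
    then obtain N where N: "16 * tail N v0 < e\<^sup>2 / 2" by (auto simp: eventually_sequentially)
    \<comment> \<open>\<open>N\<close> is fixed from here on, so the possibly huge
      \<open>c N\<close> is a mere constant, and the truncation indices are chosen after it. Below,
      \<open>h n\<close> is the share of the index \<open>n\<close> in the bound for a pair of
      indices.\<close>
    define A where "A = c N * exp (4 * C * R * T)"
    have A: "A > 0" using c by (simp add: A_def)
    define h where "h n = A * (2 * B * (norm (P n v0 - v0))\<^sup>2 + onorm J * \<delta> n / C)" for n
    have "h \<longlonglongrightarrow> A * (2 * B * (norm (v0 - v0))\<^sup>2 + onorm J * 0 / C)"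
      unfolding h_def using C by (intro tendsto_intros P_tendsto \<delta>) auto
    then have "h \<longlonglongrightarrow> 0" by simp
    then have "\<forall>\<^sub>F n in sequentially. h n < e\<^sup>2 / 4" using e by (intro order_tendstoD) auto
    then obtain M where M: "\<And>n. n \<ge> M \<Longrightarrow> h n < e\<^sup>2 / 4" by (auto simp: eventually_sequentially)
    have "dist (v m t) (v n t) < e" if t: "t \<in> {0..T}" and mn: "m \<ge> M" "n \<ge> M" for m n t
    proof -
      have P2: "(norm (P m v0 - P n v0))\<^sup>2 \<le> 2 * (norm (P m v0 - v0))\<^sup>2 + 2 * (norm (P n v0 - v0))\<^sup>2"
      proof -
        have "norm (P m v0 - P n v0) \<le> norm (P m v0 - v0) + norm (P n v0 - v0)"
          using norm_triangle_ineq4[of "P m v0 - v0" "P n v0 - v0"] by simp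
        then have "(norm (P m v0 - P n v0))\<^sup>2 \<le> (norm (P m v0 - v0) + norm (P n v0 - v0))\<^sup>2"
          by (intro power_mono) auto
        also have "\<dots> \<le> 2 * (norm (P m v0 - v0))\<^sup>2 + 2 * (norm (P n v0 - v0))\<^sup>2"
          using sum_squares_bound[of "norm (P m v0 - v0)" "norm (P n v0 - v0)"] by (simp add: power2_sum)
        finally show ?thesis .
      qed
      have "(dist (v m t) (v n t))\<^sup>2 \<le> tail N (v m t - v n t) + c N * low (v m t - v n t)"
        unfolding dist_norm low_def tail_def by (rule splitting)
      also have "\<dots> \<le> (2 * tail N (v m t) + 2 * tail N (v n t))
          + c N * ((low (P m v0 - P n v0) + onorm J * (\<delta> m + \<delta> n) / C) * exp (4 * C * R * T))"
        using c[of N] by (intro add_mono tail_diff mult_left_mono low[OF t]) auto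
      also have "\<dots> \<le> 16 * tail N v0 + A * (B * (norm (P m v0 - P n v0))\<^sup>2 + onorm J * (\<delta> m + \<delta> n) / C)"
      proof -
        have "A * (low (P m v0 - P n v0) + onorm J * (\<delta> m + \<delta> n) / C)
           \<le> A * (B * (norm (P m v0 - P n v0))\<^sup>2 + onorm J * (\<delta> m + \<delta> n) / C)"
          using A B by (intro mult_left_mono add_mono) auto
        then show ?thesis using v(5)[OF t, of N m] v(5)[OF t, of N n] by (simp add: A_def mult_ac)
      qed
      also have "\<dots> \<le> 16 * tail N v0 + (h m + h n)"
      proof -
        have "B * (norm (P m v0 - P n v0))\<^sup>2 \<le> B * (2 * (norm (P m v0 - v0))\<^sup>2 + 2 * (norm (P n v0 - v0))\<^sup>2)"
          using B P2 by (intro mult_left_mono) auto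
        then have "A * (B * (norm (P m v0 - P n v0))\<^sup>2 + onorm J * (\<delta> m + \<delta> n) / C)
          \<le> A * (B * (2 * (norm (P m v0 - v0))\<^sup>2 + 2 * (norm (P n v0 - v0))\<^sup>2) + onorm J * (\<delta> m + \<delta> n) / C)"
          using less_imp_le[OF A] by (rule mult_left_mono[OF add_right_mono])
        also have "\<dots> = h m + h n" by (simp add: h_def algebra_simps add_divide_distrib)
        finally show ?thesis by simp
      qed
      also have "\<dots> < e\<^sup>2" using N M[OF mn(1)] M[OF mn(2)] by simp
      finally show ?thesis by (rule power2_less_imp_less) (use e in simp)
    qed
    then show "\<exists>M. \<forall>x\<in>{0..T}. \<forall>m\<ge>M. \<forall>n\<ge>M. dist (v m x) (v n x) < e" by blast
  qed
  then obtain u where u: "uniform_limit {0..T} v u sequentially" by (auto simp: uniformly_convergent_on_def)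
  have lim: "(\<lambda>n. v n t) \<longlonglongrightarrow> u t" if "t \<in> {0..T}" for t
    by (rule tendsto_uniform_limitI[OF u that])
  have cu: "continuous_on {0..T} u"
    by (rule uniform_limit_theorem[OF _ u]) (auto simp: v)
  have uR: "norm (u t) \<le> R" if "t \<in> {0..T}" for t
    using tendsto_norm[OF lim[OF that]] v(4)[OF that] by (intro LIMSEQ_le_const2) auto
  have utail: "tail N (u t) \<le> 4 * tail N v0" if "t \<in> {0..T}" for N t
  proof -
    have "(\<lambda>n. tail N (v n t)) \<longlonglongrightarrow> tail N (u t)"
      unfolding tail_def by (intro tendsto_inner bounded_linear.tendsto[OF \<Theta>] lim that)
    then show ?thesis using v(5)[OF that] by (intro LIMSEQ_le_const2) auto
  qed
  have cQu: "continuous_on {0..T} (\<lambda>\<tau>. Q (u \<tau>) (u \<tau>))" by (intro Q.continuous_on cu)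
  have "((\<lambda>\<tau>. Q (u \<tau>) (u \<tau>)) has_integral J (u t) - J v0) {0..t}" if t: "t \<in> {0..T}" for t
  proof -
    have sub: "{0..t} \<subseteq> {0..T}" using t by auto
    \<comment> \<open>The residuals tend to zero only under \<open>K\<close>. So the limit is taken
      in the integrated equation with \<open>K\<close> applied, and \<open>K\<close> is removed at
      the end by injectivity.\<close>
    define f where "f n \<tau> = K (Q (v n \<tau>) (v n \<tau>) - r n \<tau>)" for n \<tau>
    have fi: "(f n has_integral K (J (v n t)) - K (J (v n 0))) {0..t}" for n
    proof -
      have "((\<lambda>\<tau>. Q (v n \<tau>) (v n \<tau>) - r n \<tau>) has_integral J (v n t) - J (v n 0)) {0..t}"
        using t by (intro fundamental_theorem_of_calculus has_vector_derivative_within_subset[OF dJ sub]) auto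
      from has_integral_linear[OF this K] show ?thesis by (simp only: f_def[abs_def] o_def K.diff)
    qed
    have ul: "uniform_limit {0..t} f (\<lambda>\<tau>. K (Q (u \<tau>) (u \<tau>))) sequentially"
    proof -
      have u': "uniform_limit {0..t} v u sequentially" by (rule uniform_limit_on_subset[OF u sub])
      have "uniform_limit {0..t} (\<lambda>n \<tau>. Q (v n \<tau>) (v n \<tau>)) (\<lambda>\<tau>. Q (u \<tau>) (u \<tau>)) sequentially"
      proof (rule Q.bounded_uniform_limit[OF u' u'])
        show "bounded (u ` {0..t})" unfolding bounded_iff using uR sub by blast
        then show "bounded (u ` {0..t})" .
      qed
      then have 1: "uniform_limit {0..t} (\<lambda>n \<tau>. K (Q (v n \<tau>) (v n \<tau>))) (\<lambda>\<tau>. K (Q (u \<tau>) (u \<tau>))) sequentially"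
        by (rule bounded_linear.uniform_limit[OF K])
      have 2: "uniform_limit {0..t} (\<lambda>n \<tau>. K (r n \<tau>)) (\<lambda>\<tau>. 0) sequentially"
      proof (rule uniform_limitI)
        fix e :: real assume "e > 0"
        then have "\<forall>\<^sub>F n in sequentially. \<delta> n < e" using \<delta> by (intro order_tendstoD) auto
        then show "\<forall>\<^sub>F n in sequentially. \<forall>x\<in>{0..t}. dist (K (r n x)) 0 < e"
        proof eventually_elim
          case (elim n)
          have "norm (K (r n x)) < e" if "x \<in> {0..t}" for x
            using r[of x n] elim that sub by (meson order_le_less_trans subsetD)
          then show ?case by simp
        qed
      qed
      from uniform_limit_minus[OF 1 2] show ?thesis by (simp add: f_def[abs_def] K.diff)
    qed
    have cf: "continuous_on {0..t} (f n)" for n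
    proof -
      have "continuous_on {0..t} (\<lambda>\<tau>. K (P n (Q (v n \<tau>) (v n \<tau>))))"
        by (intro bounded_linear.continuous_on[OF K] bounded_linear.continuous_on[OF P] Q.continuous_on
            continuous_on_subset[OF v(1) sub])
      then show ?thesis by (simp add: f_def[abs_def] r_def)
    qed
    obtain I F where IF: "\<And>n. (f n has_integral I n) {0..t}" "((\<lambda>\<tau>. K (Q (u \<tau>) (u \<tau>))) has_integral F) {0..t}"
        "I \<longlonglongrightarrow> F"
      by (rule uniform_limit_integral[OF ul cf sequentially_bot]) (rule that)
    have In: "I = (\<lambda>n. K (J (v n t)) - K (J (P n v0)))"
      using has_integral_unique[OF IF(1) fi] by (simp add: v(2) fun_eq_iff)
    have "(\<lambda>n. K (J (v n t)) - K (J (P n v0))) \<longlonglongrightarrow> K (J (u t)) - K (J v0)"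
      by (intro tendsto_diff bounded_linear.tendsto[OF K] bounded_linear.tendsto[OF J] lim t P_tendsto)
    then have F: "F = K (J (u t)) - K (J v0)"
      using LIMSEQ_unique IF(3) unfolding In by blast
    have Qi: "((\<lambda>\<tau>. Q (u \<tau>) (u \<tau>)) has_integral integral {0..t} (\<lambda>\<tau>. Q (u \<tau>) (u \<tau>))) {0..t}"
      by (intro integrable_integral integrable_continuous_real continuous_on_subset[OF cQu sub])
    have "K (integral {0..t} (\<lambda>\<tau>. Q (u \<tau>) (u \<tau>))) = F"
      by (rule has_integral_unique[OF has_integral_linear[OF Qi K, unfolded o_def] IF(2)])
    then have "K (integral {0..t} (\<lambda>\<tau>. Q (u \<tau>) (u \<tau>)) - (J (u t) - J v0)) = 0" by (simp add: K.diff F)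
    from K_inj[OF this] have "integral {0..t} (\<lambda>\<tau>. Q (u \<tau>) (u \<tau>)) = J (u t) - J v0" by simp
    with Qi show ?thesis by (simp only:)
  qed
  then have "solution T v0 u" using cu by (simp add: solution_def)
  then show ?thesis using uR utail by blast
qed

text \<open>The same splitting as for existence. The threshold \<open>N\<close> is chosen from the
  tail of \<open>v0\<close> alone, since the tail of a nearby \<open>w0\<close> is controlled by
  that of \<open>v0\<close> and the distance; afterwards the weak norm of the difference, multiplied
  by \<open>c N\<close>, is linear in the squared distance of the data. Thus \<open>\<delta>\<close>
  depends on \<open>v0\<close> through the decay of its tail.\<close>

theorem solution_continuous_dependence:
  assumes v0: "norm v0 \<le> R / 2" and R: "R > 0" and T: "T = ln 4 / (2 * C * R)"
    and v: "solution T v0 v" and e: "e > 0"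
  shows "\<exists>\<delta>>0. \<forall>w0 w. norm w0 \<le> R / 2 \<longrightarrow> norm (w0 - v0) < \<delta> \<longrightarrow> solution T w0 w \<longrightarrow>
    (\<forall>t\<in>{0..T}. norm (w t - v t) < e)"
proof -
  obtain B where B: "B > 0" "\<And>x. low x \<le> B * (norm x)\<^sup>2" using low_le by blast
  \<comment> \<open>The bounds are known for the solution that was constructed; uniqueness carries
    them over to every solution with the same data.\<close>
  have bd: "norm (w t) \<le> R \<and> tail N (w t) \<le> 4 * tail N w0"
    if "norm w0 \<le> R / 2" "solution T w0 w" "t \<in> {0..T}" for w0 w t N
    using solution_exists[OF that(1) R T] solution_unique[OF _ that(2,3)] that(3) by metis
  \<comment> \<open>The tails of both solutions contribute
    \<open>8 * tail N w0 + 8 * tail N v0\<close>, and \<open>tail N w0\<close> is at most twice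
    \<open>tail N v0\<close> plus twice the squared distance. This gives the 24 here and the 16 in
    \<open>A\<close> below.\<close>
  have T24: "(\<lambda>N. 24 * tail N v0) \<longlonglongrightarrow> 0"
      using \<Theta>_tendsto[of v0] by (auto intro: tendsto_mult_right_zero simp: tail_def)
  have "\<forall>\<^sub>F N in sequentially. 24 * tail N v0 < e\<^sup>2 / 2"
    using e by (intro order_tendstoD(2)[OF T24]) auto
  then obtain N where N: "24 * tail N v0 < e\<^sup>2 / 2" by (auto simp: eventually_sequentially)
  define A where "A = 16 + c N * (B * exp (4 * C * R * T))"
  have A: "A > 0" using c[of N] B by (simp add: A_def add_pos_pos)
  define \<delta> where "\<delta> = e / sqrt (2 * A)"
  have \<delta>: "\<delta> > 0" "A * \<delta>\<^sup>2 = e\<^sup>2 / 2" using A e by (auto simp: \<delta>_def power_divide)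
  have "norm (w t - v t) < e" if w: "norm w0 \<le> R / 2" "norm (w0 - v0) < \<delta>" "solution T w0 w" and t: "t \<in> {0..T}" for w0 w t
  proof -
    have t0: "0 \<le> t" "t \<le> T" using t by auto
    have tw: "tail N w0 \<le> 2 * (norm (w0 - v0))\<^sup>2 + 2 * tail N v0"
      using tail_diff[of N "w0 - v0" "- v0"] \<Theta>_le[of N "w0 - v0"] linear_neg[OF bounded_linear.linear[OF \<Theta>], of N v0]
      by (simp add: tail_def)
    have "low (w t - v t) \<le> low (w0 - v0) * exp (4 * C * R * t)"
      using bd[OF w(1,3)] bd[OF v0 v] by (intro low_solution_growth[OF w(3) v t R]) auto
    also have "\<dots> \<le> (B * (norm (w0 - v0))\<^sup>2) * exp (4 * C * R * T)"
      using B C R t0 low_nonneg[of "w0 - v0"] by (intro mult_mono) (auto simp: low_def)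
    finally have l: "low (w t - v t) \<le> (B * exp (4 * C * R * T)) * (norm (w0 - v0))\<^sup>2" by (simp add: mult_ac)
    have "(norm (w t - v t))\<^sup>2 \<le> tail N (w t - v t) + c N * low (w t - v t)"
      unfolding tail_def low_def by (rule splitting)
    also have "\<dots> \<le> (2 * tail N (w t) + 2 * tail N (v t)) + c N * ((B * exp (4 * C * R * T)) * (norm (w0 - v0))\<^sup>2)"
      using c[of N] by (intro add_mono tail_diff mult_left_mono l) auto
    also have "\<dots> \<le> (8 * tail N w0 + 8 * tail N v0) + c N * ((B * exp (4 * C * R * T)) * (norm (w0 - v0))\<^sup>2)"
      using bd[OF w(1,3) t, of N] bd[OF v0 v t, of N] by simp
    also have "\<dots> \<le> 24 * tail N v0 + A * (norm (w0 - v0))\<^sup>2"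
      using tw by (simp add: A_def algebra_simps)
    also have "\<dots> \<le> 24 * tail N v0 + A * \<delta>\<^sup>2"
      using w(2) A by (intro add_left_mono mult_left_mono power_mono) auto
    also have "\<dots> < e\<^sup>2" using N \<delta>(2) by simp
    finally show ?thesis by (rule power2_less_imp_less) (use e in simp)
  qed
  then show ?thesis using \<delta>(1) by blast
qed

end

section \<open>Fourier transforms of test functions and distributions\<close>

definition japanese :: "real \<Rightarrow> real" where "japanese \<xi> = sqrt (1 + \<xi>\<^sup>2)"

lemma weight_pos [simp]: "1 + (\<xi>::real)\<^sup>2 > 0" "1 + \<xi>\<^sup>2 \<noteq> 0"
  by (simp_all add: add_pos_nonneg add_nonneg_eq_0_iff)

lemma integrable_inverse_square: "integrable lborel (\<lambda>x::real. 1 / (1 + x\<^sup>2))"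
  using integrable_inverse_1_plus_square by (simp add: set_integrable_def inverse_eq_divide)

lemma seminorm_le_tempered_bound:
  "j \<le> N \<Longrightarrow> k \<le> N \<Longrightarrow> schwartz_seminorm j k \<phi> \<le> tempered_bound N \<phi>"
proof -
  assume "j \<le> N" "k \<le> N"
  then have "schwartz_seminorm j k \<phi> \<le> (\<Sum>k\<le>N. schwartz_seminorm j k \<phi>)"
    by (intro member_le_sum) (auto intro: seminorm_nonneg)
  also have "\<dots> \<le> tempered_bound N \<phi>"
    unfolding tempered_bound_def using \<open>j \<le> N\<close>
    by (intro member_le_sum[of j "{..N}" "\<lambda>j. \<Sum>k\<le>N. schwartz_seminorm j k \<phi>"]) (auto intro!: sum_nonneg seminorm_nonneg)
  finally show ?thesis .
qed

section \<open>Decay and differentiation rules for transforms of test functions\<close>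

lemma schwartz_decay: "(1 + x\<^sup>2) * \<bar>test_fun \<phi> x\<bar> \<le> 2 * tempered_bound 2 \<phi>"
  using seminorm_ge[of x 0 0 \<phi>] seminorm_ge[of x 2 0 \<phi>]
    seminorm_le_tempered_bound[of 0 2 0 \<phi>] seminorm_le_tempered_bound[of 2 2 0 \<phi>]
  by (simp add: abs_mult distrib_right)

lemma schwartz_decay': "\<bar>test_fun \<phi> x\<bar> \<le> 2 * tempered_bound 2 \<phi> * (1 / (1 + x\<^sup>2))"
proof -
  have "1 + x\<^sup>2 > 0" by (simp add: add_pos_nonneg)
  then show ?thesis using schwartz_decay[of x \<phi>] by (simp add: field_simps)
qed

lemma test_fun_DERIV: "(test_fun \<phi> has_real_derivative test_fun (schwartz_deriv \<phi>) x) (at x)"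
  using test_fun_differentiable[of \<phi> x] by (simp add: schwartz_deriv.rep_eq DERIV_deriv_iff_real_differentiable)

lemma test_fun_cont: "continuous_on A (test_fun \<phi>)"
  by (meson DERIV_isCont continuous_at_imp_continuous_on test_fun_DERIV)

lemma test_fun_measurable [measurable]: "test_fun \<phi> \<in> borel_measurable borel"
  by (intro borel_measurable_continuous_onI test_fun_cont)

lemma test_fun_integrable: "integrable lborel (test_fun \<phi>)"
proof (rule Bochner_Integration.integrable_bound)
  show "integrable lborel (\<lambda>x. 2 * tempered_bound 2 \<phi> * (1 / (1 + x\<^sup>2)))"
    by (intro integrable_mult_right integrable_inverse_square)
  show "AE x in lborel. norm (test_fun \<phi> x) \<le> norm (2 * tempered_bound 2 \<phi> * (1 / (1 + x\<^sup>2)))"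
    using schwartz_decay' by (intro AE_I2) (simp add: abs_mult tempered_bound_nonneg)
qed simp

lemma cis_measurable [measurable]: "(\<lambda>x::real. cis (x * a)) \<in> borel_measurable borel"
  "(\<lambda>x::real. cis (a * x)) \<in> borel_measurable borel" "cis \<in> borel_measurable borel" "cnj \<in> borel_measurable borel"
  by (auto intro!: borel_measurable_continuous_onI continuous_intros)

lemma ift_integrable: "integrable lborel (\<lambda>x. complex_of_real (test_fun \<phi> x) * cis (x * \<xi>))"
  by (rule Bochner_Integration.integrable_bound[OF test_fun_integrable[of \<phi>]]) (auto simp: norm_mult)

lemma ift_add: "schwartz_ift (\<phi> + \<psi>) \<xi> = schwartz_ift \<phi> \<xi> + schwartz_ift \<psi> \<xi>"
  using Bochner_Integration.integral_add[OF ift_integrable[of \<phi> \<xi>] ift_integrable[of \<psi> \<xi>]]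
  by (simp add: schwartz_ift_def plus_schwartz.rep_eq distrib_right distrib_left add_divide_distrib)

lemma ift_scaleR: "schwartz_ift (c *\<^sub>R \<phi>) \<xi> = complex_of_real c * schwartz_ift \<phi> \<xi>"
  by (simp add: schwartz_ift_def scaleR_schwartz.rep_eq mult.assoc)

lemma ift_diff: "schwartz_ift (\<phi> - \<psi>) \<xi> = schwartz_ift \<phi> \<xi> - schwartz_ift \<psi> \<xi>"
proof -
  have "\<phi> - \<psi> = \<phi> + (-1) *\<^sub>R \<psi>" by simp
  then show ?thesis by (simp only: ift_add ift_scaleR) simp
qed

lemma ift_cnj: "schwartz_ift \<phi> (- \<xi>) = cnj (schwartz_ift \<phi> \<xi>)"
proof -
  have "cnj (LINT x|lborel. complex_of_real (test_fun \<phi> x) * cis (x * \<xi>))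
     = (LINT x|lborel. cnj (complex_of_real (test_fun \<phi> x) * cis (x * \<xi>)))"
    by (rule Bochner_Integration.integral_cnj[symmetric])
  then show ?thesis by (simp add: schwartz_ift_def cis_cnj)
qed

lemma test_fun_tendsto_0:
  shows "(test_fun \<phi> \<longlongrightarrow> 0) at_top" and "(test_fun \<phi> \<longlongrightarrow> 0) at_bot"
proof -
  have "((\<lambda>x::real. 2 * tempered_bound 2 \<phi> * (1 / (1 + x\<^sup>2))) \<longlongrightarrow> 0) at_top"
       "((\<lambda>x::real. 2 * tempered_bound 2 \<phi> * (1 / (1 + x\<^sup>2))) \<longlongrightarrow> 0) at_bot"
    by real_asymp+
  note lim = this
  have "\<forall>x. norm (test_fun \<phi> x) \<le> 2 * tempered_bound 2 \<phi> * (1 / (1 + x\<^sup>2))"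
    unfolding real_norm_def using schwartz_decay' by blast
  note le = always_eventually[OF this]
  show "(test_fun \<phi> \<longlongrightarrow> 0) at_top" "(test_fun \<phi> \<longlongrightarrow> 0) at_bot"
    by (rule Lim_null_comparison[OF le lim(1)], rule Lim_null_comparison[OF le lim(2)])
qed

text \<open>Integration by parts: \<open>?f\<close> is the derivative of \<open>?F\<close>, which
  vanishes at both ends, so the integral of \<open>?f\<close> is zero.\<close>

lemma ift_deriv: "schwartz_ift (schwartz_deriv \<phi>) \<xi> = - (\<i> * complex_of_real \<xi> * schwartz_ift \<phi> \<xi>)"
proof -
  let ?F = "\<lambda>x. complex_of_real (test_fun \<phi> x) * cis (x * \<xi>)"
  let ?f = "\<lambda>x. complex_of_real (test_fun (schwartz_deriv \<phi>) x) * cis (x * \<xi>) + \<i> * complex_of_real \<xi> * ?F x"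
  have int: "integrable lborel ?f"
    by (intro Bochner_Integration.integrable_add ift_integrable integrable_mult_right)
  have lim: "(?F \<longlongrightarrow> 0) F" if "(test_fun \<phi> \<longlongrightarrow> 0) F" for F
    using that by (intro tendsto_norm_zero_cancel[of ?F]) (simp add: norm_mult tendsto_rabs_zero_iff)
  have "(LBINT x=-\<infinity>..\<infinity>. ?f x) = 0 - 0"
  proof (rule interval_integral_FTC_integrable[where F = ?F])
    fix x :: real
    have c: "((\<lambda>x. cis (x * \<xi>)) has_vector_derivative \<i> * complex_of_real \<xi> * cis (x * \<xi>)) (at x)"
    proof -
      have "((\<lambda>x. exp (\<i> * (complex_of_real x * \<xi>))) has_vector_derivative \<i> * complex_of_real \<xi> * exp (\<i> * (complex_of_real x * \<xi>))) (at x)"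
        by (rule has_vector_derivative_real_field) (auto intro!: derivative_eq_intros)
      then show ?thesis by (simp add: cis_conv_exp)
    qed
    have "((\<lambda>x. complex_of_real (test_fun \<phi> x)) has_vector_derivative complex_of_real (test_fun (schwartz_deriv \<phi>) x)) (at x)"
      using test_fun_DERIV[of \<phi> x] by (intro has_vector_derivative_of_real) (simp add: has_real_derivative_iff_has_vector_derivative)
    from has_vector_derivative_mult[OF this c]
    show "(?F has_vector_derivative ?f x) (at x)" by (simp add: algebra_simps)
    show "isCont ?f x"
      using test_fun_cont[of UNIV] has_vector_derivative_continuous[OF c]
      by (intro continuous_intros) (auto simp: continuous_on_eq_continuous_at)
  next
    show "set_integrable lborel (einterval (-\<infinity>) \<infinity>) ?f" using int by (simp add: set_integrable_def)
    show "((?F \<circ> real_of_ereal) \<longlongrightarrow> 0) (at_right (-\<infinity>))" "((?F \<circ> real_of_ereal) \<longlongrightarrow> 0) (at_left \<infinity>)"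
      using lim[OF test_fun_tendsto_0(1)] lim[OF test_fun_tendsto_0(2)] by (simp_all add: ereal_tendsto_simps)
  qed simp
  then have "(LINT x|lborel. ?f x) = 0"
    by (simp add: interval_lebesgue_integral_def set_lebesgue_integral_def)
  moreover have "(LINT x|lborel. ?f x) = (LINT x|lborel. complex_of_real (test_fun (schwartz_deriv \<phi>) x) * cis (x * \<xi>)) + \<i> * complex_of_real \<xi> * (LINT x|lborel. ?F x)"
    using Bochner_Integration.integral_add[OF ift_integrable[of "schwartz_deriv \<phi>" \<xi>] integrable_mult_right[OF ift_integrable[of \<phi> \<xi>], of "\<i> * complex_of_real \<xi>"]]
    by simp
  ultimately show ?thesis unfolding schwartz_ift_def by (simp add: eq_neg_iff_add_eq_0 algebra_simps flip: add_divide_distrib)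
qed

lemma ift_measurable [measurable]: "schwartz_ift \<phi> \<in> borel_measurable borel"
  unfolding schwartz_ift_def by measurable

lemma ift_bound: "cmod (schwartz_ift \<phi> \<xi>) \<le> (2 * (LINT x|lborel. 1 / (1 + x\<^sup>2))) * tempered_bound 2 \<phi>"
proof -
  have "cmod (LINT x|lborel. complex_of_real (test_fun \<phi> x) * cis (x * \<xi>)) \<le> (LINT x|lborel. \<bar>test_fun \<phi> x\<bar>)"
    by (rule order_trans[OF integral_norm_bound]) (simp add: norm_mult)
  also have "\<dots> \<le> (LINT x|lborel. 2 * tempered_bound 2 \<phi> * (1 / (1 + x\<^sup>2)))"
    by (intro integral_mono integrable_abs test_fun_integrable integrable_mult_right integrable_inverse_square schwartz_decay')
  also have "\<dots> = (2 * (LINT x|lborel. 1 / (1 + x\<^sup>2))) * tempered_bound 2 \<phi>"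
    unfolding Bochner_Integration.integral_mult_right_zero by simp
  finally have 1: "cmod (LINT x|lborel. complex_of_real (test_fun \<phi> x) * cis (x * \<xi>)) \<le> (2 * (LINT x|lborel. 1 / (1 + x\<^sup>2))) * tempered_bound 2 \<phi>" .
  have "cmod (schwartz_ift \<phi> \<xi>) = 1 / sqrt (2 * pi) * cmod (LINT x|lborel. complex_of_real (test_fun \<phi> x) * cis (x * \<xi>))"
    by (simp add: schwartz_ift_def norm_mult norm_divide)
  also have "\<dots> \<le> 1 * cmod (LINT x|lborel. complex_of_real (test_fun \<phi> x) * cis (x * \<xi>))"
    using pi_gt3 by (intro mult_right_mono) (auto simp: divide_le_eq real_le_rsqrt)
  finally show ?thesis using 1 by simp
qed

lemma tempered_bound_diff: "tempered_bound N (\<phi> - \<psi>) \<le> tempered_bound N \<phi> + tempered_bound N \<psi>"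
proof -
  have neg: "schwartz_seminorm j k (- \<psi>) = schwartz_seminorm j k \<psi>" for j k
  proof -
    have "test_fun (- \<psi>) = test_fun ((-1) *\<^sub>R \<psi>)" by (simp add: scaleR_schwartz.rep_eq uminus_schwartz.rep_eq)
    have "(deriv ^^ k) (test_fun (- \<psi>)) x = - (deriv ^^ k) (test_fun \<psi>) x" for x
    proof (induction k arbitrary: \<psi>)
      case (Suc k)
      have "schwartz_deriv (- \<psi>) = - schwartz_deriv \<psi>"
        using schwartz_deriv_scaleR[of "-1" \<psi>] by simp
      then show ?case
        using Suc[of "schwartz_deriv \<psi>"] unfolding deriv_pow_Suc
        by (simp add: schwartz_deriv.rep_eq[symmetric])
    qed (simp add: uminus_schwartz.rep_eq)
    then show ?thesis by (simp add: schwartz_seminorm_def abs_mult)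
  qed
  have "schwartz_seminorm j k (\<phi> - \<psi>) \<le> schwartz_seminorm j k \<phi> + schwartz_seminorm j k \<psi>" for j k
    using seminorm_add[of j k \<phi> "- \<psi>"] by (simp add: neg)
  then show ?thesis unfolding tempered_bound_def sum.distrib[symmetric] by (intro sum_mono)
qed

lemma tempered_bound_deriv: "tempered_bound N (schwartz_deriv \<phi>) \<le> tempered_bound (Suc N) \<phi>"
proof -
  have "tempered_bound N (schwartz_deriv \<phi>) = (\<Sum>j\<le>N. \<Sum>k\<le>N. schwartz_seminorm j (Suc k) \<phi>)"
    by (simp add: tempered_bound_def seminorm_deriv)
  also have "\<dots> \<le> (\<Sum>j\<le>N. \<Sum>k\<le>Suc N. schwartz_seminorm j k \<phi>)"
    by (intro sum_mono, unfold sum.atMost_Suc_shift[of _ N]) (simp add: seminorm_nonneg)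
  also have "\<dots> \<le> tempered_bound (Suc N) \<phi>"
    unfolding tempered_bound_def by (intro sum_mono2) (auto intro!: sum_nonneg add_nonneg_nonneg seminorm_nonneg)
  finally show ?thesis .
qed

lemma ift_helmholtz:
  "schwartz_ift (\<phi> - schwartz_deriv (schwartz_deriv \<phi>)) \<xi> = complex_of_real (1 + \<xi>\<^sup>2) * schwartz_ift \<phi> \<xi>"
  by (simp add: ift_diff ift_deriv algebra_simps power2_eq_square)

text \<open>Each factor \<open>1 + \<xi>\<^sup>2\<close> is traded for the operator 1 - \<partial>^2
  on the test function, at the price of two more derivatives in the seminorm. Constant and order do
  not depend on the test function, as continuity of a tempered functional demands.\<close>

lemma ift_decay: "\<exists>C N. C \<ge> 0 \<and> (\<forall>\<phi> \<xi>. (1 + \<xi>\<^sup>2) ^ k * cmod (schwartz_ift \<phi> \<xi>) \<le> C * tempered_bound N \<phi>)"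
proof (induction k)
  case 0
  have "0 \<le> 2 * (LINT x|lborel. 1 / (1 + (x::real)\<^sup>2))" by simp
  with ift_bound show ?case unfolding power_0 mult_1 by blast
next
  case (Suc k)
  then obtain C N where C: "C \<ge> 0" "\<And>\<phi> \<xi>. (1 + \<xi>\<^sup>2) ^ k * cmod (schwartz_ift \<phi> \<xi>) \<le> C * tempered_bound N \<phi>" by blast
  have "(1 + \<xi>\<^sup>2) ^ Suc k * cmod (schwartz_ift \<phi> \<xi>) \<le> (2 * C) * tempered_bound (N + 2) \<phi>" for \<phi> \<xi>
  proof -
    let ?\<psi> = "\<phi> - schwartz_deriv (schwartz_deriv \<phi>)"
    have "(1 + \<xi>\<^sup>2) ^ Suc k * cmod (schwartz_ift \<phi> \<xi>) = (1 + \<xi>\<^sup>2) ^ k * cmod (schwartz_ift ?\<psi> \<xi>)"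
    proof -
      have "\<bar>1 + \<xi>\<^sup>2\<bar> = 1 + \<xi>\<^sup>2" by (simp add: add_nonneg_nonneg)
      then show ?thesis unfolding ift_helmholtz norm_mult norm_of_real by simp
    qed
    also have "\<dots> \<le> C * tempered_bound N ?\<psi>" by (rule C)
    also have "\<dots> \<le> C * (tempered_bound (N + 2) \<phi> + tempered_bound (N + 2) \<phi>)"
    proof (intro mult_left_mono order_trans[OF tempered_bound_diff] add_mono C)
      show "tempered_bound N \<phi> \<le> tempered_bound (N + 2) \<phi>" by (intro tempered_bound_mono) simp
      show "tempered_bound N (schwartz_deriv (schwartz_deriv \<phi>)) \<le> tempered_bound (N + 2) \<phi>"
        using order_trans[OF tempered_bound_deriv tempered_bound_deriv, of N \<phi>] by simp
    qed
    finally show ?thesis by simp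
  qed
  then show ?case using C(1) by (intro exI[of _ "2 * C"] exI[of _ "N + 2"]) auto
qed

text \<open>The functional is \<phi> \<mapsto> \<integral>
  \<open>g \<xi> * schwartz_ift \<phi> \<xi>\<close> d\<xi>. It converges because the decay of the
  second factor outweighs any polynomial weight, and it is real because reflection conjugates both
  factors.\<close>

lemma tempered_of_fourier:
  assumes [measurable]: "g \<in> borel_measurable borel" and herm: "\<And>\<xi>. g (- \<xi>) = cnj (g \<xi>)"
    and int: "integrable lborel (\<lambda>\<xi>. (1 + \<xi>\<^sup>2) powr r * (cmod (g \<xi>))\<^sup>2)"
  shows "\<exists>T. is_fourier T g"
proof -
  \<comment> \<open>Chosen so that \<open>- r - 2 * k \<le> - 1\<close>: after Cauchy's inequality
    for products the power of \<open>1 + \<xi>\<^sup>2\<close> that is left is integrable. The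
    function \<open>B\<close> is the resulting majorant.\<close>
  obtain k :: nat where k: "(1 - r) / 2 \<le> k" using real_arch_simple by blast
  obtain C N where C: "C \<ge> 0" "\<And>\<phi> \<xi>. (1 + \<xi>\<^sup>2) ^ k * cmod (schwartz_ift \<phi> \<xi>) \<le> C * tempered_bound N \<phi>"
    using ift_decay by blast
  define B where "B \<xi> = (1/2) * ((1 + \<xi>\<^sup>2) powr r * (cmod (g \<xi>))\<^sup>2 + 1 / (1 + \<xi>\<^sup>2))" for \<xi>
  have Bint: "integrable lborel B"
    unfolding B_def by (intro integrable_mult_right Bochner_Integration.integrable_add int integrable_inverse_square)
  have le: "cmod (g \<xi> * schwartz_ift \<phi> \<xi>) \<le> (C * tempered_bound N \<phi>) * B \<xi>" for \<phi> \<xi>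
  proof -
    let ?w = "1 + \<xi>\<^sup>2"
    have w: "?w \<ge> 1" by simp
    have "?w powr (r/2) * cmod (g \<xi>) * (?w powr (- r/2 - k)) = ?w powr (r/2 + (- r/2 - k)) * cmod (g \<xi>)"
      unfolding powr_add by simp
    also have "?w powr (r/2 + (- r/2 - k)) = 1 / ?w ^ k"
    proof -
      have "?w powr (- real k) = 1 / ?w powr real k" by (rule powr_minus_divide)
      also have "?w powr real k = ?w ^ k" by (rule powr_realpow) (use w in linarith)
      finally show ?thesis by simp
    qed
    finally have e: "cmod (g \<xi>) / ?w ^ k = (?w powr (r/2) * cmod (g \<xi>)) * (?w powr (- r/2 - k))"
      by (simp only: times_divide_eq_left mult_1_left)
    have "2 * ((?w powr (r/2) * cmod (g \<xi>)) * (?w powr (- r/2 - k))) \<le> (?w powr (r/2) * cmod (g \<xi>))\<^sup>2 + (?w powr (- r/2 - k))\<^sup>2"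
      using sum_squares_bound[of "?w powr (r/2) * cmod (g \<xi>)" "?w powr (- r/2 - k)"] by simp
    also have "(?w powr (r/2) * cmod (g \<xi>))\<^sup>2 = ?w powr r * (cmod (g \<xi>))\<^sup>2"
      by (simp add: power_mult_distrib power2_eq_square powr_add[symmetric])
    also have "(?w powr (- r/2 - k))\<^sup>2 = ?w powr (- r - 2 * k)"
      by (simp add: power2_eq_square powr_add[symmetric])
    also have "\<dots> \<le> ?w powr (- 1)" using w k by (intro powr_mono) (auto simp: field_simps)
    also have "\<dots> = 1 / ?w" using w by (simp add: powr_minus field_simps)
    finally have 1: "cmod (g \<xi>) / ?w ^ k \<le> B \<xi>" unfolding e B_def by simp
    have "cmod (g \<xi> * schwartz_ift \<phi> \<xi>) = (cmod (g \<xi>) / ?w ^ k) * (?w ^ k * cmod (schwartz_ift \<phi> \<xi>))"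
      using weight_pos(2)[of \<xi>] by (simp add: norm_mult)
    also have "\<dots> \<le> B \<xi> * (C * tempered_bound N \<phi>)"
      using w by (intro mult_mono 1 C) (auto simp: B_def)
    finally show ?thesis by (simp add: mult.commute)
  qed
  have gi: "integrable lborel (\<lambda>\<xi>. g \<xi> * schwartz_ift \<phi> \<xi>)" for \<phi>
  proof (rule Bochner_Integration.integrable_bound)
    show "integrable lborel (\<lambda>\<xi>. (C * tempered_bound N \<phi>) * B \<xi>)" by (intro integrable_mult_right Bint)
    show "AE \<xi> in lborel. norm (g \<xi> * schwartz_ift \<phi> \<xi>) \<le> norm ((C * tempered_bound N \<phi>) * B \<xi>)"
      using order_trans[OF le abs_ge_self] by (intro AE_I2) simp
  qed measurable
  define S where "S \<phi> = (LINT \<xi>|lborel. g \<xi> * schwartz_ift \<phi> \<xi>)" for \<phi>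
  have Sreal: "complex_of_real (Re (S \<phi>)) = S \<phi>" for \<phi>
  proof -
    have "cnj (S \<phi>) = (LINT \<xi>|lborel. cnj (g \<xi> * schwartz_ift \<phi> \<xi>))"
      unfolding S_def by (rule Bochner_Integration.integral_cnj[symmetric])
    also have "\<dots> = (LINT \<xi>|lborel. g (- \<xi>) * schwartz_ift \<phi> (- \<xi>))"
      by (simp add: herm ift_cnj)
    also have "\<dots> = S \<phi>" unfolding S_def
      using lborel_integral_real_affine[of "-1" "\<lambda>\<xi>. g \<xi> * schwartz_ift \<phi> \<xi>" 0] by simp
    finally show ?thesis by (simp add: complex_eq_iff)
  qed
  have "is_tempered (\<lambda>\<phi>. Re (S \<phi>))"
  proof (rule is_temperedI)
    show "linear (\<lambda>\<phi>. Re (S \<phi>))"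
    proof
      show "Re (S (\<phi> + \<psi>)) = Re (S \<phi>) + Re (S \<psi>)" for \<phi> \<psi>
        using gi[of \<phi>] gi[of \<psi>] by (simp add: S_def ift_add distrib_left)
      show "Re (S (c *\<^sub>R \<phi>)) = c *\<^sub>R Re (S \<phi>)" for c \<phi>
      proof -
        have "S (c *\<^sub>R \<phi>) = complex_of_real c * S \<phi>"
          unfolding S_def by (simp add: ift_scaleR mult.left_commute)
        then show ?thesis by simp
      qed
    qed
    fix \<phi>
    have "\<bar>Re (S \<phi>)\<bar> \<le> cmod (S \<phi>)" by (rule abs_Re_le_cmod)
    also have "\<dots> \<le> (LINT \<xi>|lborel. cmod (g \<xi> * schwartz_ift \<phi> \<xi>))" unfolding S_def by (rule integral_norm_bound)
    also have "\<dots> \<le> (LINT \<xi>|lborel. (C * tempered_bound N \<phi>) * B \<xi>)"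
      by (intro integral_mono integrable_norm gi integrable_mult_right Bint le)
    also have "\<dots> = (C * (LINT \<xi>|lborel. B \<xi>)) * tempered_bound N \<phi>"
      using Bint by simp
    finally show "\<bar>Re (S \<phi>)\<bar> \<le> (C * (LINT \<xi>|lborel. B \<xi>)) * tempered_bound N \<phi>" .
  qed
  then have "apply_dist (Tempered (\<lambda>\<phi>. Re (S \<phi>))) = (\<lambda>\<phi>. Re (S \<phi>))"
    by (simp add: Tempered_inverse)
  then have "is_fourier (Tempered (\<lambda>\<phi>. Re (S \<phi>))) g"
    unfolding is_fourier_def using gi Sreal by (simp add: S_def)
  then show ?thesis by blast
qed

section \<open>Symmetry and algebra of transforms\<close>

lemma AE_lborel_uminus: "AE x in lborel. P (x::real) \<Longrightarrow> AE x in lborel. P (- x)"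
proof -
  assume "AE x in lborel. P x"
  then have "AE x in distr lborel borel uminus. P x" by (subst lborel_distr_uminus)
  then show ?thesis by (intro AE_distrD[of uminus lborel borel]) auto
qed

text \<open>As \<open>T\<close> takes real values, the reflected conjugate of \<open>g\<close>
  represents \<open>T\<close> as well, and the transform is unique.\<close>

lemma is_fourier_herm:
  assumes "is_fourier T g"
  shows "AE \<xi> in lborel. g (- \<xi>) = cnj (g \<xi>)"
proof -
  note [measurable] = assms[unfolded is_fourier_def, THEN conjunct1, simplified]
  have "is_fourier T (\<lambda>\<xi>. cnj (g (- \<xi>)))"
    unfolding is_fourier_def
  proof (intro conjI allI)
    show "(\<lambda>\<xi>. cnj (g (- \<xi>))) \<in> borel_measurable lborel" by measurable
    fix \<phi>
    have eq: "(\<lambda>\<xi>. cnj (g (- \<xi>)) * schwartz_ift \<phi> \<xi>) = (\<lambda>\<xi>. cnj (g (0 + - 1 * \<xi>) * schwartz_ift \<phi> (0 + - 1 * \<xi>)))"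
      by (simp add: ift_cnj fun_eq_iff)
    have i: "integrable lborel (\<lambda>\<xi>. g \<xi> * schwartz_ift \<phi> \<xi>)"
      and v: "complex_of_real (apply_dist T \<phi>) = (LINT \<xi>|lborel. g \<xi> * schwartz_ift \<phi> \<xi>)"
      using assms by (auto simp: is_fourier_def)
    show "integrable lborel (\<lambda>\<xi>. cnj (g (- \<xi>)) * schwartz_ift \<phi> \<xi>)"
      unfolding eq using lborel_integrable_real_affine[OF i, of "-1" 0]
      by (intro Bochner_Integration.integrable_cnj) simp
    have "(LINT \<xi>|lborel. cnj (g (0 + - 1 * \<xi>) * schwartz_ift \<phi> (0 + - 1 * \<xi>)))
       = cnj (LINT \<xi>|lborel. g (0 + - 1 * \<xi>) * schwartz_ift \<phi> (0 + - 1 * \<xi>))"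
      by (rule Bochner_Integration.integral_cnj)
    also have "\<dots> = cnj (complex_of_real (apply_dist T \<phi>))"
      unfolding v using lborel_integral_real_affine[of "-1" "\<lambda>\<xi>. g \<xi> * schwartz_ift \<phi> \<xi>" 0] by simp
    finally show "complex_of_real (apply_dist T \<phi>) = (LINT \<xi>|lborel. cnj (g (- \<xi>)) * schwartz_ift \<phi> \<xi>)"
      unfolding eq by simp
  qed
  from is_fourier_unique[OF this assms]
  show ?thesis by eventually_elim (metis complex_cnj_cnj)
qed

lemma is_fourier_cong_AE:
  assumes "is_fourier T g" and [measurable]: "h \<in> borel_measurable borel" and "AE \<xi> in lborel. g \<xi> = h \<xi>"
  shows "is_fourier T h"
proof -
  have [measurable]: "g \<in> borel_measurable borel" using assms(1) by (simp add: is_fourier_def)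
  show ?thesis
    unfolding is_fourier_def
  proof (intro conjI allI)
    fix \<phi>
    have AE: "AE \<xi> in lborel. g \<xi> * schwartz_ift \<phi> \<xi> = h \<xi> * schwartz_ift \<phi> \<xi>"
      using assms(3) by eventually_elim simp
    show "integrable lborel (\<lambda>\<xi>. h \<xi> * schwartz_ift \<phi> \<xi>)"
      using assms(1) integrable_cong_AE[OF _ _ AE] by (simp add: is_fourier_def)
    show "complex_of_real (apply_dist T \<phi>) = (LINT \<xi>|lborel. h \<xi> * schwartz_ift \<phi> \<xi>)"
      using assms(1) integral_cong_AE[OF _ _ AE] by (simp add: is_fourier_def)
  qed simp
qed

lemma is_fourier_inj: "is_fourier S g \<Longrightarrow> is_fourier T g \<Longrightarrow> S = T"
  using is_fourier_AE[of "S - T" "\<lambda>\<xi>. g \<xi> - g \<xi>"] is_fourier_diff[of S g T g] by simp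

lemma is_fourier_add: "is_fourier S f \<Longrightarrow> is_fourier T g \<Longrightarrow> is_fourier (S + T) (\<lambda>\<xi>. f \<xi> + g \<xi>)"
  unfolding is_fourier_def by (auto simp: distrib_right plus_tempered.rep_eq)

lemma is_fourier_scaleR: "is_fourier T g \<Longrightarrow> is_fourier (c *\<^sub>R T) (\<lambda>\<xi>. complex_of_real c * g \<xi>)"
  unfolding is_fourier_def by (auto simp: mult.assoc scaleR_tempered.rep_eq)

lemma is_fourier_deriv:
  assumes "is_fourier T g"
  shows "is_fourier (dist_deriv T) (\<lambda>\<xi>. \<i> * complex_of_real \<xi> * g \<xi>)"
proof -
  have [measurable]: "g \<in> borel_measurable borel" using assms by (simp add: is_fourier_def)
  have eq: "\<i> * complex_of_real \<xi> * g \<xi> * schwartz_ift \<phi> \<xi> = - (g \<xi> * schwartz_ift (schwartz_deriv \<phi>) \<xi>)" for \<phi> \<xi>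
    by (simp add: ift_deriv)
  show ?thesis
    unfolding is_fourier_def eq using assms by (auto simp: is_fourier_def dist_deriv.rep_eq)
qed

section \<open>The Hilbert space of square-integrable distributions\<close>

text \<open>The abstract equation, \<open>has_integral\<close> and bounded operators live on Banach
  space types. The Sobolev space of order zero is made into one; all other orders are reached from
  it by powers of the weight, see \<open>embed\<close>.\<close>

typedef l2h = "sobolev 0" morphisms dist_of L2h
  using zero_in_sobolev by blast

text \<open>A pointwise Hermitian representative of the Fourier transform.\<close>

definition hat :: "l2h \<Rightarrow> real \<Rightarrow> complex" where
  "hat x \<xi> = (fourier (dist_of x) \<xi> + cnj (fourier (dist_of x) (- \<xi>))) / 2"

definition herm_l2 :: "(real \<Rightarrow> complex) \<Rightarrow> bool" where
  "herm_l2 g \<longleftrightarrow> g \<in> borel_measurable borel \<and> (\<forall>\<xi>. g (- \<xi>) = cnj (g \<xi>)) \<and>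
     integrable lborel (\<lambda>\<xi>. (cmod (g \<xi>))\<^sup>2)"

definition of_hat :: "(real \<Rightarrow> complex) \<Rightarrow> l2h" where
  "of_hat g = L2h (THE T. is_fourier T g)"

lemma is_fourier_hat: "is_fourier (dist_of x) (hat x)"
proof -
  have f: "is_fourier (dist_of x) (fourier (dist_of x))" using dist_of[of x] by (rule sobolevD)
  then have [measurable]: "fourier (dist_of x) \<in> borel_measurable borel" by (simp add: is_fourier_def)
  show ?thesis
  proof (rule is_fourier_cong_AE[OF f])
    show "hat x \<in> borel_measurable borel" unfolding hat_def by measurable
    show "AE \<xi> in lborel. fourier (dist_of x) \<xi> = hat x \<xi>"
      using is_fourier_herm[OF f] by eventually_elim (simp add: hat_def)
  qed
qed

lemma hat_measurable [measurable]: "hat x \<in> borel_measurable borel"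
  using is_fourier_hat[of x] by (simp add: is_fourier_def)

lemma hat_minus: "hat x (- \<xi>) = cnj (hat x \<xi>)"
  by (simp add: hat_def add.commute)

lemma hat_square_integrable: "integrable lborel (\<lambda>\<xi>. (cmod (hat x \<xi>))\<^sup>2)"
  using dist_of[of x] sobolev_cong(1)[OF is_fourier_hat[of x], of 0] by simp

lemma herm_l2_hat: "herm_l2 (hat x)"
  by (simp add: herm_l2_def hat_minus hat_square_integrable)

lemma dist_of_of_hat:
  assumes "herm_l2 g"
  shows "is_fourier (dist_of (of_hat g)) g"
proof -
  obtain T where T: "is_fourier T g"
    using tempered_of_fourier[of g 0] assms by (auto simp: herm_l2_def)
  then have "(THE T. is_fourier T g) = T" using is_fourier_inj by blast
  moreover have "T \<in> sobolev 0" using assms sobolev_cong(1)[OF T, of 0] by (simp add: herm_l2_def)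
  ultimately show ?thesis using T by (simp add: of_hat_def L2h_inverse)
qed

lemma hat_of_hat: "herm_l2 g \<Longrightarrow> AE \<xi> in lborel. hat (of_hat g) \<xi> = g \<xi>"
  using is_fourier_unique[OF is_fourier_hat dist_of_of_hat] by blast

lemma l2h_eqI:
  assumes "AE \<xi> in lborel. hat x \<xi> = hat y \<xi>"
  shows "x = y"
proof -
  have "dist_of x = dist_of y"
    using is_fourier_inj[OF is_fourier_cong_AE[OF is_fourier_hat hat_measurable assms] is_fourier_hat] .
  then show ?thesis by (simp add: dist_of_inject)
qed

lemma of_hat_hat: "of_hat (hat x) = x"
  by (rule l2h_eqI[OF hat_of_hat[OF herm_l2_hat]])

lemma square_integrable_bound:
  fixes f :: "real \<Rightarrow> complex"
  assumes [measurable]: "f \<in> borel_measurable borel"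
    and "integrable lborel (\<lambda>\<xi>. (cmod (g \<xi>))\<^sup>2)" "integrable lborel (\<lambda>\<xi>. (cmod (h \<xi>))\<^sup>2)"
    and le: "\<And>\<xi>. cmod (f \<xi>) \<le> c * cmod (g \<xi>) + d * cmod (h \<xi>)"
  shows "integrable lborel (\<lambda>\<xi>. (cmod (f \<xi>))\<^sup>2)"
proof (rule Bochner_Integration.integrable_bound)
  show "integrable lborel (\<lambda>\<xi>. 2 * c\<^sup>2 * (cmod (g \<xi>))\<^sup>2 + 2 * d\<^sup>2 * (cmod (h \<xi>))\<^sup>2)"
    using assms(2,3) by (intro Bochner_Integration.integrable_add integrable_mult_right) auto
  have "(cmod (f \<xi>))\<^sup>2 \<le> 2 * c\<^sup>2 * (cmod (g \<xi>))\<^sup>2 + 2 * d\<^sup>2 * (cmod (h \<xi>))\<^sup>2" for \<xi>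
  proof -
    have "(cmod (f \<xi>))\<^sup>2 \<le> (c * cmod (g \<xi>) + d * cmod (h \<xi>))\<^sup>2"
      by (intro power_mono le) auto
    also have "\<dots> \<le> 2 * (c * cmod (g \<xi>))\<^sup>2 + 2 * (d * cmod (h \<xi>))\<^sup>2"
      using sum_squares_bound[of "c * cmod (g \<xi>)" "d * cmod (h \<xi>)"] by (simp add: power2_sum)
    finally show ?thesis by (simp add: power_mult_distrib)
  qed
  then show "AE \<xi> in lborel. norm ((cmod (f \<xi>))\<^sup>2) \<le> norm (2 * c\<^sup>2 * (cmod (g \<xi>))\<^sup>2 + 2 * d\<^sup>2 * (cmod (h \<xi>))\<^sup>2)"
    by (intro AE_I2) (simp add: order_trans[OF _ abs_ge_self])
qed measurable

lemma herm_l2_add: "herm_l2 f \<Longrightarrow> herm_l2 g \<Longrightarrow> herm_l2 (\<lambda>\<xi>. f \<xi> + g \<xi>)"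
  unfolding herm_l2_def
  using square_integrable_bound[of "\<lambda>\<xi>. f \<xi> + g \<xi>" f g 1 1]
  by (auto simp: norm_triangle_ineq intro: borel_measurable_add)

lemma herm_l2_mult:
  assumes "herm_l2 f" and m: "m \<in> borel_measurable borel" "\<And>\<xi>. m (- \<xi>) = m \<xi>" "\<And>\<xi>. \<bar>m \<xi>\<bar> \<le> M"
  shows "herm_l2 (\<lambda>\<xi>. complex_of_real (m \<xi>) * f \<xi>)"
proof -
  have [measurable]: "f \<in> borel_measurable borel" "m \<in> borel_measurable borel" using assms by (auto simp: herm_l2_def)
  have "integrable lborel (\<lambda>\<xi>. (cmod (complex_of_real (m \<xi>) * f \<xi>))\<^sup>2)"
    using assms by (subst square_integrable_bound[where g = f and h = f and c = M and d = 0])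
      (auto simp: herm_l2_def norm_mult intro!: mult_right_mono)
  then show ?thesis using assms(1) m(2) by (auto simp: herm_l2_def)
qed

section \<open>Vector space, inner product and completeness\<close>

instantiation l2h :: real_vector
begin
definition "0 = of_hat (\<lambda>_. 0)"
definition "x + y = of_hat (\<lambda>\<xi>. hat x \<xi> + hat y \<xi>)"
definition "- x = of_hat (\<lambda>\<xi>. - hat x \<xi>)"
definition "x - y = of_hat (\<lambda>\<xi>. hat x \<xi> - hat y \<xi>)"
definition "c *\<^sub>R x = of_hat (\<lambda>\<xi>. complex_of_real c * hat x \<xi>)" for x :: l2h

lemma hat_0: "AE \<xi> in lborel. hat 0 \<xi> = 0"
  unfolding zero_l2h_def by (rule hat_of_hat) (simp add: herm_l2_def)

lemma hat_add: "AE \<xi> in lborel. hat (x + y) \<xi> = hat x \<xi> + hat y \<xi>"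
  unfolding plus_l2h_def by (intro hat_of_hat herm_l2_add herm_l2_hat)

lemma hat_scaleR: "AE \<xi> in lborel. hat (c *\<^sub>R x) \<xi> = complex_of_real c * hat x \<xi>"
  unfolding scaleR_l2h_def by (intro hat_of_hat herm_l2_mult[where M = "\<bar>c\<bar>"] herm_l2_hat) auto

lemma hat_uminus: "AE \<xi> in lborel. hat (- x) \<xi> = - hat x \<xi>"
  unfolding uminus_l2h_def using herm_l2_mult[OF herm_l2_hat[of x], of "\<lambda>_. -1" 1] by (intro hat_of_hat) simp

lemma hat_diff: "AE \<xi> in lborel. hat (x - y) \<xi> = hat x \<xi> - hat y \<xi>"
  unfolding minus_l2h_def
  using herm_l2_add[OF herm_l2_hat[of x] herm_l2_mult[OF herm_l2_hat[of y], of "\<lambda>_. -1" 1]]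
  by (intro hat_of_hat) simp

instance
proof
  fix a b :: real and x y z :: l2h
  show "x + y + z = x + (y + z)"
    apply (rule l2h_eqI) using hat_add[of "x+y" z] hat_add[of x y] hat_add[of x "y+z"] hat_add[of y z]
    by eventually_elim simp
  show "x + y = y + x"
    apply (rule l2h_eqI) using hat_add[of x y] hat_add[of y x] by eventually_elim simp
  show "0 + x = x"
    apply (rule l2h_eqI) using hat_add[of 0 x] hat_0 by eventually_elim simp
  show "- x + x = 0"
    apply (rule l2h_eqI) using hat_add[of "-x" x] hat_0 hat_uminus[of x] by eventually_elim simp
  show "x - y = x + - y"
    apply (rule l2h_eqI) using hat_add[of x "-y"] hat_diff[of x y] hat_uminus[of y] by eventually_elim simp
  show "a *\<^sub>R (x + y) = a *\<^sub>R x + a *\<^sub>R y"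
    apply (rule l2h_eqI) using hat_add[of x y] hat_add[of "a *\<^sub>R x" "a *\<^sub>R y"] hat_scaleR[of a "x+y"] hat_scaleR[of a x] hat_scaleR[of a y]
    by eventually_elim (simp add: algebra_simps)
  show "(a + b) *\<^sub>R x = a *\<^sub>R x + b *\<^sub>R x"
    apply (rule l2h_eqI) using hat_add[of "a *\<^sub>R x" "b *\<^sub>R x"] hat_scaleR[of "a+b" x] hat_scaleR[of a x] hat_scaleR[of b x]
    by eventually_elim (simp add: algebra_simps)
  show "a *\<^sub>R b *\<^sub>R x = (a * b) *\<^sub>R x"
    apply (rule l2h_eqI) using hat_scaleR[of a "b *\<^sub>R x"] hat_scaleR[of b x] hat_scaleR[of "a * b" x] by eventually_elim simp
  show "1 *\<^sub>R x = x"
    apply (rule l2h_eqI) using hat_scaleR[of 1 x] by eventually_elim simp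
qed
end

lemma hat_mult_integrable: "integrable lborel (\<lambda>\<xi>. hat x \<xi> * cnj (hat y \<xi>))"
proof (rule Bochner_Integration.integrable_bound)
  show "integrable lborel (\<lambda>\<xi>. (cmod (hat x \<xi>))\<^sup>2 + (cmod (hat y \<xi>))\<^sup>2)"
    by (intro Bochner_Integration.integrable_add hat_square_integrable)
  have "cmod (hat x \<xi> * cnj (hat y \<xi>)) \<le> (cmod (hat x \<xi>))\<^sup>2 + (cmod (hat y \<xi>))\<^sup>2" for \<xi>
  proof -
    have "0 \<le> cmod (hat x \<xi>) * cmod (hat y \<xi>)" by simp
    then show ?thesis
      using sum_squares_bound[of "cmod (hat x \<xi>)" "cmod (hat y \<xi>)"] unfolding norm_mult complex_mod_cnj by linarith
  qed
  then show "AE \<xi> in lborel. norm (hat x \<xi> * cnj (hat y \<xi>)) \<le> norm ((cmod (hat x \<xi>))\<^sup>2 + (cmod (hat y \<xi>))\<^sup>2)"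
    by (intro AE_I2) (simp add: order_trans[OF _ abs_ge_self])
qed measurable

instantiation l2h :: real_inner
begin
definition "inner x y = Re (LINT \<xi>|lborel. hat x \<xi> * cnj (hat y \<xi>))"
definition "norm x = sqrt (inner x x)" for x :: l2h
definition "sgn x = inverse (norm x) *\<^sub>R x" for x :: l2h
definition "dist x y = norm (x - y)" for x y :: l2h
definition [code del]: "(uniformity :: (l2h \<times> l2h) filter) = (INF e\<in>{0<..}. principal {(x, y). dist x y < e})"
definition [code del]: "open (U :: l2h set) = (\<forall>x\<in>U. eventually (\<lambda>(x', y). x' = x \<longrightarrow> y \<in> U) uniformity)"

lemma inner_l2h_self: "inner x x = (LINT \<xi>|lborel. (cmod (hat x \<xi>))\<^sup>2)"
proof -
  have "(LINT \<xi>|lborel. hat x \<xi> * cnj (hat x \<xi>)) = (LINT \<xi>|lborel. complex_of_real ((cmod (hat x \<xi>))\<^sup>2))"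
    by (simp only: complex_norm_square)
  then show ?thesis by (simp only: inner_l2h_def integral_complex_of_real Re_complex_of_real)
qed

instance
proof
  fix x y z :: l2h and r :: real
  show "inner x y = inner y x"
  proof -
    have "cnj (LINT \<xi>|lborel. hat x \<xi> * cnj (hat y \<xi>)) = (LINT \<xi>|lborel. hat y \<xi> * cnj (hat x \<xi>))"
      by (subst Bochner_Integration.integral_cnj[symmetric]) (simp add: mult.commute)
    from this[symmetric] show ?thesis unfolding inner_l2h_def by simp
  qed
  show "inner (x + y) z = inner x z + inner y z"
  proof -
    have "(LINT \<xi>|lborel. hat (x + y) \<xi> * cnj (hat z \<xi>)) = (LINT \<xi>|lborel. hat x \<xi> * cnj (hat z \<xi>) + hat y \<xi> * cnj (hat z \<xi>))"
      using hat_add[of x y] by (intro integral_cong_AE) (measurable, auto simp: distrib_right elim: eventually_mono)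
    also have "\<dots> = (LINT \<xi>|lborel. hat x \<xi> * cnj (hat z \<xi>)) + (LINT \<xi>|lborel. hat y \<xi> * cnj (hat z \<xi>))"
      by (intro Bochner_Integration.integral_add hat_mult_integrable)
    finally show ?thesis by (simp add: inner_l2h_def)
  qed
  show "inner (r *\<^sub>R x) y = r * inner x y"
  proof -
    have "(LINT \<xi>|lborel. hat (r *\<^sub>R x) \<xi> * cnj (hat y \<xi>)) = (LINT \<xi>|lborel. complex_of_real r * (hat x \<xi> * cnj (hat y \<xi>)))"
      using hat_scaleR[of r x] by (intro integral_cong_AE) (measurable, auto simp: mult.assoc elim: eventually_mono)
    then show ?thesis by (simp add: inner_l2h_def)
  qed
  show "0 \<le> inner x x" by (simp add: inner_l2h_self)
  show "inner x x = 0 \<longleftrightarrow> x = 0"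
  proof
    assume "inner x x = 0"
    then have "AE \<xi> in lborel. (cmod (hat x \<xi>))\<^sup>2 = 0"
      unfolding inner_l2h_self using integral_nonneg_eq_0_iff_AE[OF hat_square_integrable[of x]] by simp
    then have "AE \<xi> in lborel. hat x \<xi> = hat 0 \<xi>" using hat_0 by eventually_elim simp
    then show "x = 0" by (rule l2h_eqI)
  next
    assume "x = 0"
    then have "AE \<xi> in lborel. (cmod (hat x \<xi>))\<^sup>2 = 0" using hat_0 by auto
    then show "inner x x = 0" unfolding inner_l2h_self by (rule integral_eq_zero_AE)
  qed
qed (simp_all add: norm_l2h_def sgn_l2h_def dist_l2h_def uniformity_l2h_def open_l2h_def)
end

lemma norm_l2h: "(norm (x::l2h))\<^sup>2 = (LINT \<xi>|lborel. (cmod (hat x \<xi>))\<^sup>2)"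
  by (simp add: power2_norm_eq_inner inner_l2h_self)

lemma nn_integral_hat: "(\<integral>\<^sup>+\<xi>. ennreal ((cmod (hat x \<xi>))\<^sup>2) \<partial>lborel) = ennreal ((norm x)\<^sup>2)"
  unfolding norm_l2h by (rule nn_integral_eq_integral[OF hat_square_integrable]) simp

text \<open>The subsequence below satisfies \<open>\<Sum> 2\<^sup>k \<parallel>g\<^sub>k\<^sub>+\<^sub>1 - g\<^sub>k\<parallel>\<^sup>2 < \<infinity>\<close>, which makes it converge
  almost everywhere; Fatou's lemma then gives convergence in the mean.\<close>

instance l2h :: complete_space
proof
  fix X :: "nat \<Rightarrow> l2h" assume X: "Cauchy X"
  have "\<exists>N. \<forall>m\<ge>N. \<forall>n\<ge>N. norm (X m - X n) < (1/2) ^ k" for k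
    using X unfolding Cauchy_iff by (meson half_gt_zero zero_less_one zero_less_power)
  then obtain N where N: "\<And>k m n. m \<ge> N k \<Longrightarrow> n \<ge> N k \<Longrightarrow> norm (X m - X n) < (1/2) ^ k" by metis
  \<comment> \<open>The maximum keeps \<open>r k\<close> above \<open>N k\<close> and makes the
    indices nondecreasing.\<close>
  define r where "r k = Max (N ` {..k})" for k
  have rN: "r k \<ge> N k" and rmono: "r (Suc k) \<ge> r k" for k
    unfolding r_def by (auto intro!: Max_mono)
  define g where "g k = hat (X (r k))" for k
  have [measurable]: "g k \<in> borel_measurable borel" for k by (simp add: g_def)
  have nn_diff: "(\<integral>\<^sup>+\<xi>. ennreal ((cmod (hat x \<xi> - hat y \<xi>))\<^sup>2) \<partial>lborel) = ennreal ((norm (x - y))\<^sup>2)" for x y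
    unfolding nn_integral_hat[symmetric] using hat_diff[of x y] by (intro nn_integral_cong_AE) auto
  define d where "d k \<xi> = cmod (g (Suc k) \<xi> - g k \<xi>)" for k \<xi>
  have [measurable]: "d k \<in> borel_measurable borel" for k unfolding d_def by measurable
  have d: "(\<integral>\<^sup>+\<xi>. ennreal (2 ^ k * (d k \<xi>)\<^sup>2) \<partial>lborel) \<le> ennreal ((1/2) ^ k)" for k
  proof -
    have "norm (X (r (Suc k)) - X (r k)) < (1/2) ^ k" using rN[of k] rmono[of k] by (intro N) auto
    then have "(norm (X (r (Suc k)) - X (r k)))\<^sup>2 \<le> ((1/2) ^ k)\<^sup>2" by (intro power_mono) auto
    then have "2 ^ k * (norm (X (r (Suc k)) - X (r k)))\<^sup>2 \<le> 2 ^ k * ((1/2) ^ k)\<^sup>2" by simp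
    also have "\<dots> = (1/2) ^ k" by (simp add: power2_eq_square power_mult_distrib[symmetric] mult.assoc[symmetric])
    finally have "ennreal (2 ^ k * (norm (X (r (Suc k)) - X (r k)))\<^sup>2) \<le> ennreal ((1/2) ^ k)" by (rule ennreal_leI)
    moreover have "(\<integral>\<^sup>+\<xi>. ennreal (2 ^ k * (d k \<xi>)\<^sup>2) \<partial>lborel) = ennreal (2 ^ k * (norm (X (r (Suc k)) - X (r k)))\<^sup>2)"
      by (simp add: ennreal_mult' d_def g_def nn_diff nn_integral_cmult)
    ultimately show ?thesis by simp
  qed
  have "(\<integral>\<^sup>+\<xi>. (\<Sum>k. ennreal (2 ^ k * (d k \<xi>)\<^sup>2)) \<partial>lborel) = (\<Sum>k. \<integral>\<^sup>+\<xi>. ennreal (2 ^ k * (d k \<xi>)\<^sup>2) \<partial>lborel)"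
    by (rule nn_integral_suminf) measurable
  also have "\<dots> \<le> (\<Sum>k. ennreal ((1/2) ^ k))" by (intro suminf_le d) auto
  also have "\<dots> < \<infinity>"
    by (subst suminf_ennreal_eq[of _ 2]) (use power_half_series geometric_sums[of "1/2::real"] in auto)
  finally have "AE \<xi> in lborel. (\<Sum>k. ennreal (2 ^ k * (d k \<xi>)\<^sup>2)) \<noteq> \<infinity>"
    by (intro nn_integral_PInf_AE) auto
  then have conv: "AE \<xi> in lborel. convergent (\<lambda>k. g k \<xi>)"
  proof eventually_elim
    case (elim \<xi>)
    define S where "S = (\<Sum>k. ennreal (2 ^ k * (d k \<xi>)\<^sup>2))"
    from elim have "S \<noteq> top" by (simp only: S_def infinity_ennreal_def not_False_eq_True)
    then obtain B where B: "S = ennreal B" "B \<ge> 0" by (cases S) auto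
    \<comment> \<open>Finiteness of the sum bounds each of its terms, so the increments at
      \<open>\<xi>\<close> decay like a geometric sequence of ratio 1 / sqrt 2 and are
      summable.\<close>
    have dB: "2 ^ k * (d k \<xi>)\<^sup>2 \<le> B" for k
    proof -
      have "(\<Sum>k\<in>{k}. ennreal (2 ^ k * (d k \<xi>)\<^sup>2)) \<le> S"
        unfolding S_def by (rule sum_le_suminf[OF summableI]) simp_all
      then have "ennreal (2 ^ k * (d k \<xi>)\<^sup>2) \<le> ennreal B" by (simp only: B sum.insert finite.emptyI sum.empty add_0_right) simp
      then show ?thesis using B(2) ennreal_le_iff by blast
    qed
    have dk: "norm (d k \<xi>) \<le> sqrt B * (1 / sqrt 2) ^ k" for k
    proof -
      have "(d k \<xi>)\<^sup>2 \<le> B / 2 ^ k" using dB[of k] by (simp add: field_simps)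
      then have "d k \<xi> \<le> sqrt (B / 2 ^ k)" by (rule real_le_rsqrt)
      then show ?thesis by (simp add: real_sqrt_divide real_sqrt_power power_divide d_def)
    qed
    have sm: "summable (\<lambda>k. sqrt B * (1 / sqrt 2) ^ k)"
      by (intro summable_mult summable_geometric) simp
    have "summable (\<lambda>k. d k \<xi>)"
      by (rule summable_comparison_test'[OF sm dk])
    then have "summable (\<lambda>k. g (Suc k) \<xi> - g k \<xi>)"
      unfolding d_def by (rule summable_norm_cancel)
    then have "(\<lambda>n. \<Sum>k<n. g (Suc k) \<xi> - g k \<xi>) \<longlonglongrightarrow> (\<Sum>k. g (Suc k) \<xi> - g k \<xi>)"
      by (rule summable_LIMSEQ)
    then have "(\<lambda>n. g n \<xi> - g 0 \<xi>) \<longlonglongrightarrow> (\<Sum>k. g (Suc k) \<xi> - g k \<xi>)"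
      by (simp only: sum_lessThan_telescope[of "\<lambda>k. g k \<xi>"])
    from tendsto_add[OF this tendsto_const[of "g 0 \<xi>"]] show "convergent (\<lambda>k. g k \<xi>)"
      by (auto simp: convergent_def)
  qed
  \<comment> \<open>The set where the sequence fails to converge is symmetric, because reflection
    conjugates each \<open>g k\<close>. Hence the default value 0 keeps \<open>G\<close> Hermitian
    at every point, not just almost everywhere.\<close>
  define G where "G \<xi> = (if convergent (\<lambda>k. g k \<xi>) then lim (\<lambda>k. g k \<xi>) else 0)" for \<xi>
  have Gm [measurable]: "G \<in> borel_measurable borel" unfolding G_def
    unfolding Cauchy_convergent_iff[symmetric] using borel_measurable_lim_metric[of g] by measurable
  have herm: "G (- \<xi>) = cnj (G \<xi>)" for \<xi>
  proof -
    have e: "(\<lambda>k. g k (- \<xi>)) = (\<lambda>k. cnj (g k \<xi>))" by (simp add: g_def hat_minus)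
    show ?thesis
    proof (cases "convergent (\<lambda>k. g k \<xi>)")
      case True
      then have "(\<lambda>k. g k \<xi>) \<longlonglongrightarrow> lim (\<lambda>k. g k \<xi>)" by (simp add: convergent_LIMSEQ_iff)
      then have l: "(\<lambda>k. g k (- \<xi>)) \<longlonglongrightarrow> cnj (lim (\<lambda>k. g k \<xi>))" unfolding e by (rule tendsto_cnj)
      then have "convergent (\<lambda>k. g k (- \<xi>))" by (auto simp: convergent_def)
      with True limI[OF l] show ?thesis by (simp add: G_def)
    next
      case False
      have "\<not> convergent (\<lambda>k. g k (- \<xi>))"
      proof
        assume "convergent (\<lambda>k. g k (- \<xi>))"
        then obtain l where "(\<lambda>k. cnj (g k \<xi>)) \<longlonglongrightarrow> l" unfolding e convergent_def by blast
        from tendsto_cnj[OF this] False show False by (auto simp: convergent_def)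
      qed
      with False show ?thesis by (simp add: G_def)
    qed
  qed
  have lim: "AE \<xi> in lborel. (\<lambda>k. g k \<xi>) \<longlonglongrightarrow> G \<xi>"
    using conv by eventually_elim (simp add: G_def convergent_LIMSEQ_iff)
  have fatou: "(\<integral>\<^sup>+\<xi>. ennreal ((cmod (G \<xi> - hat (X n) \<xi>))\<^sup>2) \<partial>lborel) \<le> ennreal (((1/2) ^ k)\<^sup>2)" if n: "n \<ge> N k" for n k
  proof -
    have "(\<integral>\<^sup>+\<xi>. ennreal ((cmod (G \<xi> - hat (X n) \<xi>))\<^sup>2) \<partial>lborel)
      = (\<integral>\<^sup>+\<xi>. liminf (\<lambda>j. ennreal ((cmod (g j \<xi> - hat (X n) \<xi>))\<^sup>2)) \<partial>lborel)"
    proof (rule nn_integral_cong_AE)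
      show "AE \<xi> in lborel. ennreal ((cmod (G \<xi> - hat (X n) \<xi>))\<^sup>2) = liminf (\<lambda>j. ennreal ((cmod (g j \<xi> - hat (X n) \<xi>))\<^sup>2))"
        using lim
      proof eventually_elim
        case (elim \<xi>)
        then have "(\<lambda>j. ennreal ((cmod (g j \<xi> - hat (X n) \<xi>))\<^sup>2)) \<longlonglongrightarrow> ennreal ((cmod (G \<xi> - hat (X n) \<xi>))\<^sup>2)"
          by (intro tendsto_intros) auto
        then show ?case by (intro lim_imp_Liminf[symmetric]) auto
      qed
    qed
    also have "\<dots> \<le> liminf (\<lambda>j. \<integral>\<^sup>+\<xi>. ennreal ((cmod (g j \<xi> - hat (X n) \<xi>))\<^sup>2) \<partial>lborel)"
      by (rule nn_integral_liminf) measurable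
    also have "\<dots> \<le> ennreal (((1/2) ^ k)\<^sup>2)"
    proof (rule order_trans[OF Liminf_mono])
      have "\<forall>\<^sub>F j in sequentially. j \<ge> k" by (rule eventually_ge_at_top)
      then show "\<forall>\<^sub>F j in sequentially. (\<integral>\<^sup>+\<xi>. ennreal ((cmod (g j \<xi> - hat (X n) \<xi>))\<^sup>2) \<partial>lborel) \<le> ennreal (((1/2) ^ k)\<^sup>2)"
      proof eventually_elim
        case (elim j)
        have "r j \<ge> N k" using elim unfolding r_def by (intro Max_ge) auto
        then have "norm (X (r j) - X n) < (1/2) ^ k" using n by (intro N)
        then show ?case unfolding g_def nn_diff by (intro ennreal_leI power_mono) auto
      qed
    qed (simp add: Liminf_const)
    finally show ?thesis .
  qed
  have hG: "herm_l2 G"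
  proof -
    have i: "integrable lborel (\<lambda>\<xi>. (cmod (G \<xi> - hat (X (N 0)) \<xi>))\<^sup>2)"
    proof (rule integrableI_bounded)
      have "(\<integral>\<^sup>+\<xi>. ennreal (norm ((cmod (G \<xi> - hat (X (N 0)) \<xi>))\<^sup>2)) \<partial>lborel) \<le> ennreal (((1/2) ^ 0)\<^sup>2)"
        using fatou[of 0 "N 0"] by simp
      then show "(\<integral>\<^sup>+\<xi>. ennreal (norm ((cmod (G \<xi> - hat (X (N 0)) \<xi>))\<^sup>2)) \<partial>lborel) < \<infinity>"
        by (rule order_le_less_trans) simp
    qed measurable
    have "integrable lborel (\<lambda>\<xi>. (cmod (G \<xi>))\<^sup>2)"
    proof (rule square_integrable_bound[OF Gm i hat_square_integrable[of "X (N 0)"]])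
      show "cmod (G \<xi>) \<le> 1 * cmod (G \<xi> - hat (X (N 0)) \<xi>) + 1 * cmod (hat (X (N 0)) \<xi>)" for \<xi>
        using norm_triangle_sub[of "G \<xi>" "hat (X (N 0)) \<xi>"] by simp
    qed
    with herm show ?thesis by (simp add: herm_l2_def)
  qed
  have conv: "norm (X n - of_hat G) \<le> (1/2) ^ k" if n: "n \<ge> N k" for n k
  proof -
    have "ennreal ((norm (of_hat G - X n))\<^sup>2) = (\<integral>\<^sup>+\<xi>. ennreal ((cmod (G \<xi> - hat (X n) \<xi>))\<^sup>2) \<partial>lborel)"
      unfolding nn_diff[symmetric] using hat_of_hat[OF hG] by (intro nn_integral_cong_AE) auto
    also have "\<dots> \<le> ennreal (((1/2) ^ k)\<^sup>2)" by (rule fatou[OF n])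
    finally have "(norm (of_hat G - X n))\<^sup>2 \<le> ((1/2) ^ k)\<^sup>2" by (simp add: ennreal_le_iff)
    then have "norm (of_hat G - X n) \<le> (1/2) ^ k" by (rule power2_le_imp_le) simp
    then show ?thesis by (simp add: norm_minus_commute)
  qed
  have "X \<longlonglongrightarrow> of_hat G"
  proof (rule LIMSEQ_I)
    fix e :: real assume "e > 0"
    then obtain k where k: "(1/2) ^ k < e" using real_arch_pow_inv[of e "1/2"] by auto
    show "\<exists>no. \<forall>n\<ge>no. norm (X n - of_hat G) < e"
      using conv[of k] k by (intro exI[of _ "N k"]) (auto intro: order_le_less_trans)
  qed
  then show "convergent X" by (auto simp: convergent_def)
qed

instance l2h :: banach ..

section \<open>Fourier multipliers\<close>

text \<open>Real and even multipliers preserve Hermitian functions, that is, they map real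
  distributions to real ones.\<close>

definition even_bounded :: "(real \<Rightarrow> real) \<Rightarrow> bool" where
  "even_bounded m \<longleftrightarrow> m \<in> borel_measurable borel \<and> (\<forall>\<xi>. m (- \<xi>) = m \<xi>) \<and> (\<exists>M. \<forall>\<xi>. \<bar>m \<xi>\<bar> \<le> M)"

definition fmult :: "(real \<Rightarrow> real) \<Rightarrow> l2h \<Rightarrow> l2h" where
  "fmult m x = of_hat (\<lambda>\<xi>. complex_of_real (m \<xi>) * hat x \<xi>)"

lemma even_boundedI:
  "m \<in> borel_measurable borel \<Longrightarrow> (\<And>\<xi>. m (- \<xi>) = m \<xi>) \<Longrightarrow> (\<And>\<xi>. \<bar>m \<xi>\<bar> \<le> M) \<Longrightarrow> even_bounded m"
  unfolding even_bounded_def by blast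

lemma even_bounded_mult: "even_bounded m \<Longrightarrow> even_bounded m' \<Longrightarrow> even_bounded (\<lambda>\<xi>. m \<xi> * m' \<xi>)"
proof -
  assume a: "even_bounded m" "even_bounded m'"
  then obtain M M' where "\<And>\<xi>. \<bar>m \<xi>\<bar> \<le> M" "\<And>\<xi>. \<bar>m' \<xi>\<bar> \<le> M'" unfolding even_bounded_def by blast
  then have "\<bar>m \<xi> * m' \<xi>\<bar> \<le> M * M'" for \<xi>
    unfolding abs_mult by (intro mult_mono) (auto intro: order_trans[OF abs_ge_zero])
  then show ?thesis using a by (intro even_boundedI[of _ "M * M'"]) (auto simp: even_bounded_def)
qed

lemma even_bounded_const: "even_bounded (\<lambda>_. c)"
  by (rule even_boundedI[of _ "\<bar>c\<bar>"]) auto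

lemma even_bounded_diff: "even_bounded m \<Longrightarrow> even_bounded m' \<Longrightarrow> even_bounded (\<lambda>\<xi>. m \<xi> - m' \<xi>)"
proof -
  assume a: "even_bounded m" "even_bounded m'"
  then obtain M M' where M: "\<And>\<xi>. \<bar>m \<xi>\<bar> \<le> M" "\<And>\<xi>. \<bar>m' \<xi>\<bar> \<le> M'" unfolding even_bounded_def by blast
  have "\<bar>m \<xi> - m' \<xi>\<bar> \<le> M + M'" for \<xi>
    using M(1)[of \<xi>] M(2)[of \<xi>] by linarith
  then show ?thesis using a by (intro even_boundedI[of _ "M + M'"]) (auto simp: even_bounded_def)
qed

lemma herm_l2_fmult: "even_bounded m \<Longrightarrow> herm_l2 f \<Longrightarrow> herm_l2 (\<lambda>\<xi>. complex_of_real (m \<xi>) * f \<xi>)"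
  unfolding even_bounded_def by (metis herm_l2_mult)

lemma hat_fmult: "even_bounded m \<Longrightarrow> AE \<xi> in lborel. hat (fmult m x) \<xi> = complex_of_real (m \<xi>) * hat x \<xi>"
  unfolding fmult_def by (rule hat_of_hat[OF herm_l2_fmult[OF _ herm_l2_hat]])

lemma inner_l2h: "inner x y = (LINT \<xi>|lborel. Re (hat x \<xi> * cnj (hat y \<xi>)))"
  unfolding inner_l2h_def using integral_Re[OF hat_mult_integrable[of x y]] by simp

lemma inner_fmult:
  assumes m: "even_bounded m"
  shows "inner (fmult m x) y = (LINT \<xi>|lborel. m \<xi> * Re (hat x \<xi> * cnj (hat y \<xi>)))"
    and "integrable lborel (\<lambda>\<xi>. m \<xi> * Re (hat x \<xi> * cnj (hat y \<xi>)))"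
proof -
  have [measurable]: "m \<in> borel_measurable borel" using m by (simp add: even_bounded_def)
  have AE: "AE \<xi> in lborel. Re (hat (fmult m x) \<xi> * cnj (hat y \<xi>)) = m \<xi> * Re (hat x \<xi> * cnj (hat y \<xi>))"
    using hat_fmult[OF m, of x] by eventually_elim (simp add: algebra_simps)
  show "inner (fmult m x) y = (LINT \<xi>|lborel. m \<xi> * Re (hat x \<xi> * cnj (hat y \<xi>)))"
    unfolding inner_l2h using AE by (intro integral_cong_AE) simp_all
  have "integrable lborel (\<lambda>\<xi>. Re (hat (fmult m x) \<xi> * cnj (hat y \<xi>)))"
    by (intro integrable_Re hat_mult_integrable)
  then show "integrable lborel (\<lambda>\<xi>. m \<xi> * Re (hat x \<xi> * cnj (hat y \<xi>)))"
    using integrable_cong_AE[OF _ _ AE] by simp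
qed

lemma inner_fmult_sym: "even_bounded m \<Longrightarrow> inner (fmult m x) y = inner x (fmult m y)"
  unfolding inner_commute[of x] by (simp add: inner_fmult(1) mult.commute)

lemma Re_mult_cnj_self: "Re (z * cnj z) = (cmod z)\<^sup>2"
  by (simp add: complex_norm_square[symmetric])

lemma inner_fmult_self:
  "even_bounded m \<Longrightarrow> inner (fmult m x) x = (LINT \<xi>|lborel. m \<xi> * (cmod (hat x \<xi>))\<^sup>2)"
  "even_bounded m \<Longrightarrow> integrable lborel (\<lambda>\<xi>. m \<xi> * (cmod (hat x \<xi>))\<^sup>2)"
  using inner_fmult[of m x x, unfolded Re_mult_cnj_self] by blast+

lemma inner_fmult_mono:
  assumes "even_bounded m" "even_bounded m'" "\<And>\<xi>. m \<xi> \<le> m' \<xi>"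
  shows "inner (fmult m x) x \<le> inner (fmult m' x) x"
  unfolding inner_fmult_self(1)[OF assms(1)] inner_fmult_self(1)[OF assms(2)]
  by (intro integral_mono inner_fmult_self assms mult_right_mono) simp

lemma fmult_one [simp]: "fmult (\<lambda>_. 1) x = x"
  unfolding fmult_def by (simp add: of_hat_hat)

lemma fmult_zero [simp]: "fmult (\<lambda>_. 0) x = 0"
  unfolding fmult_def by (simp add: zero_l2h_def)

lemma fmult_fmult: "even_bounded m \<Longrightarrow> even_bounded m' \<Longrightarrow> fmult m (fmult m' x) = fmult (\<lambda>\<xi>. m \<xi> * m' \<xi>) x"
proof (rule l2h_eqI)
  assume m: "even_bounded m" "even_bounded m'"
  show "AE \<xi> in lborel. hat (fmult m (fmult m' x)) \<xi> = hat (fmult (\<lambda>\<xi>. m \<xi> * m' \<xi>) x) \<xi>"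
    using hat_fmult[OF m(1), of "fmult m' x"] hat_fmult[OF m(2), of x] hat_fmult[OF even_bounded_mult[OF m], of x]
    by eventually_elim simp
qed

lemma fmult_diff_left: "even_bounded m \<Longrightarrow> even_bounded m' \<Longrightarrow> fmult m x - fmult m' x = fmult (\<lambda>\<xi>. m \<xi> - m' \<xi>) x"
proof (rule l2h_eqI)
  assume m: "even_bounded m" "even_bounded m'"
  show "AE \<xi> in lborel. hat (fmult m x - fmult m' x) \<xi> = hat (fmult (\<lambda>\<xi>. m \<xi> - m' \<xi>) x) \<xi>"
    using hat_diff[of "fmult m x" "fmult m' x"] hat_fmult[OF m(1), of x] hat_fmult[OF m(2), of x] hat_fmult[OF even_bounded_diff[OF m], of x]
    by eventually_elim (simp add: left_diff_distrib)
qed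

lemma norm_fmult_square: "even_bounded m \<Longrightarrow> (norm (fmult m x))\<^sup>2 = inner (fmult (\<lambda>\<xi>. (m \<xi>)\<^sup>2) x) x"
  by (simp only: power2_norm_eq_inner inner_fmult_sym[of m "fmult m x" x, symmetric] fmult_fmult)
    (simp only: power2_eq_square)

lemma norm_fmult_le:
  assumes m: "even_bounded m" and le: "\<And>\<xi>. \<bar>m \<xi>\<bar> \<le> M"
  shows "norm (fmult m x) \<le> M * norm x"
proof -
  have M: "0 \<le> M" by (rule order_trans[OF abs_ge_zero le])
  have m2: "even_bounded (\<lambda>\<xi>. (m \<xi>)\<^sup>2)" using even_bounded_mult[OF m m] by (simp add: power2_eq_square)
  have "(m \<xi>)\<^sup>2 \<le> M\<^sup>2" for \<xi> using power_mono[OF le abs_ge_zero, of \<xi> 2] by simp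
  then have "(norm (fmult m x))\<^sup>2 \<le> inner (fmult (\<lambda>_. M\<^sup>2) x) x"
    unfolding norm_fmult_square[OF m] by (intro inner_fmult_mono m2 even_bounded_const)
  also have "\<dots> = (M * norm x)\<^sup>2"
    by (simp add: inner_fmult_self(1) even_bounded_const norm_l2h[symmetric] power_mult_distrib)
  finally show ?thesis by (rule power2_le_imp_le) (simp add: M)
qed

lemma bounded_linear_fmult: "even_bounded m \<Longrightarrow> bounded_linear (fmult m)"
proof -
  assume m: "even_bounded m"
  then obtain M where M: "\<And>\<xi>. \<bar>m \<xi>\<bar> \<le> M" unfolding even_bounded_def by blast
  show ?thesis
  proof (rule bounded_linear_intro)
    show "fmult m (x + y) = fmult m x + fmult m y" for x y
      apply (rule l2h_eqI)
      using hat_add[of x y] hat_add[of "fmult m x" "fmult m y"] hat_fmult[OF m, of x] hat_fmult[OF m, of y] hat_fmult[OF m, of "x + y"]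
      by eventually_elim (simp add: algebra_simps)
    show "fmult m (r *\<^sub>R x) = r *\<^sub>R fmult m x" for r x
      apply (rule l2h_eqI)
      using hat_scaleR[of r x] hat_scaleR[of r "fmult m x"] hat_fmult[OF m, of x] hat_fmult[OF m, of "r *\<^sub>R x"]
      by eventually_elim simp
    show "norm (fmult m x) \<le> norm x * M" for x
      using norm_fmult_le[OF m M] by (simp add: mult.commute)
  qed
qed

lemma fmult_inj:
  assumes m: "even_bounded m" and "\<And>\<xi>. m \<xi> \<noteq> 0" and "fmult m x = 0"
  shows "x = 0"
proof (rule l2h_eqI)
  show "AE \<xi> in lborel. hat x \<xi> = hat 0 \<xi>"
    using hat_fmult[OF m, of x] hat_0 unfolding assms(3)
    by eventually_elim (use assms(2) in simp)
qed

lemma inner_fmult_tendsto: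
  assumes m: "\<And>n. even_bounded (m n)" and M: "\<And>n \<xi>. \<bar>m n \<xi>\<bar> \<le> M" and lim: "\<And>\<xi>. (\<lambda>n. m n \<xi>) \<longlonglongrightarrow> 0"
  shows "(\<lambda>n. inner (fmult (m n) x) x) \<longlonglongrightarrow> 0"
proof -
  have [measurable]: "m n \<in> borel_measurable borel" for n using m[of n] by (simp add: even_bounded_def)
  have "(\<lambda>n. LINT \<xi>|lborel. m n \<xi> * (cmod (hat x \<xi>))\<^sup>2) \<longlonglongrightarrow> (LINT \<xi>::real|lborel. 0 :: real)"
  proof (rule integral_dominated_convergence)
    show "integrable lborel (\<lambda>\<xi>. M * (cmod (hat x \<xi>))\<^sup>2)" by (intro integrable_mult_right hat_square_integrable)
    show "AE \<xi> in lborel. (\<lambda>n. m n \<xi> * (cmod (hat x \<xi>))\<^sup>2) \<longlonglongrightarrow> 0"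
      by (intro AE_I2 tendsto_mult_left_zero lim)
    show "AE \<xi> in lborel. norm (m n \<xi> * (cmod (hat x \<xi>))\<^sup>2) \<le> M * (cmod (hat x \<xi>))\<^sup>2" for n
      by (intro AE_I2) (simp add: abs_mult mult_right_mono M)
  qed simp_all
  then show ?thesis by (simp add: inner_fmult_self(1) m)
qed

section \<open>Trilinear convolution integrals\<close>

lemma ennreal_power2_le: "x\<^sup>2 \<le> ennreal (c\<^sup>2) \<Longrightarrow> 0 \<le> c \<Longrightarrow> x \<le> ennreal c" for x :: ennreal
proof (cases x)
  case (real r)
  assume "x\<^sup>2 \<le> ennreal (c\<^sup>2)" "0 \<le> c"
  then have "r\<^sup>2 \<le> c\<^sup>2" using real by (simp add: ennreal_power ennreal_le_iff)
  then have "r \<le> c" by (rule power2_le_imp_le) fact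
  then show ?thesis using real by (simp add: ennreal_leI)
next
  case top
  assume "x\<^sup>2 \<le> ennreal (c\<^sup>2)"
  then show ?thesis using top by (simp add: power2_eq_square ennreal_mult_top top_unique)
qed

lemma nn_Cauchy_Schwarz:
  fixes f g :: "real \<Rightarrow> ennreal"
  assumes [measurable]: "f \<in> borel_measurable borel" "g \<in> borel_measurable borel"
    and F: "(\<integral>\<^sup>+x. (f x)\<^sup>2 \<partial>lborel) \<le> ennreal (F\<^sup>2)" and G: "(\<integral>\<^sup>+x. (g x)\<^sup>2 \<partial>lborel) \<le> ennreal (G\<^sup>2)"
    and nn: "0 \<le> F" "0 \<le> G"
  shows "(\<integral>\<^sup>+x. f x * g x \<partial>lborel) \<le> ennreal (F * G)"
proof (rule ennreal_power2_le)
  have "(\<integral>\<^sup>+x. f x * g x \<partial>lborel)\<^sup>2 \<le> (\<integral>\<^sup>+x. (f x)\<^sup>2 \<partial>lborel) * (\<integral>\<^sup>+x. (g x)\<^sup>2 \<partial>lborel)"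
    by (rule Cauchy_Schwarz_nn_integral) auto
  also have "\<dots> \<le> ennreal (F\<^sup>2) * ennreal (G\<^sup>2)" by (intro mult_mono F G) auto
  also have "\<dots> = ennreal ((F * G)\<^sup>2)" by (simp add: ennreal_mult power_mult_distrib)
  finally show "(\<integral>\<^sup>+x. f x * g x \<partial>lborel)\<^sup>2 \<le> ennreal ((F * G)\<^sup>2)" .
qed (use nn in simp)

lemma nn_integral_translate:
  fixes f :: "real \<Rightarrow> ennreal"
  assumes [measurable]: "f \<in> borel_measurable borel"
  shows "(\<integral>\<^sup>+x. f (x - a) \<partial>lborel) = (\<integral>\<^sup>+x. f x \<partial>lborel)" "(\<integral>\<^sup>+x. f (a - x) \<partial>lborel) = (\<integral>\<^sup>+x. f x \<partial>lborel)"
  using nn_integral_real_affine[of f 1 "- a"] nn_integral_real_affine[of f "-1" a] by (simp_all add: add.commute)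

context
  fixes f g h :: "real \<Rightarrow> ennreal" and F G H :: real
  assumes [measurable]: "f \<in> borel_measurable borel" "g \<in> borel_measurable borel" "h \<in> borel_measurable borel"
    and nn: "0 \<le> F" "0 \<le> G" "0 \<le> H"
begin

text \<open>Young's inequality in trilinear form, with two factors in L^2 and the third in L^1:
  integrate the L^1 variable last and use the Cauchy-Schwarz inequality inside.
  \<open>trilinear_left\<close> and \<open>trilinear_mid\<close> treat the other positions of the
  L^1 factor.\<close>

lemma trilinear_right:
  assumes "(\<integral>\<^sup>+x. (f x)\<^sup>2 \<partial>lborel) \<le> ennreal (F\<^sup>2)" "(\<integral>\<^sup>+x. (g x)\<^sup>2 \<partial>lborel) \<le> ennreal (G\<^sup>2)"
    "(\<integral>\<^sup>+x. h x \<partial>lborel) \<le> ennreal H"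
  shows "(\<integral>\<^sup>+x. \<integral>\<^sup>+y. f x * g (x - y) * h y \<partial>lborel \<partial>lborel) \<le> ennreal (F * G * H)"
proof -
  have "(\<integral>\<^sup>+x. \<integral>\<^sup>+y. f x * g (x - y) * h y \<partial>lborel \<partial>lborel) = (\<integral>\<^sup>+y. \<integral>\<^sup>+x. f x * g (x - y) * h y \<partial>lborel \<partial>lborel)"
    by (rule lborel_pair.Fubini') measurable
  also have "\<dots> = (\<integral>\<^sup>+y. (\<integral>\<^sup>+x. f x * g (x - y) \<partial>lborel) * h y \<partial>lborel)"
    by (intro nn_integral_cong nn_integral_multc) measurable
  also have "\<dots> \<le> (\<integral>\<^sup>+y. ennreal (F * G) * h y \<partial>lborel)"
    using assms nn nn_integral_translate(1)[of "\<lambda>x. (g x)\<^sup>2"]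
    by (intro nn_integral_mono mult_right_mono nn_Cauchy_Schwarz) auto
  also have "\<dots> = ennreal (F * G) * (\<integral>\<^sup>+y. h y \<partial>lborel)" by (rule nn_integral_cmult) measurable
  also have "\<dots> \<le> ennreal (F * G) * ennreal H" by (intro mult_left_mono assms) auto
  also have "\<dots> = ennreal (F * G * H)" using nn by (simp add: ennreal_mult)
  finally show ?thesis .
qed

lemma trilinear_left:
  assumes "(\<integral>\<^sup>+x. f x \<partial>lborel) \<le> ennreal F" "(\<integral>\<^sup>+x. (g x)\<^sup>2 \<partial>lborel) \<le> ennreal (G\<^sup>2)"
    "(\<integral>\<^sup>+x. (h x)\<^sup>2 \<partial>lborel) \<le> ennreal (H\<^sup>2)"
  shows "(\<integral>\<^sup>+x. \<integral>\<^sup>+y. f x * g (x - y) * h y \<partial>lborel \<partial>lborel) \<le> ennreal (F * G * H)"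
proof -
  have "(\<integral>\<^sup>+x. \<integral>\<^sup>+y. f x * g (x - y) * h y \<partial>lborel \<partial>lborel) = (\<integral>\<^sup>+x. f x * (\<integral>\<^sup>+y. g (x - y) * h y \<partial>lborel) \<partial>lborel)"
    unfolding mult.assoc by (intro nn_integral_cong nn_integral_cmult) measurable
  also have "\<dots> \<le> (\<integral>\<^sup>+x. f x * ennreal (G * H) \<partial>lborel)"
    using assms nn nn_integral_translate(2)[of "\<lambda>x. (g x)\<^sup>2"]
    by (intro nn_integral_mono mult_left_mono nn_Cauchy_Schwarz) auto
  also have "\<dots> = (\<integral>\<^sup>+x. f x \<partial>lborel) * ennreal (G * H)" by (rule nn_integral_multc) measurable
  also have "\<dots> \<le> ennreal F * ennreal (G * H)" by (intro mult_right_mono assms) auto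
  also have "\<dots> = ennreal (F * G * H)" using nn by (simp add: ennreal_mult mult.assoc)
  finally show ?thesis .
qed

end

text \<open>The substitution of \<open>x - y\<close> for \<open>y\<close> exchanges the last two
  factors and reduces this to \<open>trilinear_right\<close>.\<close>

lemma trilinear_mid:
  fixes f g h :: "real \<Rightarrow> ennreal" and F G H :: real
  assumes [measurable]: "f \<in> borel_measurable borel" "g \<in> borel_measurable borel" "h \<in> borel_measurable borel"
    and nn: "0 \<le> F" "0 \<le> G" "0 \<le> H"
    and "(\<integral>\<^sup>+x. (f x)\<^sup>2 \<partial>lborel) \<le> ennreal (F\<^sup>2)" "(\<integral>\<^sup>+x. g x \<partial>lborel) \<le> ennreal G"
    "(\<integral>\<^sup>+x. (h x)\<^sup>2 \<partial>lborel) \<le> ennreal (H\<^sup>2)"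
  shows "(\<integral>\<^sup>+x. \<integral>\<^sup>+y. f x * g (x - y) * h y \<partial>lborel \<partial>lborel) \<le> ennreal (F * G * H)"
proof -
  have "(\<integral>\<^sup>+x. \<integral>\<^sup>+y. f x * g (x - y) * h y \<partial>lborel \<partial>lborel) = (\<integral>\<^sup>+x. \<integral>\<^sup>+y. f x * h (x - y) * g y \<partial>lborel \<partial>lborel)"
  proof (rule nn_integral_cong)
    fix x
    show "(\<integral>\<^sup>+y. f x * g (x - y) * h y \<partial>lborel) = (\<integral>\<^sup>+y. f x * h (x - y) * g y \<partial>lborel)"
      using nn_integral_translate(2)[of "\<lambda>y. f x * g (x - y) * h y" x] by (simp add: mult_ac)
  qed
  also have "\<dots> \<le> ennreal (F * H * G)" using assms by (intro trilinear_right) auto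
  finally show ?thesis by (simp add: mult_ac)
qed

text \<open>Whichever of the three factors carries the weight \<open>\<alpha> \<in> L\<^sup>2\<close> becomes integrable, and
  Young's inequality applies.\<close>

lemma trilinear_weighted:
  fixes f g h \<alpha> :: "real \<Rightarrow> ennreal" and F G H :: real
  assumes m [measurable]: "f \<in> borel_measurable borel" "g \<in> borel_measurable borel" "h \<in> borel_measurable borel" "\<alpha> \<in> borel_measurable borel"
    and nn: "0 \<le> F" "0 \<le> G" "0 \<le> H" "0 \<le> A"
    and f: "(\<integral>\<^sup>+x. (f x)\<^sup>2 \<partial>lborel) \<le> ennreal (F\<^sup>2)" and g: "(\<integral>\<^sup>+x. (g x)\<^sup>2 \<partial>lborel) \<le> ennreal (G\<^sup>2)"
    and h: "(\<integral>\<^sup>+x. (h x)\<^sup>2 \<partial>lborel) \<le> ennreal (H\<^sup>2)" and \<alpha>: "(\<integral>\<^sup>+x. (\<alpha> x)\<^sup>2 \<partial>lborel) \<le> ennreal (A\<^sup>2)"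
  shows "(\<integral>\<^sup>+x. \<integral>\<^sup>+y. \<alpha> x * (f x * g (x - y) * h y) \<partial>lborel \<partial>lborel) \<le> ennreal (A * F * G * H)"
    and "(\<integral>\<^sup>+x. \<integral>\<^sup>+y. \<alpha> (x - y) * (f x * g (x - y) * h y) \<partial>lborel \<partial>lborel) \<le> ennreal (A * F * G * H)"
    and "(\<integral>\<^sup>+x. \<integral>\<^sup>+y. \<alpha> y * (f x * g (x - y) * h y) \<partial>lborel \<partial>lborel) \<le> ennreal (A * F * G * H)"
proof -
  have "(\<integral>\<^sup>+x. \<integral>\<^sup>+y. (\<alpha> x * f x) * g (x - y) * h y \<partial>lborel \<partial>lborel) \<le> ennreal ((A * F) * G * H)"
    by (intro trilinear_left nn_Cauchy_Schwarz mult_nonneg_nonneg nn f g h \<alpha>) measurable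
  then show "(\<integral>\<^sup>+x. \<integral>\<^sup>+y. \<alpha> x * (f x * g (x - y) * h y) \<partial>lborel \<partial>lborel) \<le> ennreal (A * F * G * H)"
    by (simp add: mult_ac)
  have "(\<integral>\<^sup>+x. \<integral>\<^sup>+y. f x * (\<alpha> (x - y) * g (x - y)) * h y \<partial>lborel \<partial>lborel) \<le> ennreal (F * (A * G) * H)"
    by (intro trilinear_mid[where g = "\<lambda>x. \<alpha> x * g x"] nn_Cauchy_Schwarz mult_nonneg_nonneg nn f g h \<alpha>) measurable
  then show "(\<integral>\<^sup>+x. \<integral>\<^sup>+y. \<alpha> (x - y) * (f x * g (x - y) * h y) \<partial>lborel \<partial>lborel) \<le> ennreal (A * F * G * H)"
    by (simp add: mult_ac)
  have "(\<integral>\<^sup>+x. \<integral>\<^sup>+y. f x * g (x - y) * (\<alpha> y * h y) \<partial>lborel \<partial>lborel) \<le> ennreal (F * G * (A * H))"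
    by (intro trilinear_right nn_Cauchy_Schwarz mult_nonneg_nonneg nn f g h \<alpha>) measurable
  then show "(\<integral>\<^sup>+x. \<integral>\<^sup>+y. \<alpha> y * (f x * g (x - y) * h y) \<partial>lborel \<partial>lborel) \<le> ennreal (A * F * G * H)"
    by (simp add: mult_ac)
qed

text \<open>The converse of the Cauchy-Schwarz inequality: test \<open>g\<close> against a
  truncation of itself, cancel one power of the norm and remove the truncation by Fatou's
  lemma.\<close>

lemma nn_L2_dual:
  fixes g :: "real \<Rightarrow> ennreal"
  assumes g [measurable]: "g \<in> borel_measurable borel" and B: "0 \<le> B"
    and dual: "\<And>f F. f \<in> borel_measurable borel \<Longrightarrow> 0 \<le> F \<Longrightarrow> (\<integral>\<^sup>+x. (f x)\<^sup>2 \<partial>lborel) \<le> ennreal (F\<^sup>2) \<Longrightarrow>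
       (\<integral>\<^sup>+x. f x * g x \<partial>lborel) \<le> ennreal (B * F)"
  shows "(\<integral>\<^sup>+x. (g x)\<^sup>2 \<partial>lborel) \<le> ennreal (B\<^sup>2)"
proof -
  \<comment> \<open>Truncated in height and in space, so that the integral of the square is known to
    be finite and its root can be cancelled.\<close>
  define f where "f n x = (if \<bar>x\<bar> \<le> real n then min (g x) (ennreal (real n)) else 0)" for n :: nat and x
  have [measurable]: "f n \<in> borel_measurable borel" for n unfolding f_def by measurable
  have fn: "(\<integral>\<^sup>+x. (f n x)\<^sup>2 \<partial>lborel) \<le> ennreal (B\<^sup>2)" for n
  proof -
    have "(\<integral>\<^sup>+x. (f n x)\<^sup>2 \<partial>lborel) \<le> (\<integral>\<^sup>+x. ennreal ((real n)\<^sup>2) * indicator {- real n .. real n} x \<partial>lborel)"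
    proof (rule nn_integral_mono)
      fix x
      have "(min (g x) (ennreal (real n)))\<^sup>2 \<le> (ennreal (real n))\<^sup>2" by (intro power_mono) auto
      then show "(f n x)\<^sup>2 \<le> ennreal ((real n)\<^sup>2) * indicator {- real n .. real n} x"
        by (auto simp: f_def ennreal_power indicator_def abs_le_iff)
    qed
    also have "\<dots> = ennreal ((real n)\<^sup>2) * ennreal (2 * real n)" by (simp add: nn_integral_cmult)
    also have "\<dots> < top" by (simp add: ennreal_mult_less_top)
    finally obtain r where r: "(\<integral>\<^sup>+x. (f n x)\<^sup>2 \<partial>lborel) = ennreal r" "0 \<le> r"
      by (cases "\<integral>\<^sup>+x. (f n x)\<^sup>2 \<partial>lborel") auto
    have "ennreal r = (\<integral>\<^sup>+x. f n x * f n x \<partial>lborel)" by (simp add: r(1)[symmetric] power2_eq_square)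
    also have "\<dots> \<le> (\<integral>\<^sup>+x. f n x * g x \<partial>lborel)"
      by (intro nn_integral_mono mult_left_mono) (auto simp: f_def)
    also have "\<dots> \<le> ennreal (B * sqrt r)" using r by (intro dual) auto
    finally have "r \<le> B * sqrt r" using B r by (simp add: ennreal_le_iff)
    then have "sqrt r * sqrt r \<le> B * sqrt r" using r by simp
    then have "sqrt r \<le> B" using B r mult_right_le_imp_le[of "sqrt r" "sqrt r" B] by (cases "r = 0") simp_all
    then have "(sqrt r)\<^sup>2 \<le> B\<^sup>2" using r by (intro power_mono) auto
    then show ?thesis using r by (simp add: ennreal_leI)
  qed
  have lim: "(\<lambda>n. (f n x)\<^sup>2) \<longlonglongrightarrow> (g x)\<^sup>2" for x
  proof -
    have "(\<lambda>n. f n x) \<longlonglongrightarrow> g x"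
    proof (rule Lim_transform_eventually)
      have "(\<lambda>n. min (g x) (ennreal (real n))) \<longlonglongrightarrow> min (g x) top"
        by (intro tendsto_min tendsto_const ennreal_tendsto_top_eq_at_top[THEN iffD2] filterlim_real_sequentially)
      then show "(\<lambda>n. min (g x) (ennreal (real n))) \<longlonglongrightarrow> g x" by simp
      obtain m :: nat where m: "\<bar>x\<bar> \<le> real m" using real_arch_simple by blast
      show "\<forall>\<^sub>F n in sequentially. min (g x) (ennreal (real n)) = f n x"
        using eventually_ge_at_top[of m] by eventually_elim (use m in \<open>simp add: f_def\<close>)
    qed
    moreover have "f n x = 0" if "g x = 0" for n
      using that by (simp add: f_def min_absorb1)
    ultimately show ?thesis unfolding power2_eq_square
      by (cases "g x = 0") (simp_all add: tendsto_mult_ennreal)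
  qed
  have "(\<integral>\<^sup>+x. (g x)\<^sup>2 \<partial>lborel) = (\<integral>\<^sup>+x. liminf (\<lambda>n. (f n x)\<^sup>2) \<partial>lborel)"
    using lim by (intro nn_integral_cong lim_imp_Liminf[symmetric]) auto
  also have "\<dots> \<le> liminf (\<lambda>n. \<integral>\<^sup>+x. (f n x)\<^sup>2 \<partial>lborel)"
    by (rule nn_integral_liminf) measurable
  also have "\<dots> \<le> liminf (\<lambda>n. ennreal (B\<^sup>2))" by (intro Liminf_mono always_eventually allI fn)
  also have "\<dots> = ennreal (B\<^sup>2)" by (simp add: Liminf_const)
  finally show ?thesis .
qed

section \<open>Bilinear Fourier integral operators\<close>

lemma AE_lborel_translate: "AE x in lborel. P (x::real) \<Longrightarrow> AE y in lborel. P (a - y)"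
proof -
  assume "AE x in lborel. P x"
  moreover have "distr lborel borel (\<lambda>y. a + (-1) * y) = lborel"
    by (subst (2) lborel_real_affine[of "-1" a]) (simp_all add: density_1 flip: one_ennreal_def)
  ultimately have "AE x in distr lborel borel (\<lambda>y. a + (-1) * y). P x" by (simp only:)
  then show ?thesis using AE_distrD[of "\<lambda>y. a + (-1) * y" lborel borel P] by simp
qed

text \<open>For the b-family \<open>\<alpha> \<xi>\<close> is
  \<open>japanese \<xi> powr (1 - s)\<close>: the weight left when one derivative falls on a
  function in H^s, whose own weight is \<open>japanese \<xi> powr (- s)\<close>. Its square is
  integrable since s > 3/2.\<close>

locale l2_weight =
  fixes \<alpha> :: "real \<Rightarrow> real"
  assumes \<alpha>_measurable [measurable]: "\<alpha> \<in> borel_measurable borel"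
    and \<alpha>_nonneg: "0 \<le> \<alpha> \<xi>" and \<alpha>_le_1: "\<alpha> \<xi> \<le> 1"
    and \<alpha>_square: "integrable lborel (\<lambda>\<xi>. (\<alpha> \<xi>)\<^sup>2)"
begin

definition A :: real where "A = sqrt (LINT \<xi>|lborel. (\<alpha> \<xi>)\<^sup>2)"

lemma A_nonneg: "0 \<le> A" by (simp add: A_def)

lemma nn_\<alpha>: "(\<integral>\<^sup>+\<xi>. (ennreal (\<alpha> \<xi>))\<^sup>2 \<partial>lborel) \<le> ennreal (A\<^sup>2)"
  using nn_integral_eq_integral[OF \<alpha>_square] by (simp add: A_def ennreal_power \<alpha>_nonneg)

text \<open>Oddness under joint reflection matches the factor \<open>\<i>\<close> in
  \<open>conv\<close>: together they give Hermitian output from Hermitian input. The bound puts a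
  square-integrable weight on one of the three frequencies of the trilinear form, which is what
  \<open>trilinear_weighted\<close> takes.\<close>

definition kernel :: "(real \<Rightarrow> real \<Rightarrow> real) \<Rightarrow> bool" where
  "kernel \<kappa> \<longleftrightarrow> (\<lambda>(\<xi>, \<eta>). \<kappa> \<xi> \<eta>) \<in> borel_measurable (borel \<Otimes>\<^sub>M borel) \<and> (\<forall>\<xi> \<eta>. \<kappa> (- \<xi>) (- \<eta>) = - \<kappa> \<xi> \<eta>) \<and>
     (\<exists>C\<ge>0. \<forall>\<xi> \<eta>. \<bar>\<kappa> \<xi> \<eta>\<bar> \<le> C * (\<alpha> \<xi> + \<alpha> (\<xi> - \<eta>) + \<alpha> \<eta>))"

definition conv :: "(real \<Rightarrow> real \<Rightarrow> real) \<Rightarrow> (real \<Rightarrow> complex) \<Rightarrow> (real \<Rightarrow> complex) \<Rightarrow> real \<Rightarrow> complex" where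
  "conv \<kappa> f g \<xi> = \<i> * (LINT \<eta>|lborel. complex_of_real (\<kappa> \<xi> \<eta>) * f (\<xi> - \<eta>) * g \<eta>)"

definition bil :: "(real \<Rightarrow> real \<Rightarrow> real) \<Rightarrow> l2h \<Rightarrow> l2h \<Rightarrow> l2h" where
  "bil \<kappa> x y = of_hat (conv \<kappa> (hat x) (hat y))"

lemma kernel_measurable:
  assumes "kernel \<kappa>" and [measurable]: "f \<in> borel_measurable M" "g \<in> borel_measurable M"
  shows "(\<lambda>x. \<kappa> (f x) (g x)) \<in> borel_measurable M"
proof -
  have k: "(\<lambda>(\<xi>, \<eta>). \<kappa> \<xi> \<eta>) \<in> borel_measurable (borel \<Otimes>\<^sub>M borel)" using assms by (simp add: kernel_def)
  have "(\<lambda>x. (f x, g x)) \<in> measurable M (borel \<Otimes>\<^sub>M borel)" by measurable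
  from measurable_compose[OF this k] show ?thesis by simp
qed

lemma nn_hat: "(\<integral>\<^sup>+\<xi>. (ennreal (cmod (hat x \<xi>)))\<^sup>2 \<partial>lborel) \<le> ennreal ((norm x)\<^sup>2)"
  by (simp add: ennreal_power nn_integral_hat)

lemma conv_integrable:
  assumes \<kappa>: "kernel \<kappa>"
  shows "integrable lborel (\<lambda>\<eta>. complex_of_real (\<kappa> \<xi> \<eta>) * hat x (\<xi> - \<eta>) * hat y \<eta>)"
proof -
  note [measurable] = kernel_measurable[OF \<kappa>]
  obtain C where C: "C \<ge> 0" "\<And>\<xi> \<eta>. \<bar>\<kappa> \<xi> \<eta>\<bar> \<le> C * (\<alpha> \<xi> + \<alpha> (\<xi> - \<eta>) + \<alpha> \<eta>)" using \<kappa> unfolding kernel_def by blast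
  have le: "cmod (complex_of_real (\<kappa> \<xi> \<eta>) * hat x (\<xi> - \<eta>) * hat y \<eta>) \<le> (3 * C) * ((cmod (hat x (\<xi> - \<eta>)))\<^sup>2 + (cmod (hat y \<eta>))\<^sup>2)" for \<eta>
  proof -
    have "C * (\<alpha> \<xi> + \<alpha> (\<xi> - \<eta>) + \<alpha> \<eta>) \<le> C * 3"
      using C(1) \<alpha>_le_1[of \<xi>] \<alpha>_le_1[of "\<xi> - \<eta>"] \<alpha>_le_1[of \<eta>] by (intro mult_left_mono) auto
    then have k: "\<bar>\<kappa> \<xi> \<eta>\<bar> \<le> 3 * C" using C(2)[of \<xi> \<eta>] by linarith
    have "2 * (cmod (hat x (\<xi> - \<eta>)) * cmod (hat y \<eta>)) \<le> (cmod (hat x (\<xi> - \<eta>)))\<^sup>2 + (cmod (hat y \<eta>))\<^sup>2"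
      using sum_squares_bound[of "cmod (hat x (\<xi> - \<eta>))" "cmod (hat y \<eta>)"] by simp
    moreover have "0 \<le> cmod (hat x (\<xi> - \<eta>)) * cmod (hat y \<eta>)" by simp
    ultimately have "cmod (hat x (\<xi> - \<eta>)) * cmod (hat y \<eta>) \<le> (cmod (hat x (\<xi> - \<eta>)))\<^sup>2 + (cmod (hat y \<eta>))\<^sup>2" by linarith
    then show ?thesis
      unfolding norm_mult norm_of_real mult.assoc[of "\<bar>\<kappa> \<xi> \<eta>\<bar>"] using k C(1) by (intro mult_mono) auto
  qed
  show ?thesis
  proof (rule Bochner_Integration.integrable_bound)
    show "integrable lborel (\<lambda>\<eta>. (3 * C) * ((cmod (hat x (\<xi> - \<eta>)))\<^sup>2 + (cmod (hat y \<eta>))\<^sup>2))"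
      using lborel_integrable_real_affine[OF hat_square_integrable[of x], of "-1" \<xi>]
      by (intro integrable_mult_right Bochner_Integration.integrable_add hat_square_integrable) simp
    show "AE \<eta> in lborel. norm (complex_of_real (\<kappa> \<xi> \<eta>) * hat x (\<xi> - \<eta>) * hat y \<eta>) \<le> norm ((3 * C) * ((cmod (hat x (\<xi> - \<eta>)))\<^sup>2 + (cmod (hat y \<eta>))\<^sup>2))"
      using order_trans[OF le abs_ge_self] by (intro AE_I2) simp
  qed measurable
qed

lemma conv_measurable:
  assumes "kernel \<kappa>" and [measurable]: "f \<in> borel_measurable borel" "g \<in> borel_measurable borel"
  shows "conv \<kappa> f g \<in> borel_measurable borel"
proof -
  note [measurable] = kernel_measurable[OF assms(1)]
  show ?thesis unfolding conv_def by measurable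
qed

lemma conv_cong_AE:
  assumes "AE \<eta> in lborel. f \<eta> = f' \<eta>" "AE \<eta> in lborel. g \<eta> = g' \<eta>" and "kernel \<kappa>"
    and [measurable]: "f \<in> borel_measurable borel" "g \<in> borel_measurable borel" "f' \<in> borel_measurable borel" "g' \<in> borel_measurable borel"
  shows "conv \<kappa> f g \<xi> = conv \<kappa> f' g' \<xi>"
proof -
  note [measurable] = kernel_measurable[OF assms(3)]
  have "(LINT \<eta>|lborel. complex_of_real (\<kappa> \<xi> \<eta>) * f (\<xi> - \<eta>) * g \<eta>) = (LINT \<eta>|lborel. complex_of_real (\<kappa> \<xi> \<eta>) * f' (\<xi> - \<eta>) * g' \<eta>)"
  proof (rule integral_cong_AE)
    show "AE \<eta> in lborel. complex_of_real (\<kappa> \<xi> \<eta>) * f (\<xi> - \<eta>) * g \<eta> = complex_of_real (\<kappa> \<xi> \<eta>) * f' (\<xi> - \<eta>) * g' \<eta>"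
      using AE_lborel_translate[OF assms(1), of \<xi>] assms(2) by eventually_elim simp
  qed measurable
  then show ?thesis by (simp add: conv_def)
qed

section \<open>Bounded bilinear operators and bounds for quadratic forms\<close>

definition trilin :: "(real \<Rightarrow> real \<Rightarrow> real) \<Rightarrow> (real \<Rightarrow> ennreal) \<Rightarrow> (real \<Rightarrow> ennreal) \<Rightarrow> (real \<Rightarrow> ennreal) \<Rightarrow> ennreal" where
  "trilin \<kappa> f g h = (\<integral>\<^sup>+\<xi>. \<integral>\<^sup>+\<eta>. ennreal \<bar>\<kappa> \<xi> \<eta>\<bar> * (f \<xi> * g (\<xi> - \<eta>) * h \<eta>) \<partial>lborel \<partial>lborel)"

lemma trilin_le:
  fixes f g h :: "real \<Rightarrow> ennreal"
  assumes [measurable]: "f \<in> borel_measurable borel" "g \<in> borel_measurable borel" "h \<in> borel_measurable borel"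
    and nn: "0 \<le> F" "0 \<le> G" "0 \<le> H" "0 \<le> C"
    and f: "(\<integral>\<^sup>+x. (f x)\<^sup>2 \<partial>lborel) \<le> ennreal (F\<^sup>2)" and g: "(\<integral>\<^sup>+x. (g x)\<^sup>2 \<partial>lborel) \<le> ennreal (G\<^sup>2)"
    and h: "(\<integral>\<^sup>+x. (h x)\<^sup>2 \<partial>lborel) \<le> ennreal (H\<^sup>2)"
    and \<kappa>: "\<And>\<xi> \<eta>. \<bar>\<kappa> \<xi> \<eta>\<bar> \<le> C * (\<alpha> \<xi> + \<alpha> (\<xi> - \<eta>) + \<alpha> \<eta>)"
  shows "trilin \<kappa> f g h \<le> ennreal (3 * C * A * F * G * H)"
proof -
  let ?p = "\<lambda>\<xi> \<eta>. f \<xi> * g (\<xi> - \<eta>) * h \<eta>"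
  let ?a = "\<lambda>\<xi>. ennreal (\<alpha> \<xi>)"
  have "trilin \<kappa> f g h \<le> (\<integral>\<^sup>+\<xi>. \<integral>\<^sup>+\<eta>. ennreal C * (?a \<xi> * ?p \<xi> \<eta> + ?a (\<xi> - \<eta>) * ?p \<xi> \<eta> + ?a \<eta> * ?p \<xi> \<eta>) \<partial>lborel \<partial>lborel)"
    unfolding trilin_def
  proof (intro nn_integral_mono)
    fix \<xi> \<eta>
    have "ennreal \<bar>\<kappa> \<xi> \<eta>\<bar> \<le> ennreal (C * (\<alpha> \<xi> + \<alpha> (\<xi> - \<eta>) + \<alpha> \<eta>))" by (rule ennreal_leI[OF \<kappa>])
    also have "\<dots> = ennreal C * (?a \<xi> + ?a (\<xi> - \<eta>) + ?a \<eta>)"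
      using nn \<alpha>_nonneg by (simp add: ennreal_mult ennreal_plus add_nonneg_nonneg)
    finally have "ennreal \<bar>\<kappa> \<xi> \<eta>\<bar> * ?p \<xi> \<eta> \<le> ennreal C * (?a \<xi> + ?a (\<xi> - \<eta>) + ?a \<eta>) * ?p \<xi> \<eta>" by (rule mult_right_mono) simp
    also have "\<dots> = ennreal C * (?a \<xi> * ?p \<xi> \<eta> + ?a (\<xi> - \<eta>) * ?p \<xi> \<eta> + ?a \<eta> * ?p \<xi> \<eta>)"
      by (simp only: mult.assoc distrib_right)
    finally show "ennreal \<bar>\<kappa> \<xi> \<eta>\<bar> * ?p \<xi> \<eta> \<le> ennreal C * (?a \<xi> * ?p \<xi> \<eta> + ?a (\<xi> - \<eta>) * ?p \<xi> \<eta> + ?a \<eta> * ?p \<xi> \<eta>)" .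
  qed
  also have "\<dots> = ennreal C * ((\<integral>\<^sup>+\<xi>. \<integral>\<^sup>+\<eta>. ?a \<xi> * ?p \<xi> \<eta> \<partial>lborel \<partial>lborel)
      + (\<integral>\<^sup>+\<xi>. \<integral>\<^sup>+\<eta>. ?a (\<xi> - \<eta>) * ?p \<xi> \<eta> \<partial>lborel \<partial>lborel) + (\<integral>\<^sup>+\<xi>. \<integral>\<^sup>+\<eta>. ?a \<eta> * ?p \<xi> \<eta> \<partial>lborel \<partial>lborel))"
    by (simp add: nn_integral_cmult nn_integral_add)
  also have "\<dots> \<le> ennreal C * (ennreal (A * F * G * H) + ennreal (A * F * G * H) + ennreal (A * F * G * H))"
    using trilinear_weighted[of f g h ?a F G H A] nn A_nonneg f g h nn_\<alpha>
    by (intro mult_left_mono add_mono) auto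
  also have "\<dots> = ennreal (3 * C * A * F * G * H)"
    using nn A_nonneg by (simp add: ennreal_mult[symmetric] ennreal_plus[symmetric] del: ennreal_plus)
  finally show ?thesis .
qed

lemma conv_le_nn: "ennreal (cmod (conv \<kappa> f g \<xi>)) \<le> (\<integral>\<^sup>+\<eta>. ennreal \<bar>\<kappa> \<xi> \<eta>\<bar> * (ennreal (cmod (f (\<xi> - \<eta>))) * ennreal (cmod (g \<eta>))) \<partial>lborel)"
proof -
  let ?h = "\<lambda>\<eta>. complex_of_real (\<kappa> \<xi> \<eta>) * f (\<xi> - \<eta>) * g \<eta>"
  have "ennreal (cmod (LINT \<eta>|lborel. ?h \<eta>)) \<le> (\<integral>\<^sup>+\<eta>. ennreal (norm (?h \<eta>)) \<partial>lborel)"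
    by (cases "integrable lborel ?h") (simp_all add: integral_norm_bound_ennreal not_integrable_integral_eq)
  then have "ennreal (cmod (conv \<kappa> f g \<xi>)) \<le> (\<integral>\<^sup>+\<eta>. ennreal (norm (?h \<eta>)) \<partial>lborel)"
    unfolding conv_def norm_mult[of \<i>] norm_ii mult_1 .
  then show ?thesis by (simp add: norm_mult ennreal_mult mult.assoc)
qed

text \<open>The square norm is bounded by duality: after taking absolute values, pairing with an
  arbitrary L^2 function gives a trilinear integral, to which \<open>trilin_le\<close> applies.
  Nonnegative integrals are used so that nothing has to be known to be finite in advance.\<close>

lemma conv_herm_l2:
  assumes \<kappa>: "kernel \<kappa>"
  shows "herm_l2 (conv \<kappa> (hat x) (hat y))"
    and "\<And>C. 0 \<le> C \<Longrightarrow> (\<And>\<xi> \<eta>. \<bar>\<kappa> \<xi> \<eta>\<bar> \<le> C * (\<alpha> \<xi> + \<alpha> (\<xi> - \<eta>) + \<alpha> \<eta>)) \<Longrightarrow> norm (bil \<kappa> x y) \<le> 3 * C * A * norm x * norm y"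
proof -
  note [measurable] = kernel_measurable[OF \<kappa>]
  have m [measurable]: "conv \<kappa> (hat x) (hat y) \<in> borel_measurable borel" by (rule conv_measurable[OF \<kappa>]) measurable
  have main: "(\<integral>\<^sup>+\<xi>. ennreal ((cmod (conv \<kappa> (hat x) (hat y) \<xi>))\<^sup>2) \<partial>lborel) \<le> ennreal ((3 * C * A * norm x * norm y)\<^sup>2)"
    if C: "0 \<le> C" "\<And>\<xi> \<eta>. \<bar>\<kappa> \<xi> \<eta>\<bar> \<le> C * (\<alpha> \<xi> + \<alpha> (\<xi> - \<eta>) + \<alpha> \<eta>)" for C
  proof -
    let ?g = "\<lambda>\<xi>. \<integral>\<^sup>+\<eta>. ennreal \<bar>\<kappa> \<xi> \<eta>\<bar> * (ennreal (cmod (hat x (\<xi> - \<eta>))) * ennreal (cmod (hat y \<eta>))) \<partial>lborel"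
    have "(\<integral>\<^sup>+\<xi>. ennreal ((cmod (conv \<kappa> (hat x) (hat y) \<xi>))\<^sup>2) \<partial>lborel) \<le> (\<integral>\<^sup>+\<xi>. (?g \<xi>)\<^sup>2 \<partial>lborel)"
      using conv_le_nn[of \<kappa> "hat x" "hat y"] by (intro nn_integral_mono) (simp add: ennreal_power[symmetric] power_mono)
    also have "\<dots> \<le> ennreal ((3 * C * A * norm x * norm y)\<^sup>2)"
    proof (rule nn_L2_dual)
      show "?g \<in> borel_measurable borel" by measurable
      show "0 \<le> 3 * C * A * norm x * norm y" using C A_nonneg by simp
      fix f :: "real \<Rightarrow> ennreal" and F assume [measurable]: "f \<in> borel_measurable borel" and F: "0 \<le> F" "(\<integral>\<^sup>+x. (f x)\<^sup>2 \<partial>lborel) \<le> ennreal (F\<^sup>2)"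
      have "(\<integral>\<^sup>+\<xi>. f \<xi> * ?g \<xi> \<partial>lborel) = trilin \<kappa> f (\<lambda>\<xi>. ennreal (cmod (hat x \<xi>))) (\<lambda>\<xi>. ennreal (cmod (hat y \<xi>)))"
        unfolding trilin_def by (subst nn_integral_cmult[symmetric]) (auto simp: mult_ac)
      also have "\<dots> \<le> ennreal (3 * C * A * F * norm x * norm y)"
        by (rule trilin_le[OF _ _ _ F(1) _ _ C(1) F(2) nn_hat nn_hat C(2)]) auto
      also have "3 * C * A * F * norm x * norm y = 3 * C * A * norm x * norm y * F" by simp
      finally show "(\<integral>\<^sup>+\<xi>. f \<xi> * ?g \<xi> \<partial>lborel) \<le> ennreal (3 * C * A * norm x * norm y * F)" .
    qed
    finally show ?thesis .
  qed
  obtain C where C: "0 \<le> C" "\<And>\<xi> \<eta>. \<bar>\<kappa> \<xi> \<eta>\<bar> \<le> C * (\<alpha> \<xi> + \<alpha> (\<xi> - \<eta>) + \<alpha> \<eta>)" using \<kappa> unfolding kernel_def by blast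
  have "integrable lborel (\<lambda>\<xi>. (cmod (conv \<kappa> (hat x) (hat y) \<xi>))\<^sup>2)"
  proof (rule integrableI_bounded)
    show "(\<integral>\<^sup>+\<xi>. ennreal (norm ((cmod (conv \<kappa> (hat x) (hat y) \<xi>))\<^sup>2)) \<partial>lborel) < \<infinity>"
      using main[OF C] by (simp add: order_le_less_trans)
  qed measurable
  moreover have "conv \<kappa> (hat x) (hat y) (- \<xi>) = cnj (conv \<kappa> (hat x) (hat y) \<xi>)" for \<xi>
  proof -
    let ?I = "\<lambda>\<xi> \<eta>. complex_of_real (\<kappa> \<xi> \<eta>) * hat x (\<xi> - \<eta>) * hat y \<eta>"
    have "(LINT \<eta>|lborel. ?I (- \<xi>) \<eta>) = (LINT \<eta>|lborel. ?I (- \<xi>) (- \<eta>))"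
      using lborel_integral_real_affine[of "-1" "?I (- \<xi>)" 0] by simp
    also have "\<dots> = (LINT \<eta>|lborel. - cnj (?I \<xi> \<eta>))"
    proof (rule Bochner_Integration.integral_cong)
      fix \<eta>
      have "hat x (- \<xi> - - \<eta>) = cnj (hat x (\<xi> - \<eta>))" using hat_minus[of x "\<xi> - \<eta>"] by simp
      moreover have "\<kappa> (- \<xi>) (- \<eta>) = - \<kappa> \<xi> \<eta>" using \<kappa> by (simp add: kernel_def)
      ultimately show "?I (- \<xi>) (- \<eta>) = - cnj (?I \<xi> \<eta>)" by (simp add: hat_minus)
    qed simp
    also have "\<dots> = - cnj (LINT \<eta>|lborel. ?I \<xi> \<eta>)"
      by (simp only: Bochner_Integration.integral_minus Bochner_Integration.integral_cnj)
    finally show ?thesis by (simp add: conv_def)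
  qed
  ultimately show h: "herm_l2 (conv \<kappa> (hat x) (hat y))" by (simp add: herm_l2_def)
  show "norm (bil \<kappa> x y) \<le> 3 * C * A * norm x * norm y"
    if C: "0 \<le> C" "\<And>\<xi> \<eta>. \<bar>\<kappa> \<xi> \<eta>\<bar> \<le> C * (\<alpha> \<xi> + \<alpha> (\<xi> - \<eta>) + \<alpha> \<eta>)" for C
  proof -
    have "ennreal ((norm (bil \<kappa> x y))\<^sup>2) = (\<integral>\<^sup>+\<xi>. ennreal ((cmod (conv \<kappa> (hat x) (hat y) \<xi>))\<^sup>2) \<partial>lborel)"
      unfolding nn_integral_hat[symmetric] bil_def using hat_of_hat[OF h] by (intro nn_integral_cong_AE) auto
    also have "\<dots> \<le> ennreal ((3 * C * A * norm x * norm y)\<^sup>2)" by (rule main[OF C])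
    finally have "(norm (bil \<kappa> x y))\<^sup>2 \<le> (3 * C * A * norm x * norm y)\<^sup>2" by (simp add: ennreal_le_iff)
    then show ?thesis by (rule power2_le_imp_le) (use C A_nonneg in simp)
  qed
qed

lemma hat_bil: "kernel \<kappa> \<Longrightarrow> AE \<xi> in lborel. hat (bil \<kappa> x y) \<xi> = conv \<kappa> (hat x) (hat y) \<xi>"
  unfolding bil_def by (rule hat_of_hat[OF conv_herm_l2(1)])

lemma bounded_bilinear_bil:
  assumes \<kappa>: "kernel \<kappa>"
  shows "bounded_bilinear (bil \<kappa>)"
proof
  have eq: "x = y" if "\<And>\<xi>. f \<xi> = g \<xi>" "AE \<xi> in lborel. hat x \<xi> = f \<xi>" "AE \<xi> in lborel. hat y \<xi> = g \<xi>" for x y f g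
    by (rule l2h_eqI) (use that in \<open>auto elim!: eventually_elim2\<close>)
  fix x x' y y' :: l2h and r :: real
  have add: "conv \<kappa> (hat (x + x')) (hat y) \<xi> = conv \<kappa> (hat x) (hat y) \<xi> + conv \<kappa> (hat x') (hat y) \<xi>" for \<xi>
  proof -
    have "conv \<kappa> (hat (x + x')) (hat y) \<xi> = conv \<kappa> (\<lambda>\<xi>. hat x \<xi> + hat x' \<xi>) (hat y) \<xi>"
      by (rule conv_cong_AE[OF hat_add _ \<kappa>]) auto
    then show ?thesis unfolding conv_def distrib_left distrib_right
      using Bochner_Integration.integral_add[OF conv_integrable[OF \<kappa>, of \<xi> x y] conv_integrable[OF \<kappa>, of \<xi> x' y]]
      by (simp add: distrib_left)
  qed
  show "bil \<kappa> (x + x') y = bil \<kappa> x y + bil \<kappa> x' y"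
  proof (rule eq[OF add hat_bil[OF \<kappa>]])
    show "AE \<xi> in lborel. hat (bil \<kappa> x y + bil \<kappa> x' y) \<xi> = conv \<kappa> (hat x) (hat y) \<xi> + conv \<kappa> (hat x') (hat y) \<xi>"
      using hat_add[of "bil \<kappa> x y" "bil \<kappa> x' y"] hat_bil[OF \<kappa>, of x y] hat_bil[OF \<kappa>, of x' y] by eventually_elim simp
  qed
  have add: "conv \<kappa> (hat x) (hat (y + y')) \<xi> = conv \<kappa> (hat x) (hat y) \<xi> + conv \<kappa> (hat x) (hat y') \<xi>" for \<xi>
  proof -
    have "conv \<kappa> (hat x) (hat (y + y')) \<xi> = conv \<kappa> (hat x) (\<lambda>\<xi>. hat y \<xi> + hat y' \<xi>) \<xi>"
      by (rule conv_cong_AE[OF _ hat_add \<kappa>]) auto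
    then show ?thesis unfolding conv_def distrib_left distrib_right
      using Bochner_Integration.integral_add[OF conv_integrable[OF \<kappa>, of \<xi> x y] conv_integrable[OF \<kappa>, of \<xi> x y']]
      by (simp add: distrib_left)
  qed
  show "bil \<kappa> x (y + y') = bil \<kappa> x y + bil \<kappa> x y'"
  proof (rule eq[OF add hat_bil[OF \<kappa>]])
    show "AE \<xi> in lborel. hat (bil \<kappa> x y + bil \<kappa> x y') \<xi> = conv \<kappa> (hat x) (hat y) \<xi> + conv \<kappa> (hat x) (hat y') \<xi>"
      using hat_add[of "bil \<kappa> x y" "bil \<kappa> x y'"] hat_bil[OF \<kappa>, of x y] hat_bil[OF \<kappa>, of x y'] by eventually_elim simp
  qed
  have sc: "conv \<kappa> (hat (r *\<^sub>R x)) (hat y) \<xi> = complex_of_real r * conv \<kappa> (hat x) (hat y) \<xi>" for \<xi>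
  proof -
    have "conv \<kappa> (hat (r *\<^sub>R x)) (hat y) \<xi> = conv \<kappa> (\<lambda>\<xi>. complex_of_real r * hat x \<xi>) (hat y) \<xi>"
      by (rule conv_cong_AE[OF hat_scaleR _ \<kappa>]) auto
    also have "\<dots> = \<i> * (LINT \<eta>|lborel. complex_of_real r * (complex_of_real (\<kappa> \<xi> \<eta>) * hat x (\<xi> - \<eta>) * hat y \<eta>))"
      unfolding conv_def by (simp only: mult_ac)
    finally show ?thesis by (simp add: conv_def)
  qed
  show "bil \<kappa> (r *\<^sub>R x) y = r *\<^sub>R bil \<kappa> x y"
  proof (rule eq[OF sc hat_bil[OF \<kappa>]])
    show "AE \<xi> in lborel. hat (r *\<^sub>R bil \<kappa> x y) \<xi> = complex_of_real r * conv \<kappa> (hat x) (hat y) \<xi>"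
      using hat_scaleR[of r "bil \<kappa> x y"] hat_bil[OF \<kappa>, of x y] by eventually_elim simp
  qed
  have sc: "conv \<kappa> (hat x) (hat (r *\<^sub>R y)) \<xi> = complex_of_real r * conv \<kappa> (hat x) (hat y) \<xi>" for \<xi>
  proof -
    have "conv \<kappa> (hat x) (hat (r *\<^sub>R y)) \<xi> = conv \<kappa> (hat x) (\<lambda>\<xi>. complex_of_real r * hat y \<xi>) \<xi>"
      by (rule conv_cong_AE[OF _ hat_scaleR \<kappa>]) auto
    also have "\<dots> = \<i> * (LINT \<eta>|lborel. complex_of_real r * (complex_of_real (\<kappa> \<xi> \<eta>) * hat x (\<xi> - \<eta>) * hat y \<eta>))"
      unfolding conv_def by (simp only: mult_ac)
    finally show ?thesis by (simp add: conv_def)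
  qed
  show "bil \<kappa> x (r *\<^sub>R y) = r *\<^sub>R bil \<kappa> x y"
  proof (rule eq[OF sc hat_bil[OF \<kappa>]])
    show "AE \<xi> in lborel. hat (r *\<^sub>R bil \<kappa> x y) \<xi> = complex_of_real r * conv \<kappa> (hat x) (hat y) \<xi>"
      using hat_scaleR[of r "bil \<kappa> x y"] hat_bil[OF \<kappa>, of x y] by eventually_elim simp
  qed
  obtain C where C: "0 \<le> C" "\<And>\<xi> \<eta>. \<bar>\<kappa> \<xi> \<eta>\<bar> \<le> C * (\<alpha> \<xi> + \<alpha> (\<xi> - \<eta>) + \<alpha> \<eta>)" using \<kappa> unfolding kernel_def by blast
  show "\<exists>K. \<forall>a b. norm (bil \<kappa> a b) \<le> norm a * norm b * K"
    using conv_herm_l2(2)[OF \<kappa> C] by (intro exI[of _ "3 * C * A"]) (simp add: mult_ac)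
qed

text \<open>The form is antisymmetrised by exchanging \<open>\<xi>\<close> and \<open>\<eta>\<close>, which conjugates the integrand because
  \<open>hat z\<close> is Hermitian; this cancels the derivative that is lost in the transport term.\<close>

lemma inner_fmult_bil:
  assumes \<kappa>: "kernel \<kappa>" and m: "even_bounded m"
  shows "2 * ennreal \<bar>inner (fmult m w) (bil \<kappa> z w)\<bar> \<le>
    trilin (\<lambda>\<xi> \<eta>. m \<xi> * \<kappa> \<xi> \<eta> - m \<eta> * \<kappa> \<eta> \<xi>)
      (\<lambda>\<xi>. ennreal (cmod (hat w \<xi>))) (\<lambda>\<xi>. ennreal (cmod (hat z \<xi>))) (\<lambda>\<xi>. ennreal (cmod (hat w \<xi>)))"
proof -
  have mm [measurable]: "m \<in> borel_measurable borel" using m by (simp add: even_bounded_def)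
  note km [measurable] = kernel_measurable[OF \<kappa>]
  note cm [measurable] = conv_measurable[OF \<kappa>]
  obtain C where C: "0 \<le> C" "\<And>\<xi> \<eta>. \<bar>\<kappa> \<xi> \<eta>\<bar> \<le> C * (\<alpha> \<xi> + \<alpha> (\<xi> - \<eta>) + \<alpha> \<eta>)" using \<kappa> unfolding kernel_def by blast
  obtain M where M: "\<And>\<xi>. \<bar>m \<xi>\<bar> \<le> M" using m unfolding even_bounded_def by blast
  have M0: "0 \<le> M" by (rule order_trans[OF abs_ge_zero M])
  define \<Phi> where "\<Phi> \<xi> \<eta> = complex_of_real (m \<xi> * \<kappa> \<xi> \<eta>) * hat z (\<xi> - \<eta>) * hat w \<eta> * cnj (hat w \<xi>)" for \<xi> \<eta>
  have \<Phi>m [measurable]: "(\<lambda>(\<xi>, \<eta>). \<Phi> \<xi> \<eta>) \<in> borel_measurable (lborel \<Otimes>\<^sub>M lborel)"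
    unfolding \<Phi>_def by measurable
  have \<Phi>i: "integrable (lborel \<Otimes>\<^sub>M lborel) (\<lambda>(\<xi>, \<eta>). \<Phi> \<xi> \<eta>)"
  proof (rule integrableI_bounded)
    have "(\<integral>\<^sup>+p. ennreal (norm (case p of (\<xi>, \<eta>) \<Rightarrow> \<Phi> \<xi> \<eta>)) \<partial>(lborel \<Otimes>\<^sub>M lborel)) = (\<integral>\<^sup>+\<xi>. \<integral>\<^sup>+\<eta>. ennreal (norm (\<Phi> \<xi> \<eta>)) \<partial>lborel \<partial>lborel)"
      by (subst lborel.nn_integral_fst[symmetric]) auto
    also have "\<dots> = trilin (\<lambda>\<xi> \<eta>. m \<xi> * \<kappa> \<xi> \<eta>) (\<lambda>\<xi>. ennreal (cmod (hat w \<xi>))) (\<lambda>\<xi>. ennreal (cmod (hat z \<xi>))) (\<lambda>\<xi>. ennreal (cmod (hat w \<xi>)))"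
      unfolding trilin_def by (intro nn_integral_cong) (simp add: \<Phi>_def norm_mult abs_mult ennreal_mult mult_ac)
    also have "\<dots> \<le> ennreal (3 * (M * C) * A * norm w * norm z * norm w)"
    proof (rule trilin_le[OF _ _ _ _ _ _ _ nn_hat nn_hat nn_hat])
      show "\<bar>m \<xi> * \<kappa> \<xi> \<eta>\<bar> \<le> M * C * (\<alpha> \<xi> + \<alpha> (\<xi> - \<eta>) + \<alpha> \<eta>)" for \<xi> \<eta>
        unfolding abs_mult mult.assoc using M0 by (intro mult_mono M C) auto
    qed (use M0 C in auto)
    finally show "(\<integral>\<^sup>+p. ennreal (norm (case p of (\<xi>, \<eta>) \<Rightarrow> \<Phi> \<xi> \<eta>)) \<partial>(lborel \<Otimes>\<^sub>M lborel)) < \<infinity>"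
      by (rule order_le_less_trans) simp
  qed simp
  define I where "I = (\<integral>\<xi>. \<integral>\<eta>. \<Phi> \<xi> \<eta> \<partial>lborel \<partial>lborel)"
  \<comment> \<open>The factor \<open>\<i>\<close> of \<open>conv\<close> makes the form the
    imaginary part of \<open>I\<close>. So twice its absolute value is the modulus of
    \<open>I - cnj I\<close>, and that difference is the integral of an antisymmetrised
    integrand.\<close>
  have inner: "inner (fmult m w) (bil \<kappa> z w) = - Im I"
  proof -
    have "inner (fmult m w) (bil \<kappa> z w) = Re (LINT \<xi>|lborel. hat (bil \<kappa> z w) \<xi> * cnj (hat (fmult m w) \<xi>))"
      by (subst inner_commute) (simp add: inner_l2h_def)
    also have "(LINT \<xi>|lborel. hat (bil \<kappa> z w) \<xi> * cnj (hat (fmult m w) \<xi>)) = (LINT \<xi>|lborel. conv \<kappa> (hat z) (hat w) \<xi> * (complex_of_real (m \<xi>) * cnj (hat w \<xi>)))"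
    proof (rule integral_cong_AE)
      show "AE \<xi> in lborel. hat (bil \<kappa> z w) \<xi> * cnj (hat (fmult m w) \<xi>) = conv \<kappa> (hat z) (hat w) \<xi> * (complex_of_real (m \<xi>) * cnj (hat w \<xi>))"
        using hat_bil[OF \<kappa>, of z w] hat_fmult[OF m, of w] by eventually_elim simp
    qed measurable
    also have "\<dots> = (LINT \<xi>|lborel. \<i> * (LINT \<eta>|lborel. \<Phi> \<xi> \<eta>))"
    proof (rule Bochner_Integration.integral_cong)
      fix \<xi>
      have "\<Phi> \<xi> \<eta> = complex_of_real (m \<xi>) * cnj (hat w \<xi>) * (complex_of_real (\<kappa> \<xi> \<eta>) * hat z (\<xi> - \<eta>) * hat w \<eta>)" for \<eta>
        by (simp add: \<Phi>_def mult_ac)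
      then have "(LINT \<eta>|lborel. \<Phi> \<xi> \<eta>) = complex_of_real (m \<xi>) * cnj (hat w \<xi>) *
          (LINT \<eta>|lborel. complex_of_real (\<kappa> \<xi> \<eta>) * hat z (\<xi> - \<eta>) * hat w \<eta>)"
        by (simp only: Bochner_Integration.integral_mult_right_zero)
      then show "conv \<kappa> (hat z) (hat w) \<xi> * (complex_of_real (m \<xi>) * cnj (hat w \<xi>)) = \<i> * (LINT \<eta>|lborel. \<Phi> \<xi> \<eta>)"
        unfolding conv_def by (simp only: mult_ac)
    qed simp
    also have "\<dots> = \<i> * I" by (simp add: I_def)
    finally show ?thesis by simp
  qed
  have swap: "I = (\<integral>\<xi>. \<integral>\<eta>. \<Phi> \<eta> \<xi> \<partial>lborel \<partial>lborel)"
    unfolding I_def by (rule lborel_pair.Fubini_integral[OF \<Phi>i, symmetric])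
  define \<Psi> where "\<Psi> \<xi> \<eta> = \<Phi> \<xi> \<eta> - cnj (\<Phi> \<eta> \<xi>)" for \<xi> \<eta>
  have [measurable]: "(\<lambda>(\<xi>, \<eta>). \<Psi> \<xi> \<eta>) \<in> borel_measurable (lborel \<Otimes>\<^sub>M lborel)"
    unfolding \<Psi>_def \<Phi>_def by measurable
  have \<Phi>i': "integrable (lborel \<Otimes>\<^sub>M lborel) (\<lambda>(\<xi>, \<eta>). cnj (\<Phi> \<eta> \<xi>))"
  proof -
    have "integrable (lborel \<Otimes>\<^sub>M lborel) (\<lambda>p. cnj (case p of (\<xi>, \<eta>) \<Rightarrow> \<Phi> \<eta> \<xi>))"
      using lborel_pair.integrable_product_swap[OF \<Phi>i] by (intro Bochner_Integration.integrable_cnj) simp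
    then show ?thesis by (simp only: prod.case_distrib[of cnj])
  qed
  have pair: "(\<integral>p. (case p of (\<xi>, \<eta>) \<Rightarrow> f \<xi> \<eta>) \<partial>(lborel \<Otimes>\<^sub>M lborel)) = (\<integral>\<xi>. \<integral>\<eta>. f \<xi> \<eta> \<partial>lborel \<partial>lborel)"
    if "integrable (lborel \<Otimes>\<^sub>M lborel) (\<lambda>(\<xi>, \<eta>). f \<xi> \<eta>)" for f :: "real \<Rightarrow> real \<Rightarrow> complex"
    using lborel_pair.integral_fst'[OF that] by simp
  have "(\<integral>\<xi>. \<integral>\<eta>. cnj (\<Phi> \<eta> \<xi>) \<partial>lborel \<partial>lborel) = cnj I"
    unfolding swap by (simp only: Bochner_Integration.integral_cnj)
  then have d: "I - cnj I = (\<integral>p. (case p of (\<xi>, \<eta>) \<Rightarrow> \<Psi> \<xi> \<eta>) \<partial>(lborel \<Otimes>\<^sub>M lborel))"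
    using Bochner_Integration.integral_diff[OF \<Phi>i \<Phi>i'] pair[OF \<Phi>i] pair[OF \<Phi>i']
    by (simp add: \<Psi>_def I_def case_prod_beta)
  have "cmod (I - cnj I) = 2 * \<bar>Im I\<bar>"
  proof -
    have "I - cnj I = \<i> * complex_of_real (2 * Im I)" by (simp add: complex_eq_iff)
    then show ?thesis by (simp add: norm_mult)
  qed
  then have "2 * ennreal \<bar>inner (fmult m w) (bil \<kappa> z w)\<bar> = ennreal (cmod (I - cnj I))"
    unfolding inner by (simp add: ennreal_mult'')
  also have "\<dots> \<le> (\<integral>\<^sup>+p. ennreal (norm (case p of (\<xi>, \<eta>) \<Rightarrow> \<Psi> \<xi> \<eta>)) \<partial>(lborel \<Otimes>\<^sub>M lborel))"
    unfolding d
  proof (rule integral_norm_bound_ennreal)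
    show "integrable (lborel \<Otimes>\<^sub>M lborel) (\<lambda>p. case p of (\<xi>, \<eta>) \<Rightarrow> \<Psi> \<xi> \<eta>)"
      using Bochner_Integration.integrable_diff[OF \<Phi>i \<Phi>i'] by (simp add: \<Psi>_def case_prod_beta)
  qed
  also have "\<dots> = (\<integral>\<^sup>+\<xi>. \<integral>\<^sup>+\<eta>. ennreal (norm (\<Psi> \<xi> \<eta>)) \<partial>lborel \<partial>lborel)"
    by (subst lborel.nn_integral_fst[symmetric]) auto
  also have "\<dots> = trilin (\<lambda>\<xi> \<eta>. m \<xi> * \<kappa> \<xi> \<eta> - m \<eta> * \<kappa> \<eta> \<xi>)
      (\<lambda>\<xi>. ennreal (cmod (hat w \<xi>))) (\<lambda>\<xi>. ennreal (cmod (hat z \<xi>))) (\<lambda>\<xi>. ennreal (cmod (hat w \<xi>)))"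
    unfolding trilin_def
  proof (intro nn_integral_cong)
    fix \<xi> \<eta>
    have "hat z (\<eta> - \<xi>) = cnj (hat z (\<xi> - \<eta>))" using hat_minus[of z "\<xi> - \<eta>"] by simp
    then have "\<Psi> \<xi> \<eta> = complex_of_real (m \<xi> * \<kappa> \<xi> \<eta> - m \<eta> * \<kappa> \<eta> \<xi>) * (cnj (hat w \<xi>) * hat z (\<xi> - \<eta>) * hat w \<eta>)"
      by (simp add: \<Psi>_def \<Phi>_def algebra_simps)
    then show "ennreal (norm (\<Psi> \<xi> \<eta>)) = ennreal \<bar>m \<xi> * \<kappa> \<xi> \<eta> - m \<eta> * \<kappa> \<eta> \<xi>\<bar> * (ennreal (cmod (hat w \<xi>)) * ennreal (cmod (hat z (\<xi> - \<eta>))) * ennreal (cmod (hat w \<eta>)))"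
      by (simp add: norm_mult ennreal_mult del: of_real_diff)
  qed
  finally show ?thesis .
qed

text \<open>The factors \<open>\<mu> \<xi>\<close> and \<open>\<mu> \<eta>\<close> are absorbed into
  the two copies of \<open>w\<close>, whose L^2 norms become the square root of the weak form;
  \<open>z\<close> is estimated in plain L^2.\<close>

lemma low_form_bound:
  assumes \<kappa>: "kernel \<kappa>" and m: "even_bounded m" and \<mu>: "even_bounded \<mu>" "\<And>\<xi>. 0 \<le> \<mu> \<xi>" and C: "0 \<le> C"
    and le: "\<And>\<xi> \<eta>. \<bar>m \<xi> * \<kappa> \<xi> \<eta> - m \<eta> * \<kappa> \<eta> \<xi>\<bar> \<le> C * (\<alpha> \<xi> + \<alpha> (\<xi> - \<eta>) + \<alpha> \<eta>) * (\<mu> \<xi> * \<mu> \<eta>)"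
  shows "\<bar>inner (fmult m w) (bil \<kappa> z w)\<bar> \<le> 3 * C * A * norm z * inner (fmult (\<lambda>\<xi>. (\<mu> \<xi>)\<^sup>2) w) w"
proof -
  have [measurable]: "\<mu> \<in> borel_measurable borel" using \<mu> by (simp add: even_bounded_def)
  have \<mu>2: "even_bounded (\<lambda>\<xi>. (\<mu> \<xi>)\<^sup>2)" using even_bounded_mult[OF \<mu>(1) \<mu>(1)] by (simp add: power2_eq_square)
  define E where "E = inner (fmult (\<lambda>\<xi>. (\<mu> \<xi>)\<^sup>2) w) w"
  have E0: "0 \<le> E" unfolding E_def norm_fmult_square[OF \<mu>(1), symmetric] by simp
  let ?w = "\<lambda>\<xi>. ennreal (cmod (hat w \<xi>))" and ?z = "\<lambda>\<xi>. ennreal (cmod (hat z \<xi>))"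
  let ?mw = "\<lambda>\<xi>. ennreal (\<mu> \<xi> * cmod (hat w \<xi>))"
  have nE: "(\<integral>\<^sup>+\<xi>. (?mw \<xi>)\<^sup>2 \<partial>lborel) \<le> ennreal ((sqrt E)\<^sup>2)"
    using nn_integral_eq_integral[OF inner_fmult_self(2)[OF \<mu>2, of w]] E0 \<mu>(2)
    by (simp add: E_def inner_fmult_self(1)[OF \<mu>2] ennreal_power power_mult_distrib)
  have aux: "ennreal (s * (m1 * m2)) * (ennreal a * ennreal b * ennreal d) = ennreal s * (ennreal (m1 * a) * ennreal b * ennreal (m2 * d))"
    if "0 \<le> s" "0 \<le> m1" "0 \<le> m2" "0 \<le> a" "0 \<le> b" "0 \<le> d" for s m1 m2 a b d :: real
    using that by (simp add: ennreal_mult mult_ac)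
  have "2 * ennreal \<bar>inner (fmult m w) (bil \<kappa> z w)\<bar> \<le> trilin (\<lambda>\<xi> \<eta>. m \<xi> * \<kappa> \<xi> \<eta> - m \<eta> * \<kappa> \<eta> \<xi>) ?w ?z ?w"
    by (rule inner_fmult_bil[OF \<kappa> m])
  also have "\<dots> \<le> trilin (\<lambda>\<xi> \<eta>. C * (\<alpha> \<xi> + \<alpha> (\<xi> - \<eta>) + \<alpha> \<eta>)) ?mw ?z ?mw"
    unfolding trilin_def
  proof (intro nn_integral_mono)
    fix \<xi> \<eta>
    let ?S = "C * (\<alpha> \<xi> + \<alpha> (\<xi> - \<eta>) + \<alpha> \<eta>)"
    have S: "0 \<le> ?S" using C \<alpha>_nonneg by (intro mult_nonneg_nonneg add_nonneg_nonneg) auto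
    have "ennreal \<bar>m \<xi> * \<kappa> \<xi> \<eta> - m \<eta> * \<kappa> \<eta> \<xi>\<bar> * (?w \<xi> * ?z (\<xi> - \<eta>) * ?w \<eta>) \<le> ennreal (?S * (\<mu> \<xi> * \<mu> \<eta>)) * (?w \<xi> * ?z (\<xi> - \<eta>) * ?w \<eta>)"
      by (intro mult_right_mono ennreal_leI le) simp
    also have "\<dots> = ennreal \<bar>?S\<bar> * (?mw \<xi> * ?z (\<xi> - \<eta>) * ?mw \<eta>)"
      unfolding abs_of_nonneg[OF S] using S \<mu>(2) by (intro aux) auto
    finally show "ennreal \<bar>m \<xi> * \<kappa> \<xi> \<eta> - m \<eta> * \<kappa> \<eta> \<xi>\<bar> * (?w \<xi> * ?z (\<xi> - \<eta>) * ?w \<eta>) \<le> ennreal \<bar>?S\<bar> * (?mw \<xi> * ?z (\<xi> - \<eta>) * ?mw \<eta>)" .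
  qed
  also have "\<dots> \<le> ennreal (3 * C * A * sqrt E * norm z * sqrt E)"
  proof (rule trilin_le[OF _ _ _ _ _ _ C nE nn_hat nE])
    show "\<bar>C * (\<alpha> \<xi> + \<alpha> (\<xi> - \<eta>) + \<alpha> \<eta>)\<bar> \<le> C * (\<alpha> \<xi> + \<alpha> (\<xi> - \<eta>) + \<alpha> \<eta>)" for \<xi> \<eta>
      using C \<alpha>_nonneg by (simp add: add_nonneg_nonneg)
  qed (use E0 in simp_all)
  also have "3 * C * A * sqrt E * norm z * sqrt E = 3 * C * A * norm z * (sqrt E * sqrt E)" by (simp only: mult_ac)
  also have "sqrt E * sqrt E = E" using E0 by simp
  finally have "ennreal (2 * \<bar>inner (fmult m w) (bil \<kappa> z w)\<bar>) \<le> ennreal (3 * C * A * norm z * E)"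
    by (simp add: ennreal_mult)
  then have "2 * \<bar>inner (fmult m w) (bil \<kappa> z w)\<bar> \<le> 3 * C * A * norm z * E"
    using C A_nonneg E0 by (simp add: ennreal_le_iff)
  then show ?thesis unfolding E_def by linarith
qed

text \<open>In each of the three terms one frequency carries \<open>\<alpha>\<close> and the other
  two carry \<open>\<mu>\<close>. The two factors with \<open>\<mu>\<close> give the weighted energy
  and the remaining one gives \<open>norm v\<close>, so the bound is linear in the energy. The
  multiplier \<open>\<rho>\<close> records the frequency support of \<open>v\<close>: the symbol has
  to be estimated only where both \<open>\<xi>\<close> and \<open>\<eta>\<close> belong to
  it.\<close>

lemma energy_form_bound:
  assumes \<kappa>: "kernel \<kappa>" and m: "even_bounded m" and \<mu>: "even_bounded \<mu>" "\<And>\<xi>. 0 \<le> \<mu> \<xi>" and C: "0 \<le> C"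
    and \<rho>: "even_bounded \<rho>" "fmult \<rho> v = v"
    and le: "\<And>\<xi> \<eta>. \<rho> \<xi> \<noteq> 0 \<Longrightarrow> \<rho> \<eta> \<noteq> 0 \<Longrightarrow> \<bar>m \<xi> * \<kappa> \<xi> \<eta> - m \<eta> * \<kappa> \<eta> \<xi>\<bar> \<le>
       C * (\<alpha> (\<xi> - \<eta>) * \<mu> \<xi> * \<mu> \<eta> + \<alpha> \<eta> * \<mu> \<xi> * \<mu> (\<xi> - \<eta>) + \<alpha> \<xi> * \<mu> \<eta> * \<mu> (\<xi> - \<eta>))"
  shows "\<bar>inner (fmult m v) (bil \<kappa> v v)\<bar> \<le> 3 * C * A * norm v * inner (fmult (\<lambda>\<xi>. (\<mu> \<xi>)\<^sup>2) v) v"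
proof -
  have [measurable]: "\<mu> \<in> borel_measurable borel" "m \<in> borel_measurable borel" using \<mu> m by (auto simp: even_bounded_def)
  note [measurable] = kernel_measurable[OF \<kappa>]
  have \<mu>2: "even_bounded (\<lambda>\<xi>. (\<mu> \<xi>)\<^sup>2)" using even_bounded_mult[OF \<mu>(1) \<mu>(1)] by (simp add: power2_eq_square)
  define E where "E = inner (fmult (\<lambda>\<xi>. (\<mu> \<xi>)\<^sup>2) v) v"
  have E0: "0 \<le> E" unfolding E_def norm_fmult_square[OF \<mu>(1), symmetric] by simp
  let ?v = "\<lambda>\<xi>. ennreal (cmod (hat v \<xi>))" and ?a = "\<lambda>\<xi>. ennreal (\<alpha> \<xi>)"
  let ?mv = "\<lambda>\<xi>. ennreal (\<mu> \<xi> * cmod (hat v \<xi>))"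
  let ?k = "\<lambda>\<xi> \<eta>. m \<xi> * \<kappa> \<xi> \<eta> - m \<eta> * \<kappa> \<eta> \<xi>"
  have nE: "(\<integral>\<^sup>+\<xi>. (?mv \<xi>)\<^sup>2 \<partial>lborel) \<le> ennreal ((sqrt E)\<^sup>2)"
    using nn_integral_eq_integral[OF inner_fmult_self(2)[OF \<mu>2, of v]] E0 \<mu>(2)
    by (simp add: E_def inner_fmult_self(1)[OF \<mu>2] ennreal_power power_mult_distrib)
  define X where "X = A * norm v * (sqrt E * sqrt E)"
  have X: "0 \<le> X" using A_nonneg E0 by (simp add: X_def)
  have supp: "AE \<xi> in lborel. \<rho> \<xi> = 0 \<longrightarrow> hat v \<xi> = 0"
    using hat_fmult[OF \<rho>(1), of v] unfolding \<rho>(2) by eventually_elim auto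
  let ?T = "\<lambda>\<xi> \<eta>. ?a (\<xi> - \<eta>) * (?mv \<xi> * ?v (\<xi> - \<eta>) * ?mv \<eta>) + ?a \<eta> * (?mv \<xi> * ?mv (\<xi> - \<eta>) * ?v \<eta>) + ?a \<xi> * (?v \<xi> * ?mv (\<xi> - \<eta>) * ?mv \<eta>)"
  have pt: "ennreal \<bar>?k \<xi> \<eta>\<bar> * (?v \<xi> * ?v (\<xi> - \<eta>) * ?v \<eta>) \<le> ennreal C * ?T \<xi> \<eta>"
    if "\<rho> \<xi> = 0 \<longrightarrow> hat v \<xi> = 0" "\<rho> \<eta> = 0 \<longrightarrow> hat v \<eta> = 0" for \<xi> \<eta>
  proof (cases "\<rho> \<xi> = 0 \<or> \<rho> \<eta> = 0")
    case True
    then show ?thesis using that by auto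
  next
    case False
    let ?r = "cmod (hat v \<xi>) * cmod (hat v (\<xi> - \<eta>)) * cmod (hat v \<eta>)"
    have "\<bar>?k \<xi> \<eta>\<bar> * ?r \<le> C * (\<alpha> (\<xi> - \<eta>) * \<mu> \<xi> * \<mu> \<eta> + \<alpha> \<eta> * \<mu> \<xi> * \<mu> (\<xi> - \<eta>) + \<alpha> \<xi> * \<mu> \<eta> * \<mu> (\<xi> - \<eta>)) * ?r"
      using False by (intro mult_right_mono le) auto
    also have "\<dots> = C * (\<alpha> (\<xi> - \<eta>) * ((\<mu> \<xi> * cmod (hat v \<xi>)) * cmod (hat v (\<xi> - \<eta>)) * (\<mu> \<eta> * cmod (hat v \<eta>)))
        + \<alpha> \<eta> * ((\<mu> \<xi> * cmod (hat v \<xi>)) * (\<mu> (\<xi> - \<eta>) * cmod (hat v (\<xi> - \<eta>))) * cmod (hat v \<eta>))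
        + \<alpha> \<xi> * (cmod (hat v \<xi>) * (\<mu> (\<xi> - \<eta>) * cmod (hat v (\<xi> - \<eta>))) * (\<mu> \<eta> * cmod (hat v \<eta>))))"
      by (simp add: algebra_simps)
    finally have "ennreal (\<bar>?k \<xi> \<eta>\<bar> * ?r) \<le> ennreal (C * (\<alpha> (\<xi> - \<eta>) * ((\<mu> \<xi> * cmod (hat v \<xi>)) * cmod (hat v (\<xi> - \<eta>)) * (\<mu> \<eta> * cmod (hat v \<eta>)))
        + \<alpha> \<eta> * ((\<mu> \<xi> * cmod (hat v \<xi>)) * (\<mu> (\<xi> - \<eta>) * cmod (hat v (\<xi> - \<eta>))) * cmod (hat v \<eta>))
        + \<alpha> \<xi> * (cmod (hat v \<xi>) * (\<mu> (\<xi> - \<eta>) * cmod (hat v (\<xi> - \<eta>))) * (\<mu> \<eta> * cmod (hat v \<eta>)))))"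
      by (rule ennreal_leI)
    then show ?thesis
      using C \<mu>(2) \<alpha>_nonneg by (simp add: ennreal_mult ennreal_plus add_nonneg_nonneg)
  qed
  have "2 * ennreal \<bar>inner (fmult m v) (bil \<kappa> v v)\<bar> \<le> trilin ?k ?v ?v ?v"
    by (rule inner_fmult_bil[OF \<kappa> m])
  also have "\<dots> \<le> (\<integral>\<^sup>+\<xi>. \<integral>\<^sup>+\<eta>. ennreal C * ?T \<xi> \<eta> \<partial>lborel \<partial>lborel)"
    unfolding trilin_def
  proof (intro nn_integral_mono_AE)
    show "AE \<xi> in lborel. (\<integral>\<^sup>+\<eta>. ennreal \<bar>?k \<xi> \<eta>\<bar> * (?v \<xi> * ?v (\<xi> - \<eta>) * ?v \<eta>) \<partial>lborel) \<le> (\<integral>\<^sup>+\<eta>. ennreal C * ?T \<xi> \<eta> \<partial>lborel)"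
      using supp
    proof eventually_elim
      case (elim \<xi>)
      show ?case
        by (rule nn_integral_mono_AE, rule eventually_mono[OF supp], rule pt[OF elim])
    qed
  qed
  also have "\<dots> = ennreal C * ((\<integral>\<^sup>+\<xi>. \<integral>\<^sup>+\<eta>. ?a (\<xi> - \<eta>) * (?mv \<xi> * ?v (\<xi> - \<eta>) * ?mv \<eta>) \<partial>lborel \<partial>lborel)
     + (\<integral>\<^sup>+\<xi>. \<integral>\<^sup>+\<eta>. ?a \<eta> * (?mv \<xi> * ?mv (\<xi> - \<eta>) * ?v \<eta>) \<partial>lborel \<partial>lborel)
     + (\<integral>\<^sup>+\<xi>. \<integral>\<^sup>+\<eta>. ?a \<xi> * (?v \<xi> * ?mv (\<xi> - \<eta>) * ?mv \<eta>) \<partial>lborel \<partial>lborel))"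
    by (simp add: nn_integral_cmult nn_integral_add)
  also have "\<dots> \<le> ennreal C * (ennreal (A * sqrt E * norm v * sqrt E) + ennreal (A * sqrt E * sqrt E * norm v) + ennreal (A * norm v * sqrt E * sqrt E))"
    using E0
    by (intro mult_left_mono add_mono trilinear_weighted(2)[OF _ _ _ _ _ _ _ A_nonneg nE nn_hat nE nn_\<alpha>]
        trilinear_weighted(3)[OF _ _ _ _ _ _ _ A_nonneg nE nE nn_hat nn_\<alpha>]
        trilinear_weighted(1)[OF _ _ _ _ _ _ _ A_nonneg nn_hat nE nE nn_\<alpha>]) simp_all
  also have "\<dots> = ennreal C * (ennreal X + ennreal X + ennreal X)" unfolding X_def by (simp only: mult_ac)
  also have "\<dots> = ennreal (3 * C * X)"
    using C X by (simp add: ennreal_mult[symmetric] ennreal_plus[symmetric] del: ennreal_plus)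
  also have "3 * C * X = 3 * C * A * norm v * (sqrt E * sqrt E)" by (simp add: X_def)
  also have "sqrt E * sqrt E = E" using E0 by simp
  finally have "ennreal (2 * \<bar>inner (fmult m v) (bil \<kappa> v v)\<bar>) \<le> ennreal (3 * C * A * norm v * E)"
    by (simp add: ennreal_mult)
  then have "2 * \<bar>inner (fmult m v) (bil \<kappa> v v)\<bar> \<le> 3 * C * A * norm v * E"
    using C A_nonneg E0 by (simp add: ennreal_le_iff)
  then show ?thesis unfolding E_def by linarith
qed

end

section \<open>Symbol estimates\<close>

lemma japanese_ge_1: "1 \<le> japanese \<xi>"
  by (simp add: japanese_def)

lemma japanese_pos [simp]: "0 < japanese \<xi>"
  using japanese_ge_1[of \<xi>] by linarith

lemma japanese_nonneg [simp]: "0 \<le> japanese \<xi>"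
  using japanese_ge_1[of \<xi>] by linarith

lemma japanese_neq_0 [simp]: "japanese \<xi> \<noteq> 0"
  using japanese_ge_1[of \<xi>] by linarith

lemma abs_le_japanese: "\<bar>\<xi>\<bar> \<le> japanese \<xi>"
  unfolding japanese_def by (rule real_le_rsqrt) simp

lemma japanese_minus [simp]: "japanese (- \<xi>) = japanese \<xi>"
  by (simp add: japanese_def)

lemma japanese_square: "(japanese \<xi>)\<^sup>2 = 1 + \<xi>\<^sup>2"
  by (simp add: japanese_def add_nonneg_nonneg)

lemma japanese_powr: "japanese \<xi> powr a = (1 + \<xi>\<^sup>2) powr (a / 2)"
  unfolding japanese_def by (simp add: powr_half_sqrt[symmetric] powr_powr add_nonneg_nonneg)

lemma japanese_measurable [measurable]: "japanese \<in> borel_measurable borel"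
  unfolding japanese_def by measurable

lemma japanese_lipschitz: "\<bar>japanese \<xi> - japanese \<eta>\<bar> \<le> \<bar>\<xi> - \<eta>\<bar>"
proof -
  have j: "japanese \<xi> = cmod (Complex 1 \<xi>)" for \<xi> by (simp add: japanese_def cmod_def)
  have "cmod (Complex 1 \<xi> - Complex 1 \<eta>) = \<bar>\<xi> - \<eta>\<bar>" by (simp add: cmod_def)
  then show ?thesis unfolding j using norm_triangle_ineq3[of "Complex 1 \<xi>" "Complex 1 \<eta>"] by simp
qed

lemma japanese_triangle:
  "japanese \<xi> \<le> japanese \<eta> + japanese (\<xi> - \<eta>)" "japanese \<eta> \<le> japanese \<xi> + japanese (\<xi> - \<eta>)"
  "\<bar>japanese \<xi> - japanese \<eta>\<bar> \<le> japanese (\<xi> - \<eta>)"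
  using japanese_lipschitz[of \<xi> \<eta>] abs_le_japanese[of "\<xi> - \<eta>"] by linarith+

lemma powr_quasi_triangle:
  fixes p q r :: real
  assumes "0 < p" "0 < q" "0 < r" "p \<le> q + r" "0 \<le> a"
  shows "p powr a \<le> 2 powr a * (q powr a + r powr a)"
proof -
  have "p powr a \<le> (2 * max q r) powr a" using assms by (intro powr_mono2) auto
  also have "\<dots> = 2 powr a * (max q r) powr a" using assms by (intro powr_mult)
  also have "\<dots> \<le> 2 powr a * (q powr a + r powr a)" by (intro mult_left_mono) (auto simp: max_def)
  finally show ?thesis .
qed

text \<open>On the half-line \<open>1 + x\<^sup>2\<close> is at least half of
  \<open>(1 + x)\<^sup>2\<close>, and the power of \<open>1 + x\<close> has an explicit
  antiderivative, which vanishes at infinity because \<open>a > 1/2\<close>.\<close>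

lemma integrable_weight:
  assumes a: "a > 1/2"
  shows "integrable lborel (\<lambda>x::real. (1 + x\<^sup>2) powr (- a))"
proof (rule integrableI_bounded)
  let ?f = "\<lambda>x::real. (1 + x) powr (- 2 * a)"
  have le: "(1 + x\<^sup>2) powr (- a) \<le> 2 powr a * ?f x" if "x \<ge> 0" for x :: real
  proof -
    have "2 * x \<le> 1 + x\<^sup>2" using sum_squares_bound[of 1 x] by simp
    then have "(1 + x)\<^sup>2 / 2 \<le> 1 + x\<^sup>2" by (simp add: power2_sum)
    then have "(1 + x\<^sup>2) powr (- a) \<le> ((1 + x)\<^sup>2 / 2) powr (- a)"
      using a that by (intro powr_mono2') auto
    also have "\<dots> = ((1 + x)\<^sup>2) powr (- a) / 2 powr (- a)" using that by (simp add: powr_divide)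
    also have "((1 + x)\<^sup>2) powr (- a) = ?f x" using that by (simp add: powr_powr flip: powr_numeral)
    also have "?f x / 2 powr (- a) = 2 powr a * ?f x" by (simp add: powr_minus field_simps)
    finally show ?thesis .
  qed
  have half: "(\<integral>\<^sup>+x. ennreal (?f x) * indicator {0..} x \<partial>lborel) < \<infinity>"
  proof -
    have "(\<integral>\<^sup>+x. ennreal (?f x) * indicator {0..} x \<partial>lborel) = ennreal (0 - (1 + 0) powr (1 - 2 * a) / (1 - 2 * a))"
    proof (rule nn_integral_FTC_atLeast)
      show "((\<lambda>x. (1 + x) powr (1 - 2 * a) / (1 - 2 * a)) has_real_derivative ?f x) (at x)" if "0 \<le> x" for x
      proof -
        have "((\<lambda>x. (1 + x) powr (1 - 2 * a)) has_real_derivative (1 - 2 * a) * (1 + x) powr (1 - 2 * a - 1)) (at x)"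
          using that by (auto intro!: derivative_eq_intros)
        from DERIV_cdivide[OF this, of "1 - 2 * a"] show ?thesis using a by simp
      qed
      have "((\<lambda>x. (1 + x) powr (1 - 2 * a)) \<longlongrightarrow> 0) at_top"
        using a by (intro tendsto_neg_powr filterlim_tendsto_add_at_top[OF tendsto_const filterlim_ident]) auto
      then show "((\<lambda>x. (1 + x) powr (1 - 2 * a) / (1 - 2 * a)) \<longlongrightarrow> 0) at_top"
        using tendsto_divide[OF _ tendsto_const, of _ 0 at_top "1 - 2 * a"] a by fastforce
    qed auto
    then show ?thesis by simp
  qed
  let ?g = "\<lambda>x::real. ennreal (2 powr a) * (ennreal (?f x) * indicator {0..} x)"
  have "(\<integral>\<^sup>+x. ennreal (norm ((1 + x\<^sup>2) powr (- a))) \<partial>lborel) \<le> (\<integral>\<^sup>+x. ?g x + ?g (0 - x) \<partial>lborel)"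
  proof (rule nn_integral_mono)
    fix x :: real
    show "ennreal (norm ((1 + x\<^sup>2) powr (- a))) \<le> ?g x + ?g (0 - x)"
    proof (cases "x \<ge> 0")
      case True
      then have "ennreal (norm ((1 + x\<^sup>2) powr (- a))) \<le> ?g x"
        using ennreal_leI[OF le[of x]] by (simp add: ennreal_mult)
      then show ?thesis by (rule order_trans) simp
    next
      case False
      then have "ennreal (norm ((1 + x\<^sup>2) powr (- a))) \<le> ?g (0 - x)"
        using ennreal_leI[OF le[of "- x"]] by (simp add: ennreal_mult)
      then show ?thesis by (rule order_trans) simp
    qed
  qed
  also have "\<dots> = (\<integral>\<^sup>+x. ?g x \<partial>lborel) + (\<integral>\<^sup>+x. ?g x \<partial>lborel)"
    using nn_integral_translate(2)[of ?g 0] by (subst nn_integral_add) auto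
  also have "\<dots> < \<infinity>" using half by (simp add: nn_integral_cmult ennreal_mult_less_top)
  finally show "(\<integral>\<^sup>+x. ennreal (norm ((1 + x\<^sup>2) powr (- a))) \<partial>lborel) < \<infinity>" .
qed simp

text \<open>A crude mean value bound, to be used for quotients of comparable frequencies, hence only
  on [1,2].\<close>

lemma power_minus_1_le: "1 \<le> t \<Longrightarrow> t \<le> 2 \<Longrightarrow> t ^ n - 1 \<le> real n * 2 ^ n * (t - 1)" for t :: real
proof (induction n)
  case (Suc n)
  have "t ^ Suc n - 1 = t * (t ^ n - 1) + (t - 1)" by (simp add: algebra_simps)
  also have "\<dots> \<le> 2 * (real n * 2 ^ n * (t - 1)) + 2 ^ Suc n * (t - 1)"
  proof (intro add_mono)
    show "t * (t ^ n - 1) \<le> 2 * (real n * 2 ^ n * (t - 1))"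
      using Suc by (intro mult_mono) (auto simp: one_le_power)
    have "1 * (t - 1) \<le> 2 ^ Suc n * (t - 1)" using Suc by (intro mult_right_mono one_le_power) auto
    then show "t - 1 \<le> 2 ^ Suc n * (t - 1)" by simp
  qed
  also have "\<dots> = real (Suc n) * 2 ^ Suc n * (t - 1)" by (simp add: algebra_simps)
  finally show ?case .
qed simp

text \<open>The reflection of \<open>\<eta>\<close> into \<open>\<xi> - \<eta>\<close> exchanges the
  two factors of a convolution. With equal factors, a symbol may therefore be replaced by its
  symmetrisation.\<close>

lemma integral_symmetrize:
  fixes f g :: "real \<Rightarrow> complex"
  assumes i: "integrable lborel f" and k: "\<And>\<eta>. f \<eta> + f (\<xi> - \<eta>) = 2 * g \<eta>"
  shows "(LINT \<eta>|lborel. f \<eta>) = (LINT \<eta>|lborel. g \<eta>)"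
proof -
  have i': "integrable lborel (\<lambda>\<eta>. f (\<xi> - \<eta>))"
    using lborel_integrable_real_affine[OF i, of "-1" \<xi>] by simp
  have e: "(LINT \<eta>|lborel. f (\<xi> - \<eta>)) = (LINT \<eta>|lborel. f \<eta>)"
    using lborel_integral_real_affine[of "-1" f \<xi>] by simp
  have "2 * (LINT \<eta>|lborel. g \<eta>) = (LINT \<eta>|lborel. f \<eta> + f (\<xi> - \<eta>))"
    unfolding k by (simp only: Bochner_Integration.integral_mult_right_zero)
  also have "\<dots> = (LINT \<eta>|lborel. f \<eta>) + (LINT \<eta>|lborel. f (\<xi> - \<eta>))"
    by (rule Bochner_Integration.integral_add[OF i i'])
  finally show ?thesis unfolding e by simp
qed

locale b_family =
  fixes b s :: real
  assumes s: "s > 3 / 2"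
begin

text \<open>The argument \<open>p\<close> stands for \<langle>\<xi>\<rangle>. Thus
  \<open>\<omega> N\<close> is the weight of the H^s norm, damped below frequency \<open>N\<close>.
  The only features of \<open>\<mu> N\<close> that matter are monotonicity and at most linear
  growth, \<open>\<mu>_scale\<close>; their constants are free of \<open>N\<close>, and so are all
  estimates below.\<close>

definition \<mu> :: "real \<Rightarrow> real \<Rightarrow> real" where "\<mu> N p = min 1 (p / N)"
definition \<omega> :: "real \<Rightarrow> real \<Rightarrow> real" where "\<omega> N p = p powr s * \<mu> N p"

text \<open>Comes from \<open>power_minus_1_le\<close> with exponent \<open>2 * n\<close>:
  \<open>\<omega> N\<close> grows at most like the power s + 1, which is rounded up to the integer
  \<open>n\<close>, and its square occurs.\<close>

definition commutator_const :: real where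
  "commutator_const = (let n = nat \<lceil>s + 1\<rceil> in real (2 * n) * 2 ^ (2 * n))"

context
  fixes N :: real assumes N: "1 \<le> N"
begin

lemma \<mu>_nonneg: "0 \<le> p \<Longrightarrow> 0 \<le> \<mu> N p" and \<mu>_le_1: "\<mu> N p \<le> 1"
  using N by (simp_all add: \<mu>_def)

lemma \<mu>_scale: "0 \<le> p \<Longrightarrow> 1 \<le> k \<Longrightarrow> p \<le> k * q \<Longrightarrow> \<mu> N p \<le> k * \<mu> N q"
proof -
  assume a: "0 \<le> p" "1 \<le> k" "p \<le> k * q"
  have "p / N \<le> k * q / N" using a N by (intro divide_right_mono) auto
  then show ?thesis using a by (auto simp: \<mu>_def min_def)
qed

lemma \<omega>_nonneg: "0 \<le> p \<Longrightarrow> 0 \<le> \<omega> N p"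
  by (simp add: \<omega>_def \<mu>_nonneg)

lemma \<omega>_scale: "0 < p \<Longrightarrow> 0 < q \<Longrightarrow> 1 \<le> k \<Longrightarrow> p \<le> k * q \<Longrightarrow> \<omega> N p \<le> k powr (s + 1) * \<omega> N q"
proof -
  assume a: "0 < p" "0 < q" "1 \<le> k" "p \<le> k * q"
  have "p powr s \<le> (k * q) powr s" using a s by (intro powr_mono2) auto
  also have "\<dots> = k powr s * q powr s" using a by (simp add: powr_mult)
  finally have "\<omega> N p \<le> (k powr s * q powr s) * (k * \<mu> N q)"
    unfolding \<omega>_def using a by (intro mult_mono \<mu>_scale) (auto simp: \<mu>_nonneg)
  also have "\<dots> = k powr (s + 1) * \<omega> N q" using a by (simp add: \<omega>_def powr_add)
  finally show ?thesis .
qed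

lemma \<omega>_mono: "0 < p \<Longrightarrow> p \<le> q \<Longrightarrow> \<omega> N p \<le> \<omega> N q"
  using \<omega>_scale[of p q 1] by simp

text \<open>With \<open>t = p / q\<close> in [1,2] the difference of squares is at most
  \<open>t ^ (2 * n) - 1\<close> times \<open>(\<omega> N q)\<^sup>2\<close>, hence of size
  \<open>t - 1\<close>; the factor \<open>q\<close> turns \<open>t - 1\<close> into
  \<open>p - q\<close>, that is, the lost derivative into a difference of frequencies.\<close>

lemma \<omega>_square_diff:
  assumes "1 \<le> q" "q \<le> p" "p \<le> 2 * q"
  shows "((\<omega> N p)\<^sup>2 - (\<omega> N q)\<^sup>2) * q \<le> commutator_const * (\<omega> N q * \<omega> N p) * (p - q)"
proof -
  define n where "n = nat \<lceil>s + 1\<rceil>"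
  define t where "t = p / q"
  have t: "1 \<le> t" "t \<le> 2" using assms by (auto simp: t_def field_simps)
  have "\<omega> N p \<le> t powr (s + 1) * \<omega> N q"
    using assms t by (intro \<omega>_scale) (auto simp: t_def)
  also have "t powr (s + 1) \<le> t powr real n" using t s by (intro powr_mono) (auto simp: n_def)
  also have "t powr real n = t ^ n" using t by (intro powr_realpow) auto
  finally have "\<omega> N p \<le> t ^ n * \<omega> N q" using assms by (simp add: mult_right_mono \<omega>_nonneg)
  then have "(\<omega> N p)\<^sup>2 \<le> (t ^ n * \<omega> N q)\<^sup>2" using assms by (intro power_mono \<omega>_nonneg) auto
  then have "(\<omega> N p)\<^sup>2 - (\<omega> N q)\<^sup>2 \<le> (t ^ (2 * n) - 1) * (\<omega> N q)\<^sup>2"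
    by (simp add: power_mult_distrib power_mult[symmetric] mult.commute[of n] left_diff_distrib)
  also have "\<dots> \<le> (commutator_const * (t - 1)) * (\<omega> N q)\<^sup>2"
    using power_minus_1_le[OF t, of "2 * n"] by (intro mult_right_mono) (auto simp: commutator_const_def n_def Let_def)
  finally have "((\<omega> N p)\<^sup>2 - (\<omega> N q)\<^sup>2) * q \<le> (commutator_const * (t - 1)) * (\<omega> N q)\<^sup>2 * q"
    using assms by (intro mult_right_mono) auto
  also have "\<dots> = commutator_const * (\<omega> N q * \<omega> N q) * (p - q)"
    using assms by (simp add: t_def field_simps power2_eq_square)
  also have "\<dots> \<le> commutator_const * (\<omega> N q * \<omega> N p) * (p - q)"
    using assms by (intro mult_right_mono mult_left_mono \<omega>_mono \<omega>_nonneg) (auto simp: commutator_const_def Let_def)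
  finally show ?thesis .
qed

text \<open>If \<open>r\<close> is at least a quarter of \<open>p\<close> and of \<open>q\<close>,
  nothing has to cancel: one weight \<open>\<omega> N p\<close> or \<open>\<omega> N q\<close> of
  each square is replaced by \<open>\<omega> N r\<close> at the cost of the factor
  \<open>4 powr (s + 1)\<close>. Otherwise \<open>p\<close> and \<open>q\<close> are comparable, and
  the difference is rewritten as a difference of squared weights times one frequency, plus a squared
  weight times \<open>\<xi> - \<eta>\<close>; both cost only a factor \<open>r\<close>, so the
  derivative has moved to the third function.\<close>

lemma commutator_symbol:
  fixes \<xi> \<eta> :: real
  defines "p \<equiv> japanese \<xi>" and "q \<equiv> japanese \<eta>" and "r \<equiv> japanese (\<xi> - \<eta>)"
  shows "\<bar>(\<omega> N p)\<^sup>2 * \<eta> - (\<omega> N q)\<^sup>2 * \<xi>\<bar> \<le> (4 powr (s + 1) + commutator_const + 1) *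
    (r * \<omega> N p * \<omega> N q + q * \<omega> N p * \<omega> N r + p * \<omega> N q * \<omega> N r)"
proof -
  have pqr: "1 \<le> p" "1 \<le> q" "1 \<le> r" by (simp_all add: p_def q_def r_def japanese_ge_1)
  have tri: "p \<le> q + r" "q \<le> p + r" "\<bar>p - q\<bar> \<le> r"
    unfolding p_def q_def r_def by (rule japanese_triangle)+
  have ab: "\<bar>\<xi>\<bar> \<le> p" "\<bar>\<eta>\<bar> \<le> q" "\<bar>\<xi> - \<eta>\<bar> \<le> r" unfolding p_def q_def r_def by (rule abs_le_japanese)+
  have nn: "0 \<le> \<omega> N p" "0 \<le> \<omega> N q" "0 \<le> \<omega> N r" using pqr by (auto intro: \<omega>_nonneg)
  have cc: "0 \<le> commutator_const" by (simp add: commutator_const_def Let_def)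
  let ?X = "r * \<omega> N p * \<omega> N q" and ?Y = "q * \<omega> N p * \<omega> N r" and ?Z = "p * \<omega> N q * \<omega> N r"
  have XYZ: "0 \<le> ?X" "0 \<le> ?Y" "0 \<le> ?Z" using nn pqr by auto
  let ?D = "4 powr (s + 1)"
  have main: "\<bar>(\<omega> N p)\<^sup>2 * \<eta> - (\<omega> N q)\<^sup>2 * \<xi>\<bar> \<le> ?D * (?Y + ?Z) + (commutator_const + 1) * ?X"
  proof (cases "max p q \<le> 4 * r")
    case True
    have "\<bar>(\<omega> N p)\<^sup>2 * \<eta> - (\<omega> N q)\<^sup>2 * \<xi>\<bar> \<le> (\<omega> N p)\<^sup>2 * \<bar>\<eta>\<bar> + (\<omega> N q)\<^sup>2 * \<bar>\<xi>\<bar>"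
      using abs_triangle_ineq4[of "(\<omega> N p)\<^sup>2 * \<eta>" "(\<omega> N q)\<^sup>2 * \<xi>"] by (simp add: abs_mult)
    also have "\<dots> \<le> (\<omega> N p * (?D * \<omega> N r)) * q + (\<omega> N q * (?D * \<omega> N r)) * p"
      unfolding power2_eq_square using True pqr nn ab by (intro add_mono mult_mono \<omega>_scale) auto
    also have "\<dots> = ?D * (?Y + ?Z)" by (simp add: algebra_simps)
    finally show ?thesis using XYZ cc by (simp add: add_increasing2)
  next
    case False
    then have r4: "4 * r < max p q" by (simp only: not_le)
    then have pq: "p \<le> 2 * q" "q \<le> 2 * p" using tri pqr by (auto simp: max_def split: if_splits)
    have "\<bar>(\<omega> N p)\<^sup>2 * \<eta> - (\<omega> N q)\<^sup>2 * \<xi>\<bar> \<le> (commutator_const + 1) * ?X"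
    proof (cases "q \<le> p")
      case True
      have "(\<omega> N p)\<^sup>2 * \<eta> - (\<omega> N q)\<^sup>2 * \<xi> = ((\<omega> N p)\<^sup>2 - (\<omega> N q)\<^sup>2) * \<eta> - (\<omega> N q)\<^sup>2 * (\<xi> - \<eta>)"
        by (simp add: algebra_simps)
      moreover have W: "0 \<le> (\<omega> N p)\<^sup>2 - (\<omega> N q)\<^sup>2" using \<omega>_mono[of q p] True pqr nn by (simp add: power_mono)
      ultimately have "\<bar>(\<omega> N p)\<^sup>2 * \<eta> - (\<omega> N q)\<^sup>2 * \<xi>\<bar> \<le> ((\<omega> N p)\<^sup>2 - (\<omega> N q)\<^sup>2) * \<bar>\<eta>\<bar> + (\<omega> N q)\<^sup>2 * \<bar>\<xi> - \<eta>\<bar>"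
        using abs_triangle_ineq4[of "((\<omega> N p)\<^sup>2 - (\<omega> N q)\<^sup>2) * \<eta>" "(\<omega> N q)\<^sup>2 * (\<xi> - \<eta>)"] by (simp add: abs_mult)
      also have "\<dots> \<le> ((\<omega> N p)\<^sup>2 - (\<omega> N q)\<^sup>2) * q + (\<omega> N q * \<omega> N p) * r"
        unfolding power2_eq_square[of "\<omega> N q"] using W True pqr nn ab
        by (intro add_mono mult_mono \<omega>_mono) (auto simp: power2_eq_square)
      also have "((\<omega> N p)\<^sup>2 - (\<omega> N q)\<^sup>2) * q \<le> commutator_const * (\<omega> N q * \<omega> N p) * (p - q)"
        by (rule \<omega>_square_diff[OF pqr(2) True pq(1)])
      also have "\<dots> \<le> commutator_const * (\<omega> N q * \<omega> N p) * r" using tri nn cc by (intro mult_left_mono) auto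
      finally show ?thesis by (simp add: algebra_simps)
    next
      case False
      then have F: "p \<le> q" by simp
      have "(\<omega> N p)\<^sup>2 * \<eta> - (\<omega> N q)\<^sup>2 * \<xi> = - (((\<omega> N q)\<^sup>2 - (\<omega> N p)\<^sup>2) * \<xi>) - (\<omega> N p)\<^sup>2 * (\<xi> - \<eta>)"
        by (simp add: algebra_simps)
      moreover have W: "0 \<le> (\<omega> N q)\<^sup>2 - (\<omega> N p)\<^sup>2" using \<omega>_mono[of p q] F pqr nn by (simp add: power_mono)
      ultimately have "\<bar>(\<omega> N p)\<^sup>2 * \<eta> - (\<omega> N q)\<^sup>2 * \<xi>\<bar> \<le> ((\<omega> N q)\<^sup>2 - (\<omega> N p)\<^sup>2) * \<bar>\<xi>\<bar> + (\<omega> N p)\<^sup>2 * \<bar>\<xi> - \<eta>\<bar>"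
        using abs_triangle_ineq4[of "- (((\<omega> N q)\<^sup>2 - (\<omega> N p)\<^sup>2) * \<xi>)" "(\<omega> N p)\<^sup>2 * (\<xi> - \<eta>)"] by (simp add: abs_mult)
      also have "\<dots> \<le> ((\<omega> N q)\<^sup>2 - (\<omega> N p)\<^sup>2) * p + (\<omega> N p * \<omega> N q) * r"
        unfolding power2_eq_square[of "\<omega> N p"] using W F pqr nn ab
        by (intro add_mono mult_mono \<omega>_mono) (auto simp: power2_eq_square)
      also have "((\<omega> N q)\<^sup>2 - (\<omega> N p)\<^sup>2) * p \<le> commutator_const * (\<omega> N p * \<omega> N q) * (q - p)"
        by (rule \<omega>_square_diff[OF pqr(1) F pq(2)])
      also have "\<dots> \<le> commutator_const * (\<omega> N p * \<omega> N q) * r" using tri nn cc by (intro mult_left_mono) auto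
      finally show ?thesis by (simp add: algebra_simps)
    qed
    moreover have "0 \<le> ?D * (?Y + ?Z)" using XYZ by (intro mult_nonneg_nonneg) auto
    ultimately show ?thesis by linarith
  qed
  also have "\<dots> \<le> (?D + commutator_const + 1) * (?Y + ?Z) + (?D + commutator_const + 1) * ?X"
    using XYZ cc by (intro add_mono mult_right_mono) auto
  finally show ?thesis by (simp add: algebra_simps)
qed

end

section \<open>The kernels of the b-family\<close>

definition \<alpha> :: "real \<Rightarrow> real" where "\<alpha> \<xi> = japanese \<xi> powr (1 - s)"

lemma l2_weight: "l2_weight \<alpha>"
proof
  show "\<alpha> \<in> borel_measurable borel" unfolding \<alpha>_def by measurable
  show "0 \<le> \<alpha> \<xi>" for \<xi> by (simp add: \<alpha>_def)
  show "\<alpha> \<xi> \<le> 1" for \<xi>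
    unfolding \<alpha>_def using powr_mono2'[of "1 - s" 1 "japanese \<xi>"] s japanese_ge_1[of \<xi>] by simp
  have "(\<lambda>\<xi>. (\<alpha> \<xi>)\<^sup>2) = (\<lambda>\<xi>. (1 + \<xi>\<^sup>2) powr (- (s - 1)))"
  proof
    fix \<xi>
    have "(1 - s) / 2 + (1 - s) / 2 = - (s - 1)" by simp
    then show "(\<alpha> \<xi>)\<^sup>2 = (1 + \<xi>\<^sup>2) powr (- (s - 1))"
      by (simp only: \<alpha>_def japanese_powr power2_eq_square[of "_ powr _"] powr_add[symmetric])
  qed
  then show "integrable lborel (\<lambda>\<xi>. (\<alpha> \<xi>)\<^sup>2)" using integrable_weight[of "s - 1"] s by simp
qed

sublocale l2_weight \<alpha> by (rule l2_weight)

text \<open>\<open>smooth_part\<close> is the symbol of the nonlocal term.  The transport term \<open>u u\<^sub>x\<close> has the symbol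
  \<open>\<i> \<eta>\<close>, or \<open>\<i> \<xi> / 2\<close> after symmetrisation.\<close>

definition weight_factor :: "real \<Rightarrow> real \<Rightarrow> real" where
  "weight_factor \<xi> \<eta> = 1 / sqrt (2 * pi) * (japanese \<xi> powr (s - 1) * japanese (\<xi> - \<eta>) powr (- s) * japanese \<eta> powr (- s))"

definition smooth_part :: "real \<Rightarrow> real \<Rightarrow> real" where
  "smooth_part \<xi> \<eta> = \<xi> / 2 * (b + (b - 3) * ((\<xi> - \<eta>) * \<eta>)) / (1 + \<xi>\<^sup>2)"

definition \<kappa>_sym :: "real \<Rightarrow> real \<Rightarrow> real" where
  "\<kappa>_sym \<xi> \<eta> = - weight_factor \<xi> \<eta> * (\<xi> / 2 + smooth_part \<xi> \<eta>)"

text \<open>Both kernels give the same quadratic map, \<open>Q_eq_asym\<close>. The symmetric one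
  makes \<open>Q\<close> commutative and serves the estimate of differences. Here the derivative of
  the transport term sits on a single factor, so that exchanging \<open>\<xi>\<close> and
  \<open>\<eta>\<close> produces exactly the expression in \<open>commutator_symbol\<close>.\<close>

definition \<kappa>_asym :: "real \<Rightarrow> real \<Rightarrow> real" where
  "\<kappa>_asym \<xi> \<eta> = - weight_factor \<xi> \<eta> * (\<eta> + smooth_part \<xi> \<eta>)"

definition \<beta> :: real where "\<beta> = \<bar>b\<bar> + \<bar>b - 3\<bar>"

lemma \<beta>_nonneg: "0 \<le> \<beta>" by (simp add: \<beta>_def)

lemma inv_sqrt_2pi: "0 < 1 / sqrt (2 * pi)" "1 / sqrt (2 * pi) \<le> 1"
  using pi_gt3 by (auto simp: divide_le_eq real_le_rsqrt)

text \<open>Of the two powers gained by the division by \<open>1 + \<xi>\<^sup>2\<close>, one pays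
  for the outer factor \<open>\<xi>\<close> and one is left over as
  \<open>1 / japanese \<xi>\<close>. The inner derivatives fall once on each factor.\<close>

lemma smooth_part_le:
  "\<bar>smooth_part \<xi> \<eta>\<bar> \<le> \<beta> * (japanese (\<xi> - \<eta>) * japanese \<eta>) / japanese \<xi>"
proof -
  let ?p = "japanese \<xi>" and ?q = "japanese \<eta>" and ?r = "japanese (\<xi> - \<eta>)"
  have rq: "1 \<le> ?r * ?q" using mult_mono[of 1 ?r 1 ?q] japanese_ge_1[of "\<xi> - \<eta>"] japanese_ge_1[of \<eta>] by simp
  have "\<bar>b + (b - 3) * ((\<xi> - \<eta>) * \<eta>)\<bar> \<le> \<bar>b\<bar> * 1 + \<bar>b - 3\<bar> * (\<bar>\<xi> - \<eta>\<bar> * \<bar>\<eta>\<bar>)"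
    by (rule order_trans[OF abs_triangle_ineq]) (simp add: abs_mult)
  also have "\<dots> \<le> \<bar>b\<bar> * (?r * ?q) + \<bar>b - 3\<bar> * (?r * ?q)"
    using rq by (intro add_mono mult_left_mono mult_mono abs_le_japanese) (auto simp: less_imp_le)
  finally have 1: "\<bar>b + (b - 3) * ((\<xi> - \<eta>) * \<eta>)\<bar> \<le> \<beta> * (?r * ?q)" by (simp add: \<beta>_def distrib_right)
  have "\<bar>smooth_part \<xi> \<eta>\<bar> = (\<bar>\<xi>\<bar> / 2) * \<bar>b + (b - 3) * ((\<xi> - \<eta>) * \<eta>)\<bar> / ?p\<^sup>2"
    by (simp add: smooth_part_def japanese_square abs_mult abs_divide)
  also have "\<dots> \<le> ?p * (\<beta> * (?r * ?q)) / ?p\<^sup>2"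
  proof (intro divide_right_mono mult_mono 1)
    show "\<bar>\<xi>\<bar> / 2 \<le> ?p" using abs_le_japanese[of \<xi>] by linarith
  qed auto
  also have "\<dots> = \<beta> * (?r * ?q) / ?p" by (simp add: power2_eq_square)
  finally show ?thesis .
qed

lemma weight_factor_nonneg: "0 \<le> weight_factor \<xi> \<eta>"
  by (simp add: weight_factor_def)

text \<open>The power s - 1 of \<open>japanese \<xi>\<close> is at most a multiple of the sum of
  those of \<open>japanese \<eta>\<close> and \<open>japanese (\<xi> - \<eta>)\<close>, and each
  summand cancels one of the two weights \<open>\<alpha>\<close>. This is the algebra property of
  H^(s-1) on the level of kernels.\<close>

lemma weight_factor_le:
  "weight_factor \<xi> \<eta> * (japanese (\<xi> - \<eta>) * japanese \<eta>) \<le> 2 powr (s - 1) * (\<alpha> (\<xi> - \<eta>) + \<alpha> \<eta>)"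
proof -
  let ?p = "japanese \<xi>" and ?q = "japanese \<eta>" and ?r = "japanese (\<xi> - \<eta>)"
  have e: "?r powr (- s) * ?r = ?r powr (1 - s)" "?q powr (- s) * ?q = ?q powr (1 - s)"
    using powr_add[of ?r "- s" 1] powr_add[of ?q "- s" 1] by (simp_all add: abs_of_pos add.commute)
  have "weight_factor \<xi> \<eta> * (?r * ?q) = 1 / sqrt (2 * pi) * (?p powr (s - 1) * (?r powr (1 - s) * ?q powr (1 - s)))"
    unfolding weight_factor_def e[symmetric] by (simp only: mult_ac)
  also have "\<dots> \<le> 1 * ((2 powr (s - 1) * (?q powr (s - 1) + ?r powr (s - 1))) * (?r powr (1 - s) * ?q powr (1 - s)))"
    using inv_sqrt_2pi s japanese_triangle(1)[of \<xi> \<eta>]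
    by (intro mult_mono mult_right_mono powr_quasi_triangle) auto
  also have "\<dots> = 2 powr (s - 1) * ((?q powr (s - 1) * ?q powr (1 - s)) * ?r powr (1 - s) + (?r powr (s - 1) * ?r powr (1 - s)) * ?q powr (1 - s))"
    by (simp add: algebra_simps)
  also have "\<dots> = 2 powr (s - 1) * (\<alpha> (\<xi> - \<eta>) + \<alpha> \<eta>)"
    by (simp add: powr_add[symmetric] \<alpha>_def less_imp_neq[OF japanese_pos, symmetric])
  finally show ?thesis .
qed

lemma weight_factor_minus: "weight_factor (- \<xi>) (- \<eta>) = weight_factor \<xi> \<eta>"
proof -
  have "japanese (- \<xi> - - \<eta>) = japanese (\<xi> - \<eta>)" using japanese_minus[of "\<xi> - \<eta>"] by simp
  then show ?thesis by (simp add: weight_factor_def)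
qed

lemma japanese_product_ge_1: "1 \<le> japanese (\<xi> - \<eta>) * japanese \<eta>"
  using mult_mono[of 1 "japanese (\<xi> - \<eta>)" 1 "japanese \<eta>"] japanese_ge_1[of "\<xi> - \<eta>"] japanese_ge_1[of \<eta>] by simp

text \<open>A symbol with at most one derivative on each factor maps two functions in H^s into
  H^(s-1), because H^(s-1) is an algebra.\<close>

lemma kernel_of_symbol:
  assumes [measurable]: "(\<lambda>(\<xi>, \<eta>). t \<xi> \<eta>) \<in> borel_measurable (borel \<Otimes>\<^sub>M borel)"
    and odd: "\<And>\<xi> \<eta>. t (- \<xi>) (- \<eta>) = - t \<xi> \<eta>" and D: "0 \<le> D"
    and le: "\<And>\<xi> \<eta>. \<bar>t \<xi> \<eta>\<bar> \<le> D * (japanese (\<xi> - \<eta>) * japanese \<eta>)"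
  shows "kernel (\<lambda>\<xi> \<eta>. weight_factor \<xi> \<eta> * t \<xi> \<eta>)"
  unfolding kernel_def
proof (intro conjI allI exI)
  show "(\<lambda>(\<xi>, \<eta>). weight_factor \<xi> \<eta> * t \<xi> \<eta>) \<in> borel_measurable (borel \<Otimes>\<^sub>M borel)"
    unfolding weight_factor_def by measurable
  show "weight_factor (- \<xi>) (- \<eta>) * t (- \<xi>) (- \<eta>) = - (weight_factor \<xi> \<eta> * t \<xi> \<eta>)" for \<xi> \<eta>
    unfolding odd weight_factor_minus by simp
  show "0 \<le> D * 2 powr (s - 1)" using D by simp
  show "\<bar>weight_factor \<xi> \<eta> * t \<xi> \<eta>\<bar> \<le> D * 2 powr (s - 1) * (\<alpha> \<xi> + \<alpha> (\<xi> - \<eta>) + \<alpha> \<eta>)" for \<xi> \<eta>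
  proof -
    have "\<bar>weight_factor \<xi> \<eta> * t \<xi> \<eta>\<bar> \<le> weight_factor \<xi> \<eta> * (D * (japanese (\<xi> - \<eta>) * japanese \<eta>))"
      unfolding abs_mult using weight_factor_nonneg[of \<xi> \<eta>] le by (simp add: mult_left_mono)
    also have "\<dots> = D * (weight_factor \<xi> \<eta> * (japanese (\<xi> - \<eta>) * japanese \<eta>))" by (simp only: mult_ac)
    also have "\<dots> \<le> D * (2 powr (s - 1) * (\<alpha> (\<xi> - \<eta>) + \<alpha> \<eta>))"
      using D by (intro mult_left_mono weight_factor_le) auto
    also have "\<dots> \<le> D * (2 powr (s - 1) * (\<alpha> \<xi> + \<alpha> (\<xi> - \<eta>) + \<alpha> \<eta>))"
      using D \<alpha>_nonneg[of \<xi>] by (intro mult_left_mono) auto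
    finally show ?thesis by (simp add: mult.assoc)
  qed
qed

lemma kernel_transport:
  assumes [measurable]: "(\<lambda>(\<xi>, \<eta>). t \<xi> \<eta>) \<in> borel_measurable (borel \<Otimes>\<^sub>M borel)"
    and odd: "\<And>\<xi> \<eta>. t (- \<xi>) (- \<eta>) = - t \<xi> \<eta>"
    and le: "\<And>\<xi> \<eta>. \<bar>t \<xi> \<eta>\<bar> \<le> japanese (\<xi> - \<eta>) * japanese \<eta>"
  shows "kernel (\<lambda>\<xi> \<eta>. - weight_factor \<xi> \<eta> * (t \<xi> \<eta> + smooth_part \<xi> \<eta>))"
proof -
  have "kernel (\<lambda>\<xi> \<eta>. weight_factor \<xi> \<eta> * - (t \<xi> \<eta> + smooth_part \<xi> \<eta>))"
  proof (rule kernel_of_symbol)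
    show "(\<lambda>(\<xi>, \<eta>). - (t \<xi> \<eta> + smooth_part \<xi> \<eta>)) \<in> borel_measurable (borel \<Otimes>\<^sub>M borel)"
      unfolding smooth_part_def by measurable
    show "- (t (- \<xi>) (- \<eta>) + smooth_part (- \<xi>) (- \<eta>)) = - (- (t \<xi> \<eta> + smooth_part \<xi> \<eta>))" for \<xi> \<eta>
    proof -
      have "(- \<xi> - - \<eta>) * - \<eta> = (\<xi> - \<eta>) * \<eta>" by (simp add: algebra_simps)
      then have "smooth_part (- \<xi>) (- \<eta>) = - smooth_part \<xi> \<eta>" unfolding smooth_part_def by simp
      then show ?thesis unfolding odd by simp
    qed
    show "0 \<le> 1 + \<beta>" using \<beta>_nonneg by simp
    show "\<bar>- (t \<xi> \<eta> + smooth_part \<xi> \<eta>)\<bar> \<le> (1 + \<beta>) * (japanese (\<xi> - \<eta>) * japanese \<eta>)" for \<xi> \<eta>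
    proof -
      let ?rq = "japanese (\<xi> - \<eta>) * japanese \<eta>"
      have "\<beta> * ?rq / japanese \<xi> \<le> \<beta> * ?rq / 1"
        using japanese_ge_1[of \<xi>] \<beta>_nonneg japanese_product_ge_1[of \<xi> \<eta>] by (intro divide_left_mono) auto
      then show ?thesis
        using le[of \<xi> \<eta>] smooth_part_le[of \<xi> \<eta>] abs_triangle_ineq[of "t \<xi> \<eta>" "smooth_part \<xi> \<eta>"]
        unfolding abs_minus_cancel distrib_right by linarith
    qed
  qed
  then show ?thesis by (simp only: mult_minus_left mult_minus_right)
qed

lemma half_le_japanese_product: "\<bar>\<xi> / 2\<bar> \<le> japanese (\<xi> - \<eta>) * japanese \<eta>"
proof -
  let ?q = "japanese \<eta>" and ?r = "japanese (\<xi> - \<eta>)"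
  have "0 \<le> (?r - 1) * (?q - 1)" using japanese_ge_1 by (intro mult_nonneg_nonneg) auto
  then have "?r + ?q \<le> ?r * ?q + 1" by (simp add: algebra_simps)
  then have "?r + ?q \<le> 2 * (?r * ?q)" using japanese_product_ge_1[of \<xi> \<eta>] by simp
  then show ?thesis using abs_le_japanese[of \<xi>] japanese_triangle(1)[of \<xi> \<eta>] by simp
qed

lemma kernel_sym: "kernel \<kappa>_sym"
  unfolding \<kappa>_sym_def[abs_def] by (intro kernel_transport half_le_japanese_product) auto

lemma kernel_asym: "kernel \<kappa>_asym"
proof -
  have "\<bar>\<eta>\<bar> \<le> japanese (\<xi> - \<eta>) * japanese \<eta>" for \<xi> \<eta>
    using mult_mono[of 1 "japanese (\<xi> - \<eta>)" "\<bar>\<eta>\<bar>" "japanese \<eta>"] japanese_ge_1[of "\<xi> - \<eta>"] abs_le_japanese[of \<eta>] by simp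
  then show ?thesis unfolding \<kappa>_asym_def[abs_def] by (intro kernel_transport) auto
qed

definition Q :: "l2h \<Rightarrow> l2h \<Rightarrow> l2h" where "Q = bil \<kappa>_sym"

lemma conv_swap:
  assumes \<kappa>: "kernel \<kappa>"
  shows "conv \<kappa> f g \<xi> = conv (\<lambda>\<xi> \<eta>. \<kappa> \<xi> (\<xi> - \<eta>)) g f \<xi>"
  unfolding conv_def
  using lborel_integral_real_affine[of "-1" "\<lambda>\<eta>. complex_of_real (\<kappa> \<xi> \<eta>) * f (\<xi> - \<eta>) * g \<eta>" \<xi>]
  by (simp add: mult_ac)

lemma weight_factor_swap: "weight_factor \<xi> (\<xi> - \<eta>) = weight_factor \<xi> \<eta>"
  by (simp add: weight_factor_def mult_ac)

lemma smooth_part_swap: "smooth_part \<xi> (\<xi> - \<eta>) = smooth_part \<xi> \<eta>"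
  by (simp add: smooth_part_def mult.commute)

lemma Q_commute: "Q x y = Q y x"
proof -
  have "(\<lambda>\<xi> \<eta>. \<kappa>_sym \<xi> (\<xi> - \<eta>)) = \<kappa>_sym"
    by (simp add: \<kappa>_sym_def fun_eq_iff weight_factor_swap smooth_part_swap)
  then have "conv \<kappa>_sym (hat x) (hat y) = conv \<kappa>_sym (hat y) (hat x)"
    using conv_swap[OF kernel_sym, of "hat x" "hat y"] by (simp add: fun_eq_iff)
  then show ?thesis by (simp add: Q_def bil_def)
qed

lemma Q_eq_asym: "Q x x = bil \<kappa>_asym x x"
proof -
  let ?f = "\<lambda>\<xi> \<eta>. complex_of_real (\<kappa>_asym \<xi> \<eta>) * hat x (\<xi> - \<eta>) * hat x \<eta>"
  let ?g = "\<lambda>\<xi> \<eta>. complex_of_real (\<kappa>_sym \<xi> \<eta>) * hat x (\<xi> - \<eta>) * hat x \<eta>"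
  have "(LINT \<eta>|lborel. ?f \<xi> \<eta>) = (LINT \<eta>|lborel. ?g \<xi> \<eta>)" for \<xi>
  proof (rule integral_symmetrize[of _ \<xi>])
    show "integrable lborel (?f \<xi>)" by (rule conv_integrable[OF kernel_asym])
    fix \<eta>
    have k: "\<kappa>_asym \<xi> \<eta> + \<kappa>_asym \<xi> (\<xi> - \<eta>) = 2 * \<kappa>_sym \<xi> \<eta>"
      unfolding \<kappa>_asym_def \<kappa>_sym_def weight_factor_swap smooth_part_swap by (simp add: algebra_simps)
    have "?f \<xi> \<eta> + ?f \<xi> (\<xi> - \<eta>) = complex_of_real (\<kappa>_asym \<xi> \<eta> + \<kappa>_asym \<xi> (\<xi> - \<eta>)) * hat x (\<xi> - \<eta>) * hat x \<eta>"
      by (simp add: algebra_simps)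
    then show "?f \<xi> \<eta> + ?f \<xi> (\<xi> - \<eta>) = 2 * ?g \<xi> \<eta>" unfolding k by simp
  qed
  then have "conv \<kappa>_asym (hat x) (hat x) = conv \<kappa>_sym (hat x) (hat x)" by (simp add: conv_def fun_eq_iff)
  then show ?thesis by (simp add: Q_def bil_def)
qed

end

section \<open>Symbols of the difference estimate and of the energy estimate\<close>

context b_family
begin

lemma powr_neg_le_1: "a \<le> 0 \<Longrightarrow> japanese \<xi> powr a \<le> 1"
  using powr_mono2'[of a 1 "japanese \<xi>"] japanese_ge_1[of \<xi>] by simp

lemma even_bounded_powr: "a \<le> 0 \<Longrightarrow> even_bounded (\<lambda>\<xi>. japanese \<xi> powr a)"
  by (rule even_boundedI[where M = 1]) (simp_all add: powr_neg_le_1)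

definition cut :: "nat \<Rightarrow> real \<Rightarrow> real" where "cut n \<xi> = (if \<bar>\<xi>\<bar> \<le> real n then 1 else 0)"

lemma even_bounded_cut: "even_bounded (cut n)"
  by (rule even_boundedI[where M = 1]) (simp_all add: cut_def[abs_def])

lemma even_bounded_cut_japanese: "even_bounded (\<lambda>\<xi>. cut n \<xi> * japanese \<xi>)"
proof (rule even_boundedI[where M = "1 + real n"])
  show "\<bar>cut n \<xi> * japanese \<xi>\<bar> \<le> 1 + real n" for \<xi>
    using japanese_lipschitz[of \<xi> 0] by (auto simp: cut_def japanese_def[of 0] less_imp_le)
qed (simp_all add: cut_def[abs_def])

text \<open>The shift by one makes the threshold at least 1 and gives \<open>M 0 \<xi> = 1\<close>,
  since \<langle>\<xi>\<rangle> \<ge> 1: the tail of index 0 is the whole squared norm.\<close>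

definition M :: "nat \<Rightarrow> real \<Rightarrow> real" where "M n \<xi> = \<mu> (real n + 1) (japanese \<xi>)"

lemma M_bounds: "0 \<le> M n \<xi>" "M n \<xi> \<le> 1"
  using \<mu>_nonneg[of "real n + 1" "japanese \<xi>"] \<mu>_le_1[of "real n + 1" "japanese \<xi>"] by (simp_all add: M_def less_imp_le)

lemma even_bounded_M: "even_bounded (M n)"
  by (rule even_boundedI[where M = 1]) (use M_bounds in \<open>simp_all add: M_def[abs_def] \<mu>_def\<close>)

lemma even_bounded_M2: "even_bounded (\<lambda>\<xi>. (M n \<xi>)\<^sup>2)"
  using even_bounded_mult[OF even_bounded_M even_bounded_M, of n] by (simp add: power2_eq_square)

text \<open>The part of \<open>weight_factor\<close> that is invariant under the exchange of
  \<open>\<xi>\<close> and \<open>\<eta>\<close>. It factors out of every antisymmetrised kernel and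
  leaves a power of \<open>japanese \<xi>\<close>.\<close>

definition sym_weight :: "real \<Rightarrow> real \<Rightarrow> real" where
  "sym_weight \<xi> \<eta> = 1 / sqrt (2 * pi) * (japanese \<xi> powr (- s) * japanese \<eta> powr (- s) * japanese (\<xi> - \<eta>) powr (- s))"

lemma japanese_diff_commute: "japanese (\<eta> - \<xi>) = japanese (\<xi> - \<eta>)"
  using japanese_minus[of "\<xi> - \<eta>"] by simp

lemma sym_weight_commute: "sym_weight \<eta> \<xi> = sym_weight \<xi> \<eta>"
  by (simp add: sym_weight_def japanese_diff_commute[of \<eta>] mult_ac)

lemma sym_weight_nonneg: "0 \<le> sym_weight \<xi> \<eta>"
  by (simp add: sym_weight_def)

lemma weight_factor_eq: "weight_factor \<xi> \<eta> = sym_weight \<xi> \<eta> * japanese \<xi> powr (2 * s - 1)"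
proof -
  have "japanese \<xi> powr (s - 1) = japanese \<xi> powr (- s) * japanese \<xi> powr (2 * s - 1)"
    by (simp add: powr_add[symmetric])
  then show ?thesis by (simp add: weight_factor_def sym_weight_def mult_ac)
qed

text \<open>The power of \<open>p\<close> has to be shared equally between \<open>p\<close> and
  \<open>q\<close>. If \<open>p \<le> 4 * q\<close>, half of it is simply passed on to
  \<open>q\<close>. Otherwise \<open>p \<le> 2 * r\<close> and \<open>q \<le> r\<close>; half of it
  goes to \<open>r\<close>, and \<open>r powr (3/2 - s) \<le> q powr (3/2 - s)\<close> passes it
  back to \<open>q\<close>, as the exponent is negative. This is the point at which H^(1/2) and s >
  3/2 fit together.\<close>

lemma low_symbol_half:
  fixes p q r :: real
  assumes "1 \<le> p" "1 \<le> q" "1 \<le> r" "p \<le> q + r"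
  shows "r * p \<le> 2 * (p powr (1/2) * q powr (1/2) * (r powr s * (r powr (1 - s) + q powr (1 - s))))"
proof -
  have r1: "r powr s * r powr (1 - s) = r" using assms by (simp add: powr_add[symmetric])
  have pp: "p = p powr (1/2) * p powr (1/2)" using assms by (simp add: powr_add[symmetric])
  show ?thesis
  proof (cases "p \<le> 4 * q")
    case True
    then have "p powr (1/2) \<le> (4 * q) powr (1/2)" using assms by (intro powr_mono2) auto
    also have "\<dots> = 2 * q powr (1/2)" using assms by (simp add: powr_mult powr_half_sqrt)
    finally have "r * (p powr (1/2) * p powr (1/2)) \<le> r * (p powr (1/2) * (2 * q powr (1/2)))"
      using assms by (intro mult_left_mono) auto
    also have "\<dots> = 2 * (p powr (1/2) * q powr (1/2) * (r powr s * r powr (1 - s)))" by (simp add: r1)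
    also have "\<dots> \<le> 2 * (p powr (1/2) * q powr (1/2) * (r powr s * (r powr (1 - s) + q powr (1 - s))))"
      by (intro mult_left_mono) auto
    finally show ?thesis using pp by simp
  next
    case False
    then have pr: "p \<le> 2 * r" "q \<le> r" using assms by auto
    have "p powr (1/2) \<le> (2 * r) powr (1/2)" using assms pr by (intro powr_mono2) auto
    also have "\<dots> = sqrt 2 * r powr (1/2)" using assms by (simp add: powr_mult powr_half_sqrt)
    also have "\<dots> \<le> 2 * r powr (1/2)" using sqrt2_less_2 by (intro mult_right_mono) auto
    finally have "r * (p powr (1/2) * p powr (1/2)) \<le> r * (p powr (1/2) * (2 * r powr (1/2)))"
      using assms by (intro mult_left_mono) auto
    also have "\<dots> = 2 * (p powr (1/2) * (r * r powr (1/2)))" by simp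
    also have "r * r powr (1/2) = r powr s * r powr (3/2 - s)"
      using assms powr_add[of r 1 "1/2"] by (simp add: powr_add[symmetric])
    also have "2 * (p powr (1/2) * (r powr s * r powr (3/2 - s))) \<le> 2 * (p powr (1/2) * (r powr s * q powr (3/2 - s)))"
      using assms pr s by (intro mult_left_mono powr_mono2') auto
    also have "q powr (3/2 - s) = q powr (1/2) * q powr (1 - s)" by (simp add: powr_add[symmetric])
    also have "2 * (p powr (1/2) * (r powr s * (q powr (1/2) * q powr (1 - s)))) = 2 * (p powr (1/2) * q powr (1/2) * (r powr s * q powr (1 - s)))"
      by (simp only: mult_ac)
    also have "\<dots> \<le> 2 * (p powr (1/2) * q powr (1/2) * (r powr s * (r powr (1 - s) + q powr (1 - s))))"
      by (intro mult_left_mono) auto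
    finally show ?thesis using pp by simp
  qed
qed

text \<open>The multiplier \<open>m\<close> of \<open>K (J w)\<close> reduces the kernel to
  \<open>sym_weight\<close> times one factor \<open>japanese \<xi>\<close>. For the transport term
  the antisymmetrised symbol is half of \<open>?p * \<xi> - ?q * \<eta>\<close>, which is of size
  \<open>?r * (?p + ?q)\<close> and no longer quadratic in \<open>?p\<close> and \<open>?q\<close>.
  The nonlocal terms have this size individually.\<close>

lemma low_symbol:
  defines "m \<equiv> \<lambda>\<xi>. japanese \<xi> powr (2 - 2 * s)" and "\<nu> \<equiv> \<lambda>\<xi>. japanese \<xi> powr (1/2 - s)"
  shows "\<bar>m \<xi> * \<kappa>_sym \<xi> \<eta> - m \<eta> * \<kappa>_sym \<eta> \<xi>\<bar> \<le> (4 * (1 + \<beta>)) * (\<alpha> \<xi> + \<alpha> (\<xi> - \<eta>) + \<alpha> \<eta>) * (\<nu> \<xi> * \<nu> \<eta>)"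
proof -
  let ?p = "japanese \<xi>" and ?q = "japanese \<eta>" and ?r = "japanese (\<xi> - \<eta>)" and ?g = "sym_weight \<xi> \<eta>"
  have ge: "1 \<le> ?p" "1 \<le> ?q" "1 \<le> ?r" by (rule japanese_ge_1)+
  have mk: "m \<xi> * \<kappa>_sym \<xi> \<eta> = - sym_weight \<xi> \<eta> * (japanese \<xi> * (\<xi> / 2 + smooth_part \<xi> \<eta>))" for \<xi> \<eta>
  proof -
    have "japanese \<xi> powr (2 - 2 * s) * japanese \<xi> powr (2 * s - 1) = japanese \<xi> powr 1"
      by (simp add: powr_add[symmetric])
    then have "japanese \<xi> powr (2 - 2 * s) * japanese \<xi> powr (2 * s - 1) = japanese \<xi>" by (simp add: less_imp_le)
    moreover have "m \<xi> * \<kappa>_sym \<xi> \<eta> = - sym_weight \<xi> \<eta> * ((japanese \<xi> powr (2 - 2 * s) * japanese \<xi> powr (2 * s - 1)) * (\<xi> / 2 + smooth_part \<xi> \<eta>))"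
      unfolding m_def \<kappa>_sym_def weight_factor_eq by (simp only: mult_ac mult_minus_left mult_minus_right)
    ultimately show ?thesis by (simp only:)
  qed
  have "m \<xi> * \<kappa>_sym \<xi> \<eta> - m \<eta> * \<kappa>_sym \<eta> \<xi> = - (?g * ((?p * \<xi> - ?q * \<eta>) / 2 + (?p * smooth_part \<xi> \<eta> - ?q * smooth_part \<eta> \<xi>)))"
    unfolding mk sym_weight_commute[of \<eta> \<xi>] by (simp add: algebra_simps diff_divide_distrib)
  then have "\<bar>m \<xi> * \<kappa>_sym \<xi> \<eta> - m \<eta> * \<kappa>_sym \<eta> \<xi>\<bar> = ?g * \<bar>(?p * \<xi> - ?q * \<eta>) / 2 + (?p * smooth_part \<xi> \<eta> - ?q * smooth_part \<eta> \<xi>)\<bar>"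
    using sym_weight_nonneg[of \<xi> \<eta>] by (simp add: abs_mult)
  also have "\<dots> \<le> ?g * ((1 + \<beta>) * (?r * ?p + ?r * ?q))"
  proof (rule mult_left_mono[OF _ sym_weight_nonneg])
    have "?p * \<xi> - ?q * \<eta> = ?p * (\<xi> - \<eta>) + (?p - ?q) * \<eta>" by (simp add: algebra_simps)
    then have "\<bar>?p * \<xi> - ?q * \<eta>\<bar> \<le> ?p * \<bar>\<xi> - \<eta>\<bar> + \<bar>?p - ?q\<bar> * \<bar>\<eta>\<bar>"
      using abs_triangle_ineq[of "?p * (\<xi> - \<eta>)" "(?p - ?q) * \<eta>"] by (simp add: abs_mult)
    also have "\<dots> \<le> ?p * ?r + ?r * ?q"
      by (intro add_mono mult_left_mono mult_mono abs_le_japanese japanese_triangle) (auto simp: less_imp_le)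
    finally have 1: "\<bar>?p * \<xi> - ?q * \<eta>\<bar> \<le> ?r * ?p + ?r * ?q" by (simp add: mult.commute)
    have "?p * \<bar>smooth_part \<xi> \<eta>\<bar> \<le> ?p * (\<beta> * (?r * ?q) / ?p)" by (intro mult_left_mono smooth_part_le) (simp add: less_imp_le)
    then have 2: "\<bar>?p * smooth_part \<xi> \<eta>\<bar> \<le> \<beta> * (?r * ?q)" by (simp add: abs_mult)
    have "?q * \<bar>smooth_part \<eta> \<xi>\<bar> \<le> ?q * (\<beta> * (?r * ?p) / ?q)"
      using smooth_part_le[of \<eta> \<xi>] by (intro mult_left_mono) (simp_all add: less_imp_le japanese_diff_commute[of \<eta>])
    then have 3: "\<bar>?q * smooth_part \<eta> \<xi>\<bar> \<le> \<beta> * (?r * ?p)" by (simp add: abs_mult)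
    have 4: "0 \<le> ?r * ?p + ?r * ?q" by (simp add: less_imp_le)
    have aux: "\<bar>a / 2 + (c - d)\<bar> \<le> X + (Y + Z)" if "\<bar>a\<bar> \<le> X" "\<bar>c\<bar> \<le> Y" "\<bar>d\<bar> \<le> Z" "0 \<le> X" for a c d X Y Z :: real
      using that by linarith
    have "\<bar>(?p * \<xi> - ?q * \<eta>) / 2 + (?p * smooth_part \<xi> \<eta> - ?q * smooth_part \<eta> \<xi>)\<bar> \<le> (?r * ?p + ?r * ?q) + (\<beta> * (?r * ?q) + \<beta> * (?r * ?p))"
      by (rule aux[OF 1 2 3 4])
    then show "\<bar>(?p * \<xi> - ?q * \<eta>) / 2 + (?p * smooth_part \<xi> \<eta> - ?q * smooth_part \<eta> \<xi>)\<bar> \<le> (1 + \<beta>) * (?r * ?p + ?r * ?q)"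
      by (simp add: algebra_simps)
  qed
  also have "\<dots> \<le> ?g * ((1 + \<beta>) * (2 * (?p powr (1/2) * ?q powr (1/2) * (?r powr s * (?r powr (1 - s) + ?q powr (1 - s))))
      + 2 * (?q powr (1/2) * ?p powr (1/2) * (?r powr s * (?r powr (1 - s) + ?p powr (1 - s))))))"
    using \<beta>_nonneg ge japanese_triangle[of \<xi> \<eta>] by (intro mult_left_mono[OF _ sym_weight_nonneg] mult_left_mono add_mono low_symbol_half) auto
  also have "\<dots> = (1 + \<beta>) * 2 * (?g * (?p powr (1/2) * ?q powr (1/2) * ?r powr s)) * (2 * ?r powr (1 - s) + ?q powr (1 - s) + ?p powr (1 - s))"
    by (simp add: algebra_simps)
  also have "?g * (?p powr (1/2) * ?q powr (1/2) * ?r powr s) = 1 / sqrt (2 * pi) * (\<nu> \<xi> * \<nu> \<eta>)"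
  proof -
    have "?p powr (- s) * ?p powr (1/2) = \<nu> \<xi>" "?q powr (- s) * ?q powr (1/2) = \<nu> \<eta>" "?r powr (- s) * ?r powr s = 1"
      unfolding \<nu>_def by (simp_all add: powr_add[symmetric] less_imp_neq[OF japanese_pos, symmetric])
    moreover have "?g * (?p powr (1/2) * ?q powr (1/2) * ?r powr s) = 1 / sqrt (2 * pi) * ((?p powr (- s) * ?p powr (1/2)) * (?q powr (- s) * ?q powr (1/2)) * (?r powr (- s) * ?r powr s))"
      unfolding sym_weight_def by (simp only: mult_ac)
    ultimately show ?thesis by (simp only: mult_1_right)
  qed
  also have "(1 + \<beta>) * 2 * (1 / sqrt (2 * pi) * (\<nu> \<xi> * \<nu> \<eta>)) * (2 * ?r powr (1 - s) + ?q powr (1 - s) + ?p powr (1 - s))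
      \<le> (1 + \<beta>) * 2 * (1 * (\<nu> \<xi> * \<nu> \<eta>)) * (2 * (\<alpha> \<xi> + \<alpha> (\<xi> - \<eta>) + \<alpha> \<eta>))"
    using \<beta>_nonneg inv_sqrt_2pi by (intro mult_mono mult_left_mono mult_right_mono) (auto simp: \<alpha>_def \<nu>_def)
  also have "\<dots> = (4 * (1 + \<beta>)) * (\<alpha> \<xi> + \<alpha> (\<xi> - \<eta>) + \<alpha> \<eta>) * (\<nu> \<xi> * \<nu> \<eta>)" by (simp add: algebra_simps)
  finally show ?thesis .
qed

text \<open>No cancellation enters: the gain \<open>1 / p\<close> of \<open>smooth_part_le\<close>
  makes one weight into \<open>\<omega> N p / p\<close>, which is controlled by the same expression
  at the larger of \<open>q\<close> and \<open>r\<close>, because this is at least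
  \<open>p / 2\<close>.\<close>

lemma smooth_symbol:
  fixes N \<xi> \<eta> :: real
  assumes N: "1 \<le> N"
  defines "p \<equiv> japanese \<xi>" and "q \<equiv> japanese \<eta>" and "r \<equiv> japanese (\<xi> - \<eta>)"
  shows "(\<omega> N p)\<^sup>2 * \<bar>smooth_part \<xi> \<eta>\<bar> \<le> 2 powr s * \<beta> * (r * \<omega> N p * \<omega> N q + q * \<omega> N p * \<omega> N r)"
proof -
  have ge: "1 \<le> p" "1 \<le> q" "1 \<le> r" by (simp_all add: p_def q_def r_def japanese_ge_1)
  have nn: "0 \<le> \<omega> N p" "0 \<le> \<omega> N q" "0 \<le> \<omega> N r" using ge by (auto intro: \<omega>_nonneg[OF N])
  have half: "\<omega> N p / p \<le> 2 powr s * (\<omega> N x / x)" if x: "1 \<le> x" "p \<le> 2 * x" for x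
  proof -
    have e: "\<omega> N y / y = y powr (s - 1) * \<mu> N y" if "1 \<le> y" for y
      using that by (simp add: \<omega>_def powr_diff)
    have "p powr (s - 1) \<le> (2 * x) powr (s - 1)" using ge s x by (intro powr_mono2) auto
    also have "\<dots> = 2 powr (s - 1) * x powr (s - 1)" using x by (simp add: powr_mult)
    finally have "p powr (s - 1) * \<mu> N p \<le> (2 powr (s - 1) * x powr (s - 1)) * (2 * \<mu> N x)"
      using ge x by (intro mult_mono \<mu>_scale[OF N]) (auto simp: \<mu>_nonneg[OF N])
    also have "\<dots> = 2 powr s * (x powr (s - 1) * \<mu> N x)" by (simp add: powr_diff)
    finally show ?thesis using e ge x by simp
  qed
  have "p \<le> q + r" unfolding p_def q_def r_def by (rule japanese_triangle)
  then have "p \<le> 2 * q \<or> p \<le> 2 * r" by auto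
  then have "\<omega> N p / p \<le> 2 powr s * (\<omega> N q / q + \<omega> N r / r)"
  proof
    assume "p \<le> 2 * q"
    from half[OF ge(2) this] have "\<omega> N p / p \<le> 2 powr s * (\<omega> N q / q) + 0" by simp
    also have "\<dots> \<le> 2 powr s * (\<omega> N q / q) + 2 powr s * (\<omega> N r / r)" using nn ge by (intro add_left_mono) auto
    finally show ?thesis by (simp add: distrib_left)
  next
    assume "p \<le> 2 * r"
    from half[OF ge(3) this] have "\<omega> N p / p \<le> 0 + 2 powr s * (\<omega> N r / r)" by simp
    also have "\<dots> \<le> 2 powr s * (\<omega> N q / q) + 2 powr s * (\<omega> N r / r)" using nn ge by (intro add_right_mono) auto
    finally show ?thesis by (simp add: distrib_left)
  qed
  then have "\<omega> N p / p * (r * q) \<le> 2 powr s * (\<omega> N q / q + \<omega> N r / r) * (r * q)"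
    using ge by (intro mult_right_mono) auto
  also have "\<dots> = 2 powr s * (r * \<omega> N q + q * \<omega> N r)" using ge by (simp add: field_simps)
  finally have 1: "\<omega> N p / p * (r * q) \<le> 2 powr s * (r * \<omega> N q + q * \<omega> N r)" .
  have "(\<omega> N p)\<^sup>2 * \<bar>smooth_part \<xi> \<eta>\<bar> \<le> (\<omega> N p)\<^sup>2 * (\<beta> * (r * q) / p)"
    unfolding p_def q_def r_def by (intro mult_left_mono smooth_part_le) simp
  also have "\<dots> = \<beta> * \<omega> N p * (\<omega> N p / p * (r * q))" by (simp add: power2_eq_square)
  also have "\<dots> \<le> \<beta> * \<omega> N p * (2 powr s * (r * \<omega> N q + q * \<omega> N r))"
    using 1 \<beta>_nonneg nn by (intro mult_left_mono) auto
  finally show ?thesis by (simp add: algebra_simps)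
qed

definition energy_const :: real where
  "energy_const = 4 powr (s + 1) + commutator_const + 1 + 2 * (2 powr s * \<beta>)"

lemma energy_const_nonneg: "0 \<le> energy_const"
  unfolding energy_const_def commutator_const_def Let_def
  by (intro add_nonneg_nonneg mult_nonneg_nonneg \<beta>_nonneg) auto

text \<open>\<open>m\<close> is the symbol of \<open>L n\<close> composed with
  \<open>\<Theta> N\<close>. The factor \<langle>\<xi>\<rangle> of \<open>L n\<close> completes the
  power 2 s - 1 left by \<open>weight_factor_eq\<close> to 2 s, so
  \<open>m \<xi> * \<kappa>_asym \<xi> \<eta>\<close> becomes a squared weight
  \<open>\<omega>\<close> times the symbol. Where both cutoffs equal 1 they disappear from the
  antisymmetrised expression, which makes the bound independent of \<open>n\<close>.\<close>

lemma energy_symbol: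
  fixes n N :: nat and \<xi> \<eta> :: real
  defines "m \<equiv> \<lambda>\<xi>. cut n \<xi> * japanese \<xi> * (M N \<xi>)\<^sup>2"
  assumes cut: "cut n \<xi> \<noteq> 0" "cut n \<eta> \<noteq> 0"
  shows "\<bar>m \<xi> * \<kappa>_asym \<xi> \<eta> - m \<eta> * \<kappa>_asym \<eta> \<xi>\<bar> \<le>
    energy_const * (\<alpha> (\<xi> - \<eta>) * M N \<xi> * M N \<eta> + \<alpha> \<eta> * M N \<xi> * M N (\<xi> - \<eta>) + \<alpha> \<xi> * M N \<eta> * M N (\<xi> - \<eta>))"
proof -
  let ?N = "real N + 1"
  let ?w = "\<lambda>\<xi>. \<omega> ?N (japanese \<xi>)"
  let ?p = "japanese \<xi>" and ?q = "japanese \<eta>" and ?r = "japanese (\<xi> - \<eta>)" and ?g = "sym_weight \<xi> \<eta>"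
  have N: "1 \<le> ?N" by simp
  have cut1: "cut n \<xi> = 1" "cut n \<eta> = 1" using cut by (auto simp: cut_def split: if_splits)
  have w: "?w \<xi> = japanese \<xi> powr s * M N \<xi>" for \<xi> by (simp add: \<omega>_def M_def)
  have nn: "0 \<le> ?w \<xi>" for \<xi> by (rule \<omega>_nonneg[OF N]) (simp add: less_imp_le)
  have mk: "m \<xi> * \<kappa>_asym \<xi> \<eta> = - sym_weight \<xi> \<eta> * ((?w \<xi>)\<^sup>2 * (\<eta> + smooth_part \<xi> \<eta>))" if "cut n \<xi> = 1" for \<xi> \<eta>
  proof -
    have "japanese \<xi> * japanese \<xi> powr (2 * s - 1) = japanese \<xi> powr (1 + (2 * s - 1))"
      unfolding powr_add by (simp add: less_imp_le)
    also have "\<dots> = (japanese \<xi> powr s)\<^sup>2" by (simp add: power2_eq_square powr_add[symmetric])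
    finally have "japanese \<xi> * japanese \<xi> powr (2 * s - 1) * (M N \<xi>)\<^sup>2 = (?w \<xi>)\<^sup>2" by (simp add: w power_mult_distrib)
    moreover have "m \<xi> * \<kappa>_asym \<xi> \<eta> = - sym_weight \<xi> \<eta> * ((japanese \<xi> * japanese \<xi> powr (2 * s - 1) * (M N \<xi>)\<^sup>2) * (\<eta> + smooth_part \<xi> \<eta>))"
      unfolding m_def that \<kappa>_asym_def weight_factor_eq by (simp only: mult_ac mult_minus_left mult_minus_right mult_1_left mult_1_right)
    ultimately show ?thesis by (simp only:)
  qed
  have "m \<xi> * \<kappa>_asym \<xi> \<eta> - m \<eta> * \<kappa>_asym \<eta> \<xi> = - (?g * (((?w \<xi>)\<^sup>2 * \<eta> - (?w \<eta>)\<^sup>2 * \<xi>) + ((?w \<xi>)\<^sup>2 * smooth_part \<xi> \<eta> - (?w \<eta>)\<^sup>2 * smooth_part \<eta> \<xi>)))"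
    unfolding mk[OF cut1(1)] mk[OF cut1(2)] sym_weight_commute[of \<eta> \<xi>] by (simp add: algebra_simps)
  then have "\<bar>m \<xi> * \<kappa>_asym \<xi> \<eta> - m \<eta> * \<kappa>_asym \<eta> \<xi>\<bar> = ?g * \<bar>((?w \<xi>)\<^sup>2 * \<eta> - (?w \<eta>)\<^sup>2 * \<xi>) + ((?w \<xi>)\<^sup>2 * smooth_part \<xi> \<eta> - (?w \<eta>)\<^sup>2 * smooth_part \<eta> \<xi>)\<bar>"
    using sym_weight_nonneg[of \<xi> \<eta>] by (simp add: abs_mult)
  also have "\<dots> \<le> ?g * (energy_const * (?r * ?w \<xi> * ?w \<eta> + ?q * ?w \<xi> * ?w (\<xi> - \<eta>) + ?p * ?w \<eta> * ?w (\<xi> - \<eta>)))"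
  proof (rule mult_left_mono[OF _ sym_weight_nonneg])
    let ?X = "?r * ?w \<xi> * ?w \<eta>" and ?Y = "?q * ?w \<xi> * ?w (\<xi> - \<eta>)" and ?Z = "?p * ?w \<eta> * ?w (\<xi> - \<eta>)"
    have XYZ: "0 \<le> ?X" "0 \<le> ?Y" "0 \<le> ?Z" using nn by (simp_all add: less_imp_le)
    note 1 = commutator_symbol[OF N, of \<xi> \<eta>]
    have 2: "\<bar>(?w \<xi>)\<^sup>2 * smooth_part \<xi> \<eta>\<bar> \<le> 2 powr s * \<beta> * (?X + ?Y)"
      using smooth_symbol[OF N, of \<xi> \<eta>] by (simp add: abs_mult)
    have 3: "\<bar>(?w \<eta>)\<^sup>2 * smooth_part \<eta> \<xi>\<bar> \<le> 2 powr s * \<beta> * (?X + ?Z)"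
      using smooth_symbol[OF N, of \<eta> \<xi>] by (simp add: abs_mult japanese_diff_commute[of \<eta>] mult_ac)
    have "2 powr s * \<beta> * (?X + ?Y) + 2 powr s * \<beta> * (?X + ?Z) \<le> 2 * (2 powr s * \<beta>) * (?X + ?Y + ?Z)"
    proof -
      have "0 \<le> (2 powr s * \<beta>) * (?Y + ?Z)" using XYZ \<beta>_nonneg by (intro mult_nonneg_nonneg) auto
      then show ?thesis by (simp add: algebra_simps)
    qed
    moreover have "energy_const * (?X + ?Y + ?Z) = (4 powr (s + 1) + commutator_const + 1) * (?X + ?Y + ?Z) + 2 * (2 powr s * \<beta>) * (?X + ?Y + ?Z)"
      unfolding energy_const_def by (rule distrib_right)
    ultimately show "\<bar>((?w \<xi>)\<^sup>2 * \<eta> - (?w \<eta>)\<^sup>2 * \<xi>) + ((?w \<xi>)\<^sup>2 * smooth_part \<xi> \<eta> - (?w \<eta>)\<^sup>2 * smooth_part \<eta> \<xi>)\<bar> \<le> energy_const * (?X + ?Y + ?Z)"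
      using 1 2 3 by linarith
  qed
  also have "\<dots> = energy_const * (1 / sqrt (2 * pi)) * (\<alpha> (\<xi> - \<eta>) * M N \<xi> * M N \<eta> + \<alpha> \<eta> * M N \<xi> * M N (\<xi> - \<eta>) + \<alpha> \<xi> * M N \<eta> * M N (\<xi> - \<eta>))"
  proof -
    have c: "japanese \<xi> powr (- s) * ?w \<xi> = M N \<xi>" "japanese \<xi> powr (- s) * japanese \<xi> = \<alpha> \<xi>" for \<xi>
    proof -
      have "japanese \<xi> powr (- s) * japanese \<xi> powr s = 1"
        by (simp add: powr_add[symmetric] less_imp_neq[OF japanese_pos, symmetric])
      then show "japanese \<xi> powr (- s) * ?w \<xi> = M N \<xi>" unfolding w by (simp add: mult.assoc[symmetric])
      show "japanese \<xi> powr (- s) * japanese \<xi> = \<alpha> \<xi>"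
        using powr_add[of "japanese \<xi>" "- s" 1] by (simp add: \<alpha>_def less_imp_le)
    qed
    have "?g * (energy_const * (?r * ?w \<xi> * ?w \<eta> + ?q * ?w \<xi> * ?w (\<xi> - \<eta>) + ?p * ?w \<eta> * ?w (\<xi> - \<eta>)))
      = energy_const * (1 / sqrt (2 * pi)) * ((?r powr (- s) * ?r) * (?p powr (- s) * ?w \<xi>) * (?q powr (- s) * ?w \<eta>)
        + (?q powr (- s) * ?q) * (?p powr (- s) * ?w \<xi>) * (?r powr (- s) * ?w (\<xi> - \<eta>))
        + (?p powr (- s) * ?p) * (?q powr (- s) * ?w \<eta>) * (?r powr (- s) * ?w (\<xi> - \<eta>)))"
      unfolding sym_weight_def by (simp add: algebra_simps)
    then show ?thesis unfolding c .
  qed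
  also have "\<dots> \<le> energy_const * 1 * (\<alpha> (\<xi> - \<eta>) * M N \<xi> * M N \<eta> + \<alpha> \<eta> * M N \<xi> * M N (\<xi> - \<eta>) + \<alpha> \<xi> * M N \<eta> * M N (\<xi> - \<eta>))"
    using inv_sqrt_2pi energy_const_nonneg M_bounds \<alpha>_nonneg by (intro mult_right_mono mult_left_mono) auto
  finally show ?thesis by simp
qed

section \<open>The operators of the abstract equation and their properties\<close>

definition K :: "l2h \<Rightarrow> l2h" where "K = fmult (\<lambda>\<xi>. japanese \<xi> powr (3 - 2 * s))"
definition J :: "l2h \<Rightarrow> l2h" where "J = fmult (\<lambda>\<xi>. japanese \<xi> powr (- 1))"
definition P :: "nat \<Rightarrow> l2h \<Rightarrow> l2h" where "P n = fmult (cut n)"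
definition L :: "nat \<Rightarrow> l2h \<Rightarrow> l2h" where "L n = fmult (\<lambda>\<xi>. cut n \<xi> * japanese \<xi>)"
definition \<Theta> :: "nat \<Rightarrow> l2h \<Rightarrow> l2h" where "\<Theta> n = fmult (\<lambda>\<xi>. (M n \<xi>)\<^sup>2)"
text \<open>One constant for both form bounds, each of which contributes three times its symbol
  constant times \<open>A\<close>; the 1 makes it positive.\<close>

definition C :: real where "C = 3 * (4 * (1 + \<beta>)) * A + 3 * energy_const * A + 1"

lemmas even_boundeds = even_bounded_M2 even_bounded_cut even_bounded_cut_japanese
  even_bounded_powr even_bounded_mult

lemma exponents: "3 - 2 * s \<le> 0" "2 - 2 * s \<le> 0" "1 / 2 - s \<le> 0" "1 - 2 * s \<le> 0" "- s \<le> 0" "- 1 \<le> (0::real)"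
  using s by auto

lemma KJ: "K (J x) = fmult (\<lambda>\<xi>. japanese \<xi> powr (2 - 2 * s)) x"
  unfolding K_def J_def fmult_fmult[OF even_bounded_powr[OF exponents(1)] even_bounded_powr[OF exponents(6)]]
  by (simp only: powr_add[symmetric]) simp

lemma inner_KJ: "inner (K (J x)) (J x) = inner (fmult (\<lambda>\<xi>. (japanese \<xi> powr (1/2 - s))\<^sup>2) x) x"
proof -
  have "inner (K (J x)) (J x) = inner (J (K (J x))) x"
    unfolding J_def by (rule inner_fmult_sym[OF even_bounded_powr[OF exponents(6)], symmetric])
  also have "J (K (J x)) = fmult (\<lambda>\<xi>. (japanese \<xi> powr (1/2 - s))\<^sup>2) x"
    unfolding KJ unfolding J_def fmult_fmult[OF even_bounded_powr[OF exponents(6)] even_bounded_powr[OF exponents(2)]]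
    by (simp only: powr_add[symmetric] power2_eq_square[of "_ powr _"]) simp
  finally show ?thesis .
qed

lemma L_eq: "even_bounded m \<Longrightarrow> fmult m (L n x) = fmult (\<lambda>\<xi>. m \<xi> * (cut n \<xi> * japanese \<xi>)) x"
  unfolding L_def by (rule fmult_fmult[OF _ even_bounded_cut_japanese])

lemma even_bounded_low: "even_bounded (\<lambda>\<xi>. (japanese \<xi> powr (1/2 - s))\<^sup>2)"
  using even_bounded_mult[OF even_bounded_powr even_bounded_powr, OF exponents(3) exponents(3)] by (simp add: power2_eq_square)

text \<open>Above the threshold \<open>M n \<xi>\<close> is 1. Below it the weight
  \<langle>\<xi>\<rangle>^(1-2s) of the weak norm is at least its value at \<langle>\<xi>\<rangle> =
  n + 1, whose inverse is the constant in front.\<close>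

lemma splitting_symbol: "1 \<le> (M n \<xi>)\<^sup>2 + (real n + 1) powr (2 * s - 1) * (japanese \<xi> powr (1/2 - s))\<^sup>2"
proof (cases "real n + 1 \<le> japanese \<xi>")
  case True
  then have "M n \<xi> = 1" by (simp add: M_def \<mu>_def)
  then show ?thesis by simp
next
  case False
  have "1 = (real n + 1) powr (2 * s - 1) * (real n + 1) powr (1 - 2 * s)" by (simp add: powr_add[symmetric])
  also have "\<dots> \<le> (real n + 1) powr (2 * s - 1) * japanese \<xi> powr (1 - 2 * s)"
    using False exponents(4) by (intro mult_left_mono powr_mono2') auto
  also have "japanese \<xi> powr (1 - 2 * s) = (japanese \<xi> powr (1/2 - s))\<^sup>2"
    unfolding power2_eq_square powr_add[symmetric] by simp
  finally show ?thesis by (simp add: add_increasing)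
qed

lemma bounded_linear_ops:
  "bounded_linear J" "bounded_linear K" "bounded_linear (P n)" "bounded_linear (L n)" "bounded_linear (\<Theta> n)"
  unfolding J_def K_def P_def L_def \<Theta>_def
  by (intro bounded_linear_fmult even_boundeds exponents)+

lemma bounded_bilinear_Q: "bounded_bilinear Q"
  unfolding Q_def by (rule bounded_bilinear_bil[OF kernel_sym])

lemma quasilinear: "quasilinear J K P L \<Theta> Q C (\<lambda>n. japanese (real n) powr (3 - 2 * s)) (\<lambda>n. (real n + 1) powr (2 * s - 1))"
proof (rule quasilinear.intro[OF bounded_linear_ops bounded_bilinear_Q])
  note eb = even_bounded_powr[OF exponents(1)] even_bounded_powr[OF exponents(6)] even_bounded_M2 even_bounded_cut even_bounded_cut_japanese
  show "x = 0" if "J x = 0" for x using fmult_inj[OF eb(2)] that by (simp add: J_def)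
  show "x = 0" if "K x = 0" for x using fmult_inj[OF eb(1)] that by (simp add: K_def)
  show "inner (K x) y = inner x (K y)" for x y unfolding K_def by (rule inner_fmult_sym[OF eb(1)])
  show "inner (\<Theta> n x) y = inner x (\<Theta> n y)" for n x y unfolding \<Theta>_def by (rule inner_fmult_sym[OF eb(3)])
  show "Q x y = Q y x" for x y by (rule Q_commute)
  have cc: "cut n \<xi> * cut n \<xi> = cut n \<xi>" for n \<xi> by (simp add: cut_def)
  show "P n (P n x) = P n x" for n x unfolding P_def fmult_fmult[OF eb(4) eb(4)] cc ..
  show "J (L n x) = P n x" for n x
  proof -
    have "japanese \<xi> powr - 1 * (cut n \<xi> * japanese \<xi>) = cut n \<xi>" for \<xi> by (simp add: powr_minus)
    then show ?thesis unfolding J_def L_eq[OF eb(2)] P_def by (simp only:)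
  qed
  show "P n (L n x) = L n x" for n x
    unfolding P_def L_eq[OF eb(4)] mult.assoc[symmetric] cc by (simp add: L_def)
  show "(\<lambda>n. P n x) \<longlonglongrightarrow> x" for x
  proof -
    have eb': "even_bounded (\<lambda>\<xi>. cut n \<xi> - 1)" for n by (intro even_bounded_diff eb even_bounded_const)
    have e: "P n x - x = fmult (\<lambda>\<xi>. cut n \<xi> - 1) x" for n
      unfolding P_def fmult_diff_left[OF eb(4) even_bounded_const, symmetric] by simp
    have sq: "(norm (P n x - x))\<^sup>2 = inner (fmult (\<lambda>\<xi>. (cut n \<xi> - 1)\<^sup>2) x) x" for n
      unfolding e by (rule norm_fmult_square[OF eb'])
    have "(\<lambda>n. (norm (P n x - x))\<^sup>2) \<longlonglongrightarrow> 0"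
      unfolding sq
    proof (rule inner_fmult_tendsto[where M = 1])
      show "even_bounded (\<lambda>\<xi>. (cut n \<xi> - 1)\<^sup>2)" for n unfolding power2_eq_square by (intro even_bounded_mult eb')
      show "\<bar>(cut n \<xi> - 1)\<^sup>2\<bar> \<le> 1" for n \<xi> by (simp add: cut_def)
      show "(\<lambda>n. (cut n \<xi> - 1)\<^sup>2) \<longlonglongrightarrow> 0" for \<xi>
      proof (rule tendsto_eventually)
        obtain m :: nat where m: "\<bar>\<xi>\<bar> \<le> real m" using real_arch_simple by blast
        show "\<forall>\<^sub>F n in sequentially. (cut n \<xi> - 1)\<^sup>2 = 0"
          using eventually_ge_at_top[of m] by eventually_elim (use m in \<open>simp add: cut_def\<close>)
      qed
    qed
    from tendsto_real_sqrt[OF this] have "(\<lambda>n. norm (P n x - x)) \<longlonglongrightarrow> 0" by simp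
    then show ?thesis by (simp only: LIM_zero_iff tendsto_norm_zero_iff)
  qed
  show "0 \<le> inner (\<Theta> n x) x" for n x
    unfolding \<Theta>_def norm_fmult_square[OF even_bounded_M, symmetric] by simp
  have M2: "(M n \<xi>)\<^sup>2 \<le> 1" for n \<xi> using M_bounds[of n \<xi>] by (simp add: power_le_one)
  show "inner (\<Theta> n x) x \<le> (norm x)\<^sup>2" for n x
    using inner_fmult_mono[OF eb(3) even_bounded_const, of n 1 x] M2 by (simp add: \<Theta>_def power2_norm_eq_inner)
  show "\<Theta> 0 x = x" for x
  proof -
    have "M 0 \<xi> = 1" for \<xi> using japanese_ge_1[of \<xi>] by (simp add: M_def \<mu>_def)
    then show ?thesis by (simp add: \<Theta>_def)
  qed
  show "inner (\<Theta> n (P m x)) (P m x) \<le> inner (\<Theta> n x) x" for n m x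
  proof -
    have "inner (\<Theta> n (P m x)) (P m x) = inner (P m (\<Theta> n (P m x))) x"
      unfolding P_def by (rule inner_fmult_sym[OF eb(4), symmetric])
    also have "P m (\<Theta> n (P m x)) = fmult (\<lambda>\<xi>. cut m \<xi> * ((M n \<xi>)\<^sup>2 * cut m \<xi>)) x"
      unfolding P_def \<Theta>_def fmult_fmult[OF eb(3) eb(4)] by (rule fmult_fmult[OF eb(4) even_bounded_mult[OF eb(3) eb(4)]])
    also have "inner \<dots> x \<le> inner (\<Theta> n x) x"
      unfolding \<Theta>_def by (intro inner_fmult_mono even_bounded_mult eb) (simp add: cut_def)
    finally show ?thesis .
  qed
  show "(\<lambda>n. inner (\<Theta> n x) x) \<longlonglongrightarrow> 0" for x
    unfolding \<Theta>_def
  proof (rule inner_fmult_tendsto[OF eb(3), where M = 1])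
    show "\<bar>(M n \<xi>)\<^sup>2\<bar> \<le> 1" for n \<xi> using M2 by simp
    show "(\<lambda>n. (M n \<xi>)\<^sup>2) \<longlonglongrightarrow> 0" for \<xi>
    proof -
      have "(\<lambda>n. japanese \<xi> / (real n + 1)) \<longlonglongrightarrow> 0" by real_asymp
      then have "(\<lambda>n. min 1 (japanese \<xi> / (real n + 1))) \<longlonglongrightarrow> min 1 0" by (intro tendsto_min tendsto_const)
      from tendsto_power[OF this, of 2] show ?thesis by (simp add: M_def \<mu>_def)
    qed
  qed
  have C1: "0 \<le> 3 * (4 * (1 + \<beta>)) * A" "0 \<le> 3 * energy_const * A"
    using \<beta>_nonneg energy_const_nonneg A_nonneg by auto
  then show "C > 0" unfolding C_def by linarith
  have low0: "0 \<le> inner (fmult (\<lambda>\<xi>. (japanese \<xi> powr (1/2 - s))\<^sup>2) x) x" for x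
    unfolding norm_fmult_square[OF even_bounded_powr[OF exponents(3)], symmetric] by simp
  show "0 \<le> inner (K (J x)) (J x)" for x unfolding inner_KJ by (rule low0)
  show "inner (K (J w)) (Q z w) \<le> C * norm z * inner (K (J w)) (J w)" for z w
  proof -
    let ?E = "inner (fmult (\<lambda>\<xi>. (japanese \<xi> powr (1/2 - s))\<^sup>2) w) w"
    have "\<bar>inner (K (J w)) (Q z w)\<bar> \<le> 3 * (4 * (1 + \<beta>)) * A * norm z * ?E"
      unfolding KJ Q_def
    proof (rule low_form_bound[OF kernel_sym even_bounded_powr[OF exponents(2)] even_bounded_powr[OF exponents(3)]])
      show "\<bar>japanese \<xi> powr (2 - 2 * s) * \<kappa>_sym \<xi> \<eta> - japanese \<eta> powr (2 - 2 * s) * \<kappa>_sym \<eta> \<xi>\<bar>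
          \<le> 4 * (1 + \<beta>) * (\<alpha> \<xi> + \<alpha> (\<xi> - \<eta>) + \<alpha> \<eta>) * (japanese \<xi> powr (1 / 2 - s) * japanese \<eta> powr (1 / 2 - s))" for \<xi> \<eta>
        by (rule low_symbol)
    qed (use \<beta>_nonneg in auto)
    also have "\<dots> \<le> C * norm z * ?E"
      using C1 low0[of w] by (intro mult_right_mono) (auto simp: C_def)
    finally show ?thesis unfolding inner_KJ by linarith
  qed
  show "inner (\<Theta> N v) (L n (Q v v)) \<le> C * norm v * inner (\<Theta> N v) v" if v: "P n v = v" for n N v
  proof -
    have "inner (\<Theta> N v) (L n (Q v v)) = inner (L n (\<Theta> N v)) (Q v v)"
      unfolding L_def by (rule inner_fmult_sym[OF eb(5), symmetric])
    also have "L n (\<Theta> N v) = fmult (\<lambda>\<xi>. cut n \<xi> * japanese \<xi> * (M N \<xi>)\<^sup>2) v"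
      unfolding L_def \<Theta>_def by (rule fmult_fmult[OF eb(5) eb(3)])
    finally have e: "inner (\<Theta> N v) (L n (Q v v)) = inner (fmult (\<lambda>\<xi>. cut n \<xi> * japanese \<xi> * (M N \<xi>)\<^sup>2) v) (bil \<kappa>_asym v v)"
      unfolding Q_eq_asym .
    have "\<bar>inner (fmult (\<lambda>\<xi>. cut n \<xi> * japanese \<xi> * (M N \<xi>)\<^sup>2) v) (bil \<kappa>_asym v v)\<bar> \<le> 3 * energy_const * A * norm v * inner (fmult (\<lambda>\<xi>. (M N \<xi>)\<^sup>2) v) v"
      using v unfolding P_def
      by (intro energy_form_bound[OF kernel_asym even_bounded_mult[OF eb(5) eb(3)] even_bounded_M M_bounds(1) energy_const_nonneg eb(4)] energy_symbol)
    also have "\<dots> \<le> C * norm v * inner (fmult (\<lambda>\<xi>. (M N \<xi>)\<^sup>2) v) v"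
      using C1 norm_fmult_square[OF even_bounded_M, of N v] by (intro mult_right_mono) (auto simp: C_def simp flip: norm_fmult_square[OF even_bounded_M])
    finally show ?thesis unfolding e unfolding \<Theta>_def by linarith
  qed
  \<comment> \<open>Only frequencies above \<open>n\<close> are left, and there the symbol of
    \<open>K\<close>, a negative power, is at most its value at \<open>n\<close>. That it tends to
    zero needs the strict inequality s > 3/2.\<close>
  show "norm (K (x - P n x)) \<le> japanese (real n) powr (3 - 2 * s) * norm x" for n x
  proof -
    have eb': "even_bounded (\<lambda>\<xi>. 1 - cut n \<xi>)" by (intro even_bounded_diff eb even_bounded_const)
    have "x - P n x = fmult (\<lambda>\<xi>. 1 - cut n \<xi>) x"
      unfolding P_def fmult_diff_left[OF even_bounded_const eb(4), symmetric] by simp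
    then have "K (x - P n x) = fmult (\<lambda>\<xi>. japanese \<xi> powr (3 - 2 * s) * (1 - cut n \<xi>)) x"
      unfolding K_def by (simp only: fmult_fmult[OF eb(1) eb'])
    also have "norm \<dots> \<le> japanese (real n) powr (3 - 2 * s) * norm x"
    proof (rule norm_fmult_le[OF even_bounded_mult[OF eb(1) eb']])
      show "\<bar>japanese \<xi> powr (3 - 2 * s) * (1 - cut n \<xi>)\<bar> \<le> japanese (real n) powr (3 - 2 * s)" for \<xi>
      proof (cases "\<bar>\<xi>\<bar> \<le> real n")
        case False
        then have "(real n)\<^sup>2 \<le> \<xi>\<^sup>2" using power_mono[of "real n" "\<bar>\<xi>\<bar>" 2] by simp
        then have "japanese (real n) \<le> japanese \<xi>" by (simp add: japanese_def)
        then show ?thesis using False exponents(1) by (simp add: cut_def powr_mono2')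
      qed (simp add: cut_def)
    qed
    finally show ?thesis .
  qed
  show "(\<lambda>n. japanese (real n) powr (3 - 2 * s)) \<longlonglongrightarrow> 0"
  proof (rule tendsto_neg_powr)
    show "3 - 2 * s < 0" using s by simp
    show "filterlim (\<lambda>n. japanese (real n)) at_top sequentially" unfolding japanese_def by real_asymp
  qed
  show "(norm x)\<^sup>2 \<le> inner (\<Theta> n x) x + (real n + 1) powr (2 * s - 1) * inner (K (J x)) (J x)" for n x
  proof -
    let ?c = "(real n + 1) powr (2 * s - 1)" and ?l = "\<lambda>\<xi>. (japanese \<xi> powr (1/2 - s))\<^sup>2"
    have i: "integrable lborel (\<lambda>\<xi>. (M n \<xi>)\<^sup>2 * (cmod (hat x \<xi>))\<^sup>2)" "integrable lborel (\<lambda>\<xi>. ?c * (?l \<xi> * (cmod (hat x \<xi>))\<^sup>2))"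
      by (intro integrable_mult_right inner_fmult_self(2) eb even_bounded_low)+
    have "(norm x)\<^sup>2 \<le> (LINT \<xi>|lborel. (M n \<xi>)\<^sup>2 * (cmod (hat x \<xi>))\<^sup>2 + ?c * (?l \<xi> * (cmod (hat x \<xi>))\<^sup>2))"
      unfolding norm_l2h
    proof (intro integral_mono hat_square_integrable Bochner_Integration.integrable_add i)
      fix \<xi>
      have "1 * (cmod (hat x \<xi>))\<^sup>2 \<le> ((M n \<xi>)\<^sup>2 + ?c * ?l \<xi>) * (cmod (hat x \<xi>))\<^sup>2"
        by (intro mult_right_mono splitting_symbol) simp
      then show "(cmod (hat x \<xi>))\<^sup>2 \<le> (M n \<xi>)\<^sup>2 * (cmod (hat x \<xi>))\<^sup>2 + ?c * (?l \<xi> * (cmod (hat x \<xi>))\<^sup>2)"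
        by (simp only: distrib_right mult_1_left mult.assoc)
    qed
    also have "\<dots> = inner (\<Theta> n x) x + ?c * inner (K (J x)) (J x)"
      unfolding Bochner_Integration.integral_add[OF i] Bochner_Integration.integral_mult_right_zero
      by (simp only: \<Theta>_def inner_KJ inner_fmult_self(1)[OF even_bounded_M2] inner_fmult_self(1)[OF even_bounded_low])
    finally show ?thesis .
  qed
  show "0 < (real n + 1) powr (2 * s - 1)" for n by simp
qed

sublocale quasilinear J K P L \<Theta> Q C "\<lambda>n. japanese (real n) powr (3 - 2 * s)" "\<lambda>n. (real n + 1) powr (2 * s - 1)"
  by (rule quasilinear)

end

section \<open>Fourier inversion and products\<close>

lemma schwartz_ift_integrable: "integrable lborel (schwartz_ift \<phi>)"
  and schwartz_ift_japanese_integrable: "integrable lborel (\<lambda>\<xi>. japanese \<xi> * cmod (schwartz_ift \<phi> \<xi>))"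
  and schwartz_ift_bounded: "\<exists>B\<ge>0. \<forall>\<xi>. cmod (schwartz_ift \<phi> \<xi>) \<le> B"
proof -
  obtain C N where C: "C \<ge> 0" "\<And>\<phi> \<xi>. (1 + \<xi>\<^sup>2) ^ 2 * cmod (schwartz_ift \<phi> \<xi>) \<le> C * tempered_bound N \<phi>"
    using ift_decay by blast
  let ?B = "C * tempered_bound N \<phi>"
  have B: "0 \<le> ?B" using C tempered_bound_nonneg by simp
  have le: "japanese \<xi> * cmod (schwartz_ift \<phi> \<xi>) \<le> ?B * (1 / (1 + \<xi>\<^sup>2))" for \<xi>
  proof -
    have "japanese \<xi> * 1 \<le> japanese \<xi> * japanese \<xi>" using japanese_ge_1[of \<xi>] by (intro mult_left_mono) auto
    also have "\<dots> = 1 + \<xi>\<^sup>2" using japanese_square[of \<xi>] by (simp only: power2_eq_square[of "japanese \<xi>"])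
    finally have "japanese \<xi> \<le> 1 + \<xi>\<^sup>2" by simp
    then have "japanese \<xi> * cmod (schwartz_ift \<phi> \<xi>) * (1 + \<xi>\<^sup>2) \<le> (1 + \<xi>\<^sup>2) * cmod (schwartz_ift \<phi> \<xi>) * (1 + \<xi>\<^sup>2)"
      by (intro mult_right_mono) auto
    also have "\<dots> \<le> ?B" using C(2)[of \<xi> \<phi>] by (simp add: power2_eq_square mult_ac)
    finally show ?thesis by (simp add: pos_le_divide_eq)
  qed
  have le': "cmod (schwartz_ift \<phi> \<xi>) \<le> japanese \<xi> * cmod (schwartz_ift \<phi> \<xi>)" for \<xi>
    using japanese_ge_1[of \<xi>] by (simp add: mult_le_cancel_right1)
  have i: "integrable lborel (\<lambda>\<xi>. ?B * (1 / (1 + \<xi>\<^sup>2)))" by (intro integrable_mult_right integrable_inverse_square)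
  show I: "integrable lborel (\<lambda>\<xi>. japanese \<xi> * cmod (schwartz_ift \<phi> \<xi>))"
    by (rule Bochner_Integration.integrable_bound[OF i]) (use order_trans[OF le abs_ge_self] in \<open>auto simp: abs_mult\<close>)
  show "integrable lborel (schwartz_ift \<phi>)"
    by (rule Bochner_Integration.integrable_bound[OF I]) (use le' in \<open>auto simp: abs_mult\<close>)
  have "cmod (schwartz_ift \<phi> \<xi>) \<le> ?B" for \<xi>
  proof -
    have "cmod (schwartz_ift \<phi> \<xi>) \<le> ?B * (1 / (1 + \<xi>\<^sup>2))" using le le' order_trans by blast
    also have "\<dots> \<le> ?B * 1" using B by (intro mult_left_mono) (auto simp: divide_le_eq)
    finally show ?thesis by simp
  qed
  then show "\<exists>B\<ge>0. \<forall>\<xi>. cmod (schwartz_ift \<phi> \<xi>) \<le> B" using B by blast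
qed

lemma gauss_integral: "(LINT x|lborel. complex_of_real (exp (- x\<^sup>2 / 2)) * cis (x * t)) = complex_of_real (sqrt (2 * pi) * exp (- t\<^sup>2 / 2))"
proof -
  have "complex_of_real (1 / sqrt (2 * pi)) * (LINT x|lborel. complex_of_real (exp (- x\<^sup>2 / 2)) * cis (x * t)) = complex_of_real (exp (- t\<^sup>2 / 2))"
    using schwartz_ift_gauss[of 0 t] by (simp add: schwartz_ift_def gauss.rep_eq)
  then have "complex_of_real (sqrt (2 * pi)) * (complex_of_real (1 / sqrt (2 * pi)) * (LINT x|lborel. complex_of_real (exp (- x\<^sup>2 / 2)) * cis (x * t)))
     = complex_of_real (sqrt (2 * pi)) * complex_of_real (exp (- t\<^sup>2 / 2))" by (simp only:)
  then show ?thesis unfolding mult.assoc[symmetric] of_real_mult[symmetric] by simp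
qed

lemma gauss_integrable: "integrable lborel (\<lambda>x::real. exp (- x\<^sup>2 / 2))"
  using test_fun_integrable[of "gauss 0"] by (simp add: gauss.rep_eq)

text \<open>The integral on the right is regularised by a Gaussian factor, which turns the inversion formula into
  an approximation of the identity.\<close>

lemma schwartz_inversion:
  "complex_of_real (test_fun \<psi> x) = complex_of_real (1 / sqrt (2 * pi)) * (LINT \<xi>|lborel. schwartz_ift \<psi> \<xi> * cis (- (x * \<xi>)))"
proof -
  define G where "G z = exp (- z\<^sup>2 / 2)" for z :: real
  define e where "e n = 1 / (real n + 1)" for n :: nat
  have e: "e n > 0" for n by (simp add: e_def)
  have e0: "e \<longlonglongrightarrow> 0" unfolding e_def by real_asymp
  have Gm [measurable]: "G \<in> borel_measurable borel" unfolding G_def by measurable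
  have G1: "0 \<le> G z" "G z \<le> 1" for z by (auto simp: G_def)
  have Gi: "integrable lborel G" unfolding G_def by (rule gauss_integrable)
  let ?c = "complex_of_real (1 / sqrt (2 * pi))"
  define I where "I n = (LINT \<xi>|lborel. schwartz_ift \<psi> \<xi> * cis (- (x * \<xi>)) * complex_of_real (G (e n * \<xi>)))" for n
  have lim1: "I \<longlonglongrightarrow> (LINT \<xi>|lborel. schwartz_ift \<psi> \<xi> * cis (- (x * \<xi>)))"
    unfolding I_def
  proof (rule integral_dominated_convergence)
    show "integrable lborel (\<lambda>\<xi>. cmod (schwartz_ift \<psi> \<xi>))" by (intro integrable_norm schwartz_ift_integrable)
    show "AE \<xi> in lborel. (\<lambda>n. schwartz_ift \<psi> \<xi> * cis (- (x * \<xi>)) * complex_of_real (G (e n * \<xi>))) \<longlonglongrightarrow> schwartz_ift \<psi> \<xi> * cis (- (x * \<xi>))"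
    proof (rule AE_I2)
      fix \<xi>
      have "(\<lambda>n. exp (- (e n * \<xi>)\<^sup>2 / 2)) \<longlonglongrightarrow> exp (- (0 * \<xi>)\<^sup>2 / 2)" by (intro tendsto_intros e0) auto
      then have "(\<lambda>n. complex_of_real (G (e n * \<xi>))) \<longlonglongrightarrow> complex_of_real 1" unfolding G_def by (intro tendsto_of_real) simp
      from tendsto_mult[OF tendsto_const this]
      show "(\<lambda>n. schwartz_ift \<psi> \<xi> * cis (- (x * \<xi>)) * complex_of_real (G (e n * \<xi>))) \<longlonglongrightarrow> schwartz_ift \<psi> \<xi> * cis (- (x * \<xi>))" by simp
    qed
    show "AE \<xi> in lborel. norm (schwartz_ift \<psi> \<xi> * cis (- (x * \<xi>)) * complex_of_real (G (e n * \<xi>))) \<le> cmod (schwartz_ift \<psi> \<xi>)" for n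
      using G1 by (intro AE_I2) (simp add: norm_mult mult_left_le)
    have "(\<lambda>\<xi>. cis (- (x * \<xi>))) \<in> borel_measurable borel" by measurable
    then show "(\<lambda>\<xi>. schwartz_ift \<psi> \<xi> * cis (- (x * \<xi>))) \<in> borel_measurable lborel"
      "(\<lambda>\<xi>. schwartz_ift \<psi> \<xi> * cis (- (x * \<xi>)) * complex_of_real (G (e n * \<xi>))) \<in> borel_measurable lborel" for n
      by (auto intro!: borel_measurable_times)
  qed
  \<comment> \<open>Exchange the integrals, evaluate the inner one as the transform of a rescaled
    Gaussian, and substitute \<open>y = x + e n * z\<close>: the regularised integral is an average
    of the test function at distance of order \<open>e n\<close> from \<open>x\<close>.\<close>
  have I_eq: "I n = (LINT z|lborel. complex_of_real (test_fun \<psi> (x + e n * z) * G z))" for n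
  proof -
    let ?k = "\<lambda>\<xi> y. complex_of_real (test_fun \<psi> y) * cis ((y - x) * \<xi>) * complex_of_real (G (e n * \<xi>))"
    have Gei: "integrable lborel (\<lambda>\<xi>. G (e n * \<xi>))"
      using lborel_integrable_real_affine[OF Gi, of "e n" 0] e[of n] by simp
    have "I n = (LINT \<xi>|lborel. ?c * (LINT y|lborel. ?k \<xi> y))"
      unfolding I_def
    proof (rule Bochner_Integration.integral_cong)
      fix \<xi>
      have "(LINT y|lborel. ?k \<xi> y) = (LINT y|lborel. complex_of_real (test_fun \<psi> y) * cis (y * \<xi>)) * (cis (- (x * \<xi>)) * complex_of_real (G (e n * \<xi>)))"
      proof -
        have "cis ((y - x) * \<xi>) = cis (y * \<xi>) * cis (- (x * \<xi>))" for y by (simp add: cis_mult left_diff_distrib)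
        then show ?thesis unfolding Bochner_Integration.integral_mult_left_zero[symmetric] by (simp only: mult.assoc)
      qed
      then show "schwartz_ift \<psi> \<xi> * cis (- (x * \<xi>)) * complex_of_real (G (e n * \<xi>)) = ?c * (LINT y|lborel. ?k \<xi> y)"
        by (simp only: schwartz_ift_def mult.assoc)
    qed simp
    also have "\<dots> = ?c * (LINT \<xi>|lborel. LINT y|lborel. ?k \<xi> y)" by simp
    also have "(LINT \<xi>|lborel. LINT y|lborel. ?k \<xi> y) = (LINT y|lborel. LINT \<xi>|lborel. ?k \<xi> y)"
    proof (rule lborel_pair.Fubini_integral[symmetric])
      show "integrable (lborel \<Otimes>\<^sub>M lborel) (\<lambda>(\<xi>, y). ?k \<xi> y)"
      proof (rule integrableI_bounded)
        have "(\<integral>\<^sup>+p. ennreal (norm (case p of (\<xi>, y) \<Rightarrow> ?k \<xi> y)) \<partial>(lborel \<Otimes>\<^sub>M lborel)) = (\<integral>\<^sup>+\<xi>. \<integral>\<^sup>+y. ennreal (norm (?k \<xi> y)) \<partial>lborel \<partial>lborel)"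
          by (subst lborel.nn_integral_fst[symmetric]) auto
        also have "\<dots> = (\<integral>\<^sup>+\<xi>. ennreal (G (e n * \<xi>)) * (\<integral>\<^sup>+y. ennreal (norm (test_fun \<psi> y)) \<partial>lborel) \<partial>lborel)"
          using G1 by (simp add: norm_mult ennreal_mult nn_integral_multc mult.commute)
        also have "\<dots> = (\<integral>\<^sup>+\<xi>. ennreal (G (e n * \<xi>)) \<partial>lborel) * (\<integral>\<^sup>+y. ennreal (norm (test_fun \<psi> y)) \<partial>lborel)"
          by (rule nn_integral_multc) measurable
        also have "\<dots> < \<infinity>"
          using Gei test_fun_integrable[of \<psi>] G1 by (simp add: integrable_iff_bounded ennreal_mult_less_top)
        finally show "(\<integral>\<^sup>+p. ennreal (norm (case p of (\<xi>, y) \<Rightarrow> ?k \<xi> y)) \<partial>(lborel \<Otimes>\<^sub>M lborel)) < \<infinity>" .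
      next
        have [measurable]: "(\<lambda>p. cis ((snd p - x) * fst p)) \<in> borel_measurable (lborel \<Otimes>\<^sub>M lborel)"
          by (rule measurable_compose[OF _ cis_measurable(3)]) measurable
        show "(\<lambda>(\<xi>, y). ?k \<xi> y) \<in> borel_measurable (lborel \<Otimes>\<^sub>M lborel)" unfolding case_prod_beta by measurable
      qed
    qed
    also have "\<dots> = (LINT y|lborel. complex_of_real (test_fun \<psi> y * (sqrt (2 * pi) / e n * G ((y - x) / e n))))"
    proof (rule Bochner_Integration.integral_cong)
      fix y
      have "(LINT \<xi>|lborel. cis ((y - x) * \<xi>) * complex_of_real (G (e n * \<xi>))) = complex_of_real (sqrt (2 * pi) / e n * G ((y - x) / e n))"
      proof -
        have "(LINT \<xi>|lborel. cis ((y - x) * \<xi>) * complex_of_real (G (e n * \<xi>)))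
          = (1 / e n) *\<^sub>R (LINT z|lborel. cis ((y - x) * (0 + 1 / e n * z)) * complex_of_real (G (e n * (0 + 1 / e n * z))))"
          using lborel_integral_real_affine[of "1 / e n" "\<lambda>\<xi>. cis ((y - x) * \<xi>) * complex_of_real (G (e n * \<xi>))" 0] e[of n] by simp
        also have "(\<lambda>z. cis ((y - x) * (0 + 1 / e n * z)) * complex_of_real (G (e n * (0 + 1 / e n * z)))) = (\<lambda>z. complex_of_real (exp (- z\<^sup>2 / 2)) * cis (z * ((y - x) / e n)))"
          using e[of n] by (auto simp: G_def mult_ac fun_eq_iff)
        finally show ?thesis unfolding gauss_integral by (simp add: G_def scaleR_conv_of_real)
      qed
      then show "(LINT \<xi>|lborel. ?k \<xi> y) = complex_of_real (test_fun \<psi> y * (sqrt (2 * pi) / e n * G ((y - x) / e n)))"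
        unfolding mult.assoc Bochner_Integration.integral_mult_right_zero by simp
    qed simp
    also have "\<dots> = e n *\<^sub>R (LINT z|lborel. complex_of_real (test_fun \<psi> (x + e n * z) * (sqrt (2 * pi) / e n * G ((x + e n * z - x) / e n))))"
      using lborel_integral_real_affine[of "e n" "\<lambda>y. complex_of_real (test_fun \<psi> y * (sqrt (2 * pi) / e n * G ((y - x) / e n)))" x] e[of n] by simp
    also have "(\<lambda>z. complex_of_real (test_fun \<psi> (x + e n * z) * (sqrt (2 * pi) / e n * G ((x + e n * z - x) / e n))))
       = (\<lambda>z. complex_of_real (sqrt (2 * pi) / e n) * complex_of_real (test_fun \<psi> (x + e n * z) * G z))"
      using e[of n] by (auto simp: fun_eq_iff mult_ac)
    also have "?c * (e n *\<^sub>R (LINT z|lborel. complex_of_real (sqrt (2 * pi) / e n) * complex_of_real (test_fun \<psi> (x + e n * z) * G z)))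
       = complex_of_real (1 / sqrt (2 * pi) * (e n * (sqrt (2 * pi) / e n))) * (LINT z|lborel. complex_of_real (test_fun \<psi> (x + e n * z) * G z))"
      unfolding Bochner_Integration.integral_mult_right_zero scaleR_conv_of_real by (simp only: of_real_mult mult_ac)
    also have "1 / sqrt (2 * pi) * (e n * (sqrt (2 * pi) / e n)) = 1" using e[of n] by simp
    finally show ?thesis by simp
  qed
  have "I \<longlonglongrightarrow> (LINT z|lborel. complex_of_real (test_fun \<psi> x * G z))"
    unfolding I_eq
  proof (rule integral_dominated_convergence)
    show "integrable lborel (\<lambda>z. schwartz_seminorm 0 0 \<psi> * G z)" by (intro integrable_mult_right Gi)
    show "AE z in lborel. (\<lambda>n. complex_of_real (test_fun \<psi> (x + e n * z) * G z)) \<longlonglongrightarrow> complex_of_real (test_fun \<psi> x * G z)"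
    proof (rule AE_I2)
      fix z
      have "isCont (test_fun \<psi>) x" using test_fun_DERIV DERIV_isCont by blast
      moreover have "(\<lambda>n. x + e n * z) \<longlonglongrightarrow> x + 0 * z" by (intro tendsto_intros e0)
      then have "(\<lambda>n. x + e n * z) \<longlonglongrightarrow> x" by simp
      ultimately have "(\<lambda>n. test_fun \<psi> (x + e n * z)) \<longlonglongrightarrow> test_fun \<psi> x" by (rule isCont_tendsto_compose)
      then show "(\<lambda>n. complex_of_real (test_fun \<psi> (x + e n * z) * G z)) \<longlonglongrightarrow> complex_of_real (test_fun \<psi> x * G z)"
        by (intro tendsto_of_real tendsto_mult tendsto_const)
    qed
    show "AE z in lborel. norm (complex_of_real (test_fun \<psi> (x + e n * z) * G z)) \<le> schwartz_seminorm 0 0 \<psi> * G z" for n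
      using seminorm_ge[of _ 0 0 \<psi>] G1 by (intro AE_I2) (auto simp: abs_mult simp del: of_real_mult intro!: mult_right_mono)
  qed measurable
  also have "(LINT z|lborel. complex_of_real (test_fun \<psi> x * G z)) = complex_of_real (test_fun \<psi> x) * complex_of_real (sqrt (2 * pi))"
    using gauss_integral[of 0] by (simp add: G_def)
  finally have "(LINT \<xi>|lborel. schwartz_ift \<psi> \<xi> * cis (- (x * \<xi>))) = complex_of_real (test_fun \<psi> x) * complex_of_real (sqrt (2 * pi))"
    by (rule LIMSEQ_unique[OF lim1])
  then show ?thesis by simp
qed

text \<open>The convolution theorem: write \<open>\<psi>\<close> by the inversion formula inside the
  transform of the product and exchange the integrals.\<close>

lemma schwartz_ift_mult:
  "schwartz_ift (schwartz_mult \<psi> \<phi>) \<eta> = complex_of_real (1 / sqrt (2 * pi)) * (LINT \<xi>|lborel. schwartz_ift \<psi> (\<eta> - \<xi>) * schwartz_ift \<phi> \<xi>)"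
proof -
  let ?c = "complex_of_real (1 / sqrt (2 * pi))"
  let ?k = "\<lambda>x \<xi>. schwartz_ift \<psi> \<xi> * (complex_of_real (test_fun \<phi> x) * cis (x * (\<eta> - \<xi>)))"
  have "schwartz_ift (schwartz_mult \<psi> \<phi>) \<eta> = ?c * (LINT x|lborel. ?c * (LINT \<xi>|lborel. ?k x \<xi>))"
    unfolding schwartz_ift_def[of "schwartz_mult \<psi> \<phi>"]
  proof (intro arg_cong[where f = "times ?c"] Bochner_Integration.integral_cong)
    fix x
    have "?c * (LINT \<xi>|lborel. ?k x \<xi>) = ?c * (LINT \<xi>|lborel. (schwartz_ift \<psi> \<xi> * cis (- (x * \<xi>))) * (complex_of_real (test_fun \<phi> x) * cis (x * \<eta>)))"
    proof -
      have "cis (x * (\<eta> - \<xi>)) = cis (- (x * \<xi>)) * cis (x * \<eta>)" for \<xi> by (simp add: cis_mult right_diff_distrib)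
      then show ?thesis by (simp only: mult_ac)
    qed
    also have "\<dots> = complex_of_real (test_fun \<psi> x) * (complex_of_real (test_fun \<phi> x) * cis (x * \<eta>))"
    proof -
      have "(LINT \<xi>|lborel. (schwartz_ift \<psi> \<xi> * cis (- (x * \<xi>))) * (complex_of_real (test_fun \<phi> x) * cis (x * \<eta>)))
         = (LINT \<xi>|lborel. schwartz_ift \<psi> \<xi> * cis (- (x * \<xi>))) * (complex_of_real (test_fun \<phi> x) * cis (x * \<eta>))"
        by (rule Bochner_Integration.integral_mult_left_zero)
      then show ?thesis unfolding schwartz_inversion[of \<psi> x] by (simp only: mult.assoc)
    qed
    finally show "complex_of_real (test_fun (schwartz_mult \<psi> \<phi>) x) * cis (x * \<eta>) = ?c * (LINT \<xi>|lborel. ?k x \<xi>)"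
      by (simp add: schwartz_mult.rep_eq mult.assoc)
  qed simp
  also have "\<dots> = ?c * (?c * (LINT x|lborel. LINT \<xi>|lborel. ?k x \<xi>))" by simp
  also have "(LINT x|lborel. LINT \<xi>|lborel. ?k x \<xi>) = (LINT \<xi>|lborel. LINT x|lborel. ?k x \<xi>)"
  proof (rule lborel_pair.Fubini_integral[symmetric])
    show "integrable (lborel \<Otimes>\<^sub>M lborel) (\<lambda>(x, \<xi>). ?k x \<xi>)"
    proof (rule integrableI_bounded)
      have "(\<integral>\<^sup>+p. ennreal (norm (case p of (x, \<xi>) \<Rightarrow> ?k x \<xi>)) \<partial>(lborel \<Otimes>\<^sub>M lborel)) = (\<integral>\<^sup>+x. \<integral>\<^sup>+\<xi>. ennreal (norm (?k x \<xi>)) \<partial>lborel \<partial>lborel)"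
        by (subst lborel.nn_integral_fst[symmetric]) auto
      also have "\<dots> = (\<integral>\<^sup>+x. ennreal (norm (test_fun \<phi> x)) * (\<integral>\<^sup>+\<xi>. ennreal (norm (schwartz_ift \<psi> \<xi>)) \<partial>lborel) \<partial>lborel)"
        by (simp add: norm_mult ennreal_mult nn_integral_multc nn_integral_cmult mult.commute)
      also have "\<dots> = (\<integral>\<^sup>+x. ennreal (norm (test_fun \<phi> x)) \<partial>lborel) * (\<integral>\<^sup>+\<xi>. ennreal (norm (schwartz_ift \<psi> \<xi>)) \<partial>lborel)"
        by (rule nn_integral_multc) measurable
      also have "\<dots> < \<infinity>"
        using schwartz_ift_integrable[of \<psi>] test_fun_integrable[of \<phi>] by (simp add: integrable_iff_bounded ennreal_mult_less_top)
      finally show "(\<integral>\<^sup>+p. ennreal (norm (case p of (x, \<xi>) \<Rightarrow> ?k x \<xi>)) \<partial>(lborel \<Otimes>\<^sub>M lborel)) < \<infinity>" .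
    next
      have [measurable]: "(\<lambda>p. cis (fst p * (\<eta> - snd p))) \<in> borel_measurable (lborel \<Otimes>\<^sub>M lborel)"
        by (rule measurable_compose[OF _ cis_measurable(3)]) measurable
      show "(\<lambda>(x, \<xi>). ?k x \<xi>) \<in> borel_measurable (lborel \<Otimes>\<^sub>M lborel)" unfolding case_prod_beta by measurable
    qed
  qed
  also have "?c * (LINT \<xi>|lborel. LINT x|lborel. ?k x \<xi>) = (LINT \<xi>|lborel. schwartz_ift \<psi> \<xi> * schwartz_ift \<phi> (\<eta> - \<xi>))"
    unfolding Bochner_Integration.integral_mult_right_zero schwartz_ift_def[of \<phi>]
    unfolding Bochner_Integration.integral_mult_right_zero[symmetric] by (simp only: mult.left_commute)
  also have "\<dots> = (LINT \<xi>|lborel. schwartz_ift \<psi> (\<eta> - \<xi>) * schwartz_ift \<phi> \<xi>)"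
    using lborel_integral_real_affine[of "-1" "\<lambda>\<xi>. schwartz_ift \<psi> \<xi> * schwartz_ift \<phi> (\<eta> - \<xi>)" \<eta>] by simp
  finally show ?thesis .
qed

text \<open>The transpose of \<open>schwartz_ift_mult\<close>. The exchange of integrals is
  justified because \<open>F\<close> and the transform of \<open>\<phi>\<close> are integrable while
  that of \<open>\<psi>\<close> is bounded.\<close>

lemma is_fourier_schwartz_times:
  assumes f: "is_fourier f F" and F: "integrable lborel F"
  shows "is_fourier (schwartz_times \<psi> f) (\<lambda>\<xi>. complex_of_real (1 / sqrt (2 * pi)) * (LINT \<eta>|lborel. F \<eta> * schwartz_ift \<psi> (\<eta> - \<xi>)))"
proof -
  let ?c = "complex_of_real (1 / sqrt (2 * pi))"
  have [measurable]: "F \<in> borel_measurable borel" using f by (simp add: is_fourier_def)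
  obtain B where B: "0 \<le> B" "\<And>\<xi>. cmod (schwartz_ift \<psi> \<xi>) \<le> B" using schwartz_ift_bounded by blast
  have key: "integrable lborel (\<lambda>\<xi>. (?c * (LINT \<eta>|lborel. F \<eta> * schwartz_ift \<psi> (\<eta> - \<xi>))) * schwartz_ift \<phi> \<xi>) \<and>
    complex_of_real (apply_dist (schwartz_times \<psi> f) \<phi>) = (LINT \<xi>|lborel. (?c * (LINT \<eta>|lborel. F \<eta> * schwartz_ift \<psi> (\<eta> - \<xi>))) * schwartz_ift \<phi> \<xi>)" for \<phi>
  proof -
    let ?k = "\<lambda>\<xi> \<eta>. F \<eta> * schwartz_ift \<psi> (\<eta> - \<xi>) * schwartz_ift \<phi> \<xi>"
    have int: "integrable (lborel \<Otimes>\<^sub>M lborel) (\<lambda>(\<xi>, \<eta>). ?k \<xi> \<eta>)"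
    proof (rule integrableI_bounded)
      have "(\<integral>\<^sup>+p. ennreal (norm (case p of (\<xi>, \<eta>) \<Rightarrow> ?k \<xi> \<eta>)) \<partial>(lborel \<Otimes>\<^sub>M lborel)) = (\<integral>\<^sup>+\<xi>. \<integral>\<^sup>+\<eta>. ennreal (norm (?k \<xi> \<eta>)) \<partial>lborel \<partial>lborel)"
        by (subst lborel.nn_integral_fst[symmetric]) auto
      also have "\<dots> \<le> (\<integral>\<^sup>+\<xi>. \<integral>\<^sup>+\<eta>. (ennreal (norm (F \<eta>)) * (ennreal B * ennreal (norm (schwartz_ift \<phi> \<xi>)))) \<partial>lborel \<partial>lborel)"
      proof (intro nn_integral_mono)
        fix \<xi> \<eta>
        have "norm (?k \<xi> \<eta>) \<le> norm (F \<eta>) * (B * norm (schwartz_ift \<phi> \<xi>))"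
          unfolding norm_mult mult.assoc using B by (intro mult_left_mono mult_right_mono) auto
        from ennreal_leI[OF this] show "ennreal (norm (?k \<xi> \<eta>)) \<le> ennreal (norm (F \<eta>)) * (ennreal B * ennreal (norm (schwartz_ift \<phi> \<xi>)))"
          using B by (simp add: ennreal_mult)
      qed
      also have "\<dots> = (\<integral>\<^sup>+\<eta>. ennreal (norm (F \<eta>)) \<partial>lborel) * (ennreal B * (\<integral>\<^sup>+\<xi>. ennreal (norm (schwartz_ift \<phi> \<xi>)) \<partial>lborel))"
        by (simp add: nn_integral_multc nn_integral_cmult)
      also have "\<dots> < \<infinity>"
        using F schwartz_ift_integrable[of \<phi>] by (simp add: integrable_iff_bounded ennreal_mult_less_top)
      finally show "(\<integral>\<^sup>+p. ennreal (norm (case p of (\<xi>, \<eta>) \<Rightarrow> ?k \<xi> \<eta>)) \<partial>(lborel \<Otimes>\<^sub>M lborel)) < \<infinity>" .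
    qed measurable
    have e: "(?c * (LINT \<eta>|lborel. F \<eta> * schwartz_ift \<psi> (\<eta> - \<xi>))) * schwartz_ift \<phi> \<xi> = ?c * (LINT \<eta>|lborel. ?k \<xi> \<eta>)" for \<xi>
    proof -
      have "(LINT \<eta>|lborel. ?k \<xi> \<eta>) = (LINT \<eta>|lborel. F \<eta> * schwartz_ift \<psi> (\<eta> - \<xi>)) * schwartz_ift \<phi> \<xi>"
        by (rule Bochner_Integration.integral_mult_left_zero)
      then show ?thesis by (simp only: mult.assoc)
    qed
    have "complex_of_real (apply_dist (schwartz_times \<psi> f) \<phi>) = (LINT \<eta>|lborel. F \<eta> * schwartz_ift (schwartz_mult \<psi> \<phi>) \<eta>)"
      using f by (simp add: schwartz_times.rep_eq is_fourier_def)
    also have "\<dots> = (LINT \<eta>|lborel. ?c * (LINT \<xi>|lborel. ?k \<xi> \<eta>))"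
    proof (rule Bochner_Integration.integral_cong)
      fix \<eta>
      have "(LINT \<xi>|lborel. ?k \<xi> \<eta>) = F \<eta> * (LINT \<xi>|lborel. schwartz_ift \<psi> (\<eta> - \<xi>) * schwartz_ift \<phi> \<xi>)"
        by (simp only: Bochner_Integration.integral_mult_right_zero[symmetric] mult.assoc)
      then show "F \<eta> * schwartz_ift (schwartz_mult \<psi> \<phi>) \<eta> = ?c * (LINT \<xi>|lborel. ?k \<xi> \<eta>)"
        unfolding schwartz_ift_mult by (simp only: mult.left_commute)
    qed simp
    also have "\<dots> = ?c * (LINT \<eta>|lborel. LINT \<xi>|lborel. ?k \<xi> \<eta>)" by simp
    also have "(LINT \<eta>|lborel. LINT \<xi>|lborel. ?k \<xi> \<eta>) = (LINT \<xi>|lborel. LINT \<eta>|lborel. ?k \<xi> \<eta>)"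
      by (rule lborel_pair.Fubini_integral[OF int])
    finally show ?thesis
      unfolding e using integrable_mult_right[OF lborel_pair.integrable_fst'[OF int], of ?c] by simp
  qed
  have "(\<lambda>\<xi>. ?c * (LINT \<eta>|lborel. F \<eta> * schwartz_ift \<psi> (\<eta> - \<xi>))) \<in> borel_measurable lborel" by measurable
  with key show ?thesis unfolding is_fourier_def by blast
qed

text \<open>The bracket of \<open>g\<close> with \<open>\<psi>\<close> times \<open>f\<close>,
  written out on the Fourier side, is a double integral; after an exchange of the integrals it is
  the convolution of \<open>G\<close> and \<open>F\<close> paired with \<open>\<psi>\<close>. Since
  \<open>g\<close> may have negative order, \<open>G\<close> itself need not be integrable or square
  integrable, so absolute convergence is asked only of the full double integral, with the decay of
  \<open>\<psi>\<close> included. The description in \<open>dist_mult\<close> determines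
  \<open>h\<close>, as it prescribes all its values.\<close>

lemma dist_mult_eq:
  assumes f: "is_fourier f F" and F: "integrable lborel F" and g: "is_fourier g G"
    and h: "is_fourier h (\<lambda>\<omega>. complex_of_real (1 / sqrt (2 * pi)) * (LINT \<eta>|lborel. G (\<omega> - \<eta>) * F \<eta>))"
    and fin: "\<And>\<psi>. (\<integral>\<^sup>+\<omega>. \<integral>\<^sup>+\<eta>. ennreal (cmod (G (\<omega> - \<eta>) * F \<eta> * schwartz_ift \<psi> \<omega>)) \<partial>lborel \<partial>lborel) < \<infinity>"
  shows "dist_mult f g = h"
proof -
  let ?c = "complex_of_real (1 / sqrt (2 * pi))"
  have [measurable]: "F \<in> borel_measurable borel" "G \<in> borel_measurable borel" using f g by (simp_all add: is_fourier_def)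
  have main: "apply_dist h \<psi> = dual_bracket g (schwartz_times \<psi> f)" for \<psi>
  proof -
    let ?k = "\<lambda>\<omega> \<eta>. G (\<omega> - \<eta>) * F \<eta> * schwartz_ift \<psi> \<omega>"
    \<comment> \<open>\<open>?l\<close> is the integrand as the bracket produces it and
      \<open>?k\<close> as the convolution does; they are related by \<omega> = \<xi> + \<eta> for
      fixed \<open>\<eta>\<close>.\<close>
    let ?l = "\<lambda>\<xi> \<eta>. G \<xi> * F \<eta> * schwartz_ift \<psi> (\<eta> + \<xi>)"
    have int: "integrable (lborel \<Otimes>\<^sub>M lborel) (\<lambda>(\<omega>, \<eta>). ?k \<omega> \<eta>)"
    proof (rule integrableI_bounded)
      show "(\<integral>\<^sup>+p. ennreal (norm (case p of (\<omega>, \<eta>) \<Rightarrow> ?k \<omega> \<eta>)) \<partial>(lborel \<Otimes>\<^sub>M lborel)) < \<infinity>"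
        using fin[of \<psi>] by (subst lborel.nn_integral_fst[symmetric]) auto
    qed measurable
    have int': "integrable (lborel \<Otimes>\<^sub>M lborel) (\<lambda>(\<xi>, \<eta>). ?l \<xi> \<eta>)"
    proof (rule integrableI_bounded)
      have "(\<integral>\<^sup>+p. ennreal (norm (case p of (\<xi>, \<eta>) \<Rightarrow> ?l \<xi> \<eta>)) \<partial>(lborel \<Otimes>\<^sub>M lborel)) = (\<integral>\<^sup>+\<xi>. \<integral>\<^sup>+\<eta>. ennreal (cmod (?l \<xi> \<eta>)) \<partial>lborel \<partial>lborel)"
        by (subst lborel.nn_integral_fst[symmetric]) auto
      also have "\<dots> = (\<integral>\<^sup>+\<eta>. \<integral>\<^sup>+\<xi>. ennreal (cmod (?l \<xi> \<eta>)) \<partial>lborel \<partial>lborel)"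
        by (rule lborel_pair.Fubini'[symmetric]) measurable
      also have "\<dots> = (\<integral>\<^sup>+\<eta>. \<integral>\<^sup>+\<omega>. ennreal (cmod (?k \<omega> \<eta>)) \<partial>lborel \<partial>lborel)"
      proof (rule nn_integral_cong)
        fix \<eta>
        show "(\<integral>\<^sup>+\<xi>. ennreal (cmod (?l \<xi> \<eta>)) \<partial>lborel) = (\<integral>\<^sup>+\<omega>. ennreal (cmod (?k \<omega> \<eta>)) \<partial>lborel)"
          using nn_integral_translate(1)[of "\<lambda>\<xi>. ennreal (cmod (?l \<xi> \<eta>))" \<eta>] by simp
      qed
      also have "\<dots> = (\<integral>\<^sup>+\<omega>. \<integral>\<^sup>+\<eta>. ennreal (cmod (?k \<omega> \<eta>)) \<partial>lborel \<partial>lborel)"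
        by (rule lborel_pair.Fubini') measurable
      finally show "(\<integral>\<^sup>+p. ennreal (norm (case p of (\<xi>, \<eta>) \<Rightarrow> ?l \<xi> \<eta>)) \<partial>(lborel \<Otimes>\<^sub>M lborel)) < \<infinity>"
        using fin[of \<psi>] by simp
    qed measurable
    define S where "S \<xi> = ?c * (LINT \<eta>|lborel. F \<eta> * schwartz_ift \<psi> (\<eta> - \<xi>))" for \<xi>
    have S: "is_fourier (schwartz_times \<psi> f) S" unfolding S_def[abs_def] by (rule is_fourier_schwartz_times[OF f F])
    have [measurable]: "S \<in> borel_measurable borel" using S by (simp add: is_fourier_def)
    have "AE \<xi> in lborel. fourier (schwartz_times \<psi> f) (- \<xi>) = S (- \<xi>)"
      by (rule AE_lborel_uminus[OF is_fourier_unique[OF is_fourier_fourier[OF S] S]])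
    moreover have "AE \<xi> in lborel. fourier g \<xi> = G \<xi>" by (rule is_fourier_unique[OF is_fourier_fourier[OF g] g])
    ultimately have AE: "AE \<xi> in lborel. fourier g \<xi> * fourier (schwartz_times \<psi> f) (- \<xi>) = G \<xi> * S (- \<xi>)"
      by eventually_elim simp
    have [measurable]: "fourier g \<in> borel_measurable borel" "fourier (schwartz_times \<psi> f) \<in> borel_measurable borel"
      using is_fourier_fourier[OF g] is_fourier_fourier[OF S] by (simp_all add: is_fourier_def)
    have "(LINT \<xi>|lborel. fourier g \<xi> * fourier (schwartz_times \<psi> f) (- \<xi>)) = (LINT \<xi>|lborel. G \<xi> * S (- \<xi>))"
      by (rule integral_cong_AE[OF _ _ AE]) measurable
    also have "\<dots> = (LINT \<xi>|lborel. ?c * (LINT \<eta>|lborel. ?l \<xi> \<eta>))"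
    proof (rule Bochner_Integration.integral_cong)
      fix \<xi>
      have "(LINT \<eta>|lborel. ?l \<xi> \<eta>) = G \<xi> * (LINT \<eta>|lborel. F \<eta> * schwartz_ift \<psi> (\<eta> - - \<xi>))"
        unfolding Bochner_Integration.integral_mult_right_zero[symmetric] by (simp add: mult.assoc)
      then show "G \<xi> * S (- \<xi>) = ?c * (LINT \<eta>|lborel. ?l \<xi> \<eta>)" by (simp only: S_def mult.left_commute)
    qed simp
    also have "\<dots> = ?c * (LINT \<xi>|lborel. LINT \<eta>|lborel. ?l \<xi> \<eta>)" by simp
    also have "(LINT \<xi>|lborel. LINT \<eta>|lborel. ?l \<xi> \<eta>) = (LINT \<eta>|lborel. LINT \<xi>|lborel. ?l \<xi> \<eta>)"
      by (rule lborel_pair.Fubini_integral[OF int', symmetric])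
    also have "\<dots> = (LINT \<eta>|lborel. LINT \<omega>|lborel. ?k \<omega> \<eta>)"
    proof (rule Bochner_Integration.integral_cong)
      fix \<eta>
      show "(LINT \<xi>|lborel. ?l \<xi> \<eta>) = (LINT \<omega>|lborel. ?k \<omega> \<eta>)"
        using lborel_integral_real_affine[of 1 "\<lambda>\<xi>. ?l \<xi> \<eta>" "- \<eta>"] by (simp add: add.commute)
    qed simp
    also have "\<dots> = (LINT \<omega>|lborel. LINT \<eta>|lborel. ?k \<omega> \<eta>)" by (rule lborel_pair.Fubini_integral[OF int])
    also have "?c * \<dots> = (LINT \<omega>|lborel. (?c * (LINT \<eta>|lborel. G (\<omega> - \<eta>) * F \<eta>)) * schwartz_ift \<psi> \<omega>)"
    proof -
      have k: "(LINT \<eta>|lborel. ?k \<omega> \<eta>) = (LINT \<eta>|lborel. G (\<omega> - \<eta>) * F \<eta>) * schwartz_ift \<psi> \<omega>" for \<omega>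
        by (rule Bochner_Integration.integral_mult_left_zero)
      have "?c * (LINT \<omega>|lborel. LINT \<eta>|lborel. ?k \<omega> \<eta>) = (LINT \<omega>|lborel. ?c * (LINT \<eta>|lborel. ?k \<omega> \<eta>))"
        by (rule Bochner_Integration.integral_mult_right_zero[symmetric])
      then show ?thesis unfolding k by (simp only: mult.assoc)
    qed
    also have "\<dots> = complex_of_real (apply_dist h \<psi>)" using h by (simp add: is_fourier_def)
    finally show ?thesis unfolding dual_bracket_def by simp
  qed
  show ?thesis
    unfolding dist_mult_def
  proof (rule the_equality)
    show "\<forall>\<psi>. apply_dist h \<psi> = dual_bracket g (schwartz_times \<psi> f)" using main by blast
    fix k assume "\<forall>\<psi>. apply_dist k \<psi> = dual_bracket g (schwartz_times \<psi> f)"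
    then show "k = h" using main by (simp add: apply_dist_inject[symmetric] fun_eq_iff)
  qed
qed

section \<open>The Helmholtz operator\<close>

context
  fixes \<sigma> :: real
  assumes \<sigma>: "\<sigma> = 1 \<or> \<sigma> = -1"
begin

definition half_exp :: "real \<Rightarrow> real" where "half_exp y = (if y > 0 then exp (- y) else 0)"
text \<open>The decaying solution \<psi> of \<psi> - \<sigma> \<psi>' = \<phi>. As 1 - \<partial>^2
  is the product of 1 - \<partial> and 1 + \<partial>, the two signs of \<open>\<sigma>\<close>
  together invert the Helmholtz operator on test functions, by one-sided integrals in place of
  Fourier inversion.\<close>

definition resolvent :: "schwartz \<Rightarrow> real \<Rightarrow> real" where
  "resolvent \<phi> x = (LINT y|lborel. half_exp y * test_fun \<phi> (x + \<sigma> * y))"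

lemma half_exp_measurable [measurable]: "half_exp \<in> borel_measurable borel"
  unfolding half_exp_def by measurable

lemma half_exp_nonneg: "0 \<le> half_exp y" by (simp add: half_exp_def)

lemma half_exp_moment: "integrable lborel (\<lambda>y. \<bar>y\<bar> ^ j * half_exp y)"
proof (rule integrableI_bounded)
  have "(\<integral>\<^sup>+y. ennreal (norm (\<bar>y\<bar> ^ j * half_exp y)) \<partial>lborel) \<le> (\<integral>\<^sup>+y. ennreal (y ^ j * exp (- y)) * indicator {0..} y \<partial>lborel)"
    by (intro nn_integral_mono) (auto simp: indicator_def half_exp_def abs_mult)
  also have "\<dots> < \<infinity>" by (subst nn_intergal_power_times_exp_Ici) simp
  finally show "(\<integral>\<^sup>+y. ennreal (norm (\<bar>y\<bar> ^ j * half_exp y)) \<partial>lborel) < \<infinity>" .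
qed measurable

lemma half_exp_integrable: "integrable lborel half_exp"
  using half_exp_moment[of 0] by simp

lemma test_fun_bound: "\<bar>x ^ j * test_fun \<phi> x\<bar> \<le> schwartz_seminorm j 0 \<phi>"
  using seminorm_ge[of x j 0 \<phi>] by simp

lemma resolvent_integrable: "integrable lborel (\<lambda>y. half_exp y * test_fun \<phi> (x + \<sigma> * y))"
proof (rule Bochner_Integration.integrable_bound)
  show "integrable lborel (\<lambda>y. schwartz_seminorm 0 0 \<phi> * half_exp y)" by (intro integrable_mult_right half_exp_integrable)
  show "AE y in lborel. norm (half_exp y * test_fun \<phi> (x + \<sigma> * y)) \<le> norm (schwartz_seminorm 0 0 \<phi> * half_exp y)"
    using test_fun_bound[of _ 0 \<phi>] half_exp_nonneg
    by (intro AE_I2) (simp add: abs_mult mult.commute mult_left_mono abs_of_nonneg[OF seminorm_nonneg])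
qed measurable

lemma resolvent_DERIV: "(resolvent \<phi> has_real_derivative resolvent (schwartz_deriv \<phi>) x) (at x)"
proof -
  have "((\<lambda>h. (resolvent \<phi> (x + h) - resolvent \<phi> x) / h) \<longlongrightarrow> resolvent (schwartz_deriv \<phi>) x) (at 0)"
    unfolding tendsto_at_iff_sequentially comp_def
  proof (intro allI impI)
    fix h :: "nat \<Rightarrow> real" assume h: "\<forall>i. h i \<in> UNIV - {0}" "h \<longlonglongrightarrow> 0"
    let ?q = "\<lambda>n y. (test_fun \<phi> (x + h n + \<sigma> * y) - test_fun \<phi> (x + \<sigma> * y)) / h n"
    have eq: "(resolvent \<phi> (x + h n) - resolvent \<phi> x) / h n = (LINT y|lborel. half_exp y * ?q n y)" for n
    proof -
      have "(LINT y|lborel. half_exp y * ?q n y) = (LINT y|lborel. (half_exp y * test_fun \<phi> (x + h n + \<sigma> * y) - half_exp y * test_fun \<phi> (x + \<sigma> * y)) / h n)"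
        by (simp add: right_diff_distrib)
      also have "\<dots> = (LINT y|lborel. half_exp y * test_fun \<phi> (x + h n + \<sigma> * y) - half_exp y * test_fun \<phi> (x + \<sigma> * y)) / h n" by simp
      also have "\<dots> = (resolvent \<phi> (x + h n) - resolvent \<phi> x) / h n"
        using Bochner_Integration.integral_diff[OF resolvent_integrable[of \<phi> "x + h n"] resolvent_integrable[of \<phi> x]] by (simp add: resolvent_def)
      finally show ?thesis by (rule sym)
    qed
    show "(\<lambda>n. (resolvent \<phi> (x + h n) - resolvent \<phi> x) / h n) \<longlonglongrightarrow> resolvent (schwartz_deriv \<phi>) x"
      unfolding eq resolvent_def[of "schwartz_deriv \<phi>"]
    proof (rule integral_dominated_convergence)
      let ?B = "schwartz_seminorm 0 0 (schwartz_deriv \<phi>)"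
      show "integrable lborel (\<lambda>y. ?B * half_exp y)" by (intro integrable_mult_right half_exp_integrable)
      show "AE y in lborel. (\<lambda>n. half_exp y * ?q n y) \<longlonglongrightarrow> half_exp y * test_fun (schwartz_deriv \<phi>) (x + \<sigma> * y)"
      proof (intro AE_I2 tendsto_mult tendsto_const)
        fix y
        have "((\<lambda>k. (test_fun \<phi> ((x + \<sigma> * y) + k) - test_fun \<phi> (x + \<sigma> * y)) / k) \<longlongrightarrow> test_fun (schwartz_deriv \<phi>) (x + \<sigma> * y)) (at 0)"
          using test_fun_DERIV[of \<phi> "x + \<sigma> * y"] by (simp add: DERIV_def)
        then show "(\<lambda>n. ?q n y) \<longlonglongrightarrow> test_fun (schwartz_deriv \<phi>) (x + \<sigma> * y)"
          unfolding tendsto_at_iff_sequentially comp_def using h by (simp add: add_ac)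
      qed
      show "AE y in lborel. norm (half_exp y * ?q n y) \<le> ?B * half_exp y" for n
      proof (rule AE_I2)
        fix y
        have "norm (test_fun \<phi> (x + h n + \<sigma> * y) - test_fun \<phi> (x + \<sigma> * y)) \<le> ?B * norm ((x + h n + \<sigma> * y) - (x + \<sigma> * y))"
        proof (rule field_differentiable_bound[where S = UNIV])
          show "(test_fun \<phi> has_field_derivative test_fun (schwartz_deriv \<phi>) z) (at z within UNIV)" for z using test_fun_DERIV by simp
          show "norm (test_fun (schwartz_deriv \<phi>) z) \<le> ?B" for z using test_fun_bound[of z 0 "schwartz_deriv \<phi>"] by simp
        qed auto
        then have "\<bar>?q n y\<bar> \<le> ?B" using h(1) by (simp add: abs_divide pos_divide_le_eq)
        then show "norm (half_exp y * ?q n y) \<le> ?B * half_exp y"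
          using half_exp_nonneg[of y] by (simp only: real_norm_def abs_mult abs_of_nonneg mult.commute[of ?B] mult_left_mono)
      qed
    qed measurable
  qed
  then show ?thesis by (simp add: DERIV_def)
qed

text \<open>The integrand of the left-hand side is, up to sign, the derivative in \<open>y\<close>
  of \<open>exp (- y) * test_fun \<phi> (x + \<sigma> * y)\<close>; the boundary value at 0 gives
  \<phi>, that at infinity vanishes. That \<sigma>^2 = 1 is not involved: \<open>\<sigma>\<close>
  enters only by the chain rule.\<close>

lemma resolvent_equation: "resolvent \<phi> x - \<sigma> * resolvent (schwartz_deriv \<phi>) x = test_fun \<phi> x"
proof -
  let ?F = "\<lambda>y. exp (- y) * test_fun \<phi> (x + \<sigma> * y)"
  let ?f = "\<lambda>y. - (exp (- y) * test_fun \<phi> (x + \<sigma> * y)) + \<sigma> * (exp (- y) * test_fun (schwartz_deriv \<phi>) (x + \<sigma> * y))"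
  let ?g = "\<lambda>y. - (half_exp y * test_fun \<phi> (x + \<sigma> * y)) + \<sigma> * (half_exp y * test_fun (schwartz_deriv \<phi>) (x + \<sigma> * y))"
  have g: "integrable lborel ?g"
    by (intro Bochner_Integration.integrable_add integrable_minus integrable_mult_right resolvent_integrable)
  have eq: "(\<lambda>y. indicator (einterval 0 \<infinity>) y *\<^sub>R ?f y) = ?g"
    by (auto simp: fun_eq_iff indicator_def half_exp_def einterval_def zero_ereal_def)
  have D: "(?F has_real_derivative ?f y) (at y)" for y
    by (rule derivative_eq_intros DERIV_chain2[OF test_fun_DERIV] refl)+ (simp add: algebra_simps)
  have cont: "isCont (test_fun \<theta>) z" for \<theta> z using test_fun_DERIV DERIV_isCont by blast
  have "(LBINT y=0..\<infinity>. ?f y) = 0 - test_fun \<phi> x"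
  proof (rule interval_integral_FTC_integrable[where F = ?F])
    show "(?F has_vector_derivative ?f y) (at y)" for y using D by (simp add: has_real_derivative_iff_has_vector_derivative)
    show "isCont ?f y" for y
      by (intro continuous_intros isCont_o2[OF _ cont])
    show "set_integrable lborel (einterval 0 \<infinity>) ?f" unfolding set_integrable_def eq by (rule g)
    have "(?F \<longlongrightarrow> ?F 0) (at_right 0)"
      using DERIV_isCont[OF D[of 0]] by (simp add: isCont_def filterlim_at_split)
    then show "((?F \<circ> real_of_ereal) \<longlongrightarrow> test_fun \<phi> x) (at_right 0)" by (simp add: ereal_tendsto_simps zero_ereal_def)
    have "(?F \<longlongrightarrow> 0) at_top"
    proof (rule Lim_null_comparison)
      show "\<forall>\<^sub>F y in at_top. norm (?F y) \<le> schwartz_seminorm 0 0 \<phi> * exp (- y)"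
        using test_fun_bound[of _ 0 \<phi>] by (intro always_eventually allI) (simp add: abs_mult mult.commute mult_left_mono)
      show "((\<lambda>y. schwartz_seminorm 0 0 \<phi> * exp (- y)) \<longlongrightarrow> 0) at_top" by real_asymp
    qed
    then show "((?F \<circ> real_of_ereal) \<longlongrightarrow> 0) (at_left \<infinity>)" by (simp add: ereal_tendsto_simps)
  qed simp
  moreover have "(LBINT y=0..\<infinity>. ?f y) = (LINT y|lborel. indicator (einterval 0 \<infinity>) y *\<^sub>R ?f y)"
    unfolding interval_lebesgue_integral_def set_lebesgue_integral_def by simp
  ultimately have "(LINT y|lborel. ?g y) = 0 - test_fun \<phi> x" unfolding eq by (simp only:)
  moreover have "(LINT y|lborel. ?g y) = - resolvent \<phi> x + \<sigma> * resolvent (schwartz_deriv \<phi>) x"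
    using resolvent_integrable[of \<phi> x] resolvent_integrable[of "schwartz_deriv \<phi>" x] by (simp add: resolvent_def)
  ultimately show ?thesis by simp
qed

text \<open>By \<bar>x\<bar> \<le> \<bar>x + \<sigma> y\<bar> + \<bar>y\<bar> a power of
  \<open>x\<close> is paid for either by the decay of the test function at the shifted point or by a
  moment of the exponential.\<close>

lemma resolvent_bounded: "bounded (range (\<lambda>x. x ^ j * resolvent \<phi> x))"
proof -
  let ?B = "schwartz_seminorm j 0 \<phi>" and ?A = "schwartz_seminorm 0 0 \<phi>"
  let ?h = "\<lambda>y. 2 ^ j * (?B * half_exp y + ?A * (\<bar>y\<bar> ^ j * half_exp y))"
  have hi: "integrable lborel ?h"
    by (intro integrable_mult_right Bochner_Integration.integrable_add half_exp_integrable half_exp_moment)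
  have le: "\<bar>x ^ j * (half_exp y * test_fun \<phi> (x + \<sigma> * y))\<bar> \<le> ?h y" for x y
  proof -
    let ?z = "x + \<sigma> * y"
    have "\<bar>\<sigma> * y\<bar> = \<bar>y\<bar>" using \<sigma> by auto
    then have "\<bar>x\<bar> \<le> \<bar>?z\<bar> + \<bar>y\<bar>" by linarith
    moreover have "\<bar>?z\<bar> \<le> max \<bar>?z\<bar> \<bar>y\<bar>" "\<bar>y\<bar> \<le> max \<bar>?z\<bar> \<bar>y\<bar>" by simp_all
    ultimately have "\<bar>x\<bar> \<le> 2 * max \<bar>?z\<bar> \<bar>y\<bar>" by linarith
    then have "\<bar>x\<bar> ^ j \<le> (2 * max \<bar>?z\<bar> \<bar>y\<bar>) ^ j" by (intro power_mono) auto
    also have "\<dots> \<le> 2 ^ j * (\<bar>?z\<bar> ^ j + \<bar>y\<bar> ^ j)" by (simp add: power_mult_distrib max_def)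
    finally have "\<bar>x ^ j * test_fun \<phi> ?z\<bar> \<le> 2 ^ j * (\<bar>?z\<bar> ^ j + \<bar>y\<bar> ^ j) * \<bar>test_fun \<phi> ?z\<bar>"
      by (simp add: abs_mult power_abs mult_right_mono)
    also have "\<dots> = 2 ^ j * (\<bar>?z ^ j * test_fun \<phi> ?z\<bar> + \<bar>y\<bar> ^ j * \<bar>?z ^ 0 * test_fun \<phi> ?z\<bar>)"
      by (simp add: abs_mult power_abs algebra_simps)
    also have "\<dots> \<le> 2 ^ j * (?B + \<bar>y\<bar> ^ j * ?A)"
      by (rule mult_left_mono[OF add_mono[OF test_fun_bound mult_left_mono[OF test_fun_bound]]]) simp_all
    finally have "\<bar>x ^ j * test_fun \<phi> ?z\<bar> * half_exp y \<le> 2 ^ j * (?B + \<bar>y\<bar> ^ j * ?A) * half_exp y"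
      by (rule mult_right_mono[OF _ half_exp_nonneg])
    then show ?thesis using half_exp_nonneg[of y] by (simp add: abs_mult algebra_simps)
  qed
  have "\<bar>x ^ j * resolvent \<phi> x\<bar> \<le> (LINT y|lborel. ?h y)" for x
  proof -
    have "x ^ j * resolvent \<phi> x = (LINT y|lborel. x ^ j * (half_exp y * test_fun \<phi> (x + \<sigma> * y)))" by (simp add: resolvent_def)
    also have "\<bar>\<dots>\<bar> \<le> (LINT y|lborel. \<bar>x ^ j * (half_exp y * test_fun \<phi> (x + \<sigma> * y))\<bar>)"
      by (rule integral_abs_bound)
    also have "\<dots> \<le> (LINT y|lborel. ?h y)"
      by (intro integral_mono integrable_abs integrable_mult_right resolvent_integrable hi le)
    finally show ?thesis .
  qed
  then show ?thesis by (auto simp: bounded_iff)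
qed

lemma resolvent_exists: "\<exists>\<psi>. \<psi> - \<sigma> *\<^sub>R schwartz_deriv \<psi> = \<phi>"
proof -
  have d: "deriv (resolvent \<phi>) = resolvent (schwartz_deriv \<phi>)" for \<phi>
    by (rule ext, rule DERIV_imp_deriv, rule resolvent_DERIV)
  have "decaying_upto n (resolvent \<phi>)" for n \<phi>
  proof (induction n arbitrary: \<phi>)
    case 0
    show ?case unfolding decaying_upto_0 using resolvent_bounded resolvent_DERIV real_differentiable_def by blast
  next
    case (Suc n)
    show ?case unfolding decaying_upto_Suc decaying_upto_0 d
      using resolvent_bounded resolvent_DERIV real_differentiable_def Suc by blast
  qed
  then have sch: "is_schwartz (resolvent \<phi>)" by (simp add: is_schwartz_upto)
  then have t: "test_fun (Schwartz (resolvent \<phi>)) = resolvent \<phi>" by (simp add: Schwartz_inverse)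
  have "test_fun (Schwartz (resolvent \<phi>) - \<sigma> *\<^sub>R schwartz_deriv (Schwartz (resolvent \<phi>))) = test_fun \<phi>"
    by (simp add: fun_eq_iff minus_schwartz.rep_eq scaleR_schwartz.rep_eq schwartz_deriv.rep_eq t d resolvent_equation)
  then show ?thesis by (auto simp: test_fun_inject)
qed

end

section \<open>The inverse Helmholtz operator on distributions\<close>

lemma helmholtz_surj: "\<exists>\<psi>. \<psi> - schwartz_deriv (schwartz_deriv \<psi>) = \<phi>"
proof -
  obtain \<theta> where x: "\<theta> - 1 *\<^sub>R schwartz_deriv \<theta> = \<phi>" using resolvent_exists[of 1 \<phi>] by auto
  obtain \<psi> where p: "\<psi> - (-1) *\<^sub>R schwartz_deriv \<psi> = \<theta>" using resolvent_exists[of "-1" \<theta>] by auto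
  have p': "\<theta> = \<psi> + schwartz_deriv \<psi>" using p by simp
  have "\<phi> = (\<psi> + schwartz_deriv \<psi>) - schwartz_deriv (\<psi> + schwartz_deriv \<psi>)" using x by (simp add: p')
  then show ?thesis by (intro exI[of _ \<psi>]) (simp add: schwartz_deriv_add)
qed

lemma apply_dist_linear: "linear (apply_dist T)"
  using apply_dist[of T] by (simp add: is_tempered_def)

text \<open>Uniqueness by transposition: 1 - \<partial>^2 maps test functions onto test functions,
  so a tempered distribution is determined by its image under 1 - \<partial>^2. No growth
  restriction beyond temperedness enters.\<close>

lemma helmholtz_inverse_eq:
  assumes "v - dist_deriv (dist_deriv v) = f"
  shows "helmholtz_inverse f = v"
  unfolding helmholtz_inverse_def
proof (rule the_equality)
  fix w assume w: "w - dist_deriv (dist_deriv w) = f"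
  have "apply_dist w \<phi> = apply_dist v \<phi>" for \<phi>
  proof -
    obtain \<psi> where \<psi>: "\<psi> - schwartz_deriv (schwartz_deriv \<psi>) = \<phi>" using helmholtz_surj by blast
    have "apply_dist T \<phi> = apply_dist (T - dist_deriv (dist_deriv T)) \<psi>" for T
      unfolding \<psi>[symmetric] linear_diff[OF apply_dist_linear] by (simp add: minus_tempered.rep_eq dist_deriv.rep_eq)
    then show ?thesis using w assms by simp
  qed
  then show "w = v" by (simp add: apply_dist_inject[symmetric] fun_eq_iff)
qed (rule assms)

section \<open>Sobolev spaces as copies of square-integrable functions\<close>

text \<open>The operator \<langle>D\<rangle>^(-r), an isometric isomorphism of \<open>l2h\<close>
  onto H^r. All statements about Sobolev spaces are translated through it into statements about the
  type \<open>l2h\<close>.\<close>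

definition embed :: "real \<Rightarrow> l2h \<Rightarrow> tempered" where
  "embed r x = (THE T. is_fourier T (\<lambda>\<xi>. complex_of_real (japanese \<xi> powr (- r)) * hat x \<xi>))"

lemma japanese_weight_cancel: "(1 + \<xi>\<^sup>2) powr r * (cmod (complex_of_real (japanese \<xi> powr (- r)) * z))\<^sup>2 = (cmod z)\<^sup>2"
proof -
  have p: "0 < 1 + \<xi>\<^sup>2" by (simp add: add_pos_nonneg)
  have "(1 + \<xi>\<^sup>2) powr r * (japanese \<xi> powr (- r))\<^sup>2 = 1"
    unfolding japanese_powr power2_eq_square[of "_ powr _"] powr_add[symmetric] using p by simp
  then show ?thesis by (simp add: norm_mult power_mult_distrib flip: mult.assoc)
qed

lemma is_fourier_embed: "is_fourier (embed r x) (\<lambda>\<xi>. complex_of_real (japanese \<xi> powr (- r)) * hat x \<xi>)"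
proof -
  let ?g = "\<lambda>\<xi>. complex_of_real (japanese \<xi> powr (- r)) * hat x \<xi>"
  have "\<exists>T. is_fourier T ?g"
  proof (rule tempered_of_fourier[where r = r])
    show "integrable lborel (\<lambda>\<xi>. (1 + \<xi>\<^sup>2) powr r * (cmod (?g \<xi>))\<^sup>2)"
      unfolding japanese_weight_cancel by (rule hat_square_integrable)
    show "?g (- \<xi>) = cnj (?g \<xi>)" for \<xi> by (simp add: hat_minus)
  qed measurable
  then obtain T where T: "is_fourier T ?g" by blast
  show ?thesis unfolding embed_def by (rule theI[of _ T]) (use T is_fourier_inj in blast)+
qed

lemma embedI:
  assumes "is_fourier T g" and "AE \<xi> in lborel. g \<xi> = complex_of_real (japanese \<xi> powr (- r)) * hat x \<xi>"
  shows "T = embed r x"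
proof -
  have "is_fourier T (\<lambda>\<xi>. complex_of_real (japanese \<xi> powr (- r)) * hat x \<xi>)"
    by (rule is_fourier_cong_AE[OF assms(1) _ assms(2)]) measurable
  then show ?thesis by (rule is_fourier_inj[OF _ is_fourier_embed])
qed

lemma embed_in_sobolev [simp]: "embed r x \<in> sobolev r"
  unfolding sobolev_cong(1)[OF is_fourier_embed] japanese_weight_cancel by (rule hat_square_integrable)

lemma sobolev_norm_embed [simp]: "sobolev_norm r (embed r x) = norm x"
  unfolding sobolev_cong(2)[OF is_fourier_embed] japanese_weight_cancel norm_l2h[symmetric] by simp

lemma embed_add: "embed r x + embed r y = embed r (x + y)"
  by (rule embedI[OF is_fourier_add[OF is_fourier_embed is_fourier_embed]])
     (use hat_add[of x y] in eventually_elim, simp add: distrib_left)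

lemma embed_diff: "embed r x - embed r y = embed r (x - y)"
  by (rule embedI[OF is_fourier_diff[OF is_fourier_embed is_fourier_embed]])
     (use hat_diff[of x y] in eventually_elim, simp add: right_diff_distrib)

lemma embed_scaleR: "c *\<^sub>R embed r x = embed r (c *\<^sub>R x)"
  by (rule embedI[OF is_fourier_scaleR[OF is_fourier_embed]])
     (use hat_scaleR[of c x] in eventually_elim, simp)

lemma embed_0 [simp]: "embed r 0 = 0"
  using embed_diff[of r 0 0] by simp

lemma embed_sum: "(\<Sum>i\<in>I. embed r (f i)) = embed r (\<Sum>i\<in>I. f i)"
  by (induction I rule: infinite_finite_induct) (simp_all add: embed_add)

lemma embed_eq_iff [simp]: "embed r x = embed r y \<longleftrightarrow> x = y"
proof
  assume "embed r x = embed r y"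
  then have "sobolev_norm r (embed r (x - y)) = sobolev_norm r 0" by (simp flip: embed_diff)
  then show "x = y" by (simp add: sobolev_norm_zero)
qed simp

lemma sobolev_embed:
  assumes T: "T \<in> sobolev r"
  obtains x where "T = embed r x"
proof -
  let ?F = "fourier T"
  have [measurable]: "?F \<in> borel_measurable borel" using sobolevD(1)[OF T] unfolding is_fourier_def by simp
  \<comment> \<open>The average with the reflected conjugate alters \<open>?F\<close> only on a null
    set and makes \<open>g\<close> Hermitian at every point, as \<open>herm_l2\<close>
    demands.\<close>
  define g where "g \<xi> = complex_of_real (japanese \<xi> powr r) * ((?F \<xi> + cnj (?F (- \<xi>))) / 2)" for \<xi>
  have [measurable]: "g \<in> borel_measurable borel" unfolding g_def by measurable
  have g: "AE \<xi> in lborel. ?F \<xi> = complex_of_real (japanese \<xi> powr (- r)) * g \<xi>"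
    using is_fourier_herm[OF sobolevD(1)[OF T]]
  proof eventually_elim
    case (elim \<xi>)
    have "japanese \<xi> powr (- r) * japanese \<xi> powr r = 1" by (simp flip: powr_add)
    then have "complex_of_real (japanese \<xi> powr (- r)) * complex_of_real (japanese \<xi> powr r) = 1"
      by (simp only: of_real_mult[symmetric] of_real_1)
    moreover have "(?F \<xi> + cnj (?F (- \<xi>))) / 2 = ?F \<xi>" unfolding elim by simp
    ultimately show ?case unfolding g_def by (metis mult.assoc mult_1)
  qed
  have "herm_l2 g"
    unfolding herm_l2_def
  proof (intro conjI allI)
    show "g (- \<xi>) = cnj (g \<xi>)" for \<xi> by (simp add: g_def add.commute)
    have "AE \<xi> in lborel. (1 + \<xi>\<^sup>2) powr r * (cmod (?F \<xi>))\<^sup>2 = (cmod (g \<xi>))\<^sup>2"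
      using g by eventually_elim (simp only: japanese_weight_cancel)
    then show "integrable lborel (\<lambda>\<xi>. (cmod (g \<xi>))\<^sup>2)"
      by (rule integrable_cong_AE_imp[OF sobolevD(3)[OF T], rotated]) measurable
  qed measurable
  from hat_of_hat[OF this] have "AE \<xi> in lborel. ?F \<xi> = complex_of_real (japanese \<xi> powr (- r)) * hat (of_hat g) \<xi>"
    using g by eventually_elim simp
  from embedI[OF sobolevD(1)[OF T] this] show thesis by (rule that)
qed

text \<open>\<open>embed r\<close> is linear, so it maps Riemann sums to Riemann sums; it is
  isometric, so it preserves and reflects their convergence; and it is onto, so every limit in H^r
  has a preimage.\<close>

lemma has_sobolev_integral_embed:
  assumes F: "\<And>\<tau>. \<tau> \<in> {a..b} \<Longrightarrow> F \<tau> = embed r (f \<tau>)"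
  shows "has_sobolev_integral r F I a b \<longleftrightarrow> (\<exists>y. I = embed r y \<and> (f has_integral y) {a..b})"
proof -
  interpret S: Metric_space "sobolev r" "\<lambda>S T. sobolev_norm r (S - T)" by (rule Metric_space_sobolev)
  let ?S = "\<lambda>p. \<Sum>(\<tau>, K)\<in>p. measure lborel K *\<^sub>R F \<tau>" and ?s = "\<lambda>p. \<Sum>(\<tau>, K)\<in>p. measure lborel K *\<^sub>R f \<tau>"
  have ev: "\<forall>\<^sub>F p in division_filter (cbox a b). ?S p = embed r (?s p)"
    using eventually_division_filter_tagged_division[of "cbox a b"]
  proof eventually_elim
    case (elim p)
    have "?S p = (\<Sum>q\<in>p. embed r (case q of (\<tau>, K) \<Rightarrow> measure lborel K *\<^sub>R f \<tau>))"
      using elim F tag_in_interval[OF elim] by (intro sum.cong) (auto simp: embed_scaleR)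
    then show ?case by (simp only: embed_sum)
  qed
  have top: "mtopology_of (sobolev_metric r) = S.mtopology"
    by (simp add: mtopology_of_def sobolev_metric_def)
  have "limitin S.mtopology ?S (embed r y) (division_filter (cbox a b)) \<longleftrightarrow> (f has_integral y) {a..b}" for y
  proof -
    have "(\<forall>\<^sub>F p in division_filter (cbox a b). ?S p \<in> sobolev r \<and> sobolev_norm r (?S p - embed r y) < e)
      \<longleftrightarrow> (\<forall>\<^sub>F p in division_filter (cbox a b). dist (?s p) y < e)" for e
      by (rule eventually_cong[OF ev]) (simp add: embed_diff dist_norm)
    then show ?thesis
      unfolding S.limitin_metric using has_integral_cbox[of f y a b] by (simp add: tendsto_iff)
  qed
  moreover have "\<exists>y. I = embed r y" if "limitin S.mtopology ?S I (division_filter (cbox a b))"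
    using S.limitin_mspace[OF that] sobolev_embed by metis
  ultimately show ?thesis unfolding has_sobolev_integral_def top using F by auto
qed

lemma Lipschitz_embed: "Lipschitz_continuous_map euclidean_metric (sobolev_metric r) (embed r)"
proof -
  have "sobolev_norm r (embed r x - embed r y) \<le> 1 * dist x y" for x y by (simp only: embed_diff sobolev_norm_embed dist_norm mult_1)
  then show ?thesis unfolding Lipschitz_continuous_map_def mspace_sobolev_metric mdist_sobolev_metric
    by (intro conjI exI[of _ 1]) auto
qed

lemma Lipschitz_inv_embed: "Lipschitz_continuous_map (sobolev_metric r) euclidean_metric (inv (embed r))"
proof -
  have "inj (embed r)" by (simp add: inj_def)
  then have i: "inv (embed r) (embed r x) = x" for x by simp
  have "dist (inv (embed r) S) (inv (embed r) T) \<le> 1 * sobolev_norm r (S - T)" if "S \<in> sobolev r" "T \<in> sobolev r" for S T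
  proof -
    obtain x where x: "S = embed r x" by (rule sobolev_embed[OF \<open>S \<in> sobolev r\<close>])
    obtain y where y: "T = embed r y" by (rule sobolev_embed[OF \<open>T \<in> sobolev r\<close>])
    from x y show ?thesis by (simp only: i embed_diff sobolev_norm_embed dist_norm mult_1)
  qed
  then show ?thesis unfolding Lipschitz_continuous_map_def mspace_sobolev_metric mdist_sobolev_metric
    by (intro conjI exI[of _ 1]) auto
qed

text \<open>\<open>embed r\<close> and its inverse are Lipschitz, hence continuity passes in both
  directions; boundedness comes from compactness of \<open>{0..T}\<close>, and the restriction
  supplies the extensional representative.\<close>

lemma mspace_C0_sobolev:
  "u \<in> mspace (C0_sobolev T r) \<longleftrightarrow> (\<exists>v. continuous_on {0..T} v \<and> u = restrict (\<lambda>t. embed r (v t)) {0..T})"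
proof
  note mspace = compactin_mspace_cfunspace[of "top_of_set {0..T}" "sobolev_metric r"]
  have c: "compactin (top_of_set {0..T}) (topspace (top_of_set {0..T}))"
    by (simp add: compactin_subtopology)
  {
    assume "u \<in> mspace (C0_sobolev T r)"
    then have u: "\<And>t. t \<in> {0..T} \<Longrightarrow> u t \<in> sobolev r" "u \<in> extensional {0..T}"
      and cu: "continuous_map (top_of_set {0..T}) (mtopology_of (sobolev_metric r)) u"
      unfolding C0_sobolev_def mspace[OF c] by auto
    have "continuous_map (mtopology_of (sobolev_metric r)) (mtopology_of euclidean_metric) (inv (embed r))"
      by (rule Lipschitz_continuous_imp_continuous_map[OF Lipschitz_inv_embed])
    from continuous_map_compose[OF cu this] have "continuous_on {0..T} (inv (embed r) \<circ> u)" by simp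
    moreover have "u = restrict (\<lambda>t. embed r ((inv (embed r) \<circ> u) t)) {0..T}"
    proof (rule extensionalityI[OF u(2)])
      show "u t = restrict (\<lambda>t. embed r ((inv (embed r) \<circ> u) t)) {0..T} t" if "t \<in> {0..T}" for t
      proof -
        obtain x where "u t = embed r x" by (rule sobolev_embed[OF u(1)[OF \<open>t \<in> {0..T}\<close>]])
        then have "u t \<in> range (embed r)" by blast
        then show ?thesis using that by (simp add: f_inv_into_f)
      qed
    qed simp
    ultimately show "\<exists>v. continuous_on {0..T} v \<and> u = restrict (\<lambda>t. embed r (v t)) {0..T}" by blast
  }
  {
    assume "\<exists>v. continuous_on {0..T} v \<and> u = restrict (\<lambda>t. embed r (v t)) {0..T}"
    then obtain v where v: "continuous_on {0..T} v" and u: "u = restrict (\<lambda>t. embed r (v t)) {0..T}" by blast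
    have "continuous_map (mtopology_of euclidean_metric) (mtopology_of (sobolev_metric r)) (embed r)"
      by (rule Lipschitz_continuous_imp_continuous_map[OF Lipschitz_embed])
    then have "continuous_map (top_of_set {0..T}) (mtopology_of (sobolev_metric r)) (embed r \<circ> v)"
      using v by (intro continuous_map_compose[of _ euclidean]) simp_all
    then have "continuous_map (top_of_set {0..T}) (mtopology_of (sobolev_metric r)) u"
      by (rule continuous_map_eq) (simp add: u)
    then show "u \<in> mspace (C0_sobolev T r)" unfolding C0_sobolev_def mspace[OF c] by (auto simp: u)
  }
qed

section \<open>The nonlinearity on the Fourier side\<close>

context b_family
begin

lemma nn_hat_conv: "(\<integral>\<^sup>+\<eta>. ennreal (cmod (hat x (\<xi> - \<eta>)) * cmod (hat y \<eta>)) \<partial>lborel) \<le> ennreal (norm x * norm y)"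
proof -
  have "(\<integral>\<^sup>+\<eta>. ennreal (cmod (hat x (\<xi> - \<eta>))) * ennreal (cmod (hat y \<eta>)) \<partial>lborel) \<le> ennreal (norm x * norm y)"
  proof (rule nn_Cauchy_Schwarz)
    show "(\<integral>\<^sup>+\<eta>. (ennreal (cmod (hat x (\<xi> - \<eta>))))\<^sup>2 \<partial>lborel) \<le> ennreal ((norm x)\<^sup>2)"
      using nn_hat[of x] by (subst nn_integral_translate(2)[of "\<lambda>\<eta>. (ennreal (cmod (hat x \<eta>)))\<^sup>2"]) measurable
  qed (use nn_hat in auto)
  then show ?thesis by (simp add: ennreal_mult)
qed

text \<open>The common part of the two products of the equation. Both factors come from the same
  \<open>x\<close>, so the convolution may be symmetrised, and \<open>eq\<close> has to identify the
  kernel only after symmetrisation. The bound \<open>le\<close> may grow like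
  \<open>japanese \<omega>\<close>, because transforms of test functions are integrable against this
  weight.\<close>

lemma dist_mult_embed:
  assumes f: "is_fourier f F" and F: "integrable lborel F" and g: "is_fourier g G" and \<kappa>: "kernel \<kappa>"
    and le: "\<And>\<omega> \<eta>. cmod (G (\<omega> - \<eta>) * F \<eta>) \<le> 2 * japanese \<omega> * (cmod (hat x (\<omega> - \<eta>)) * cmod (hat x \<eta>))"
    and eq: "\<And>\<omega> \<eta>. complex_of_real (1 / sqrt (2 * pi)) * (G (\<omega> - \<eta>) * F \<eta> + G \<eta> * F (\<omega> - \<eta>)) =
       2 * (complex_of_real (japanese \<omega> powr (- r)) * (\<i> * (complex_of_real (\<kappa> \<omega> \<eta>) * hat x (\<omega> - \<eta>) * hat x \<eta>)))"
  shows "dist_mult f g = embed r (bil \<kappa> x x)"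
proof (rule dist_mult_eq[OF f F g])
  have [measurable]: "F \<in> borel_measurable borel" "G \<in> borel_measurable borel" using f g by (simp_all add: is_fourier_def)
  let ?c = "complex_of_real (1 / sqrt (2 * pi))"
  have conv: "?c * (LINT \<eta>|lborel. G (\<omega> - \<eta>) * F \<eta>) = complex_of_real (japanese \<omega> powr (- r)) * conv \<kappa> (hat x) (hat x) \<omega>" for \<omega>
  proof -
    have "integrable lborel (\<lambda>\<eta>. G (\<omega> - \<eta>) * F \<eta>)"
    proof (rule integrableI_bounded)
      have "(\<integral>\<^sup>+\<eta>. ennreal (norm (G (\<omega> - \<eta>) * F \<eta>)) \<partial>lborel)
          \<le> (\<integral>\<^sup>+\<eta>. ennreal (2 * japanese \<omega>) * ennreal (cmod (hat x (\<omega> - \<eta>)) * cmod (hat x \<eta>)) \<partial>lborel)"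
        using le by (intro nn_integral_mono) (simp add: ennreal_mult[symmetric] ennreal_leI)
      also have "\<dots> = ennreal (2 * japanese \<omega>) * (\<integral>\<^sup>+\<eta>. ennreal (cmod (hat x (\<omega> - \<eta>)) * cmod (hat x \<eta>)) \<partial>lborel)"
        by (rule nn_integral_cmult) measurable
      also have "\<dots> < \<infinity>"
        using order_le_less_trans[OF nn_hat_conv[of x \<omega> x] ennreal_less_top] by (simp add: ennreal_mult_less_top)
      finally show "(\<integral>\<^sup>+\<eta>. ennreal (norm (G (\<omega> - \<eta>) * F \<eta>)) \<partial>lborel) < \<infinity>" .
    qed measurable
    then have i: "integrable lborel (\<lambda>\<eta>. ?c * (G (\<omega> - \<eta>) * F \<eta>))" by (rule integrable_mult_right)
    have "?c * (LINT \<eta>|lborel. G (\<omega> - \<eta>) * F \<eta>) = (LINT \<eta>|lborel. ?c * (G (\<omega> - \<eta>) * F \<eta>))"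
      by (rule Bochner_Integration.integral_mult_right_zero[symmetric])
    also have "\<dots> = (LINT \<eta>|lborel. complex_of_real (japanese \<omega> powr (- r)) * (\<i> * (complex_of_real (\<kappa> \<omega> \<eta>) * hat x (\<omega> - \<eta>) * hat x \<eta>)))"
    proof (rule integral_symmetrize[OF i, of \<omega>])
      fix \<eta>
      show "?c * (G (\<omega> - \<eta>) * F \<eta>) + ?c * (G (\<omega> - (\<omega> - \<eta>)) * F (\<omega> - \<eta>)) =
        2 * (complex_of_real (japanese \<omega> powr (- r)) * (\<i> * (complex_of_real (\<kappa> \<omega> \<eta>) * hat x (\<omega> - \<eta>) * hat x \<eta>)))"
        using eq[of \<omega> \<eta>] by (simp only: distrib_left diff_diff_eq2 add_diff_cancel_left')
    qed
    also have "\<dots> = complex_of_real (japanese \<omega> powr (- r)) * conv \<kappa> (hat x) (hat x) \<omega>"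
      unfolding conv_def by (simp only: Bochner_Integration.integral_mult_right_zero)
    finally show ?thesis .
  qed
  show "is_fourier (embed r (bil \<kappa> x x)) (\<lambda>\<omega>. ?c * (LINT \<eta>|lborel. G (\<omega> - \<eta>) * F \<eta>))"
    unfolding conv
  proof (rule is_fourier_cong_AE[OF is_fourier_embed])
    show "(\<lambda>\<xi>. complex_of_real (japanese \<xi> powr (- r)) * conv \<kappa> (hat x) (hat x) \<xi>) \<in> borel_measurable borel"
      using conv_measurable[OF \<kappa> hat_measurable[of x] hat_measurable[of x]] by measurable
    show "AE \<xi> in lborel. complex_of_real (japanese \<xi> powr (- r)) * hat (bil \<kappa> x x) \<xi> = complex_of_real (japanese \<xi> powr (- r)) * conv \<kappa> (hat x) (hat x) \<xi>"
      using hat_bil[OF \<kappa>, of x x] by eventually_elim simp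
  qed
  fix \<psi>
  have "(\<integral>\<^sup>+\<omega>. \<integral>\<^sup>+\<eta>. ennreal (cmod (G (\<omega> - \<eta>) * F \<eta> * schwartz_ift \<psi> \<omega>)) \<partial>lborel \<partial>lborel)
      \<le> (\<integral>\<^sup>+\<omega>. ennreal (2 * (norm x * norm x)) * ennreal (japanese \<omega> * cmod (schwartz_ift \<psi> \<omega>)) \<partial>lborel)"
  proof (rule nn_integral_mono)
    fix \<omega>
    have "(\<integral>\<^sup>+\<eta>. ennreal (cmod (G (\<omega> - \<eta>) * F \<eta> * schwartz_ift \<psi> \<omega>)) \<partial>lborel)
        \<le> (\<integral>\<^sup>+\<eta>. ennreal (2 * japanese \<omega> * cmod (schwartz_ift \<psi> \<omega>)) * ennreal (cmod (hat x (\<omega> - \<eta>)) * cmod (hat x \<eta>)) \<partial>lborel)"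
    proof (rule nn_integral_mono)
      fix \<eta>
      have "cmod (G (\<omega> - \<eta>) * F \<eta> * schwartz_ift \<psi> \<omega>) \<le> (2 * japanese \<omega> * (cmod (hat x (\<omega> - \<eta>)) * cmod (hat x \<eta>))) * cmod (schwartz_ift \<psi> \<omega>)"
        unfolding norm_mult[of _ "schwartz_ift \<psi> \<omega>"] by (intro mult_right_mono le) simp
      also have "\<dots> = 2 * japanese \<omega> * cmod (schwartz_ift \<psi> \<omega>) * (cmod (hat x (\<omega> - \<eta>)) * cmod (hat x \<eta>))" by (simp only: mult_ac)
      finally show "ennreal (cmod (G (\<omega> - \<eta>) * F \<eta> * schwartz_ift \<psi> \<omega>)) \<le> ennreal (2 * japanese \<omega> * cmod (schwartz_ift \<psi> \<omega>)) * ennreal (cmod (hat x (\<omega> - \<eta>)) * cmod (hat x \<eta>))"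
        by (subst ennreal_mult[symmetric]) (auto intro!: ennreal_leI)
    qed
    also have "\<dots> = ennreal (2 * japanese \<omega> * cmod (schwartz_ift \<psi> \<omega>)) * (\<integral>\<^sup>+\<eta>. ennreal (cmod (hat x (\<omega> - \<eta>)) * cmod (hat x \<eta>)) \<partial>lborel)"
      by (rule nn_integral_cmult) measurable
    also have "\<dots> \<le> ennreal (2 * japanese \<omega> * cmod (schwartz_ift \<psi> \<omega>)) * ennreal (norm x * norm x)"
      by (intro mult_left_mono nn_hat_conv) simp
    also have "\<dots> = ennreal (2 * (norm x * norm x)) * ennreal (japanese \<omega> * cmod (schwartz_ift \<psi> \<omega>))"
      by (subst (1 2) ennreal_mult[symmetric]) (simp_all add: mult_ac)
    finally show "(\<integral>\<^sup>+\<eta>. ennreal (cmod (G (\<omega> - \<eta>) * F \<eta> * schwartz_ift \<psi> \<omega>)) \<partial>lborel)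
        \<le> ennreal (2 * (norm x * norm x)) * ennreal (japanese \<omega> * cmod (schwartz_ift \<psi> \<omega>))" .
  qed
  also have "\<dots> = ennreal (2 * (norm x * norm x)) * (\<integral>\<^sup>+\<omega>. ennreal (japanese \<omega> * cmod (schwartz_ift \<psi> \<omega>)) \<partial>lborel)"
    by (rule nn_integral_cmult) measurable
  also have "\<dots> < \<infinity>"
    using schwartz_ift_japanese_integrable[of \<psi>] by (simp add: integrable_iff_bounded ennreal_mult_less_top)
  finally show "(\<integral>\<^sup>+\<omega>. \<integral>\<^sup>+\<eta>. ennreal (cmod (G (\<omega> - \<eta>) * F \<eta> * schwartz_ift \<psi> \<omega>)) \<partial>lborel \<partial>lborel) < \<infinity>" .
qed

section \<open>The two products and the right-hand side\<close>

definition \<kappa>_uux :: "real \<Rightarrow> real \<Rightarrow> real" where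
  "\<kappa>_uux \<xi> \<eta> = weight_factor \<xi> \<eta> * (\<xi> / 2)"

text \<open>From u_x u_xx = (u_x^2)_x / 2. The denominator appears because the product is
  represented as an element of H^(s-3), two orders below the target: applying (1 -
  \<partial>^2)^(-1) then only changes the order of \<open>embed\<close>, not the kernel.\<close>

definition \<kappa>_uxuxx :: "real \<Rightarrow> real \<Rightarrow> real" where
  "\<kappa>_uxuxx \<xi> \<eta> = weight_factor \<xi> \<eta> * - (\<xi> / 2 * ((\<xi> - \<eta>) * \<eta>) / (1 + \<xi>\<^sup>2))"

lemma kernel_uux: "kernel \<kappa>_uux"
  unfolding \<kappa>_uux_def[abs_def]
  by (rule kernel_of_symbol[where D = 1]) (use half_le_japanese_product in auto)

lemma kernel_uxuxx: "kernel \<kappa>_uxuxx"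
  unfolding \<kappa>_uxuxx_def[abs_def]
proof (rule kernel_of_symbol[where D = 1])
  fix \<xi> \<eta> :: real
  show "- ((- \<xi>) / 2 * ((- \<xi> - - \<eta>) * - \<eta>) / (1 + (- \<xi>)\<^sup>2)) = - (- (\<xi> / 2 * ((\<xi> - \<eta>) * \<eta>) / (1 + \<xi>\<^sup>2)))"
  proof -
    have "(- \<xi> - - \<eta>) * - \<eta> = (\<xi> - \<eta>) * \<eta>" by (simp add: algebra_simps)
    then show ?thesis by simp
  qed
  have "\<bar>\<xi> / 2\<bar> \<le> 1 + \<xi>\<^sup>2"
    using abs_le_japanese[of \<xi>] japanese_ge_1[of \<xi>] self_le_power[of "japanese \<xi>" 2] by (simp add: japanese_square)
  then have 1: "\<bar>\<xi> / 2\<bar> / (1 + \<xi>\<^sup>2) \<le> 1" by (simp add: divide_le_eq add_pos_nonneg)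
  have "\<bar>- (\<xi> / 2 * ((\<xi> - \<eta>) * \<eta>) / (1 + \<xi>\<^sup>2))\<bar> = (\<bar>\<xi> / 2\<bar> / (1 + \<xi>\<^sup>2)) * (\<bar>\<xi> - \<eta>\<bar> * \<bar>\<eta>\<bar>)"
    by (simp add: abs_mult abs_divide abs_of_nonneg[of "1 + \<xi>\<^sup>2"])
  also have "\<dots> \<le> 1 * (japanese (\<xi> - \<eta>) * japanese \<eta>)"
    by (intro mult_mono 1 abs_le_japanese) auto
  finally show "\<bar>- (\<xi> / 2 * ((\<xi> - \<eta>) * \<eta>) / (1 + \<xi>\<^sup>2))\<bar> \<le> 1 * (japanese (\<xi> - \<eta>) * japanese \<eta>)" .
next
  show "(\<lambda>(\<xi>::real, \<eta>::real). - (\<xi> / 2 * ((\<xi> - \<eta>) * \<eta>) / (1 + \<xi>\<^sup>2))) \<in> borel_measurable (borel \<Otimes>\<^sub>M borel)"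
    unfolding case_prod_beta by measurable
qed simp

abbreviation \<U> :: "l2h \<Rightarrow> real \<Rightarrow> complex" where
  "\<U> x \<xi> \<equiv> complex_of_real (japanese \<xi> powr (- s)) * hat x \<xi>"

lemma japanese_times_powr: "japanese \<xi> * japanese \<xi> powr a = japanese \<xi> powr (1 + a)"
  by (simp add: powr_add)

lemma abs_times_weight_le: "\<bar>\<xi>\<bar> * japanese \<xi> powr a \<le> japanese \<xi> powr (1 + a)"
  unfolding japanese_times_powr[symmetric] by (intro mult_right_mono abs_le_japanese) simp

text \<open>A function in H^(s-1) has an integrable transform, namely \<open>\<alpha>\<close> times
  a square-integrable function. This makes u and u_x admissible as the integrable factor of
  \<open>dist_mult_eq\<close>.\<close>

lemma weighted_hat_integrable:
  assumes [measurable]: "m \<in> borel_measurable borel" and le: "\<And>\<xi>. \<bar>m \<xi>\<bar> \<le> japanese \<xi>"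
  shows "integrable lborel (\<lambda>\<xi>. complex_of_real (m \<xi>) * \<U> x \<xi>)"
proof (rule Bochner_Integration.integrable_bound)
  show "integrable lborel (\<lambda>\<xi>. (\<alpha> \<xi>)\<^sup>2 + (cmod (hat x \<xi>))\<^sup>2)"
    by (intro Bochner_Integration.integrable_add \<alpha>_square hat_square_integrable)
  have "cmod (complex_of_real (m \<xi>) * \<U> x \<xi>) \<le> (\<alpha> \<xi>)\<^sup>2 + (cmod (hat x \<xi>))\<^sup>2" for \<xi>
  proof -
    have "cmod (complex_of_real (m \<xi>) * \<U> x \<xi>) = (\<bar>m \<xi>\<bar> * japanese \<xi> powr (- s)) * cmod (hat x \<xi>)"
      by (simp add: norm_mult)
    also have "\<dots> \<le> (japanese \<xi> * japanese \<xi> powr (- s)) * cmod (hat x \<xi>)"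
      by (intro mult_right_mono le) simp_all
    also have "\<dots> = \<alpha> \<xi> * cmod (hat x \<xi>)" unfolding japanese_times_powr by (simp add: \<alpha>_def)
    also have "\<dots> \<le> (\<alpha> \<xi>)\<^sup>2 + (cmod (hat x \<xi>))\<^sup>2"
      using sum_squares_bound[of "\<alpha> \<xi>" "cmod (hat x \<xi>)"] zero_le_power2[of "\<alpha> \<xi>"] zero_le_power2[of "cmod (hat x \<xi>)"]
        mult_nonneg_nonneg[OF \<alpha>_nonneg[of \<xi>] norm_ge_zero[of "hat x \<xi>"]] by linarith
    finally show ?thesis .
  qed
  then show "AE \<xi> in lborel. norm (complex_of_real (m \<xi>) * \<U> x \<xi>) \<le> norm ((\<alpha> \<xi>)\<^sup>2 + (cmod (hat x \<xi>))\<^sup>2)"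
    by (intro AE_I2) (simp add: abs_of_nonneg)
qed measurable

lemma inverse_weights_eq:
  "complex_of_real (1 / sqrt (2 * pi)) * (complex_of_real (japanese (\<xi> - \<eta>) powr (- s)) * complex_of_real (japanese \<eta> powr (- s)))
   = complex_of_real (japanese \<xi> powr (- (s - 1))) * complex_of_real (weight_factor \<xi> \<eta>)"
proof -
  have "japanese \<xi> powr (- (s - 1)) * japanese \<xi> powr (s - 1) = 1" by (simp flip: powr_add)
  then have "japanese \<xi> powr (- (s - 1)) * weight_factor \<xi> \<eta> = 1 / sqrt (2 * pi) * (japanese (\<xi> - \<eta>) powr (- s) * japanese \<eta> powr (- s))"
    unfolding weight_factor_def by (simp add: field_simps)
  then show ?thesis by (simp only: of_real_mult[symmetric])
qed

lemma dist_mult_uux: "dist_mult (embed s x) (dist_deriv (embed s x)) = embed (s - 1) (bil \<kappa>_uux x x)"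
proof (rule dist_mult_embed[OF is_fourier_embed _ is_fourier_deriv[OF is_fourier_embed] kernel_uux])
  show "integrable lborel (\<U> x)"
    using weighted_hat_integrable[of "\<lambda>_. 1" x] japanese_ge_1 by simp
  fix \<omega> \<eta>
  let ?X = "hat x (\<omega> - \<eta>)" and ?Y = "hat x \<eta>"
  let ?r = "japanese (\<omega> - \<eta>)" and ?q = "japanese \<eta>"
  have "cmod (\<i> * complex_of_real (\<omega> - \<eta>) * \<U> x (\<omega> - \<eta>) * \<U> x \<eta>) = (\<bar>\<omega> - \<eta>\<bar> * ?r powr (- s)) * ?q powr (- s) * (cmod ?X * cmod ?Y)"
    by (simp only: norm_mult norm_ii norm_of_real abs_of_nonneg[OF powr_ge_zero] mult_1_left mult_ac)
  also have "\<dots> \<le> (1 * 1) * (cmod ?X * cmod ?Y)"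
  proof (intro mult_right_mono mult_mono)
    show "\<bar>\<omega> - \<eta>\<bar> * ?r powr (- s) \<le> 1"
      using abs_times_weight_le[of "\<omega> - \<eta>" "- s"] powr_mono[of "1 - s" 0 ?r] japanese_ge_1[of "\<omega> - \<eta>"] s by simp
    show "?q powr (- s) \<le> 1"
      using powr_mono[of "- s" 0 ?q] japanese_ge_1[of \<eta>] s by simp
  qed simp_all
  also have "\<dots> \<le> 2 * japanese \<omega> * (cmod ?X * cmod ?Y)"
    using japanese_ge_1[of \<omega>] by (intro mult_right_mono) auto
  finally show "cmod (\<i> * complex_of_real (\<omega> - \<eta>) * \<U> x (\<omega> - \<eta>) * \<U> x \<eta>) \<le> 2 * japanese \<omega> * (cmod ?X * cmod ?Y)" .
  let ?c = "complex_of_real (1 / sqrt (2 * pi))" and ?R = "complex_of_real (?r powr (- s))" and ?S = "complex_of_real (?q powr (- s))"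
  have "?c * (\<i> * complex_of_real (\<omega> - \<eta>) * \<U> x (\<omega> - \<eta>) * \<U> x \<eta> + \<i> * complex_of_real \<eta> * \<U> x \<eta> * \<U> x (\<omega> - \<eta>))
    = (?c * (?R * ?S)) * (\<i> * complex_of_real \<omega> * ?X * ?Y)"
    by (simp add: algebra_simps)
  also have "\<dots> = 2 * (complex_of_real (japanese \<omega> powr (- (s - 1))) * (\<i> * (complex_of_real (\<kappa>_uux \<omega> \<eta>) * ?X * ?Y)))"
    unfolding inverse_weights_eq \<kappa>_uux_def by simp
  finally show "?c * (\<i> * complex_of_real (\<omega> - \<eta>) * \<U> x (\<omega> - \<eta>) * \<U> x \<eta> + \<i> * complex_of_real \<eta> * \<U> x \<eta> * \<U> x (\<omega> - \<eta>))
    = 2 * (complex_of_real (japanese \<omega> powr (- (s - 1))) * (\<i> * (complex_of_real (\<kappa>_uux \<omega> \<eta>) * ?X * ?Y)))" .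
qed

text \<open>The delicate range is s < 2, where the weight of u_xx grows with its frequency. There
  \<open>japanese (\<omega> - \<eta>)\<close> is at most
  \<open>2 * japanese \<omega> * japanese \<eta>\<close>, and the powers of
  \<open>japanese \<eta>\<close> add up to 3 - 2 s, which is negative.\<close>

lemma second_derivative_weight:
  fixes \<omega> \<eta> :: real
  shows "japanese (\<omega> - \<eta>) powr (2 - s) * japanese \<eta> powr (1 - s) \<le> 2 * japanese \<omega>"
proof -
  let ?p = "japanese \<omega>" and ?r = "japanese (\<omega> - \<eta>)" and ?q = "japanese \<eta>"
  have ge: "1 \<le> ?p" "1 \<le> ?r" "1 \<le> ?q" by (rule japanese_ge_1)+
  show ?thesis
  proof (cases "s \<ge> 2")
    case True
    have "?r powr (2 - s) * ?q powr (1 - s) \<le> ?r powr 0 * ?q powr 0"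
      using True ge by (intro mult_mono powr_mono) auto
    then show ?thesis using ge by simp
  next
    case False
    have "?r \<le> ?p + ?q" using japanese_triangle(1)[of "\<omega> - \<eta>" "- \<eta>"] japanese_triangle(1)[of "\<omega> - \<eta>" \<omega>] by simp
    also have "?p + ?q \<le> 2 * ?p * ?q"
      using mult_nonneg_nonneg[of "?p - 1" "?q - 1"] mult_mono[of 1 ?p 1 ?q] ge by (simp add: algebra_simps)
    finally have "?r powr (2 - s) \<le> (2 * ?p * ?q) powr (2 - s)" using False by (intro powr_mono2) auto
    also have "\<dots> = (2 * ?p) powr (2 - s) * ?q powr (2 - s)" by (simp add: powr_mult)
    finally have "?r powr (2 - s) * ?q powr (1 - s) \<le> ((2 * ?p) powr (2 - s) * ?q powr (2 - s)) * ?q powr (1 - s)"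
      by (intro mult_right_mono) auto
    also have "\<dots> = (2 * ?p) powr (2 - s) * ?q powr (3 - 2 * s)"
      by (simp only: mult.assoc powr_add[symmetric]) simp
    also have "\<dots> \<le> (2 * ?p) powr 1 * ?q powr 0"
      using ge False s by (intro mult_mono powr_mono) auto
    finally show ?thesis by simp
  qed
qed

lemma dist_mult_uxuxx:
  "dist_mult (dist_deriv (embed s x)) (dist_deriv (dist_deriv (embed s x))) = embed (s - 3) (bil \<kappa>_uxuxx x x)"
proof (rule dist_mult_embed[OF is_fourier_deriv[OF is_fourier_embed] _ is_fourier_deriv[OF is_fourier_deriv[OF is_fourier_embed]] kernel_uxuxx])
  show "integrable lborel (\<lambda>\<xi>. \<i> * complex_of_real \<xi> * \<U> x \<xi>)"
    using integrable_mult_right[OF weighted_hat_integrable[of "\<lambda>\<xi>. \<xi>" x], of \<i>] abs_le_japanese by (simp add: mult.assoc)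
  fix \<omega> \<eta>
  let ?X = "hat x (\<omega> - \<eta>)" and ?Y = "hat x \<eta>"
  let ?r = "japanese (\<omega> - \<eta>)" and ?q = "japanese \<eta>"
  have "cmod (\<i> * complex_of_real (\<omega> - \<eta>) * (\<i> * complex_of_real (\<omega> - \<eta>) * \<U> x (\<omega> - \<eta>)) * (\<i> * complex_of_real \<eta> * \<U> x \<eta>))
     = ((\<bar>\<omega> - \<eta>\<bar> * (\<bar>\<omega> - \<eta>\<bar> * ?r powr (- s))) * (\<bar>\<eta>\<bar> * ?q powr (- s))) * (cmod ?X * cmod ?Y)"
    by (simp only: norm_mult norm_ii norm_of_real abs_of_nonneg[OF powr_ge_zero] mult_1_left mult_ac)
  also have "\<dots> \<le> (?r powr (2 - s) * ?q powr (1 - s)) * (cmod ?X * cmod ?Y)"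
  proof (intro mult_right_mono mult_mono)
    have "\<bar>\<omega> - \<eta>\<bar> * (\<bar>\<omega> - \<eta>\<bar> * ?r powr (- s)) \<le> \<bar>\<omega> - \<eta>\<bar> * ?r powr (1 + - s)"
      by (intro mult_left_mono abs_times_weight_le) simp
    also have "\<dots> \<le> ?r powr (1 + (1 + - s))" by (rule abs_times_weight_le)
    finally show "\<bar>\<omega> - \<eta>\<bar> * (\<bar>\<omega> - \<eta>\<bar> * ?r powr (- s)) \<le> ?r powr (2 - s)" by simp
    show "\<bar>\<eta>\<bar> * ?q powr (- s) \<le> ?q powr (1 - s)" using abs_times_weight_le[of \<eta> "- s"] by simp
  qed simp_all
  also have "\<dots> \<le> 2 * japanese \<omega> * (cmod ?X * cmod ?Y)"
    by (intro mult_right_mono second_derivative_weight) auto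
  finally show "cmod (\<i> * complex_of_real (\<omega> - \<eta>) * (\<i> * complex_of_real (\<omega> - \<eta>) * \<U> x (\<omega> - \<eta>)) * (\<i> * complex_of_real \<eta> * \<U> x \<eta>))
     \<le> 2 * japanese \<omega> * (cmod ?X * cmod ?Y)" .
  let ?c = "complex_of_real (1 / sqrt (2 * pi))" and ?R = "complex_of_real (?r powr (- s))" and ?S = "complex_of_real (?q powr (- s))"
  have k: "japanese \<omega> powr (- (s - 3)) * \<kappa>_uxuxx \<omega> \<eta> = - (japanese \<omega> powr (- (s - 1)) * weight_factor \<omega> \<eta>) * (\<omega> / 2 * ((\<omega> - \<eta>) * \<eta>))"
  proof -
    have "japanese \<omega> powr (- (s - 3)) = japanese \<omega> powr (- (s - 1)) * japanese \<omega> powr 2" unfolding powr_add[symmetric] by simp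
    then have e: "japanese \<omega> powr (- (s - 3)) = japanese \<omega> powr (- (s - 1)) * (1 + \<omega>\<^sup>2)" by (simp add: japanese_square)
    have "1 + \<omega>\<^sup>2 \<noteq> 0" using zero_le_power2[of \<omega>] by linarith
    then obtain N where N: "1 + \<omega>\<^sup>2 = N" "N \<noteq> 0" by blast
    show ?thesis unfolding e \<kappa>_uxuxx_def N(1) using N(2) by simp
  qed
  have "?c * (\<i> * complex_of_real (\<omega> - \<eta>) * (\<i> * complex_of_real (\<omega> - \<eta>) * \<U> x (\<omega> - \<eta>)) * (\<i> * complex_of_real \<eta> * \<U> x \<eta>)
      + \<i> * complex_of_real \<eta> * (\<i> * complex_of_real \<eta> * \<U> x \<eta>) * (\<i> * complex_of_real (\<omega> - \<eta>) * \<U> x (\<omega> - \<eta>)))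
    = \<i> * \<i> * \<i> * (?c * (?R * ?S)) * (complex_of_real (\<omega> * ((\<omega> - \<eta>) * \<eta>)) * (?X * ?Y))"
    unfolding of_real_mult of_real_diff by algebra
  also have "\<dots> = - \<i> * complex_of_real (japanese \<omega> powr (- (s - 1)) * weight_factor \<omega> \<eta>) * (complex_of_real (\<omega> * ((\<omega> - \<eta>) * \<eta>)) * (?X * ?Y))"
    unfolding inverse_weights_eq of_real_mult by simp
  also have "\<dots> = 2 * (\<i> * (complex_of_real (- (japanese \<omega> powr (- (s - 1)) * weight_factor \<omega> \<eta>) * (\<omega> / 2 * ((\<omega> - \<eta>) * \<eta>))) * (?X * ?Y)))"
    by simp
  also have "\<dots> = 2 * (complex_of_real (japanese \<omega> powr (- (s - 3))) * (\<i> * (complex_of_real (\<kappa>_uxuxx \<omega> \<eta>) * ?X * ?Y)))"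
    unfolding k[symmetric] of_real_mult by (simp only: mult_ac)
  finally show "?c * (\<i> * complex_of_real (\<omega> - \<eta>) * (\<i> * complex_of_real (\<omega> - \<eta>) * \<U> x (\<omega> - \<eta>)) * (\<i> * complex_of_real \<eta> * \<U> x \<eta>)
      + \<i> * complex_of_real \<eta> * (\<i> * complex_of_real \<eta> * \<U> x \<eta>) * (\<i> * complex_of_real (\<omega> - \<eta>) * \<U> x (\<omega> - \<eta>)))
    = 2 * (complex_of_real (japanese \<omega> powr (- (s - 3))) * (\<i> * (complex_of_real (\<kappa>_uxuxx \<omega> \<eta>) * ?X * ?Y)))" .
qed

lemma even_bounded_powr_minus_2: "even_bounded (\<lambda>\<xi>. japanese \<xi> powr - 2)"
  by (rule even_bounded_powr) simp

text \<open>A preimage under 1 - \<partial>^2 is exhibited on the Fourier side. The term in H^(s-1)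
  is damped by the factor \<langle>\<xi>\<rangle>^(-2), whereas the term in H^(s-3) keeps its
  coordinate \<open>y\<close> and merely rises by two orders.\<close>

lemma helmholtz_inverse_embed:
  "helmholtz_inverse ((- b) *\<^sub>R embed (s - 1) x + (b - 3) *\<^sub>R embed (s - 3) y)
   = embed (s - 1) ((- b) *\<^sub>R fmult (\<lambda>\<xi>. japanese \<xi> powr - 2) x + (b - 3) *\<^sub>R y)"
proof (rule helmholtz_inverse_eq)
  let ?m = "fmult (\<lambda>\<xi>. japanese \<xi> powr - 2) x"
  let ?v = "(- b) *\<^sub>R ?m + (b - 3) *\<^sub>R y"
  let ?p = "\<lambda>a \<xi>. complex_of_real (japanese \<xi> powr a)"
  have l: "is_fourier (embed (s - 1) ?v - dist_deriv (dist_deriv (embed (s - 1) ?v)))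
    (\<lambda>\<xi>. ?p (- (s - 1)) \<xi> * hat ?v \<xi> - \<i> * complex_of_real \<xi> * (\<i> * complex_of_real \<xi> * (?p (- (s - 1)) \<xi> * hat ?v \<xi>)))"
    by (intro is_fourier_diff is_fourier_deriv is_fourier_embed)
  have r: "is_fourier ((- b) *\<^sub>R embed (s - 1) x + (b - 3) *\<^sub>R embed (s - 3) y)
    (\<lambda>\<xi>. complex_of_real (- b) * (?p (- (s - 1)) \<xi> * hat x \<xi>) + complex_of_real (b - 3) * (?p (- (s - 3)) \<xi> * hat y \<xi>))"
    by (intro is_fourier_add is_fourier_scaleR is_fourier_embed)
  show "embed (s - 1) ?v - dist_deriv (dist_deriv (embed (s - 1) ?v)) = (- b) *\<^sub>R embed (s - 1) x + (b - 3) *\<^sub>R embed (s - 3) y"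
  proof (rule is_fourier_inj[OF is_fourier_cong_AE[OF l] r])
    show "AE \<xi> in lborel. ?p (- (s - 1)) \<xi> * hat ?v \<xi> - \<i> * complex_of_real \<xi> * (\<i> * complex_of_real \<xi> * (?p (- (s - 1)) \<xi> * hat ?v \<xi>))
      = complex_of_real (- b) * (?p (- (s - 1)) \<xi> * hat x \<xi>) + complex_of_real (b - 3) * (?p (- (s - 3)) \<xi> * hat y \<xi>)"
      using hat_add[of "(- b) *\<^sub>R ?m" "(b - 3) *\<^sub>R y"] hat_scaleR[of "- b" ?m] hat_scaleR[of "b - 3" y]
        hat_fmult[OF even_bounded_powr_minus_2, of x]
    proof eventually_elim
      case (elim \<xi>)
      have j: "japanese \<xi> powr 2 = 1 + \<xi>\<^sup>2" by (simp add: japanese_square)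
      have e: "?p (- (s - 3)) \<xi> = ?p (- (s - 1)) \<xi> * complex_of_real (1 + \<xi>\<^sup>2)"
        and e': "?p (- (s - 1)) \<xi> = ?p (- (s - 1)) \<xi> * complex_of_real (1 + \<xi>\<^sup>2) * ?p (- 2) \<xi>"
        unfolding of_real_mult[symmetric] of_real_eq_iff j[symmetric] powr_add[symmetric] by simp_all
      have "?p (- (s - 1)) \<xi> * hat ?v \<xi> - \<i> * complex_of_real \<xi> * (\<i> * complex_of_real \<xi> * (?p (- (s - 1)) \<xi> * hat ?v \<xi>))
        = ?p (- (s - 1)) \<xi> * complex_of_real (1 + \<xi>\<^sup>2) * hat ?v \<xi>"
        by (simp add: power2_eq_square algebra_simps)
      also have "\<dots> = complex_of_real (- b) * ((?p (- (s - 1)) \<xi> * complex_of_real (1 + \<xi>\<^sup>2) * ?p (- 2) \<xi>) * hat x \<xi>)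
          + complex_of_real (b - 3) * ((?p (- (s - 1)) \<xi> * complex_of_real (1 + \<xi>\<^sup>2)) * hat y \<xi>)"
        unfolding elim by (simp only: distrib_left mult_ac)
      finally show ?case unfolding e'[symmetric] unfolding e[symmetric] .
    qed
  qed measurable
qed

text \<open>The link between the equation and the abstract setting. For each \<open>\<xi>\<close>
  the kernel \<open>\<kappa>_sym\<close> is a linear combination of the kernels of the two products,
  with coefficients independent of \<open>\<eta>\<close>, so the identity passes through the
  integral.\<close>

lemma b_family_rhs_embed: "b_family_rhs b (embed s x) = embed (s - 1) (Q x x)"
proof -
  let ?B1 = "bil \<kappa>_uux x x" and ?B2 = "bil \<kappa>_uxuxx x x"
  let ?m = "fmult (\<lambda>\<xi>. japanese \<xi> powr - 2) ?B1"
  have "b_family_rhs b (embed s x) = embed (s - 1) ((- b) *\<^sub>R ?m + (b - 3) *\<^sub>R ?B2 - ?B1)"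
    unfolding b_family_rhs_def Let_def dist_mult_uux dist_mult_uxuxx helmholtz_inverse_embed embed_diff ..
  also have "(- b) *\<^sub>R ?m + (b - 3) *\<^sub>R ?B2 - ?B1 = Q x x"
  proof (rule l2h_eqI)
    show "AE \<xi> in lborel. hat ((- b) *\<^sub>R ?m + (b - 3) *\<^sub>R ?B2 - ?B1) \<xi> = hat (Q x x) \<xi>"
      using hat_diff[of "(- b) *\<^sub>R ?m + (b - 3) *\<^sub>R ?B2" ?B1] hat_add[of "(- b) *\<^sub>R ?m" "(b - 3) *\<^sub>R ?B2"] hat_scaleR[of "- b" ?m] hat_scaleR[of "b - 3" ?B2]
        hat_fmult[OF even_bounded_powr_minus_2, of ?B1] hat_bil[OF kernel_uux, of x x] hat_bil[OF kernel_uxuxx, of x x] hat_bil[OF kernel_sym, of x x]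
    proof eventually_elim
      case (elim \<xi>)
      let ?f = "\<lambda>\<kappa> \<eta>. complex_of_real (\<kappa> \<xi> \<eta>) * hat x (\<xi> - \<eta>) * hat x \<eta>"
      let ?a = "complex_of_real (- b * japanese \<xi> powr - 2 - 1)" and ?d = "complex_of_real (b - 3)"
      have j: "japanese \<xi> powr - 2 = 1 / (1 + \<xi>\<^sup>2)" by (simp add: powr_minus japanese_square inverse_eq_divide)
      have k: "\<kappa>_sym \<xi> \<eta> = (- b * japanese \<xi> powr - 2 - 1) * \<kappa>_uux \<xi> \<eta> + (b - 3) * \<kappa>_uxuxx \<xi> \<eta>" for \<eta>
        unfolding j \<kappa>_sym_def \<kappa>_uux_def \<kappa>_uxuxx_def smooth_part_def divide_inverse by algebra
      have "(LINT \<eta>|lborel. ?f \<kappa>_sym \<eta>) = (LINT \<eta>|lborel. ?a * ?f \<kappa>_uux \<eta> + ?d * ?f \<kappa>_uxuxx \<eta>)"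
        unfolding k of_real_add of_real_mult[of "- b * japanese \<xi> powr - 2 - 1"] of_real_mult[of "b - 3"] by (simp only: distrib_right mult.assoc)
      also have "\<dots> = ?a * (LINT \<eta>|lborel. ?f \<kappa>_uux \<eta>) + ?d * (LINT \<eta>|lborel. ?f \<kappa>_uxuxx \<eta>)"
        using conv_integrable[OF kernel_uux, of \<xi> x x] conv_integrable[OF kernel_uxuxx, of \<xi> x x]
        by (subst Bochner_Integration.integral_add) (simp_all del: of_real_diff)
      finally have c: "conv \<kappa>_sym (hat x) (hat x) \<xi> = ?a * conv \<kappa>_uux (hat x) (hat x) \<xi> + ?d * conv \<kappa>_uxuxx (hat x) (hat x) \<xi>"
        unfolding conv_def by (simp only: distrib_left mult.left_commute)
      show ?case unfolding Q_def elim c by (simp add: algebra_simps)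
    qed
  qed
  finally show ?thesis .
qed

end

section \<open>Well-posedness\<close>

context b_family
begin

text \<open>In coordinates \<open>J\<close> is the inclusion of H^s in H^(s-1).\<close>

lemma embed_J: "embed s x = embed (s - 1) (J x)"
proof (rule embedI[OF is_fourier_embed])
  show "AE \<xi> in lborel. complex_of_real (japanese \<xi> powr (- s)) * hat x \<xi> = complex_of_real (japanese \<xi> powr (- (s - 1))) * hat (J x) \<xi>"
    using hat_fmult[OF even_bounded_powr[OF exponents(6)], of x]
  proof eventually_elim
    case (elim \<xi>)
    have "japanese \<xi> powr (- s) = japanese \<xi> powr (- (s - 1)) * japanese \<xi> powr - 1"
      unfolding powr_add[symmetric] by simp
    then show ?case unfolding J_def elim by simp
  qed
qed

text \<open>The curve and its initial value lie in H^s, the integral in H^(s-1). The equation is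
  therefore compared in the coordinates of H^(s-1), where a curve with coordinate \<open>v\<close>
  in H^s has the coordinate \<open>J v\<close>; this is the abstract notion of solution.\<close>

lemma b_family_solution_iff:
  "b_family_solution b s T (embed s v0) u \<longleftrightarrow> (\<exists>v. solution T v0 v \<and> u = restrict (\<lambda>t. embed s (v t)) {0..T})"
proof -
  have "(\<exists>I. has_sobolev_integral (s - 1) (\<lambda>\<tau>. b_family_rhs b (u \<tau>)) I 0 t \<and> u t = embed s v0 + I)
     \<longleftrightarrow> ((\<lambda>\<tau>. Q (v \<tau>) (v \<tau>)) has_integral (J (v t) - J v0)) {0..t}"
    if u: "u = restrict (\<lambda>t. embed s (v t)) {0..T}" and t: "t \<in> {0..T}" for v t
  proof -
    have i: "has_sobolev_integral (s - 1) (\<lambda>\<tau>. b_family_rhs b (u \<tau>)) I 0 t \<longleftrightarrow>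
       (\<exists>y. I = embed (s - 1) y \<and> ((\<lambda>\<tau>. Q (v \<tau>) (v \<tau>)) has_integral y) {0..t})" for I
      using t by (intro has_sobolev_integral_embed) (simp add: u b_family_rhs_embed)
    have e: "u t = embed s v0 + embed (s - 1) y \<longleftrightarrow> y = J (v t) - J v0" for y
      using t by (auto simp: u embed_J embed_add)
    have "(\<exists>I. has_sobolev_integral (s - 1) (\<lambda>\<tau>. b_family_rhs b (u \<tau>)) I 0 t \<and> u t = embed s v0 + I)
       \<longleftrightarrow> (\<exists>y. ((\<lambda>\<tau>. Q (v \<tau>) (v \<tau>)) has_integral y) {0..t} \<and> u t = embed s v0 + embed (s - 1) y)"
      unfolding i by blast
    then show ?thesis unfolding e by simp
  qed
  note eq = this
  show ?thesis
  proof
    assume a: "b_family_solution b s T (embed s v0) u"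
    then obtain v where v: "continuous_on {0..T} v" "u = restrict (\<lambda>t. embed s (v t)) {0..T}"
      unfolding b_family_solution_def mspace_C0_sobolev by blast
    then have "solution T v0 v" using a eq[OF v(2)] unfolding b_family_solution_def solution_def by blast
    with v(2) show "\<exists>v. solution T v0 v \<and> u = restrict (\<lambda>t. embed s (v t)) {0..T}" by blast
  next
    assume "\<exists>v. solution T v0 v \<and> u = restrict (\<lambda>t. embed s (v t)) {0..T}"
    then obtain v where v: "solution T v0 v" "u = restrict (\<lambda>t. embed s (v t)) {0..T}" by blast
    then show "b_family_solution b s T (embed s v0) u"
      using eq[OF v(2)] unfolding b_family_solution_def mspace_C0_sobolev solution_def by blast
  qed
qed

lemma solution_embed_unique:
  assumes "solution T v0 v" "b_family_solution b s T (embed s v0) u"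
  shows "u = restrict (\<lambda>t. embed s (v t)) {0..T}"
proof -
  obtain w where w: "solution T v0 w" "u = restrict (\<lambda>t. embed s (w t)) {0..T}"
    using assms(2) unfolding b_family_solution_iff by blast
  show ?thesis unfolding w(2) using solution_unique[OF w(1) assms(1)] by (auto simp: restrict_def)
qed

theorem well_posed:
  assumes u0: "u0 \<in> sobolev s"
  shows "\<exists>T>0. (\<exists>!u. b_family_solution b s T u0 u) \<and>
    (\<exists>U. openin (mtopology_of (sobolev_metric s)) U \<and> u0 \<in> U \<and>
      (\<forall>v\<in>U. \<exists>!u. b_family_solution b s T v u) \<and>
      continuous_map (subtopology (mtopology_of (sobolev_metric s)) U)
        (mtopology_of (C0_sobolev T s))
        (\<lambda>v. THE u. b_family_solution b s T v u))"
proof -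
  obtain x0 where x0: "u0 = embed s x0" by (rule sobolev_embed[OF u0])
  \<comment> \<open>Data in the unit ball around \<open>u0\<close> have norm at most
    \<open>norm x0 + 1 = R / 2\<close>, the bound under which solutions exist up to
    \<open>T\<close>. As \<open>T\<close> depends on \<open>R\<close> alone, it is common to the
    whole ball.\<close>
  define R where "R = 2 * (norm x0 + 1)"
  define T where "T = ln 4 / (2 * C * R)"
  have R: "R > 0" by (simp add: R_def add_nonneg_pos)
  have T: "T > 0" using R C by (simp add: T_def)
  define U where "U = mball_of (sobolev_metric s) u0 1"
  have U: "\<exists>v0. w = embed s v0 \<and> norm v0 \<le> R / 2" if "w \<in> U" for w
  proof -
    have w: "w \<in> sobolev s" "sobolev_norm s (u0 - w) < 1" using that by (auto simp: U_def)
    obtain v0 where v0: "w = embed s v0" by (rule sobolev_embed[OF w(1)])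
    have "norm (x0 - v0) < 1" using w(2) by (simp add: x0 v0 embed_diff)
    then have "norm v0 \<le> norm x0 + 1" using norm_triangle_sub[of v0 x0] by (simp add: norm_minus_commute)
    then show ?thesis using v0 by (auto simp: R_def)
  qed
  define \<Phi> where "\<Phi> w = (THE u. b_family_solution b s T w u)" for w
  have sol: "\<exists>v. solution T v0 v" if "norm v0 \<le> R / 2" for v0
    using solution_exists[OF that R T_def] by blast
  have ex1: "\<exists>!u. b_family_solution b s T (embed s v0) u" if "norm v0 \<le> R / 2" for v0
  proof -
    obtain v where v: "solution T v0 v" using sol[OF \<open>norm v0 \<le> R / 2\<close>] by blast
    then have "b_family_solution b s T (embed s v0) (restrict (\<lambda>t. embed s (v t)) {0..T})"
      unfolding b_family_solution_iff by blast
    then show ?thesis using solution_embed_unique[OF v] by blast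
  qed
  have \<Phi>: "\<Phi> (embed s v0) = restrict (\<lambda>t. embed s (v t)) {0..T}" if "norm v0 \<le> R / 2" "solution T v0 v" for v0 v
    unfolding \<Phi>_def using solution_embed_unique[OF that(2)] theI'[OF ex1[OF that(1)]] by blast
  have \<Phi>_mspace: "\<Phi> w \<in> mspace (C0_sobolev T s)" if w: "w \<in> U" for w
  proof -
    obtain v0 where "w = embed s v0" "norm v0 \<le> R / 2" using U[OF w] by blast
    then have "b_family_solution b s T w (\<Phi> w)" unfolding \<Phi>_def using theI'[OF ex1] by blast
    then show ?thesis by (simp add: b_family_solution_def)
  qed
  have cont: "\<exists>\<delta>>0. \<forall>w'. w' \<in> U \<and> w' \<in> sobolev s \<and> sobolev_norm s (w - w') < \<delta> \<longrightarrow> mdist (C0_sobolev T s) (\<Phi> w) (\<Phi> w') < e"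
    if w: "w \<in> U" and e: "e > 0" for w e
  proof -
    obtain v0 where v0: "w = embed s v0" "norm v0 \<le> R / 2" using U[OF w] by blast
    obtain v where v: "solution T v0 v" using sol[OF v0(2)] by blast
    \<comment> \<open>Half of \<open>e\<close>, because the supremum over time turns the strict
      bound at each time into a weak one.\<close>
    obtain \<delta> where \<delta>: "\<delta> > 0" "\<And>w0 w. norm w0 \<le> R / 2 \<Longrightarrow> norm (w0 - v0) < \<delta> \<Longrightarrow> solution T w0 w \<Longrightarrow>
        (\<forall>t\<in>{0..T}. norm (w t - v t) < e / 2)"
      using solution_continuous_dependence[OF v0(2) R T_def v, of "e / 2"] e by auto
    have "mdist (C0_sobolev T s) (\<Phi> w) (\<Phi> w') < e" if w': "w' \<in> U" "sobolev_norm s (w - w') < \<delta>" for w'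
    proof -
      obtain w0 where w0: "w' = embed s w0" "norm w0 \<le> R / 2" using U[OF w'(1)] by blast
      obtain y where y: "solution T w0 y" using sol[OF w0(2)] by blast
      have "norm (w0 - v0) < \<delta>" using w'(2) by (simp add: v0 w0 embed_diff norm_minus_commute)
      then have "norm (v t - y t) \<le> e / 2" if "t \<in> {0..T}" for t
        using \<delta>(2)[OF w0(2) _ y] that by (simp add: norm_minus_commute less_imp_le)
      then have "mdist (C0_sobolev T s) (\<Phi> w) (\<Phi> w') \<le> e / 2"
        unfolding C0_sobolev_def v0(1) w0(1) \<Phi>[OF v0(2) v] \<Phi>[OF w0(2) y]
        using e by (intro mdist_cfunspace_le) (auto simp: embed_diff)
      then show ?thesis using e by simp
    qed
    then show ?thesis by (intro exI[of _ \<delta>] conjI \<delta>(1)) simp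
  qed
  have "continuous_map (mtopology_of (submetric (sobolev_metric s) U)) (mtopology_of (C0_sobolev T s)) \<Phi>"
    unfolding mtopology_of_def
  proof (subst Metric_space.metric_continuous_map[OF Metric_space_mspace_mdist Metric_space_mspace_mdist], intro conjI ballI allI impI)
    show "\<Phi> ` mspace (submetric (sobolev_metric s) U) \<subseteq> mspace (C0_sobolev T s)" using \<Phi>_mspace by auto
    fix w and e :: real assume "w \<in> mspace (submetric (sobolev_metric s) U)" "0 < e"
    then show "\<exists>\<delta>>0. \<forall>w'. w' \<in> mspace (submetric (sobolev_metric s) U) \<and> mdist (submetric (sobolev_metric s) U) w w' < \<delta> \<longrightarrow>
        mdist (C0_sobolev T s) (\<Phi> w) (\<Phi> w') < e"
      using cont[of w e] by simp
  qed
  then have cont_\<Phi>: "continuous_map (subtopology (mtopology_of (sobolev_metric s)) U) (mtopology_of (C0_sobolev T s)) \<Phi>"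
    unfolding mtopology_of_submetric .
  have open_U: "openin (mtopology_of (sobolev_metric s)) U"
    unfolding U_def mtopology_of_def mball_of_def by (rule Metric_space.openin_mball[OF Metric_space_mspace_mdist])
  have u0_U: "u0 \<in> U" using u0 by (simp add: U_def sobolev_norm_zero)
  have ex1_U: "\<exists>!u. b_family_solution b s T w u" if w: "w \<in> U" for w
  proof -
    obtain v0 where "w = embed s v0" "norm v0 \<le> R / 2" using U[OF w] by blast
    then show ?thesis by (simp only: ex1)
  qed
  show ?thesis
    by (intro exI[of _ T] exI[of _ U] conjI ballI T open_U u0_U ex1_U cont_\<Phi>[unfolded \<Phi>_def[abs_def]])
qed

end

theorem theorem1p1:
  fixes b s :: real and u0 :: tempered
  assumes "s > 3 / 2" and "u0 \<in> sobolev s"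
  shows "\<exists>T>0. (\<exists>!u. b_family_solution b s T u0 u) \<and>
    (\<exists>U. openin (mtopology_of (sobolev_metric s)) U \<and> u0 \<in> U \<and>
      (\<forall>v\<in>U. \<exists>!u. b_family_solution b s T v u) \<and>
      continuous_map (subtopology (mtopology_of (sobolev_metric s)) U)
        (mtopology_of (C0_sobolev T s))
        (\<lambda>v. THE u. b_family_solution b s T v u))"
proof -
  interpret b_family b s by (rule b_family.intro) (rule assms)
  show ?thesis using assms(2) by (rule well_posed)
qed

end
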